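(* Let $B$ be a pointed Poisson Hopf algebra over $k$ with group of group-like elements $G$, such that $\{g,t\}=0$ for all $g,t\in G$; let $C=\mathrm{gr}\,B\cong R\#kG$. Then the algebra $R^e$ becomes a $(kG)^e$-module algebra via $$g\cdot y=y,\qquad g\cdot\beta_y=\beta_y+g^{-1}\{g,y\},$$ $$h_g\cdot y=g^{-1}\{g,y\},\qquad h_g\cdot\beta_y=\beta_{g^{-1}\{g,y\}}+\{g,\{y,g^{-1}\}\},$$ for all $g\in G$ and $y\in R$. Moreover, the map $\Psi:R^e\to T$ is a $(kG)^e$-module map.
   Context: $k$ is a field; Sweedler notation is used. A Poisson algebra is a commutative $k$-algebra with a Lie bracket $\{\cdot,\cdot\}$ such that $\{a,bc\}=\{a,b\}c+b\{a,c\}$; $A\otimes A$ is Poisson with $\{a\otimes b,c\otimes d\}=ac\otimes\{b,d\}+\{a,c\}\otimes bd$. A Poisson Hopf algebra is a commutative Hopf algebra with a Poisson bracket such that $\Delta(\{a,b\})=\{\Delta(a),\Delta(b)\}$; pointed means pointed as a coalgebra. Graded object: let $\{B_n\}$ be the coradical filtration of $B$ and $C=\bigoplus_nC(n)$, $C(n)=B_n/B_{n-1}$. Under the hypothesis, $\{B_i,B_j\}\subset B_{i+j}$, and $C$ is a graded Poisson Hopf algebra with bracket $\{\overline x,\overline y\}=\overline{\{x,y\}}\in C(i+j)$ for $x\in B_i$, $y\in B_j$. Biproduct: $C(0)=kG$; let $\iota:kG\to C$ be the inclusion and $\pi:C\to kG$ the projection with kernel $\bigoplus_{i\ge1}C(i)$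 (both are Poisson Hopf algebra maps, $kG$ having zero bracket). Let $R=\{x\in C:(\mathrm{id}\otimes\pi)\Delta(x)=x\otimes1\}$, a Poisson subalgebra of $C$, with $C\cong R\#kG$ (Radford biproduct, $xg\mapsto x\#g$). For $g\in G$, $y\in R$ one has $g^{-1}\{g,y\}\in R$ and $\{g,\{y,g^{-1}\}\}\in R$ (products and brackets computed in $C$). Universal enveloping algebra: for a Poisson algebra $A$, $A^e$ is the associative unital $k$-algebra generated by two copies $\{m_a\}$, $\{h_a\}$ of the vector space $A$ (linear in $a$) subject to $m_{xy}=m_xm_y$, $h_{\{x,y\}}=h_xh_y-h_yh_x$, $h_{xy}=m_yh_x+m_xh_y$, $m_{\{x,y\}}=h_xm_y-m_yh_x$, $m_1=1$. The map $a\mapsto m_a$ is injective and $a$ is identified with $m_a$. The generators $h_y$ of $R^e$ are written $\beta_y$. If $A$ is a Poisson Hopf algebra, $A^e$ is a Hopf algebra with $\Delta(a)=a_1\otimes a_2$ for $a\in A$, $\Delta(h_a)=a_1\otimes h_{a_2}+h_{a_1}\otimes a_2$, $\epsilon(h_a)=0$. The maps $\iota,\pi$ induce Hopf algebra maps $\iota^e:(kG)^e\to C^e$ and $\pi^e:C^e\to(kG)^e$ with $\pi^e\iota^e=\mathrm{id}$; $(kG)^e$ is regarded as a Hopf subalgebra of $C^e$ via $\iota^e$. $T=\{z\in C^e:(\mathrm{id}\otimes\pi^e)\Delta(z)=z\otimes1\}$, with $(kG)^e$-action $a\cdot z=a_1zS(a_2)$ (computed in $C^e$, $S$ the antipode).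 $\Psi:R^e\to C^e$ is the algebra map induced by the inclusion $R\subset C$, so $\Psi(y)=y$ and $\Psi(\beta_y)=h_y$ for $y\in R$; its image lies in $T$. *)

theory Defs
  imports "HOL-Algebra.QuotRing" "HOL-Algebra.Module"
begin

section \<open>Algebras over a field, monoid algebras, quotients\<close>

text \<open>The locale \<^locale>\<open>algebra\<close> of HOL-Algebra is commutative; enveloping algebras are not.\<close>

definition assoc_algebra :: "('k, 'r) ring_scheme \<Rightarrow> ('k, 'a, 'c) module_scheme \<Rightarrow> bool" where
  "assoc_algebra K A \<longleftrightarrow> module K A \<and> ring A \<and>
     (\<forall>c\<in>carrier K. \<forall>x\<in>carrier A. \<forall>y\<in>carrier A.
        (c \<odot>\<^bsub>A\<^esub> x) \<otimes>\<^bsub>A\<^esub> y = c \<odot>\<^bsub>A\<^esub> (x \<otimes>\<^bsub>A\<^esub> y) \<and>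
        x \<otimes>\<^bsub>A\<^esub> (c \<odot>\<^bsub>A\<^esub> y) = c \<odot>\<^bsub>A\<^esub> (x \<otimes>\<^bsub>A\<^esub> y))"

definition linear_maps ::
  "('k, 'r) ring_scheme \<Rightarrow> ('k, 'a, 'c) module_scheme \<Rightarrow> ('k, 'b, 'd) module_scheme \<Rightarrow> ('a \<Rightarrow> 'b) set"
  where
  "linear_maps K V W = {f. f \<in> carrier V \<rightarrow> carrier W \<and>
     (\<forall>x\<in>carrier V. \<forall>y\<in>carrier V. f (x \<oplus>\<^bsub>V\<^esub> y) = f x \<oplus>\<^bsub>W\<^esub> f y) \<and>
     (\<forall>c\<in>carrier K. \<forall>x\<in>carrier V. f (c \<odot>\<^bsub>V\<^esub> x) = c \<odot>\<^bsub>W\<^esub> f x)}"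

definition alg_homs ::
  "('k, 'r) ring_scheme \<Rightarrow> ('k, 'a, 'c) module_scheme \<Rightarrow> ('k, 'b, 'd) module_scheme \<Rightarrow> ('a \<Rightarrow> 'b) set"
  where
  "alg_homs K A B = ring_hom A B \<inter> linear_maps K A B"

definition base_algebra :: "('k, 'r) ring_scheme \<Rightarrow> ('k, 'k) module" where
  "base_algebra K = \<lparr>carrier = carrier K, mult = mult K, one = \<one>\<^bsub>K\<^esub>,
     zero = \<zero>\<^bsub>K\<^esub>, add = add K, smult = mult K\<rparr>"

definition lin_span :: "('k, 'r) ring_scheme \<Rightarrow> ('k, 'a, 'c) module_scheme \<Rightarrow> 'a set \<Rightarrow> 'a set" where
  "lin_span K M X = \<Inter>{N. submodule N K M \<and> X \<subseteq> N}"

definition mdelta :: "('k, 'r) ring_scheme \<Rightarrow> 'm \<Rightarrow> 'm \<Rightarrow> 'k" where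
  "mdelta K x = (\<lambda>y. if y = x then \<one>\<^bsub>K\<^esub> else \<zero>\<^bsub>K\<^esub>)"

definition supp :: "('k, 'r) ring_scheme \<Rightarrow> ('m \<Rightarrow> 'k) \<Rightarrow> 'm set" where
  "supp K r = {x. r x \<noteq> \<zero>\<^bsub>K\<^esub>}"

definition monoid_algebra ::
  "('k, 'r) ring_scheme \<Rightarrow> ('m, 's) monoid_scheme \<Rightarrow> ('k, 'm \<Rightarrow> 'k) module" where
  "monoid_algebra K M =
     \<lparr>carrier = {r. range r \<subseteq> carrier K \<and> finite (supp K r) \<and> supp K r \<subseteq> carrier M},
      mult = (\<lambda>r s z. \<Oplus>\<^bsub>K\<^esub>p\<in>{p \<in> supp K r \<times> supp K s. fst p \<otimes>\<^bsub>M\<^esub> snd p = z}.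
                r (fst p) \<otimes>\<^bsub>K\<^esub> s (snd p)),
      one = mdelta K \<one>\<^bsub>M\<^esub>,
      zero = (\<lambda>z. \<zero>\<^bsub>K\<^esub>),
      add = (\<lambda>r s z. r z \<oplus>\<^bsub>K\<^esub> s z),
      smult = (\<lambda>c r z. c \<otimes>\<^bsub>K\<^esub> r z)\<rparr>"

text \<open>The linear map on formal combinations that extends \<open>f\<close> on basis elements.\<close>

definition lin_ext ::
  "('k, 'r) ring_scheme \<Rightarrow> ('k, 'a, 'c) module_scheme \<Rightarrow> ('m \<Rightarrow> 'a) \<Rightarrow> ('m \<Rightarrow> 'k) \<Rightarrow> 'a" where
  "lin_ext K V f r = (\<Oplus>\<^bsub>V\<^esub>x\<in>supp K r. r x \<odot>\<^bsub>V\<^esub> f x)"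

definition quot_algebra ::
  "('k, 'a, 'c) module_scheme \<Rightarrow> 'a set \<Rightarrow> ('k, 'a set) module" where
  "quot_algebra A I =
     ring.extend (A Quot I) (module.fields (\<lambda>c X. \<Union>x\<in>X. I +>\<^bsub>A\<^esub> (c \<odot>\<^bsub>A\<^esub> x)))"


section \<open>Tensor products\<close>

text \<open>
  \<open>A \<otimes> B\<close> is the free vector space on \<open>A \<times> B\<close> modulo the span of the bilinearity relators.
  The free vector space is taken as the monoid algebra of the multiplicative monoid \<open>A \<times> B\<close>,
  in which that span is an ideal, so the quotient carries the usual product
  \<open>(a \<otimes> b)(a' \<otimes> b') = aa' \<otimes> bb'\<close>.
\<close>

definition tensor_free ::
  "('k, 'r) ring_scheme \<Rightarrow> ('k, 'a, 'c) module_scheme \<Rightarrow> ('k, 'b, 'd) module_scheme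
     \<Rightarrow> ('k, 'a \<times> 'b \<Rightarrow> 'k) module" where
  "tensor_free K A B = monoid_algebra K (A \<times>\<times> B)"

definition tensor_relators ::
  "('k, 'r) ring_scheme \<Rightarrow> ('k, 'a, 'c) module_scheme \<Rightarrow> ('k, 'b, 'd) module_scheme
     \<Rightarrow> ('a \<times> 'b \<Rightarrow> 'k) set" where
  "tensor_relators K A B = (let F = tensor_free K A B in
       {mdelta K (a \<oplus>\<^bsub>A\<^esub> a', b) \<ominus>\<^bsub>F\<^esub> (mdelta K (a, b) \<oplus>\<^bsub>F\<^esub> mdelta K (a', b)) | a a' b.
          a \<in> carrier A \<and> a' \<in> carrier A \<and> b \<in> carrier B}
     \<union> {mdelta K (a, b \<oplus>\<^bsub>B\<^esub> b') \<ominus>\<^bsub>F\<^esub> (mdelta K (a, b) \<oplus>\<^bsub>F\<^esub> mdelta K (a, b')) | a b b'.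
          a \<in> carrier A \<and> b \<in> carrier B \<and> b' \<in> carrier B}
     \<union> {mdelta K (c \<odot>\<^bsub>A\<^esub> a, b) \<ominus>\<^bsub>F\<^esub> (c \<odot>\<^bsub>F\<^esub> mdelta K (a, b)) | c a b.
          c \<in> carrier K \<and> a \<in> carrier A \<and> b \<in> carrier B}
     \<union> {mdelta K (a, c \<odot>\<^bsub>B\<^esub> b) \<ominus>\<^bsub>F\<^esub> (c \<odot>\<^bsub>F\<^esub> mdelta K (a, b)) | c a b.
          c \<in> carrier K \<and> a \<in> carrier A \<and> b \<in> carrier B})"

definition tensor_null ::
  "('k, 'r) ring_scheme \<Rightarrow> ('k, 'a, 'c) module_scheme \<Rightarrow> ('k, 'b, 'd) module_scheme
     \<Rightarrow> ('a \<times> 'b \<Rightarrow> 'k) set" where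
  "tensor_null K A B = lin_span K (tensor_free K A B) (tensor_relators K A B)"

definition tensor ::
  "('k, 'r) ring_scheme \<Rightarrow> ('k, 'a, 'c) module_scheme \<Rightarrow> ('k, 'b, 'd) module_scheme
     \<Rightarrow> ('k, ('a \<times> 'b \<Rightarrow> 'k) set) module" where
  "tensor K A B = quot_algebra (tensor_free K A B) (tensor_null K A B)"

definition tensor_class ::
  "('k, 'r) ring_scheme \<Rightarrow> ('k, 'a, 'c) module_scheme \<Rightarrow> ('k, 'b, 'd) module_scheme
     \<Rightarrow> ('a \<times> 'b \<Rightarrow> 'k) \<Rightarrow> ('a \<times> 'b \<Rightarrow> 'k) set" where
  "tensor_class K A B r = tensor_null K A B +>\<^bsub>tensor_free K A B\<^esub> r"

definition ptensor ::
  "('k, 'r) ring_scheme \<Rightarrow> ('k, 'a, 'c) module_scheme \<Rightarrow> ('k, 'b, 'd) module_scheme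
     \<Rightarrow> 'a \<Rightarrow> 'b \<Rightarrow> ('a \<times> 'b \<Rightarrow> 'k) set" where
  "ptensor K A B a b = tensor_class K A B (mdelta K (a, b))"

text \<open>
  The linear map out of a tensor product induced by a bilinear map \<open>f\<close> into \<open>V\<close>.
  In Sweedler notation, \<open>tlift K V f (\<Delta> x)\<close> is \<open>f x\<^sub>1 x\<^sub>2\<close>.
\<close>

definition tlift ::
  "('k, 'r) ring_scheme \<Rightarrow> ('k, 'v, 'c) module_scheme \<Rightarrow> ('a \<Rightarrow> 'b \<Rightarrow> 'v)
     \<Rightarrow> ('a \<times> 'b \<Rightarrow> 'k) set \<Rightarrow> 'v" where
  "tlift K V f X = (THE v. \<forall>r\<in>X. v = lin_ext K V (\<lambda>(a, b). f a b) r)"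


section \<open>Hopf algebras\<close>

record ('k, 'a) hopf = "('k, 'a) module" +
  comult :: "'a \<Rightarrow> ('a \<times> 'a \<Rightarrow> 'k) set"
  counit :: "'a \<Rightarrow> 'k"
  antipode :: "'a \<Rightarrow> 'a"

definition bialgebra :: "('k, 'r) ring_scheme \<Rightarrow> ('k, 'a, 'c) hopf_scheme \<Rightarrow> bool" where
  "bialgebra K A \<longleftrightarrow> (let A2 = tensor K A A; A3 = tensor K A A2 in
     assoc_algebra K A \<and>
     comult A \<in> alg_homs K A A2 \<and>
     counit A \<in> alg_homs K A (base_algebra K) \<and>
     (\<forall>x\<in>carrier A.
        tlift K A3 (\<lambda>a b. ptensor K A A2 a (comult A b)) (comult A x) =
        tlift K A3 (\<lambda>a b. tlift K A3 (\<lambda>c d. ptensor K A A2 c (ptensor K A A d b)) (comult A a))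
          (comult A x)) \<and>
     (\<forall>x\<in>carrier A. tlift K A (\<lambda>a b. counit A a \<odot>\<^bsub>A\<^esub> b) (comult A x) = x) \<and>
     (\<forall>x\<in>carrier A. tlift K A (\<lambda>a b. counit A b \<odot>\<^bsub>A\<^esub> a) (comult A x) = x))"

definition is_antipode ::
  "('k, 'r) ring_scheme \<Rightarrow> ('k, 'a, 'c) module_scheme \<Rightarrow> ('a \<Rightarrow> ('a \<times> 'a \<Rightarrow> 'k) set)
     \<Rightarrow> ('a \<Rightarrow> 'k) \<Rightarrow> ('a \<Rightarrow> 'a) \<Rightarrow> bool" where
  "is_antipode K A \<Delta> \<epsilon> S \<longleftrightarrow> S \<in> linear_maps K A A \<and>
     (\<forall>x\<in>carrier A. tlift K A (\<lambda>a b. S a \<otimes>\<^bsub>A\<^esub> b) (\<Delta> x) = \<epsilon> x \<odot>\<^bsub>A\<^esub> \<one>\<^bsub>A\<^esub>) \<and>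
     (\<forall>x\<in>carrier A. tlift K A (\<lambda>a b. a \<otimes>\<^bsub>A\<^esub> S b) (\<Delta> x) = \<epsilon> x \<odot>\<^bsub>A\<^esub> \<one>\<^bsub>A\<^esub>)"

definition hopf_algebra :: "('k, 'r) ring_scheme \<Rightarrow> ('k, 'a, 'c) hopf_scheme \<Rightarrow> bool" where
  "hopf_algebra K A \<longleftrightarrow> bialgebra K A \<and> is_antipode K A (comult A) (counit A) (antipode A)"

definition grouplikes :: "('k, 'r) ring_scheme \<Rightarrow> ('k, 'a, 'c) hopf_scheme \<Rightarrow> 'a set" where
  "grouplikes K A =
     {g \<in> carrier A. comult A g = ptensor K A A g g \<and> counit A g = \<one>\<^bsub>K\<^esub>}"

definition grouplike_group :: "('k, 'r) ring_scheme \<Rightarrow> ('k, 'a, 'c) hopf_scheme \<Rightarrow> 'a monoid" where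
  "grouplike_group K A = \<lparr>carrier = grouplikes K A, mult = mult A, one = \<one>\<^bsub>A\<^esub>\<rparr>"

definition group_algebra ::
  "('k, 'r) ring_scheme \<Rightarrow> ('g, 's) monoid_scheme \<Rightarrow> ('k, 'g \<Rightarrow> 'k) hopf" where
  "group_algebra K G = (let A = monoid_algebra K G in
     module.extend A (hopf.fields
       (lin_ext K (tensor K A A) (\<lambda>g. ptensor K A A (mdelta K g) (mdelta K g)))
       (lin_ext K (base_algebra K) (\<lambda>g. \<one>\<^bsub>K\<^esub>))
       (lin_ext K A (\<lambda>g. mdelta K (inv\<^bsub>G\<^esub> g)))))"

definition right_coinvariants ::
  "('k, 'r) ring_scheme \<Rightarrow> ('k, 'a, 'c) hopf_scheme \<Rightarrow> ('k, 'h, 'd) module_scheme \<Rightarrow> ('a \<Rightarrow> 'h)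
     \<Rightarrow> ('k, 'a) module" where
  "right_coinvariants K A H p = (module.truncate A)
     \<lparr>carrier := {x \<in> carrier A. tlift K (tensor K A H) (\<lambda>a b. ptensor K A H a (p b)) (comult A x)
                                = ptensor K A H x \<one>\<^bsub>H\<^esub>}\<rparr>"


section \<open>Modules and module algebras over a Hopf algebra\<close>

definition left_module ::
  "('k, 'r) ring_scheme \<Rightarrow> ('k, 'h, 'c) module_scheme \<Rightarrow> ('k, 'v, 'd) module_scheme
     \<Rightarrow> ('h \<Rightarrow> 'v \<Rightarrow> 'v) \<Rightarrow> bool" where
  "left_module K H V act \<longleftrightarrow> module K V \<and>
     (\<forall>a\<in>carrier H. act a \<in> linear_maps K V V) \<and>
     (\<forall>v\<in>carrier V. (\<lambda>a. act a v) \<in> linear_maps K H V) \<and>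
     (\<forall>v\<in>carrier V. act \<one>\<^bsub>H\<^esub> v = v) \<and>
     (\<forall>a\<in>carrier H. \<forall>b\<in>carrier H. \<forall>v\<in>carrier V. act (a \<otimes>\<^bsub>H\<^esub> b) v = act a (act b v))"

definition module_algebra ::
  "('k, 'r) ring_scheme \<Rightarrow> ('k, 'h, 'c) hopf_scheme \<Rightarrow> ('k, 'v, 'd) module_scheme
     \<Rightarrow> ('h \<Rightarrow> 'v \<Rightarrow> 'v) \<Rightarrow> bool" where
  "module_algebra K H A act \<longleftrightarrow> assoc_algebra K A \<and> left_module K H A act \<and>
     (\<forall>a\<in>carrier H. \<forall>x\<in>carrier A. \<forall>y\<in>carrier A.
        act a (x \<otimes>\<^bsub>A\<^esub> y) = tlift K A (\<lambda>b c. act b x \<otimes>\<^bsub>A\<^esub> act c y) (comult H a)) \<and>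
     (\<forall>a\<in>carrier H. act a \<one>\<^bsub>A\<^esub> = counit H a \<odot>\<^bsub>A\<^esub> \<one>\<^bsub>A\<^esub>)"

definition module_homs ::
  "('k, 'r) ring_scheme \<Rightarrow> ('k, 'h, 'c) module_scheme
     \<Rightarrow> ('k, 'v, 'd) module_scheme \<Rightarrow> ('h \<Rightarrow> 'v \<Rightarrow> 'v)
     \<Rightarrow> ('k, 'w, 'e) module_scheme \<Rightarrow> ('h \<Rightarrow> 'w \<Rightarrow> 'w) \<Rightarrow> ('v \<Rightarrow> 'w) set" where
  "module_homs K H V act W act' = {f \<in> linear_maps K V W.
     \<forall>a\<in>carrier H. \<forall>v\<in>carrier V. f (act a v) = act' a (f v)}"

text \<open>
  The action \<open>a \<cdot> z = a\<^sub>1 z S(a\<^sub>2)\<close> of a Hopf algebra \<open>H\<close> on an algebra \<open>E\<close> containing it via \<open>j\<close>.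
  When \<open>j\<close> embeds \<open>H\<close> as a Hopf subalgebra of \<open>E\<close>, the antipode of \<open>E\<close> restricts to that of \<open>H\<close>.
\<close>

definition adjoint_action ::
  "('k, 'r) ring_scheme \<Rightarrow> ('k, 'h, 'c) hopf_scheme \<Rightarrow> ('k, 'v, 'd) module_scheme \<Rightarrow> ('h \<Rightarrow> 'v)
     \<Rightarrow> 'h \<Rightarrow> 'v \<Rightarrow> 'v" where
  "adjoint_action K H E j a z =
     tlift K E (\<lambda>b c. j b \<otimes>\<^bsub>E\<^esub> z \<otimes>\<^bsub>E\<^esub> j (antipode H c)) (comult H a)"


section \<open>Poisson algebras\<close>

definition poisson_algebra ::
  "('k, 'r) ring_scheme \<Rightarrow> ('k, 'a, 'c) module_scheme \<Rightarrow> ('a \<Rightarrow> 'a \<Rightarrow> 'a) \<Rightarrow> bool" where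
  "poisson_algebra K A br \<longleftrightarrow> algebra K A \<and>
     (\<forall>x\<in>carrier A. br x \<in> linear_maps K A A) \<and>
     (\<forall>y\<in>carrier A. (\<lambda>x. br x y) \<in> linear_maps K A A) \<and>
     (\<forall>x\<in>carrier A. br x x = \<zero>\<^bsub>A\<^esub>) \<and>
     (\<forall>x\<in>carrier A. \<forall>y\<in>carrier A. \<forall>z\<in>carrier A.
        br x (br y z) \<oplus>\<^bsub>A\<^esub> br y (br z x) \<oplus>\<^bsub>A\<^esub> br z (br x y) = \<zero>\<^bsub>A\<^esub>) \<and>
     (\<forall>x\<in>carrier A. \<forall>y\<in>carrier A. \<forall>z\<in>carrier A.
        br x (y \<otimes>\<^bsub>A\<^esub> z) = br x y \<otimes>\<^bsub>A\<^esub> z \<oplus>\<^bsub>A\<^esub> y \<otimes>\<^bsub>A\<^esub> br x z)"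

definition tensor_bracket ::
  "('k, 'r) ring_scheme \<Rightarrow> ('k, 'a, 'c) module_scheme \<Rightarrow> ('a \<Rightarrow> 'a \<Rightarrow> 'a)
     \<Rightarrow> ('a \<times> 'a \<Rightarrow> 'k) set \<Rightarrow> ('a \<times> 'a \<Rightarrow> 'k) set \<Rightarrow> ('a \<times> 'a \<Rightarrow> 'k) set" where
  "tensor_bracket K A br X Y = (let A2 = tensor K A A in
     tlift K A2 (\<lambda>a b. tlift K A2 (\<lambda>c d.
       ptensor K A A (a \<otimes>\<^bsub>A\<^esub> c) (br b d) \<oplus>\<^bsub>A2\<^esub> ptensor K A A (br a c) (b \<otimes>\<^bsub>A\<^esub> d)) Y) X)"

definition poisson_hopf_algebra ::
  "('k, 'r) ring_scheme \<Rightarrow> ('k, 'a, 'c) hopf_scheme \<Rightarrow> ('a \<Rightarrow> 'a \<Rightarrow> 'a) \<Rightarrow> bool" where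
  "poisson_hopf_algebra K A br \<longleftrightarrow> hopf_algebra K A \<and> poisson_algebra K A br \<and>
     (\<forall>x\<in>carrier A. \<forall>y\<in>carrier A.
        comult A (br x y) = tensor_bracket K A br (comult A x) (comult A y))"


section \<open>Pointed coalgebras and the coradical filtration\<close>

definition tensor_subspace ::
  "('k, 'r) ring_scheme \<Rightarrow> ('k, 'a, 'c) module_scheme \<Rightarrow> 'a set \<Rightarrow> 'a set \<Rightarrow> ('a \<times> 'a \<Rightarrow> 'k) set set"
  where
  "tensor_subspace K A U V = lin_span K (tensor K A A) {ptensor K A A u v | u v. u \<in> U \<and> v \<in> V}"

definition subcoalgebra :: "('k, 'r) ring_scheme \<Rightarrow> ('k, 'a, 'c) hopf_scheme \<Rightarrow> 'a set \<Rightarrow> bool" where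
  "subcoalgebra K A D \<longleftrightarrow> submodule D K A \<and> (\<forall>x\<in>D. comult A x \<in> tensor_subspace K A D D)"

definition simple_subcoalgebra ::
  "('k, 'r) ring_scheme \<Rightarrow> ('k, 'a, 'c) hopf_scheme \<Rightarrow> 'a set \<Rightarrow> bool" where
  "simple_subcoalgebra K A D \<longleftrightarrow> subcoalgebra K A D \<and> D \<noteq> {\<zero>\<^bsub>A\<^esub>} \<and>
     (\<forall>E. subcoalgebra K A E \<and> E \<subseteq> D \<longrightarrow> E = {\<zero>\<^bsub>A\<^esub>} \<or> E = D)"

definition pointed :: "('k, 'r) ring_scheme \<Rightarrow> ('k, 'a, 'c) hopf_scheme \<Rightarrow> bool" where
  "pointed K A \<longleftrightarrow> (\<forall>D. simple_subcoalgebra K A D \<longrightarrow>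
     (\<exists>d\<in>D. d \<noteq> \<zero>\<^bsub>A\<^esub> \<and> D = {c \<odot>\<^bsub>A\<^esub> d | c. c \<in> carrier K}))"

definition coradical :: "('k, 'r) ring_scheme \<Rightarrow> ('k, 'a, 'c) hopf_scheme \<Rightarrow> 'a set" where
  "coradical K A = lin_span K A (\<Union>{D. simple_subcoalgebra K A D})"

text \<open>\<open>A\<^sub>n\<^sub>+\<^sub>1 = \<Delta>\<^sup>-\<^sup>1(A \<otimes> A\<^sub>n + A\<^sub>0 \<otimes> A)\<close>\<close>

fun corad_filt :: "('k, 'r) ring_scheme \<Rightarrow> ('k, 'a, 'c) hopf_scheme \<Rightarrow> nat \<Rightarrow> 'a set" where
  "corad_filt K A 0 = coradical K A"
| "corad_filt K A (Suc n) = {x \<in> carrier A. comult A x \<in>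
     tensor_subspace K A (carrier A) (corad_filt K A n)
       <+>\<^bsub>tensor K A A\<^esub> tensor_subspace K A (coradical K A) (carrier A)}"


section \<open>The associated graded Poisson Hopf algebra\<close>

text \<open>\<open>B\<^sub>n\<^sub>-\<^sub>1\<close>, with \<open>B\<^sub>-\<^sub>1 = 0\<close>\<close>

definition corad_low :: "('k, 'r) ring_scheme \<Rightarrow> ('k, 'b, 'c) hopf_scheme \<Rightarrow> nat \<Rightarrow> 'b set" where
  "corad_low K B n = (case n of 0 \<Rightarrow> {\<zero>\<^bsub>B\<^esub>} | Suc m \<Rightarrow> corad_filt K B m)"

text \<open>The class in \<open>C(n) = B\<^sub>n/B\<^sub>n\<^sub>-\<^sub>1\<close> of \<open>x \<in> B\<^sub>n\<close>, as an element of \<open>C\<close>.\<close>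

definition gr_class ::
  "('k, 'r) ring_scheme \<Rightarrow> ('k, 'b, 'c) hopf_scheme \<Rightarrow> nat \<Rightarrow> 'b \<Rightarrow> nat \<Rightarrow> 'b set" where
  "gr_class K B n x = (\<lambda>m. if m = n then corad_low K B n +>\<^bsub>B\<^esub> x else corad_low K B m)"

text \<open>
  The operation \<open>C(i) \<times> C(j) \<rightarrow> C(i+j)\<close> induced by a bilinear operation \<open>f\<close> on \<open>B\<close> with
  \<open>f B\<^sub>i B\<^sub>j \<subseteq> B\<^sub>i\<^sub>+\<^sub>j\<close>, extended bilinearly to \<open>C\<close>.
\<close>

definition gr_op ::
  "('k, 'r) ring_scheme \<Rightarrow> ('k, 'b, 'c) hopf_scheme \<Rightarrow> ('b \<Rightarrow> 'b \<Rightarrow> 'b)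
     \<Rightarrow> (nat \<Rightarrow> 'b set) \<Rightarrow> (nat \<Rightarrow> 'b set) \<Rightarrow> nat \<Rightarrow> 'b set" where
  "gr_op K B f c d = (\<lambda>n. \<Union>{corad_low K B n +>\<^bsub>B\<^esub> (\<Oplus>\<^bsub>B\<^esub>i\<in>{..n}. f (x i) (y (n - i))) | x y.
      (\<forall>i. x i \<in> c i) \<and> (\<forall>i. y i \<in> d i)})"

definition gr_algebra ::
  "('k, 'r) ring_scheme \<Rightarrow> ('k, 'b, 'c) hopf_scheme \<Rightarrow> ('k, nat \<Rightarrow> 'b set) module" where
  "gr_algebra K B =
     \<lparr>carrier = {c. (\<forall>n. \<exists>x\<in>corad_filt K B n. c n = corad_low K B n +>\<^bsub>B\<^esub> x) \<and>
                    finite {n. c n \<noteq> corad_low K B n}},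
      mult = gr_op K B (mult B),
      one = gr_class K B 0 \<one>\<^bsub>B\<^esub>,
      zero = corad_low K B,
      add = (\<lambda>c d n. c n <+>\<^bsub>B\<^esub> d n),
      smult = (\<lambda>s c n. \<Union>x\<in>c n. corad_low K B n +>\<^bsub>B\<^esub> (s \<odot>\<^bsub>B\<^esub> x))\<rparr>"

text \<open>
  For \<open>x \<in> B\<^sub>n\<close> write \<open>\<Delta> x = \<Sum>\<^sub>i t\<^sub>i\<close> with \<open>t\<^sub>i \<in> B\<^sub>i \<otimes> B\<^sub>n\<^sub>-\<^sub>i\<close>; then the coproduct of the class of
  \<open>x\<close> in \<open>C(n)\<close> is the sum of the images of the \<open>t\<^sub>i\<close> in \<open>C(i) \<otimes> C(n - i)\<close>. Here \<open>t\<^sub>i\<close> is given by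
  a formal combination \<open>r i\<close> of pairs in \<open>B\<^sub>i \<times> B\<^sub>n\<^sub>-\<^sub>i\<close>.
\<close>

definition gr_comult_class ::
  "('k, 'r) ring_scheme \<Rightarrow> ('k, 'b, 'c) hopf_scheme \<Rightarrow> nat \<Rightarrow> 'b
     \<Rightarrow> ((nat \<Rightarrow> 'b set) \<times> (nat \<Rightarrow> 'b set) \<Rightarrow> 'k) set \<Rightarrow> bool" where
  "gr_comult_class K B n x w \<longleftrightarrow> (let C = gr_algebra K B; F = tensor_free K B B in
     \<exists>r. (\<forall>i\<le>n. r i \<in> carrier F \<and> supp K (r i) \<subseteq> corad_filt K B i \<times> corad_filt K B (n - i)) \<and>
         comult B x = tensor_class K B B (\<Oplus>\<^bsub>F\<^esub>i\<in>{..n}. r i) \<and>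
         w = (\<Oplus>\<^bsub>tensor K C C\<^esub>i\<in>{..n}. lin_ext K (tensor K C C)
               (\<lambda>(a, b). ptensor K C C (gr_class K B i a) (gr_class K B (n - i) b)) (r i)))"

definition gr_comult ::
  "('k, 'r) ring_scheme \<Rightarrow> ('k, 'b, 'c) hopf_scheme \<Rightarrow> (nat \<Rightarrow> 'b set)
     \<Rightarrow> ((nat \<Rightarrow> 'b set) \<times> (nat \<Rightarrow> 'b set) \<Rightarrow> 'k) set" where
  "gr_comult K B c = (let C = gr_algebra K B in
     \<Oplus>\<^bsub>tensor K C C\<^esub>n\<in>{n. c n \<noteq> corad_low K B n}. (THE w. \<exists>x\<in>c n. gr_comult_class K B n x w))"

text \<open>\<open>C(0) = B\<^sub>0/0\<close> consists of singletons, and the counit vanishes on \<open>C(n)\<close> for \<open>n > 0\<close>.\<close>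

definition gr ::
  "('k, 'r) ring_scheme \<Rightarrow> ('k, 'b, 'c) hopf_scheme \<Rightarrow> ('k, nat \<Rightarrow> 'b set) hopf" where
  "gr K B = module.extend (gr_algebra K B) (hopf.fields
     (gr_comult K B)
     (\<lambda>c. counit B (the_elem (c 0)))
     (\<lambda>c n. \<Union>x\<in>c n. corad_low K B n +>\<^bsub>B\<^esub> antipode B x))"

definition gr_bracket ::
  "('k, 'r) ring_scheme \<Rightarrow> ('k, 'b, 'c) hopf_scheme \<Rightarrow> ('b \<Rightarrow> 'b \<Rightarrow> 'b)
     \<Rightarrow> (nat \<Rightarrow> 'b set) \<Rightarrow> (nat \<Rightarrow> 'b set) \<Rightarrow> nat \<Rightarrow> 'b set" where
  "gr_bracket K B br = gr_op K B br"

text \<open>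
  \<open>kG\<close> is the group algebra of \<open>G\<close>; \<open>gr_incl\<close> identifies it with \<open>C(0) = B\<^sub>0\<close>, and \<open>gr_proj\<close> is the
  projection of \<open>C\<close> onto \<open>C(0) = kG\<close> along the sum of the \<open>C(n)\<close> with \<open>n > 0\<close>.
\<close>

definition gr_incl ::
  "('k, 'r) ring_scheme \<Rightarrow> ('k, 'b, 'c) hopf_scheme \<Rightarrow> ('b \<Rightarrow> 'k) \<Rightarrow> nat \<Rightarrow> 'b set" where
  "gr_incl K B = lin_ext K (gr_algebra K B) (gr_class K B 0)"

definition gr_proj ::
  "('k, 'r) ring_scheme \<Rightarrow> ('k, 'b, 'c) hopf_scheme \<Rightarrow> (nat \<Rightarrow> 'b set) \<Rightarrow> 'b \<Rightarrow> 'k" where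
  "gr_proj K B c = (THE a. a \<in> carrier (group_algebra K (grouplike_group K B)) \<and>
     gr_incl K B a = (\<lambda>n. if n = 0 then c 0 else corad_low K B n))"


section \<open>The universal enveloping algebra of a Poisson algebra\<close>

datatype 'a env_gen = Mgen 'a | Hgen 'a

definition env_words :: "('k, 'a, 'c) module_scheme \<Rightarrow> 'a env_gen list monoid" where
  "env_words A =
     \<lparr>carrier = lists (Mgen ` carrier A \<union> Hgen ` carrier A), mult = (@), one = []\<rparr>"

definition env_free ::
  "('k, 'r) ring_scheme \<Rightarrow> ('k, 'a, 'c) module_scheme \<Rightarrow> ('k, 'a env_gen list \<Rightarrow> 'k) module" where
  "env_free K A = monoid_algebra K (env_words A)"

definition env_relators ::
  "('k, 'r) ring_scheme \<Rightarrow> ('k, 'a, 'c) module_scheme \<Rightarrow> ('a \<Rightarrow> 'a \<Rightarrow> 'a)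
     \<Rightarrow> ('a env_gen list \<Rightarrow> 'k) set" where
  "env_relators K A br =
    (let F = env_free K A; m = (\<lambda>a. mdelta K [Mgen a]); h = (\<lambda>a. mdelta K [Hgen a]) in
       (\<Union>x\<in>carrier A. \<Union>y\<in>carrier A.
         {m (x \<oplus>\<^bsub>A\<^esub> y) \<ominus>\<^bsub>F\<^esub> (m x \<oplus>\<^bsub>F\<^esub> m y),
          h (x \<oplus>\<^bsub>A\<^esub> y) \<ominus>\<^bsub>F\<^esub> (h x \<oplus>\<^bsub>F\<^esub> h y),
          m (x \<otimes>\<^bsub>A\<^esub> y) \<ominus>\<^bsub>F\<^esub> (m x \<otimes>\<^bsub>F\<^esub> m y),
          h (br x y) \<ominus>\<^bsub>F\<^esub> (h x \<otimes>\<^bsub>F\<^esub> h y \<ominus>\<^bsub>F\<^esub> h y \<otimes>\<^bsub>F\<^esub> h x),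
          h (x \<otimes>\<^bsub>A\<^esub> y) \<ominus>\<^bsub>F\<^esub> (m y \<otimes>\<^bsub>F\<^esub> h x \<oplus>\<^bsub>F\<^esub> m x \<otimes>\<^bsub>F\<^esub> h y),
          m (br x y) \<ominus>\<^bsub>F\<^esub> (h x \<otimes>\<^bsub>F\<^esub> m y \<ominus>\<^bsub>F\<^esub> m y \<otimes>\<^bsub>F\<^esub> h x)})
     \<union> (\<Union>c\<in>carrier K. \<Union>x\<in>carrier A.
         {m (c \<odot>\<^bsub>A\<^esub> x) \<ominus>\<^bsub>F\<^esub> (c \<odot>\<^bsub>F\<^esub> m x),
          h (c \<odot>\<^bsub>A\<^esub> x) \<ominus>\<^bsub>F\<^esub> (c \<odot>\<^bsub>F\<^esub> h x)})
     \<union> {m \<one>\<^bsub>A\<^esub> \<ominus>\<^bsub>F\<^esub> \<one>\<^bsub>F\<^esub>})"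

definition env_ideal ::
  "('k, 'r) ring_scheme \<Rightarrow> ('k, 'a, 'c) module_scheme \<Rightarrow> ('a \<Rightarrow> 'a \<Rightarrow> 'a)
     \<Rightarrow> ('a env_gen list \<Rightarrow> 'k) set" where
  "env_ideal K A br = Idl\<^bsub>env_free K A\<^esub> (env_relators K A br)"

definition env ::
  "('k, 'r) ring_scheme \<Rightarrow> ('k, 'a, 'c) module_scheme \<Rightarrow> ('a \<Rightarrow> 'a \<Rightarrow> 'a)
     \<Rightarrow> ('k, ('a env_gen list \<Rightarrow> 'k) set) module" where
  "env K A br = quot_algebra (env_free K A) (env_ideal K A br)"

definition env_m ::
  "('k, 'r) ring_scheme \<Rightarrow> ('k, 'a, 'c) module_scheme \<Rightarrow> ('a \<Rightarrow> 'a \<Rightarrow> 'a)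
     \<Rightarrow> 'a \<Rightarrow> ('a env_gen list \<Rightarrow> 'k) set" where
  "env_m K A br a = env_ideal K A br +>\<^bsub>env_free K A\<^esub> mdelta K [Mgen a]"

definition env_h ::
  "('k, 'r) ring_scheme \<Rightarrow> ('k, 'a, 'c) module_scheme \<Rightarrow> ('a \<Rightarrow> 'a \<Rightarrow> 'a)
     \<Rightarrow> 'a \<Rightarrow> ('a env_gen list \<Rightarrow> 'k) set" where
  "env_h K A br a = env_ideal K A br +>\<^bsub>env_free K A\<^esub> mdelta K [Hgen a]"

text \<open>The algebra map out of the enveloping algebra with \<open>m\<^sub>a \<mapsto> \<alpha> a\<close> and \<open>h\<^sub>a \<mapsto> \<beta> a\<close>.\<close>

definition env_lift ::
  "('k, 'r) ring_scheme \<Rightarrow> ('k, 'a, 'c) module_scheme \<Rightarrow> ('a \<Rightarrow> 'a \<Rightarrow> 'a)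
     \<Rightarrow> ('k, 'e, 'd) module_scheme \<Rightarrow> ('a \<Rightarrow> 'e) \<Rightarrow> ('a \<Rightarrow> 'e)
     \<Rightarrow> ('a env_gen list \<Rightarrow> 'k) set \<Rightarrow> 'e" where
  "env_lift K A br E \<alpha> \<beta> = (THE f. f \<in> extensional (carrier (env K A br)) \<and>
     f \<in> alg_homs K (env K A br) E \<and>
     (\<forall>a\<in>carrier A. f (env_m K A br a) = \<alpha> a \<and> f (env_h K A br a) = \<beta> a))"

definition env_comult ::
  "('k, 'r) ring_scheme \<Rightarrow> ('k, 'a, 'c) hopf_scheme \<Rightarrow> ('a \<Rightarrow> 'a \<Rightarrow> 'a)
     \<Rightarrow> ('a env_gen list \<Rightarrow> 'k) set
     \<Rightarrow> (('a env_gen list \<Rightarrow> 'k) set \<times> ('a env_gen list \<Rightarrow> 'k) set \<Rightarrow> 'k) set" where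
  "env_comult K A br =
    (let E = env K A br; E2 = tensor K E E; m = env_m K A br; h = env_h K A br in
     env_lift K A br E2
       (\<lambda>a. tlift K E2 (\<lambda>b c. ptensor K E E (m b) (m c)) (comult A a))
       (\<lambda>a. tlift K E2 (\<lambda>b c. ptensor K E E (m b) (h c) \<oplus>\<^bsub>E2\<^esub> ptensor K E E (h b) (m c))
              (comult A a)))"

definition env_counit ::
  "('k, 'r) ring_scheme \<Rightarrow> ('k, 'a, 'c) hopf_scheme \<Rightarrow> ('a \<Rightarrow> 'a \<Rightarrow> 'a)
     \<Rightarrow> ('a env_gen list \<Rightarrow> 'k) set \<Rightarrow> 'k" where
  "env_counit K A br = env_lift K A br (base_algebra K) (counit A) (\<lambda>a. \<zero>\<^bsub>K\<^esub>)"

definition env_antipode ::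
  "('k, 'r) ring_scheme \<Rightarrow> ('k, 'a, 'c) hopf_scheme \<Rightarrow> ('a \<Rightarrow> 'a \<Rightarrow> 'a)
     \<Rightarrow> ('a env_gen list \<Rightarrow> 'k) set \<Rightarrow> ('a env_gen list \<Rightarrow> 'k) set" where
  "env_antipode K A br = (THE S. S \<in> extensional (carrier (env K A br)) \<and>
     is_antipode K (env K A br) (env_comult K A br) (env_counit K A br) S)"

definition env_hopf ::
  "('k, 'r) ring_scheme \<Rightarrow> ('k, 'a, 'c) hopf_scheme \<Rightarrow> ('a \<Rightarrow> 'a \<Rightarrow> 'a)
     \<Rightarrow> ('k, ('a env_gen list \<Rightarrow> 'k) set) hopf" where
  "env_hopf K A br = module.extend (env K A br)
     (hopf.fields (env_comult K A br) (env_counit K A br) (env_antipode K A br))"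

text \<open>The algebra map between enveloping algebras induced by a Poisson algebra map \<open>f\<close>.\<close>

definition env_map ::
  "('k, 'r) ring_scheme \<Rightarrow> ('k, 'a, 'c) module_scheme \<Rightarrow> ('a \<Rightarrow> 'a \<Rightarrow> 'a)
     \<Rightarrow> ('k, 'b, 'd) module_scheme \<Rightarrow> ('b \<Rightarrow> 'b \<Rightarrow> 'b) \<Rightarrow> ('a \<Rightarrow> 'b)
     \<Rightarrow> ('a env_gen list \<Rightarrow> 'k) set \<Rightarrow> ('b env_gen list \<Rightarrow> 'k) set" where
  "env_map K A brA B brB f = env_lift K A brA (env K B brB)
     (\<lambda>a. env_m K B brB (f a)) (\<lambda>a. env_h K B brB (f a))"

end

theory Submission
  imports Defs
begin

text \<open>
  In \<open>C\<^sup>e\<close> the elements \<open>g\<close> and \<open>h\<^sub>g\<close> act by \<open>w \<mapsto> g w g\<^sup>-\<^sup>1\<close> and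
  \<open>w \<mapsto> g w h\<^bsub>g\<^sup>-\<^sup>1\<^esub> + h\<^sub>g w g\<^sup>-\<^sup>1\<close>, and on \<open>y\<close> and \<open>h\<^sub>y\<close> this gives the stated formulas; hence \<open>\<Psi>\<close> commutes with the actions as soon as the action on \<open>R\<^sup>e\<close> exists.
  For the existence, \<open>d\<^sub>g(y) = g\<^sup>-\<^sup>1{g, y}\<close> is a Poisson derivation of \<open>R\<close>, additive in \<open>g\<close>, and the
  \<open>d\<^sub>g\<close> commute. It induces a derivation of \<open>R\<^sup>e\<close> and an automorphism \<open>\<beta>\<^sub>y \<mapsto> \<beta>\<^sub>y + d\<^sub>g(y)\<close>. All
  of these commute, and they define a representation of \<open>(kG)\<^sup>e\<close>.

  The filtration is controlled by functionals: \<open>x \<in> B\<^sub>n\<close> iff \<open>(f \<otimes> 1)\<Delta>(x) \<in> B\<^sub>n\<^sub>-\<^sub>1\<close> for every \<open>f\<close>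
  that vanishes on \<open>B\<^sub>0\<close>. This yields \<open>\<Delta>(B\<^sub>n) \<subseteq> \<Sum>\<^sub>i B\<^sub>i \<otimes> B\<^sub>n\<^sub>-\<^sub>i\<close>. Since \<open>B\<^sub>0 = kG\<close> is a
  subalgebra with zero bracket, \<open>B\<^sub>i B\<^sub>j \<subseteq> B\<^sub>i\<^sub>+\<^sub>j\<close> and \<open>{B\<^sub>i, B\<^sub>j} \<subseteq> B\<^sub>i\<^sub>+\<^sub>j\<close> follow by induction
  on \<open>i + j\<close>, so \<open>C\<close> is a Poisson Hopf algebra with the maps \<open>\<iota>\<close> and \<open>\<pi>\<close>.
\<close>

section \<open>Linear maps\<close>

text \<open>The argument is split at the locale \<open>boson\<close>, which keeps what the formulas
  involve: a Poisson algebra with a multiplicative coproduct that respects the bracket, and a copy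
  of kG in it with zero bracket, split off by a projection that kills brackets. The study of the
  filtration brings gr B into this form. In (kG)^e the element g^-1 h_g is primitive, so in a module
  algebra g acts by an automorphism and h_g by a derivation followed by it. The derivation is
  formally the bracket with log g, whence its additivity in g. The conclusion concerns every action
  with the given values, so the compatibility of \<Psi> has to be drawn from the module algebra
  axioms, not from the action constructed here. Lifts, the antipode and the graded coproduct are
  definite descriptions, so existence and uniqueness must be shown for each. Elements of a tensor
  product are classes of formal combinations; over a field, functionals on the second factor decide
  whether such a class vanishes, and the key facts on the filtration rest on this test.\<close>

lemma linear_mapsI:
  assumes "\<And>x. x \<in> carrier V \<Longrightarrow> f x \<in> carrier W"
    and "\<And>x y. x \<in> carrier V \<Longrightarrow> y \<in> carrier V \<Longrightarrow> f (x \<oplus>\<^bsub>V\<^esub> y) = f x \<oplus>\<^bsub>W\<^esub> f y"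
    and "\<And>c x. c \<in> carrier K \<Longrightarrow> x \<in> carrier V \<Longrightarrow> f (c \<odot>\<^bsub>V\<^esub> x) = c \<odot>\<^bsub>W\<^esub> f x"
  shows "f \<in> linear_maps K V W"
  using assms unfolding linear_maps_def by auto

lemma linear_mapsD:
  assumes "f \<in> linear_maps K V W"
  shows "x \<in> carrier V \<Longrightarrow> f x \<in> carrier W"
    and "x \<in> carrier V \<Longrightarrow> y \<in> carrier V \<Longrightarrow> f (x \<oplus>\<^bsub>V\<^esub> y) = f x \<oplus>\<^bsub>W\<^esub> f y"
    and "c \<in> carrier K \<Longrightarrow> x \<in> carrier V \<Longrightarrow> f (c \<odot>\<^bsub>V\<^esub> x) = c \<odot>\<^bsub>W\<^esub> f x"
  using assms unfolding linear_maps_def by auto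

lemma linear_maps_zero:
  assumes "module K V" "module K W" "f \<in> linear_maps K V W"
  shows "f \<zero>\<^bsub>V\<^esub> = \<zero>\<^bsub>W\<^esub>"
proof -
  interpret V: module K V by fact
  interpret W: module K W by fact
  have "f (\<zero>\<^bsub>K\<^esub> \<odot>\<^bsub>V\<^esub> \<zero>\<^bsub>V\<^esub>) = \<zero>\<^bsub>K\<^esub> \<odot>\<^bsub>W\<^esub> f \<zero>\<^bsub>V\<^esub>"
    by (rule linear_mapsD(3)[OF assms(3)]) auto
  then show ?thesis
    using linear_mapsD(1)[OF assms(3), of "\<zero>\<^bsub>V\<^esub>"] by simp
qed

lemma linear_maps_uminus:
  assumes "module K V" "module K W" "f \<in> linear_maps K V W" "x \<in> carrier V"
  shows "f (\<ominus>\<^bsub>V\<^esub> x) = \<ominus>\<^bsub>W\<^esub> f x"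
proof -
  interpret V: module K V by fact
  interpret W: module K W by fact
  note f = linear_mapsD[OF assms(3)]
  have "f (\<ominus>\<^bsub>V\<^esub> x) \<oplus>\<^bsub>W\<^esub> f x = f (\<ominus>\<^bsub>V\<^esub> x \<oplus>\<^bsub>V\<^esub> x)"
    using f assms(4) by simp
  also have "\<dots> = \<zero>\<^bsub>W\<^esub>"
    using assms(4) linear_maps_zero[OF assms(1-3)] by (simp add: V.M.l_neg)
  finally show ?thesis
    using f assms(4) by (simp add: W.M.minus_equality)
qed

lemma linear_maps_minus:
  assumes "module K V" "module K W" "f \<in> linear_maps K V W" "x \<in> carrier V" "y \<in> carrier V"
  shows "f (x \<ominus>\<^bsub>V\<^esub> y) = f x \<ominus>\<^bsub>W\<^esub> f y"
proof -
  interpret V: module K V by fact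
  show ?thesis
    using linear_mapsD[OF assms(3)] linear_maps_uminus[OF assms(1-3)] assms(4,5)
    by (simp add: a_minus_def)
qed

lemma linear_maps_comp:
  assumes "f \<in> linear_maps K V W" "g \<in> linear_maps K W U"
  shows "(\<lambda>x. g (f x)) \<in> linear_maps K V U"
  using linear_mapsD[OF assms(1)] linear_mapsD[OF assms(2)] by (intro linear_mapsI) auto

lemma linear_maps_finsum:
  assumes "module K V" "module K W" "f \<in> linear_maps K V W" "finite X" "g \<in> X \<rightarrow> carrier V"
  shows "f (\<Oplus>\<^bsub>V\<^esub>x\<in>X. g x) = (\<Oplus>\<^bsub>W\<^esub>x\<in>X. f (g x))"
proof -
  interpret V: module K V by fact
  interpret W: module K W by fact
  note f = linear_mapsD[OF assms(3)]
  show ?thesis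
    using assms(4,5)
  proof (induction X rule: finite_induct)
    case empty then show ?case using linear_maps_zero[OF assms(1-3)] by simp
  next
    case (insert x X)
    then have g: "g x \<in> carrier V" "g \<in> X \<rightarrow> carrier V" by auto
    then have fg: "(\<lambda>x. f (g x)) \<in> X \<rightarrow> carrier W" "f (g x) \<in> carrier W" using f by auto
    have "f (finsum V g (insert x X)) = f (g x \<oplus>\<^bsub>V\<^esub> finsum V g X)"
      using insert g by simp
    also have "\<dots> = f (g x) \<oplus>\<^bsub>W\<^esub> f (finsum V g X)"
      using g by (intro f V.M.finsum_closed) auto
    finally show ?case
      using insert g fg by simp
  qed
qed

lemma linear_maps_add:
  assumes "module K W" "f \<in> linear_maps K V W" "g \<in> linear_maps K V W"
  shows "(\<lambda>x. f x \<oplus>\<^bsub>W\<^esub> g x) \<in> linear_maps K V W"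
proof -
  interpret W: module K W by fact
  show ?thesis
    using linear_mapsD[OF assms(2)] linear_mapsD[OF assms(3)]
    by (intro linear_mapsI) (auto simp: W.M.a_ac W.smult_r_distr)
qed

lemma linear_maps_const_smult:
  assumes "module K W" "f \<in> linear_maps K V W" "c \<in> carrier K"
  shows "(\<lambda>x. c \<odot>\<^bsub>W\<^esub> f x) \<in> linear_maps K V W"
proof -
  interpret W: module K W by fact
  show ?thesis
    using linear_mapsD[OF assms(2)] assms(3)
    by (intro linear_mapsI) (auto simp: W.smult_r_distr W.smult_assoc1[symmetric] W.R.m_comm)
qed

lemma linear_maps_zero_map:
  assumes "module K W"
  shows "(\<lambda>x. \<zero>\<^bsub>W\<^esub>) \<in> linear_maps K V W"
proof -
  interpret W: module K W by fact
  show ?thesis by (intro linear_mapsI) auto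
qed

lemma linear_maps_ident: "(\<lambda>x. x) \<in> linear_maps K V V"
  by (intro linear_mapsI) auto

lemma linear_maps_finsum_map:
  assumes "module K W" "finite X" "\<And>i. i \<in> X \<Longrightarrow> f i \<in> linear_maps K V W"
  shows "(\<lambda>x. \<Oplus>\<^bsub>W\<^esub>i\<in>X. f i x) \<in> linear_maps K V W"
proof -
  interpret W: module K W by fact
  note f = linear_mapsD[OF assms(3)]
  show ?thesis
  proof (intro linear_mapsI)
    fix x assume "x \<in> carrier V"
    then show "(\<Oplus>\<^bsub>W\<^esub>i\<in>X. f i x) \<in> carrier W" using f by (intro W.M.finsum_closed) auto
  next
    fix x y assume xy: "x \<in> carrier V" "y \<in> carrier V"
    then have "(\<Oplus>\<^bsub>W\<^esub>i\<in>X. f i (x \<oplus>\<^bsub>V\<^esub> y)) = (\<Oplus>\<^bsub>W\<^esub>i\<in>X. f i x \<oplus>\<^bsub>W\<^esub> f i y)"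
      using f by (intro W.M.finsum_cong') auto
    also have "\<dots> = (\<Oplus>\<^bsub>W\<^esub>i\<in>X. f i x) \<oplus>\<^bsub>W\<^esub> (\<Oplus>\<^bsub>W\<^esub>i\<in>X. f i y)"
      using f xy by (intro W.M.finsum_addf) auto
    finally show "(\<Oplus>\<^bsub>W\<^esub>i\<in>X. f i (x \<oplus>\<^bsub>V\<^esub> y)) = \<dots>" .
  next
    fix c x assume cx: "c \<in> carrier K" "x \<in> carrier V"
    then have "(\<Oplus>\<^bsub>W\<^esub>i\<in>X. f i (c \<odot>\<^bsub>V\<^esub> x)) = (\<Oplus>\<^bsub>W\<^esub>i\<in>X. c \<odot>\<^bsub>W\<^esub> f i x)"
      using f by (intro W.M.finsum_cong') auto
    also have "\<dots> = c \<odot>\<^bsub>W\<^esub> (\<Oplus>\<^bsub>W\<^esub>i\<in>X. f i x)"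
      using f cx assms(2) by (intro W.finsum_smult_ldistr[symmetric]) auto
    finally show "(\<Oplus>\<^bsub>W\<^esub>i\<in>X. f i (c \<odot>\<^bsub>V\<^esub> x)) = \<dots>" .
  qed
qed

section \<open>Associative algebras\<close>

locale asalg = module K A + ring A for K :: "('k, 'r) ring_scheme" and A :: "('k, 'a, 'c) module_scheme" (structure) +
  assumes smult_l: "\<lbrakk>c \<in> carrier K; x \<in> carrier A; y \<in> carrier A\<rbrakk> \<Longrightarrow> (c \<odot> x) \<otimes> y = c \<odot> (x \<otimes> y)"
    and smult_r: "\<lbrakk>c \<in> carrier K; x \<in> carrier A; y \<in> carrier A\<rbrakk> \<Longrightarrow> x \<otimes> (c \<odot> y) = c \<odot> (x \<otimes> y)"

lemma assoc_algebra_iff: "assoc_algebra K A \<longleftrightarrow> asalg K A"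
  unfolding assoc_algebra_def asalg_def asalg_axioms_def by blast

lemma asalgI:
  assumes "module K A" "monoid A"
    and "\<And>x y z. \<lbrakk>x \<in> carrier A; y \<in> carrier A; z \<in> carrier A\<rbrakk> \<Longrightarrow> (x \<oplus>\<^bsub>A\<^esub> y) \<otimes>\<^bsub>A\<^esub> z = x \<otimes>\<^bsub>A\<^esub> z \<oplus>\<^bsub>A\<^esub> y \<otimes>\<^bsub>A\<^esub> z"
    and "\<And>x y z. \<lbrakk>x \<in> carrier A; y \<in> carrier A; z \<in> carrier A\<rbrakk> \<Longrightarrow> z \<otimes>\<^bsub>A\<^esub> (x \<oplus>\<^bsub>A\<^esub> y) = z \<otimes>\<^bsub>A\<^esub> x \<oplus>\<^bsub>A\<^esub> z \<otimes>\<^bsub>A\<^esub> y"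
    and "\<And>c x y. \<lbrakk>c \<in> carrier K; x \<in> carrier A; y \<in> carrier A\<rbrakk> \<Longrightarrow> (c \<odot>\<^bsub>A\<^esub> x) \<otimes>\<^bsub>A\<^esub> y = c \<odot>\<^bsub>A\<^esub> (x \<otimes>\<^bsub>A\<^esub> y)"
    and "\<And>c x y. \<lbrakk>c \<in> carrier K; x \<in> carrier A; y \<in> carrier A\<rbrakk> \<Longrightarrow> x \<otimes>\<^bsub>A\<^esub> (c \<odot>\<^bsub>A\<^esub> y) = c \<odot>\<^bsub>A\<^esub> (x \<otimes>\<^bsub>A\<^esub> y)"
  shows "asalg K A"
proof -
  interpret module K A by fact
  have "ring A" using assms by (intro ringI M.abelian_group_axioms) auto
  then show ?thesis
    using assms by (intro asalg.intro asalg_axioms.intro) auto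
qed

lemma algebra_asalg: assumes "algebra K A" shows "asalg K A"
proof -
  interpret algebra K A by fact
  show ?thesis
    by (intro asalgI module_axioms) (auto simp: l_distr r_distr smult_assoc2 is_monoid, metis m_comm smult_assoc2 smult_closed)
qed

lemma asalg_algebra: assumes "asalg K A" "\<And>x y. x \<in> carrier A \<Longrightarrow> y \<in> carrier A \<Longrightarrow> x \<otimes>\<^bsub>A\<^esub> y = y \<otimes>\<^bsub>A\<^esub> x"
  shows "algebra K A"
proof -
  interpret asalg K A by fact
  have "cring A" using assms(2) by (intro cring.intro ring_axioms comm_monoid.intro is_monoid comm_monoid_axioms.intro)
  then show ?thesis
    by (intro algebra.intro module_axioms algebra_axioms.intro) (auto simp: smult_l)
qed

lemma (in asalg) smult_conv_mult: "\<lbrakk>c \<in> carrier K; x \<in> carrier A\<rbrakk> \<Longrightarrow> c \<odot> x = (c \<odot> \<one>) \<otimes> x"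
  by (simp add: smult_l)

lemma (in asalg) linear_mult_left: "x \<in> carrier A \<Longrightarrow> (\<lambda>y. x \<otimes> y) \<in> linear_maps K A A"
  by (intro linear_mapsI) (auto simp: r_distr smult_r)

lemma (in asalg) linear_mult_right: "x \<in> carrier A \<Longrightarrow> (\<lambda>y. y \<otimes> x) \<in> linear_maps K A A"
  by (intro linear_mapsI) (auto simp: l_distr smult_l)

lemma alg_homsI:
  assumes "f \<in> linear_maps K A B"
    and "\<And>x y. x \<in> carrier A \<Longrightarrow> y \<in> carrier A \<Longrightarrow> f (x \<otimes>\<^bsub>A\<^esub> y) = f x \<otimes>\<^bsub>B\<^esub> f y"
    and "f \<one>\<^bsub>A\<^esub> = \<one>\<^bsub>B\<^esub>"
  shows "f \<in> alg_homs K A B"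
  using assms linear_mapsD[OF assms(1)] unfolding alg_homs_def ring_hom_def by auto

lemma alg_homsD:
  assumes "f \<in> alg_homs K A B"
  shows "f \<in> linear_maps K A B"
    and "x \<in> carrier A \<Longrightarrow> y \<in> carrier A \<Longrightarrow> f (x \<otimes>\<^bsub>A\<^esub> y) = f x \<otimes>\<^bsub>B\<^esub> f y"
    and "f \<one>\<^bsub>A\<^esub> = \<one>\<^bsub>B\<^esub>"
  using assms unfolding alg_homs_def ring_hom_def by auto

lemma alg_homs_comp:
  assumes "f \<in> alg_homs K A B" "g \<in> alg_homs K B C"
  shows "(\<lambda>x. g (f x)) \<in> alg_homs K A C"
  by (intro alg_homsI linear_maps_comp[OF alg_homsD(1)[OF assms(1)] alg_homsD(1)[OF assms(2)]])
    (simp_all add: alg_homsD(2,3)[OF assms(1)] alg_homsD(2,3)[OF assms(2)] linear_mapsD(1)[OF alg_homsD(1)[OF assms(1)]])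

text \<open>Group algebras, \<^const>\<open>gr\<close> and \<^const>\<open>env_hopf\<close> extend an algebra by further record fields, which the
  constructions on algebras ignore.\<close>

definition same_algebra ::
  "('k, 'a, 'c) module_scheme \<Rightarrow> ('k, 'a, 'd) module_scheme \<Rightarrow> bool" where
  "same_algebra A B \<longleftrightarrow> carrier A = carrier B \<and> mult A = mult B \<and> one A = one B \<and>
     zero A = zero B \<and> add A = add B \<and> smult A = smult B"

lemma same_algebraD:
  assumes "same_algebra A B"
  shows "carrier A = carrier B" "mult A = mult B" "one A = one B"
     "zero A = zero B" "add A = add B" "smult A = smult B"
  using assms unfolding same_algebra_def by auto

lemma same_algebra_sym: "same_algebra A B \<Longrightarrow> same_algebra B A"
  unfolding same_algebra_def by auto

lemma same_algebra_linear_maps: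
  "same_algebra A A' \<Longrightarrow> same_algebra B B' \<Longrightarrow> linear_maps K A B = linear_maps K A' B'"
  unfolding same_algebra_def linear_maps_def by simp

lemma same_algebra_alg_homs:
  "same_algebra A A' \<Longrightarrow> same_algebra B B' \<Longrightarrow> alg_homs K A B = alg_homs K A' B'"
  unfolding same_algebra_def linear_maps_def alg_homs_def ring_hom_def by simp

lemma same_algebra_module:
  assumes "same_algebra A B" "module K A" shows "module K B"
proof -
  interpret module K A by fact
  note s [simp] = same_algebraD[OF assms(1), symmetric]
  show ?thesis
    by (intro moduleI abelian_groupI R.cring_axioms)
      (auto simp: M.a_ac smult_l_distr smult_r_distr smult_assoc1
        intro!: bexI[of _ "\<ominus>\<^bsub>A\<^esub> _"] M.l_neg)
qed

lemma same_algebra_asalg: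
  assumes "same_algebra A B" "asalg K A" shows "asalg K B"
proof -
  interpret asalg K A by fact
  note s [simp] = same_algebraD[OF assms(1), symmetric]
  show ?thesis
    by (intro asalgI same_algebra_module[OF assms(1)] module_axioms monoidI)
      (auto simp: m_assoc l_distr r_distr smult_l smult_r)
qed

lemma same_algebra_finsum:
  "same_algebra A B \<Longrightarrow> finsum A f X = finsum B f X"
  unfolding finsum_def finprod_def by (simp add: same_algebra_def)

lemma same_algebra_lin_ext:
  "same_algebra A B \<Longrightarrow> lin_ext K A = lin_ext K B"
  unfolding lin_ext_def by (intro ext) (simp add: same_algebra_finsum same_algebraD)

section \<open>The base field as an algebra\<close>

lemma base_algebra_sel [simp]:
  "carrier (base_algebra K) = carrier K" "mult (base_algebra K) = mult K"
  "one (base_algebra K) = one K" "zero (base_algebra K) = zero K"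
  "add (base_algebra K) = add K" "smult (base_algebra K) = mult K"
  by (simp_all add: base_algebra_def)

lemma base_algebra_asalg:
  assumes "cring K" shows "asalg K (base_algebra K)"
proof -
  interpret cring K by fact
  show ?thesis
    by (intro asalgI moduleI abelian_groupI monoidI cring_axioms)
      (auto simp: m_assoc l_distr r_distr a_ac m_lcomm intro!: bexI[of _ "\<ominus>\<^bsub>K\<^esub> _"] l_neg)
qed

section \<open>Monoid algebras\<close>

locale monalg = K: cring K + M: monoid M for K :: "('k, 'r) ring_scheme" and M :: "('m, 's) monoid_scheme"
begin

abbreviation A where "A \<equiv> monoid_algebra K M"

lemma ma_carrier: "r \<in> carrier A \<longleftrightarrow> (\<forall>x. r x \<in> carrier K) \<and> finite (supp K r) \<and> supp K r \<subseteq> carrier M"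
  unfolding monoid_algebra_def by auto

lemma ma_sel:
  "r \<oplus>\<^bsub>A\<^esub> s = (\<lambda>z. r z \<oplus>\<^bsub>K\<^esub> s z)" "\<zero>\<^bsub>A\<^esub> = (\<lambda>z. \<zero>\<^bsub>K\<^esub>)" "c \<odot>\<^bsub>A\<^esub> r = (\<lambda>z. c \<otimes>\<^bsub>K\<^esub> r z)" "\<one>\<^bsub>A\<^esub> = mdelta K \<one>\<^bsub>M\<^esub>"
  unfolding monoid_algebra_def by auto

text \<open>The defining sum runs over the supports, which change under addition and scaling.
  Enlarging both index sets only adds zero terms, so products of different elements can be compared
  over common sets.\<close>

lemma mult_eq:
  assumes "r \<in> carrier A" "s \<in> carrier A" "finite X" "supp K r \<subseteq> X" "finite Y" "supp K s \<subseteq> Y"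
  shows "(r \<otimes>\<^bsub>A\<^esub> s) z = (\<Oplus>\<^bsub>K\<^esub>p\<in>{p \<in> X \<times> Y. fst p \<otimes>\<^bsub>M\<^esub> snd p = z}. r (fst p) \<otimes>\<^bsub>K\<^esub> s (snd p))"
  using assms(1,2) unfolding monoid_algebra_def
  apply simp
  apply (rule K.add.finprod_mono_neutral_cong_left)
  using assms by (auto simp: supp_def image_subset_iff)

lemma delta_closed [simp]: "x \<in> carrier M \<Longrightarrow> mdelta K x \<in> carrier A"
  by (auto simp: ma_carrier mdelta_def supp_def)

lemma A_module: "module K A"
proof (intro moduleI abelian_groupI K.cring_axioms)
  fix r s assume "r \<in> carrier A" "s \<in> carrier A"
  moreover have "supp K (\<lambda>z. r z \<oplus>\<^bsub>K\<^esub> s z) \<subseteq> supp K r \<union> supp K s"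
    unfolding supp_def by auto
  ultimately show "r \<oplus>\<^bsub>A\<^esub> s \<in> carrier A"
    by (auto simp: ma_carrier ma_sel dest: finite_subset)
next
  fix c r assume "c \<in> carrier K" "r \<in> carrier A"
  moreover from this have "supp K (\<lambda>z. c \<otimes>\<^bsub>K\<^esub> r z) \<subseteq> supp K r"
    unfolding supp_def by auto
  ultimately show "c \<odot>\<^bsub>A\<^esub> r \<in> carrier A"
    by (auto simp: ma_carrier ma_sel dest: finite_subset)
next
  fix r assume r: "r \<in> carrier A"
  moreover from this have "supp K (\<lambda>z. \<ominus>\<^bsub>K\<^esub> r z) \<subseteq> supp K r"
    unfolding supp_def by (auto simp: ma_carrier)
  ultimately have "(\<lambda>z. \<ominus>\<^bsub>K\<^esub> r z) \<in> carrier A"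
    by (auto simp: ma_carrier ma_sel dest: finite_subset)
  then show "\<exists>s\<in>carrier A. s \<oplus>\<^bsub>A\<^esub> r = \<zero>\<^bsub>A\<^esub>"
    using r by (intro bexI[of _ "\<lambda>z. \<ominus>\<^bsub>K\<^esub> r z"]) (auto simp: ma_carrier ma_sel K.l_neg)
qed (auto simp: ma_carrier ma_sel supp_def K.a_ac K.l_distr K.r_distr K.m_assoc)

interpretation A: module K A by (rule A_module)

text \<open>Induction over a finite set that contains the support: the value at one point is set to
  zero and added back as a multiple of a basis element.\<close>

lemma ma_induct [consumes 1, case_names zero add delta]:
  assumes "r \<in> carrier A" "P \<zero>\<^bsub>A\<^esub>"
    and add: "\<And>r s. r \<in> carrier A \<Longrightarrow> s \<in> carrier A \<Longrightarrow> P r \<Longrightarrow> P s \<Longrightarrow> P (r \<oplus>\<^bsub>A\<^esub> s)"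
    and delta: "\<And>c x. c \<in> carrier K \<Longrightarrow> x \<in> carrier M \<Longrightarrow> P (c \<odot>\<^bsub>A\<^esub> mdelta K x)"
  shows "P r"
proof -
  have "\<forall>r. r \<in> carrier A \<longrightarrow> supp K r \<subseteq> X \<longrightarrow> P r" if "finite X" "X \<subseteq> carrier M" for X
    using that
  proof (induction X rule: finite_induct)
    case empty
    have "r = \<zero>\<^bsub>A\<^esub>" if "supp K r \<subseteq> {}" for r
      using that by (auto simp: supp_def ma_sel)
    with assms(2) show ?case by auto
  next
    case (insert x X)
    show ?case
    proof (intro allI impI)
      fix r assume r: "r \<in> carrier A" "supp K r \<subseteq> insert x X"
      let ?s = "r(x := \<zero>\<^bsub>K\<^esub>)"
      have "supp K ?s \<subseteq> supp K r" by (auto simp: supp_def)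
      then have s: "?s \<in> carrier A" using r by (auto simp: ma_carrier dest: finite_subset)
      have "supp K ?s \<subseteq> X" using r by (auto simp: supp_def)
      with s insert have "P ?s" by auto
      moreover have rx: "r x \<in> carrier K" "x \<in> carrier M" using r insert by (auto simp: ma_carrier)
      moreover have "r = ?s \<oplus>\<^bsub>A\<^esub> r x \<odot>\<^bsub>A\<^esub> mdelta K x"
        using r rx by (auto simp: ma_sel mdelta_def ma_carrier)
      ultimately show "P r" using add[OF s, of "r x \<odot>\<^bsub>A\<^esub> mdelta K x"] delta by auto
    qed
  qed
  then show ?thesis using assms(1) by (auto simp: ma_carrier)
qed

lemma mult_closed: assumes "r \<in> carrier A" "s \<in> carrier A" shows "r \<otimes>\<^bsub>A\<^esub> s \<in> carrier A"
proof -
  have rs: "finite (supp K r)" "finite (supp K s)" "supp K r \<subseteq> carrier M" "supp K s \<subseteq> carrier M"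
    using assms by (auto simp: ma_carrier)
  have eq: "(r \<otimes>\<^bsub>A\<^esub> s) z = (\<Oplus>\<^bsub>K\<^esub>p\<in>{p \<in> supp K r \<times> supp K s. fst p \<otimes>\<^bsub>M\<^esub> snd p = z}. r (fst p) \<otimes>\<^bsub>K\<^esub> s (snd p))" for z
    using assms rs by (intro mult_eq) auto
  have "(r \<otimes>\<^bsub>A\<^esub> s) z = \<zero>\<^bsub>K\<^esub>" if "z \<notin> (\<lambda>p. fst p \<otimes>\<^bsub>M\<^esub> snd p) ` (supp K r \<times> supp K s)" for z
  proof -
    have "{p \<in> supp K r \<times> supp K s. fst p \<otimes>\<^bsub>M\<^esub> snd p = z} = {}" using that by force
    then show ?thesis unfolding eq by (simp only: K.finsum_empty)
  qed
  then have sub: "supp K (r \<otimes>\<^bsub>A\<^esub> s) \<subseteq> (\<lambda>p. fst p \<otimes>\<^bsub>M\<^esub> snd p) ` (supp K r \<times> supp K s)"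
    unfolding supp_def by auto
  then have "finite (supp K (r \<otimes>\<^bsub>A\<^esub> s))" using rs finite_subset by blast
  moreover have "supp K (r \<otimes>\<^bsub>A\<^esub> s) \<subseteq> carrier M" using sub rs by fastforce
  moreover have "(r \<otimes>\<^bsub>A\<^esub> s) z \<in> carrier K" for z
    unfolding eq using assms by (intro K.finsum_closed) (auto simp: ma_carrier)
  ultimately show ?thesis by (simp add: ma_carrier)
qed

lemma supp_add: "r \<in> carrier A \<Longrightarrow> s \<in> carrier A \<Longrightarrow> supp K (r \<oplus>\<^bsub>A\<^esub> s) \<subseteq> supp K r \<union> supp K s"
  by (auto simp: supp_def ma_sel)

lemma ma_l_distr: assumes "r \<in> carrier A" "s \<in> carrier A" "t \<in> carrier A"
  shows "(r \<oplus>\<^bsub>A\<^esub> s) \<otimes>\<^bsub>A\<^esub> t = r \<otimes>\<^bsub>A\<^esub> t \<oplus>\<^bsub>A\<^esub> s \<otimes>\<^bsub>A\<^esub> t"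
proof
  fix z
  let ?X = "supp K r \<union> supp K s" and ?Y = "supp K t"
  have fin: "finite ?X" "finite ?Y" using assms by (auto simp: ma_carrier)
  have cl: "r x \<in> carrier K" "s x \<in> carrier K" "t x \<in> carrier K" for x
    using assms by (auto simp: ma_carrier)
  let ?P = "{p \<in> ?X \<times> ?Y. fst p \<otimes>\<^bsub>M\<^esub> snd p = z}"
  have "((r \<oplus>\<^bsub>A\<^esub> s) \<otimes>\<^bsub>A\<^esub> t) z = (\<Oplus>\<^bsub>K\<^esub>p\<in>?P. (r \<oplus>\<^bsub>A\<^esub> s) (fst p) \<otimes>\<^bsub>K\<^esub> t (snd p))"
    using assms fin supp_add[OF assms(1,2)] by (intro mult_eq) auto
  also have "\<dots> = (\<Oplus>\<^bsub>K\<^esub>p\<in>?P. r (fst p) \<otimes>\<^bsub>K\<^esub> t (snd p) \<oplus>\<^bsub>K\<^esub> s (fst p) \<otimes>\<^bsub>K\<^esub> t (snd p))"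
    using cl by (intro K.finsum_cong') (auto simp: ma_sel K.l_distr)
  also have "\<dots> = (\<Oplus>\<^bsub>K\<^esub>p\<in>?P. r (fst p) \<otimes>\<^bsub>K\<^esub> t (snd p)) \<oplus>\<^bsub>K\<^esub> (\<Oplus>\<^bsub>K\<^esub>p\<in>?P. s (fst p) \<otimes>\<^bsub>K\<^esub> t (snd p))"
    using cl by (intro K.finsum_addf) auto
  also have "\<dots> = (r \<otimes>\<^bsub>A\<^esub> t) z \<oplus>\<^bsub>K\<^esub> (s \<otimes>\<^bsub>A\<^esub> t) z"
    using mult_eq[OF assms(1,3), of ?X ?Y z] mult_eq[OF assms(2,3), of ?X ?Y z] fin by simp
  finally show "((r \<oplus>\<^bsub>A\<^esub> s) \<otimes>\<^bsub>A\<^esub> t) z = (r \<otimes>\<^bsub>A\<^esub> t \<oplus>\<^bsub>A\<^esub> s \<otimes>\<^bsub>A\<^esub> t) z" by (simp add: ma_sel)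
qed

lemma ma_r_distr: assumes "r \<in> carrier A" "s \<in> carrier A" "t \<in> carrier A"
  shows "t \<otimes>\<^bsub>A\<^esub> (r \<oplus>\<^bsub>A\<^esub> s) = t \<otimes>\<^bsub>A\<^esub> r \<oplus>\<^bsub>A\<^esub> t \<otimes>\<^bsub>A\<^esub> s"
proof
  fix z
  let ?X = "supp K r \<union> supp K s" and ?Y = "supp K t"
  have fin: "finite ?X" "finite ?Y" using assms by (auto simp: ma_carrier)
  have cl: "r x \<in> carrier K" "s x \<in> carrier K" "t x \<in> carrier K" for x
    using assms by (auto simp: ma_carrier)
  let ?P = "{p \<in> ?Y \<times> ?X. fst p \<otimes>\<^bsub>M\<^esub> snd p = z}"
  have "(t \<otimes>\<^bsub>A\<^esub> (r \<oplus>\<^bsub>A\<^esub> s)) z = (\<Oplus>\<^bsub>K\<^esub>p\<in>?P. t (fst p) \<otimes>\<^bsub>K\<^esub> (r \<oplus>\<^bsub>A\<^esub> s) (snd p))"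
    using assms fin supp_add[OF assms(1,2)] by (intro mult_eq) auto
  also have "\<dots> = (\<Oplus>\<^bsub>K\<^esub>p\<in>?P. t (fst p) \<otimes>\<^bsub>K\<^esub> r (snd p) \<oplus>\<^bsub>K\<^esub> t (fst p) \<otimes>\<^bsub>K\<^esub> s (snd p))"
    using cl by (intro K.finsum_cong') (auto simp: ma_sel K.r_distr)
  also have "\<dots> = (\<Oplus>\<^bsub>K\<^esub>p\<in>?P. t (fst p) \<otimes>\<^bsub>K\<^esub> r (snd p)) \<oplus>\<^bsub>K\<^esub> (\<Oplus>\<^bsub>K\<^esub>p\<in>?P. t (fst p) \<otimes>\<^bsub>K\<^esub> s (snd p))"
    using cl by (intro K.finsum_addf) auto
  also have "\<dots> = (t \<otimes>\<^bsub>A\<^esub> r) z \<oplus>\<^bsub>K\<^esub> (t \<otimes>\<^bsub>A\<^esub> s) z"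
    using mult_eq[OF assms(3,1), of ?Y ?X z] mult_eq[OF assms(3,2), of ?Y ?X z] fin by simp
  finally show "(t \<otimes>\<^bsub>A\<^esub> (r \<oplus>\<^bsub>A\<^esub> s)) z = (t \<otimes>\<^bsub>A\<^esub> r \<oplus>\<^bsub>A\<^esub> t \<otimes>\<^bsub>A\<^esub> s) z" by (simp add: ma_sel)
qed

lemma ma_smult: assumes "c \<in> carrier K" "r \<in> carrier A" "s \<in> carrier A"
  shows "(c \<odot>\<^bsub>A\<^esub> r) \<otimes>\<^bsub>A\<^esub> s = c \<odot>\<^bsub>A\<^esub> (r \<otimes>\<^bsub>A\<^esub> s)" "r \<otimes>\<^bsub>A\<^esub> (c \<odot>\<^bsub>A\<^esub> s) = c \<odot>\<^bsub>A\<^esub> (r \<otimes>\<^bsub>A\<^esub> s)"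
proof -
  let ?X = "supp K r" and ?Y = "supp K s"
  have fin: "finite ?X" "finite ?Y" using assms by (auto simp: ma_carrier)
  have cl: "r x \<in> carrier K" "s x \<in> carrier K" for x
    using assms by (auto simp: ma_carrier)
  have cr: "supp K (c \<odot>\<^bsub>A\<^esub> r) \<subseteq> ?X" "supp K (c \<odot>\<^bsub>A\<^esub> s) \<subseteq> ?Y"
    using assms by (auto simp: supp_def ma_sel)
  let ?P = "\<lambda>z. {p \<in> ?X \<times> ?Y. fst p \<otimes>\<^bsub>M\<^esub> snd p = z}"
  have *: "c \<otimes>\<^bsub>K\<^esub> (r \<otimes>\<^bsub>A\<^esub> s) z = (\<Oplus>\<^bsub>K\<^esub>p\<in>?P z. c \<otimes>\<^bsub>K\<^esub> (r (fst p) \<otimes>\<^bsub>K\<^esub> s (snd p)))" for z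
    using mult_eq[OF assms(2,3), of ?X ?Y z] fin cl assms(1)
    by (simp add: K.finsum_rdistr Pi_def)
  show "(c \<odot>\<^bsub>A\<^esub> r) \<otimes>\<^bsub>A\<^esub> s = c \<odot>\<^bsub>A\<^esub> (r \<otimes>\<^bsub>A\<^esub> s)"
  proof
    fix z
    have "((c \<odot>\<^bsub>A\<^esub> r) \<otimes>\<^bsub>A\<^esub> s) z = (\<Oplus>\<^bsub>K\<^esub>p\<in>?P z. (c \<odot>\<^bsub>A\<^esub> r) (fst p) \<otimes>\<^bsub>K\<^esub> s (snd p))"
      using assms fin cr by (intro mult_eq) auto
    also have "\<dots> = (\<Oplus>\<^bsub>K\<^esub>p\<in>?P z. c \<otimes>\<^bsub>K\<^esub> (r (fst p) \<otimes>\<^bsub>K\<^esub> s (snd p)))"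
      using cl assms(1) by (intro K.finsum_cong') (auto simp: ma_sel K.m_assoc)
    finally show "((c \<odot>\<^bsub>A\<^esub> r) \<otimes>\<^bsub>A\<^esub> s) z = (c \<odot>\<^bsub>A\<^esub> (r \<otimes>\<^bsub>A\<^esub> s)) z" by (simp add: ma_sel *)
  qed
  show "r \<otimes>\<^bsub>A\<^esub> (c \<odot>\<^bsub>A\<^esub> s) = c \<odot>\<^bsub>A\<^esub> (r \<otimes>\<^bsub>A\<^esub> s)"
  proof
    fix z
    have "(r \<otimes>\<^bsub>A\<^esub> (c \<odot>\<^bsub>A\<^esub> s)) z = (\<Oplus>\<^bsub>K\<^esub>p\<in>?P z. r (fst p) \<otimes>\<^bsub>K\<^esub> (c \<odot>\<^bsub>A\<^esub> s) (snd p))"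
      using assms fin cr by (intro mult_eq) auto
    also have "\<dots> = (\<Oplus>\<^bsub>K\<^esub>p\<in>?P z. c \<otimes>\<^bsub>K\<^esub> (r (fst p) \<otimes>\<^bsub>K\<^esub> s (snd p)))"
      using cl assms(1) by (intro K.finsum_cong') (auto simp: ma_sel K.m_lcomm)
    finally show "(r \<otimes>\<^bsub>A\<^esub> (c \<odot>\<^bsub>A\<^esub> s)) z = (c \<odot>\<^bsub>A\<^esub> (r \<otimes>\<^bsub>A\<^esub> s)) z" by (simp add: ma_sel *)
  qed
qed

lemma supp_delta: "supp K (mdelta K x) \<subseteq> {x}"
  by (auto simp: supp_def mdelta_def)

lemma ma_null: assumes "u \<in> carrier A" shows "\<zero>\<^bsub>A\<^esub> \<otimes>\<^bsub>A\<^esub> u = \<zero>\<^bsub>A\<^esub>" "u \<otimes>\<^bsub>A\<^esub> \<zero>\<^bsub>A\<^esub> = \<zero>\<^bsub>A\<^esub>"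
  using ma_smult[of "\<zero>\<^bsub>K\<^esub>" "\<zero>\<^bsub>A\<^esub>" u] ma_smult[of "\<zero>\<^bsub>K\<^esub>" u "\<zero>\<^bsub>A\<^esub>"] assms mult_closed by auto

lemma delta_mult: assumes "x \<in> carrier M" "y \<in> carrier M"
  shows "mdelta K x \<otimes>\<^bsub>A\<^esub> mdelta K y = mdelta K (x \<otimes>\<^bsub>M\<^esub> y)"
proof
  fix z
  have "(mdelta K x \<otimes>\<^bsub>A\<^esub> mdelta K y) z =
      (\<Oplus>\<^bsub>K\<^esub>p\<in>{p \<in> {x} \<times> {y}. fst p \<otimes>\<^bsub>M\<^esub> snd p = z}. mdelta K x (fst p) \<otimes>\<^bsub>K\<^esub> mdelta K y (snd p))"
    by (intro mult_eq delta_closed assms supp_delta) auto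
  also have "{p \<in> {x} \<times> {y}. fst p \<otimes>\<^bsub>M\<^esub> snd p = z} = (if z = x \<otimes>\<^bsub>M\<^esub> y then {(x, y)} else {})"
    by auto
  finally show "(mdelta K x \<otimes>\<^bsub>A\<^esub> mdelta K y) z = mdelta K (x \<otimes>\<^bsub>M\<^esub> y) z"
    by (simp add: mdelta_def)
qed

text \<open>Associativity is trilinear, so three nested inductions reduce it to basis elements,
  where it is associativity of \<open>M\<close>.\<close>

lemma A_asalg: "asalg K A"
proof (intro asalgI A_module monoidI mult_closed)
  note [simp] = mult_closed ma_smult delta_mult
  show "\<one>\<^bsub>A\<^esub> \<in> carrier A" by (simp add: ma_sel(4))
  show "(x \<otimes>\<^bsub>A\<^esub> y) \<otimes>\<^bsub>A\<^esub> z = x \<otimes>\<^bsub>A\<^esub> (y \<otimes>\<^bsub>A\<^esub> z)" if "x \<in> carrier A" "y \<in> carrier A" "z \<in> carrier A" for x y z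
  proof -
    note n1 = ma_null
    show ?thesis
      using that(1)
    proof (induction x rule: ma_induct)
      case zero then show ?case using that by (simp add: n1)
    next
      case (add r s) then show ?case using that by (simp add: ma_l_distr)
    next
      case (delta c x)
      have "(mdelta K x \<otimes>\<^bsub>A\<^esub> y) \<otimes>\<^bsub>A\<^esub> z = mdelta K x \<otimes>\<^bsub>A\<^esub> (y \<otimes>\<^bsub>A\<^esub> z)"
        using that(2)
      proof (induction y rule: ma_induct)
        case zero then show ?case using that delta by (simp add: n1)
      next
        case (add r s) then show ?case using that delta by (simp add: ma_l_distr ma_r_distr)
      next
        case (delta d y)
        have "(mdelta K x \<otimes>\<^bsub>A\<^esub> mdelta K y) \<otimes>\<^bsub>A\<^esub> z = mdelta K x \<otimes>\<^bsub>A\<^esub> (mdelta K y \<otimes>\<^bsub>A\<^esub> z)"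
          using that(3)
        proof (induction z rule: ma_induct)
          case zero then show ?case using \<open>x \<in> carrier M\<close> delta by (simp add: n1)
        next
          case (add r s) then show ?case using \<open>x \<in> carrier M\<close> delta by (simp add: ma_r_distr)
        next
          case (delta e z)
          then show ?case using \<open>x \<in> carrier M\<close> \<open>y \<in> carrier M\<close> by (simp add: M.m_assoc)
        qed
        then show ?case using that delta \<open>x \<in> carrier M\<close> by simp
      qed
      then show ?case using that delta by simp
    qed
  qed
  have one: "\<one>\<^bsub>A\<^esub> \<otimes>\<^bsub>A\<^esub> x = x \<and> x \<otimes>\<^bsub>A\<^esub> \<one>\<^bsub>A\<^esub> = x" if "x \<in> carrier A" for x
    using that
  proof (induction x rule: ma_induct)
    case zero
    show ?case by (simp add: ma_null ma_sel(4))
  next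
    case (add r s) then show ?case by (simp add: ma_l_distr ma_r_distr ma_sel(4))
  next
    case (delta c x) then show ?case by (simp add: ma_sel(4))
  qed
  show "\<one>\<^bsub>A\<^esub> \<otimes>\<^bsub>A\<^esub> x = x" "x \<otimes>\<^bsub>A\<^esub> \<one>\<^bsub>A\<^esub> = x" if "x \<in> carrier A" for x using one[OF that] by auto
qed (auto intro: ma_l_distr ma_r_distr simp: ma_smult)

end

lemma lin_ext_superset:
  assumes "module K V" "finite X" "supp K r \<subseteq> X" "range r \<subseteq> carrier K" "f \<in> X \<rightarrow> carrier V"
  shows "lin_ext K V f r = (\<Oplus>\<^bsub>V\<^esub>x\<in>X. r x \<odot>\<^bsub>V\<^esub> f x)"
proof -
  interpret module K V by fact
  show ?thesis
    unfolding lin_ext_def using assms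
    by (intro M.add.finprod_mono_neutral_cong_left) (auto simp: supp_def image_subset_iff Pi_def)
qed

lemma lin_ext_delta:
  assumes "module K V" "f x \<in> carrier V"
  shows "lin_ext K V f (mdelta K x) = f x"
proof -
  interpret module K V by fact
  have "lin_ext K V f (mdelta K x) = (\<Oplus>\<^bsub>V\<^esub>y\<in>{x}. mdelta K x y \<odot>\<^bsub>V\<^esub> f y)"
    using assms by (intro lin_ext_superset) (auto simp: supp_def mdelta_def)
  then show ?thesis using assms by (simp add: mdelta_def)
qed

lemma lin_ext_linear:
  assumes "module K V" "f \<in> carrier M \<rightarrow> carrier V" "monoid M"
  shows "lin_ext K V f \<in> linear_maps K (monoid_algebra K M) V"
proof -
  interpret module K V by fact
  interpret M: monoid M by fact
  interpret monalg K M by unfold_locales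
  show ?thesis
  proof (intro linear_mapsI)
    fix r s assume r: "r \<in> carrier A" and s: "s \<in> carrier A"
    have ran: "range r \<subseteq> carrier K" "range s \<subseteq> carrier K" using r s by (auto simp: ma_carrier)
    let ?X = "supp K r \<union> supp K s"
    have X: "finite ?X" "f \<in> ?X \<rightarrow> carrier V" using r s assms(2) by (auto simp: ma_carrier Pi_def)
    show "lin_ext K V f r \<in> carrier V"
      unfolding lin_ext_def using r assms(2) by (intro M.finsum_closed) (auto simp: ma_carrier Pi_def)
    have "lin_ext K V f (r \<oplus>\<^bsub>A\<^esub> s) = (\<Oplus>\<^bsub>V\<^esub>x\<in>?X. (r \<oplus>\<^bsub>A\<^esub> s) x \<odot>\<^bsub>V\<^esub> f x)"
      using r s X assms ran by (intro lin_ext_superset) (auto simp: ma_sel supp_def image_subset_iff)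
    also have "\<dots> = (\<Oplus>\<^bsub>V\<^esub>x\<in>?X. r x \<odot>\<^bsub>V\<^esub> f x \<oplus>\<^bsub>V\<^esub> s x \<odot>\<^bsub>V\<^esub> f x)"
      using ran X(2) by (intro M.finsum_cong') (auto simp: ma_sel smult_l_distr image_subset_iff Pi_def)
    also have "\<dots> = (\<Oplus>\<^bsub>V\<^esub>x\<in>?X. r x \<odot>\<^bsub>V\<^esub> f x) \<oplus>\<^bsub>V\<^esub> (\<Oplus>\<^bsub>V\<^esub>x\<in>?X. s x \<odot>\<^bsub>V\<^esub> f x)"
      using ran X(2) by (intro M.finsum_addf) (auto simp: image_subset_iff Pi_def)
    also have "\<dots> = lin_ext K V f r \<oplus>\<^bsub>V\<^esub> lin_ext K V f s"
      using lin_ext_superset[OF assms(1) X(1) _ ran(1) X(2)] lin_ext_superset[OF assms(1) X(1) _ ran(2) X(2)]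
      by simp
    finally show "lin_ext K V f (r \<oplus>\<^bsub>A\<^esub> s) = lin_ext K V f r \<oplus>\<^bsub>V\<^esub> lin_ext K V f s" .
  next
    fix c r assume c: "c \<in> carrier K" and r: "r \<in> carrier A"
    let ?X = "supp K r"
    have ran: "range r \<subseteq> carrier K" using r by (auto simp: ma_carrier)
    have X: "finite ?X" "f \<in> ?X \<rightarrow> carrier V" using r assms(2) by (auto simp: ma_carrier Pi_def)
    have "lin_ext K V f (c \<odot>\<^bsub>A\<^esub> r) = (\<Oplus>\<^bsub>V\<^esub>x\<in>?X. (c \<odot>\<^bsub>A\<^esub> r) x \<odot>\<^bsub>V\<^esub> f x)"
      using r c X assms ran by (intro lin_ext_superset) (auto simp: ma_sel supp_def image_subset_iff)
    also have "\<dots> = (\<Oplus>\<^bsub>V\<^esub>x\<in>?X. c \<odot>\<^bsub>V\<^esub> (r x \<odot>\<^bsub>V\<^esub> f x))"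
      using ran X(2) c by (intro M.finsum_cong') (auto simp: ma_sel smult_assoc1 image_subset_iff Pi_def)
    also have "\<dots> = c \<odot>\<^bsub>V\<^esub> lin_ext K V f r"
      unfolding lin_ext_def using ran X c by (intro finsum_smult_ldistr[symmetric]) (auto simp: image_subset_iff Pi_def)
    finally show "lin_ext K V f (c \<odot>\<^bsub>A\<^esub> r) = c \<odot>\<^bsub>V\<^esub> lin_ext K V f r" .
  qed
qed

lemma monoid_algebra_linear_eq:
  assumes "cring K" "monoid M" "module K V"
    and f: "f \<in> linear_maps K (monoid_algebra K M) V" and g: "g \<in> linear_maps K (monoid_algebra K M) V"
    and "\<And>x. x \<in> carrier M \<Longrightarrow> f (mdelta K x) = g (mdelta K x)"
    and "r \<in> carrier (monoid_algebra K M)"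
  shows "f r = g r"
proof -
  interpret cring K by fact
  interpret M: monoid M by fact
  interpret monalg K M by unfold_locales
  note f' = linear_mapsD[OF f] and g' = linear_mapsD[OF g]
  interpret A: module K A by (rule A_module)
  show ?thesis
    using assms(7)
    by (induction r rule: ma_induct)
      (simp_all add: linear_maps_zero[OF A_module assms(3) f] linear_maps_zero[OF A_module assms(3) g] f' g' assms(6))
qed

text \<open>With one factor fixed, the product rule is an equality of linear maps in the other and
  can be tested on the basis.\<close>

lemma lin_ext_alg_hom:
  assumes "asalg K E" "monoid M" "f \<in> carrier M \<rightarrow> carrier E"
    and fm: "\<And>x y. x \<in> carrier M \<Longrightarrow> y \<in> carrier M \<Longrightarrow> f (x \<otimes>\<^bsub>M\<^esub> y) = f x \<otimes>\<^bsub>E\<^esub> f y"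
    and f1: "f \<one>\<^bsub>M\<^esub> = \<one>\<^bsub>E\<^esub>"
  shows "lin_ext K E f \<in> alg_homs K (monoid_algebra K M) E"
proof -
  interpret E: asalg K E by fact
  interpret M: monoid M by fact
  interpret monalg K M by unfold_locales
  interpret A: asalg K A by (rule A_asalg)
  have fE: "x \<in> carrier M \<Longrightarrow> f x \<in> carrier E" for x using assms(3) by auto
  let ?F = "lin_ext K E f"
  have lin: "?F \<in> linear_maps K A E"
    by (rule lin_ext_linear) (use assms(3) in \<open>auto intro: E.module_axioms M.monoid_axioms\<close>)
  note l = linear_mapsD[OF lin]
  have d: "?F (mdelta K x) = f x" if "x \<in> carrier M" for x
    using that fE by (intro lin_ext_delta E.module_axioms)
  show ?thesis
  proof (intro alg_homsI lin)
    show "?F \<one>\<^bsub>A\<^esub> = \<one>\<^bsub>E\<^esub>" using d[of "\<one>\<^bsub>M\<^esub>"] by (simp add: ma_sel(4) f1)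
    show "?F (r \<otimes>\<^bsub>A\<^esub> s) = ?F r \<otimes>\<^bsub>E\<^esub> ?F s" if r: "r \<in> carrier A" and s: "s \<in> carrier A" for r s
    proof (rule monoid_algebra_linear_eq[where M = M and V = E, OF _ _ _ _ _ _ r])
      show "(\<lambda>r. ?F (r \<otimes>\<^bsub>A\<^esub> s)) \<in> linear_maps K A E"
        using s l by (intro linear_mapsI) (auto simp: A.l_distr A.smult_l)
      show "(\<lambda>r. ?F r \<otimes>\<^bsub>E\<^esub> ?F s) \<in> linear_maps K A E"
        using s l by (intro linear_mapsI) (auto simp: E.l_distr E.smult_l)
      fix x assume x: "x \<in> carrier M"
      show "?F (mdelta K x \<otimes>\<^bsub>A\<^esub> s) = ?F (mdelta K x) \<otimes>\<^bsub>E\<^esub> ?F s"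
      proof (rule monoid_algebra_linear_eq[where M = M and V = E, OF _ _ _ _ _ _ s])
        show "(\<lambda>s. ?F (mdelta K x \<otimes>\<^bsub>A\<^esub> s)) \<in> linear_maps K A E"
          using x l by (intro linear_mapsI) (auto simp: A.r_distr A.smult_r)
        show "(\<lambda>s. ?F (mdelta K x) \<otimes>\<^bsub>E\<^esub> ?F s) \<in> linear_maps K A E"
          using x l by (intro linear_mapsI) (auto simp: E.r_distr E.smult_r)
      qed (use x in \<open>auto simp: delta_mult d fm intro: E.module_axioms M.monoid_axioms E.R.cring_axioms\<close>)
    qed (auto intro: E.module_axioms M.monoid_axioms E.R.cring_axioms)
  qed
qed

section \<open>Cosets and spans\<close>

lemma coset_mem:
  assumes "abelian_group V" "additive_subgroup N V" "x \<in> carrier V"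
  shows "z \<in> N +>\<^bsub>V\<^esub> x \<longleftrightarrow> z \<in> carrier V \<and> z \<ominus>\<^bsub>V\<^esub> x \<in> N"
proof -
  interpret abelian_subgroup N V by (rule abelian_subgroupI3[OF assms(2,1)])
  show ?thesis
  proof (cases "z \<in> carrier V")
    case True
    then show ?thesis using a_rcos_module[OF assms(3) True] by (simp add: a_minus_def)
  next
    case False
    then show ?thesis using a_elemrcos_carrier[OF assms(3)] by blast
  qed
qed

lemma coset_self:
  assumes "abelian_group V" "additive_subgroup N V" "x \<in> carrier V"
  shows "x \<in> N +>\<^bsub>V\<^esub> x"
proof -
  interpret abelian_subgroup N V by (rule abelian_subgroupI3[OF assms(2,1)])
  show ?thesis using assms(3) by (rule a_rcos_self)
qed

lemma coset_eq:
  assumes "abelian_group V" "additive_subgroup N V" "x \<in> carrier V" "y \<in> carrier V"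
  shows "N +>\<^bsub>V\<^esub> x = N +>\<^bsub>V\<^esub> y \<longleftrightarrow> x \<ominus>\<^bsub>V\<^esub> y \<in> N"
proof -
  interpret abelian_subgroup N V by (rule abelian_subgroupI3[OF assms(2,1)])
  show ?thesis
    using coset_mem[OF assms(1,2,4)] coset_self[OF assms(1-3)] a_repr_independence'[OF _ assms(4)] assms(3)
    by metis
qed

lemma coset_add:
  assumes "abelian_group V" "additive_subgroup N V" "x \<in> carrier V" "y \<in> carrier V"
  shows "(N +>\<^bsub>V\<^esub> x) <+>\<^bsub>V\<^esub> (N +>\<^bsub>V\<^esub> y) = N +>\<^bsub>V\<^esub> (x \<oplus>\<^bsub>V\<^esub> y)"
proof -
  interpret abelian_subgroup N V by (rule abelian_subgroupI3[OF assms(2,1)])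
  show ?thesis using assms(3,4) by (rule a_rcos_sum)
qed

lemma coset_zero:
  assumes "abelian_group V" "additive_subgroup N V"
  shows "N +>\<^bsub>V\<^esub> \<zero>\<^bsub>V\<^esub> = N"
proof -
  interpret abelian_subgroup N V by (rule abelian_subgroupI3[OF assms(2,1)])
  show ?thesis by (rule a_coset_add_zero) (rule a_subset)
qed

lemma minus_zero_iff:
  assumes "abelian_group V" "x \<in> carrier V" "y \<in> carrier V"
  shows "x \<ominus>\<^bsub>V\<^esub> y = \<zero>\<^bsub>V\<^esub> \<longleftrightarrow> x = y"
proof -
  interpret abelian_group V by fact
  have "x = y" if "x \<ominus>\<^bsub>V\<^esub> y = \<zero>\<^bsub>V\<^esub>"
    using that assms minus_equality[of x "\<ominus>\<^bsub>V\<^esub> y"] by (simp add: a_minus_def)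
  then show ?thesis using assms by (auto simp: a_minus_def r_neg)
qed

lemma submodule_additive:
  "submodule N K M \<Longrightarrow> additive_subgroup N M"
  by (simp add: additive_subgroup_def submodule_def)

lemma submodule_minus:
  assumes "module K M" "submodule N K M" "x \<in> N" "y \<in> N"
  shows "x \<ominus>\<^bsub>M\<^esub> y \<in> N"
  using assms module.submoduleE(3,5)[OF assms(1,2)] by (simp add: a_minus_def)

lemma submodule_zero:
  assumes "module K M" "submodule N K M"
  shows "\<zero>\<^bsub>M\<^esub> \<in> N"
  using assms(2) submodule_additive additive_subgroup.zero_closed by blast

lemma submodule_finsum:
  assumes "module K M" "submodule N K M" "finite X" "\<And>i. i \<in> X \<Longrightarrow> f i \<in> N"
  shows "(\<Oplus>\<^bsub>M\<^esub>i\<in>X. f i) \<in> N"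
proof -
  interpret module K M by fact
  note N = submoduleE[OF assms(2)]
  show ?thesis
    using assms(3,4)
  proof (induction X rule: finite_induct)
    case empty then show ?case using submodule_zero[OF assms(1,2)] by simp
  next
    case (insert x X)
    then have "f \<in> X \<rightarrow> carrier M" "f x \<in> carrier M" using N(1) by auto
    then show ?case using insert N(5) by simp
  qed
qed

lemma lin_span_submodule:
  assumes "module K M" "X \<subseteq> carrier M"
  shows "submodule (lin_span K M X) K M"
proof -
  interpret module K M by fact
  have c: "carrier M \<in> {N. submodule N K M \<and> X \<subseteq> N}" using assms(2) carrier_is_submodule by auto
  show ?thesis
    unfolding lin_span_def
  proof (rule submoduleI)
    show "\<Inter>{N. submodule N K M \<and> X \<subseteq> N} \<subseteq> carrier M" using c by blast
  qed (use submoduleE submodule_zero[OF assms(1)] in \<open>auto\<close>)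
qed

lemma lin_span_superset: "X \<subseteq> lin_span K M X"
  unfolding lin_span_def by blast

lemma lin_span_minimal: "submodule N K M \<Longrightarrow> X \<subseteq> N \<Longrightarrow> lin_span K M X \<subseteq> N"
  unfolding lin_span_def by blast

lemma lin_span_mono: "X \<subseteq> Y \<Longrightarrow> lin_span K M X \<subseteq> lin_span K M Y"
  unfolding lin_span_def by blast

text \<open>The elements of the span with property \<open>P\<close> form a submodule that contains
  \<open>X\<close>. Closure under negation follows from the scalar case, since -x is (-1) x.\<close>

lemma lin_span_induct [consumes 3, case_names zero base add smult]:
  assumes "module K M" "X \<subseteq> carrier M" "x \<in> lin_span K M X"
    and zero: "P \<zero>\<^bsub>M\<^esub>"
    and base: "\<And>x. x \<in> X \<Longrightarrow> P x"
    and add: "\<And>x y. x \<in> lin_span K M X \<Longrightarrow> y \<in> lin_span K M X \<Longrightarrow> P x \<Longrightarrow> P y \<Longrightarrow> P (x \<oplus>\<^bsub>M\<^esub> y)"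
    and smult: "\<And>c x. c \<in> carrier K \<Longrightarrow> x \<in> lin_span K M X \<Longrightarrow> P x \<Longrightarrow> P (c \<odot>\<^bsub>M\<^esub> x)"
  shows "P x"
proof -
  interpret module K M by fact
  let ?S = "lin_span K M X"
  note S = lin_span_submodule[OF assms(1,2)]
  note SE = submoduleE[OF S]
  have "submodule {x \<in> ?S. P x} K M"
  proof (rule submoduleI)
    show "{x \<in> ?S. P x} \<subseteq> carrier M" using SE by auto
    show "\<zero>\<^bsub>M\<^esub> \<in> {x \<in> ?S. P x}" using zero submodule_zero[OF assms(1) S] by auto
    show "\<ominus>\<^bsub>M\<^esub> a \<in> {x \<in> ?S. P x}" if "a \<in> {x \<in> ?S. P x}" for a
    proof -
      have a: "a \<in> carrier M" "a \<in> ?S" "P a" using that SE by auto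
      then have "\<ominus>\<^bsub>M\<^esub> a = (\<ominus>\<^bsub>K\<^esub> \<one>\<^bsub>K\<^esub>) \<odot>\<^bsub>M\<^esub> a" by (simp add: smult_l_minus)
      then show ?thesis using smult[of "\<ominus>\<^bsub>K\<^esub> \<one>\<^bsub>K\<^esub>" a] a SE by auto
    qed
  qed (use SE add smult in auto)
  moreover have "X \<subseteq> {x \<in> ?S. P x}" using base lin_span_superset[of X K M] by auto
  ultimately show ?thesis using lin_span_minimal[of "{x \<in> ?S. P x}" K M X] assms(3) by blast
qed

lemma linear_preimage_submodule:
  assumes "module K V" "module K W" "f \<in> linear_maps K V W" "submodule N K W"
  shows "submodule {x \<in> carrier V. f x \<in> N} K V"
proof -
  interpret V: module K V by fact
  interpret W: module K W by fact
  note f = linear_mapsD[OF assms(3)]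
  show ?thesis
    using W.submoduleE[OF assms(4)] submodule_zero[OF assms(2,4)] linear_maps_zero[OF assms(1-3)]
    by (intro V.submoduleI) (auto simp: f linear_maps_uminus[OF assms(1-3)])
qed

lemma zero_submodule: assumes "module K V" shows "submodule {\<zero>\<^bsub>V\<^esub>} K V"
proof -
  interpret module K V by fact
  show ?thesis by (intro submoduleI) auto
qed

lemma linear_kernel_submodule:
  assumes "module K V" "module K W" "f \<in> linear_maps K V W"
  shows "submodule {x \<in> carrier V. f x = \<zero>\<^bsub>W\<^esub>} K V"
  using linear_preimage_submodule[OF assms zero_submodule[OF assms(2)]] by simp

section \<open>Quotient algebras\<close>

locale quotient_alg = asalg K A + ideal I A for K :: "('k, 'r) ring_scheme" and A :: "('k, 'a, 'c) module_scheme" (structure) and I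
begin

abbreviation Q where "Q \<equiv> quot_algebra A I"

lemma q_sel:
  "carrier Q = a_rcosets I" "X \<otimes>\<^bsub>Q\<^esub> Y = rcoset_mult A I X Y" "\<one>\<^bsub>Q\<^esub> = I +> \<one>" "\<zero>\<^bsub>Q\<^esub> = I"
  "X \<oplus>\<^bsub>Q\<^esub> Y = X <+>\<^bsub>A\<^esub> Y" "c \<odot>\<^bsub>Q\<^esub> X = (\<Union>x\<in>X. I +> (c \<odot> x))"
  by (simp_all add: quot_algebra_def FactRing_def ring.defs module.defs)

lemma q_coset_eq: "x \<in> carrier A \<Longrightarrow> y \<in> carrier A \<Longrightarrow> I +> x = I +> y \<longleftrightarrow> x \<ominus> y \<in> I"
  by (intro coset_eq M.abelian_group_axioms is_additive_subgroup)

lemma q_mem: "X \<in> carrier Q \<longleftrightarrow> (\<exists>x\<in>carrier A. X = I +> x)"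
  by (auto simp: q_sel A_RCOSETS_def')

lemma q_closed: "x \<in> carrier A \<Longrightarrow> I +> x \<in> carrier Q"
  by (auto simp: q_mem)

text \<open>An ideal is closed under scalars because c x = (c 1) x.\<close>

lemma I_submodule: "submodule I K A"
proof -
  have "c \<odot> x \<in> I" if "c \<in> carrier K" "x \<in> I" for c x
    using that smult_conv_mult[of c x] I_l_closed[of x "c \<odot> \<one>"] by (auto simp: a_Hcarr)
  then show ?thesis
    by (intro submoduleI) (auto simp: a_Hcarr)
qed

text \<open>All cosets in the union that defines the scalar product coincide: two representatives
  differ by an element of \<open>I\<close>, and \<open>I\<close> is stable under scalars.\<close>

lemma q_smult: "c \<in> carrier K \<Longrightarrow> x \<in> carrier A \<Longrightarrow> c \<odot>\<^bsub>Q\<^esub> (I +> x) = I +> (c \<odot> x)"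
proof -
  assume c: "c \<in> carrier K" and x: "x \<in> carrier A"
  have "I +> (c \<odot> y) = I +> (c \<odot> x)" if "y \<in> I +> x" for y
  proof -
    have y: "y \<in> carrier A" "y \<ominus> x \<in> I"
      using that coset_mem[OF M.abelian_group_axioms is_additive_subgroup x] by auto
    have "c \<odot> y \<ominus> c \<odot> x = c \<odot> (y \<ominus> x)"
      using c x y by (simp add: a_minus_def smult_r_distr smult_r_minus)
    then show ?thesis using c x y submoduleE(4)[OF I_submodule] by (simp add: q_coset_eq)
  qed
  then have "(\<Union>y\<in>I +> x. I +> (c \<odot> y)) = (\<Union>y\<in>I +> x. I +> (c \<odot> x))"
    by (intro SUP_cong refl)
  moreover have "I +> x \<noteq> {}" using a_rcos_self[OF x] by blast
  ultimately show ?thesis unfolding q_sel by (simp only: UN_constant if_False)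
qed

lemma q_mult: "x \<in> carrier A \<Longrightarrow> y \<in> carrier A \<Longrightarrow> (I +> x) \<otimes>\<^bsub>Q\<^esub> (I +> y) = I +> (x \<otimes> y)"
  by (simp add: q_sel rcoset_mult_add)

lemma q_add: "x \<in> carrier A \<Longrightarrow> y \<in> carrier A \<Longrightarrow> (I +> x) \<oplus>\<^bsub>Q\<^esub> (I +> y) = I +> (x \<oplus> y)"
  by (simp add: q_sel a_rcos_sum)

lemma q_zero: "\<zero>\<^bsub>Q\<^esub> = I +> \<zero>"
  by (simp add: q_sel coset_zero[OF M.abelian_group_axioms is_additive_subgroup])

lemma q_asalg: "asalg K Q"
proof (intro asalgI moduleI abelian_groupI monoidI R.cring_axioms)
  fix X assume "X \<in> carrier Q"
  then obtain x where x: "x \<in> carrier A" "X = I +> x" by (auto simp: q_mem)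
  then show "\<exists>Y\<in>carrier Q. Y \<oplus>\<^bsub>Q\<^esub> X = \<zero>\<^bsub>Q\<^esub>"
    by (intro bexI[of _ "I +> (\<ominus> x)"]) (auto simp: q_add q_zero q_closed M.l_neg)
qed (auto simp: q_mem q_add q_mult q_smult q_zero q_sel(3) M.a_ac m_assoc l_distr r_distr smult_l_distr
      smult_r_distr smult_assoc1 smult_l smult_r intro!: q_closed)

lemma q_class_alg_hom: "(\<lambda>x. I +> x) \<in> alg_homs K A Q"
  by (intro alg_homsI linear_mapsI) (auto simp: q_add q_mult q_smult q_sel(3) intro!: q_closed)

text \<open>The induced map is evaluated at a chosen representative; two representatives differ by
  an element of \<open>I\<close>, where \<open>f\<close> vanishes.\<close>

lemma q_lift:
  assumes "asalg K E" "f \<in> alg_homs K A E" "\<And>x. x \<in> I \<Longrightarrow> f x = \<zero>\<^bsub>E\<^esub>"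
  obtains F where "F \<in> alg_homs K Q E" "\<And>x. x \<in> carrier A \<Longrightarrow> F (I +> x) = f x"
proof -
  interpret E: asalg K E by fact
  note f = alg_homsD[OF assms(2)] note l = linear_mapsD[OF f(1)]
  define F where "F X = f (SOME x. x \<in> carrier A \<and> X = I +> x)" for X
  have F: "F (I +> x) = f x" if x: "x \<in> carrier A" for x
  proof -
    let ?y = "SOME y. y \<in> carrier A \<and> I +> x = I +> y"
    have y: "?y \<in> carrier A" "I +> x = I +> ?y"
      using someI[of "\<lambda>y. y \<in> carrier A \<and> I +> x = I +> y" x] x by auto
    then have "?y \<ominus> x \<in> I" using x q_coset_eq[of ?y x] by simp
    then have "f (?y \<ominus> x) = \<zero>\<^bsub>E\<^esub>" by (rule assms(3))
    then have "f ?y \<ominus>\<^bsub>E\<^esub> f x = \<zero>\<^bsub>E\<^esub>"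
      using linear_maps_minus[OF module_axioms E.module_axioms f(1)] x y by simp
    then show ?thesis unfolding F_def using x(1) y(1) l(1) by (subst (asm) minus_zero_iff) (auto intro: E.M.abelian_group_axioms)
  qed
  have "F \<in> alg_homs K Q E"
    by (intro alg_homsI linear_mapsI) (auto simp: q_mem q_add q_mult q_smult q_sel(3) F l f)
  then show thesis using F that by blast
qed

end

section \<open>Bilinear maps and tensor products\<close>

definition bilin ::
  "('k, 'r) ring_scheme \<Rightarrow> ('k, 'a, 'c) module_scheme \<Rightarrow> ('k, 'b, 'd) module_scheme
    \<Rightarrow> ('k, 'v, 'e) module_scheme \<Rightarrow> ('a \<Rightarrow> 'b \<Rightarrow> 'v) \<Rightarrow> bool" where
  "bilin K A B V f \<longleftrightarrow> (\<forall>a\<in>carrier A. f a \<in> linear_maps K B V) \<and> (\<forall>b\<in>carrier B. (\<lambda>a. f a b) \<in> linear_maps K A V)"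

lemma bilinI:
  assumes "\<And>a. a \<in> carrier A \<Longrightarrow> f a \<in> linear_maps K B V" "\<And>b. b \<in> carrier B \<Longrightarrow> (\<lambda>a. f a b) \<in> linear_maps K A V"
  shows "bilin K A B V f"
  using assms unfolding bilin_def by auto

lemma bilinD:
  assumes "bilin K A B V f"
  shows "a \<in> carrier A \<Longrightarrow> f a \<in> linear_maps K B V" "b \<in> carrier B \<Longrightarrow> (\<lambda>a. f a b) \<in> linear_maps K A V"
  using assms unfolding bilin_def by auto

lemma bilin_simps:
  assumes "bilin K A B V f" "a \<in> carrier A" "b \<in> carrier B"
  shows "f a b \<in> carrier V"
    "a' \<in> carrier A \<Longrightarrow> f (a \<oplus>\<^bsub>A\<^esub> a') b = f a b \<oplus>\<^bsub>V\<^esub> f a' b"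
    "b' \<in> carrier B \<Longrightarrow> f a (b \<oplus>\<^bsub>B\<^esub> b') = f a b \<oplus>\<^bsub>V\<^esub> f a b'"
    "c \<in> carrier K \<Longrightarrow> f (c \<odot>\<^bsub>A\<^esub> a) b = c \<odot>\<^bsub>V\<^esub> f a b"
    "c \<in> carrier K \<Longrightarrow> f a (c \<odot>\<^bsub>B\<^esub> b) = c \<odot>\<^bsub>V\<^esub> f a b"
  using linear_mapsD[OF bilinD(1)[OF assms(1,2)]] linear_mapsD[OF bilinD(2)[OF assms(1,3)]] assms by auto

lemma bilin_compose:
  assumes "bilin K A' B' V f" "\<phi> \<in> linear_maps K A A'" "\<psi> \<in> linear_maps K B B'"
  shows "bilin K A B V (\<lambda>a b. f (\<phi> a) (\<psi> b))"
  using linear_mapsD(1)[OF assms(2)] linear_mapsD(1)[OF assms(3)]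
  by (intro bilinI linear_maps_comp[OF assms(3) bilinD(1)[OF assms(1)]] linear_maps_comp[OF assms(2) bilinD(2)[OF assms(1)]])

lemma bilin_linear:
  assumes "bilin K A B V f" "g \<in> linear_maps K V W"
  shows "bilin K A B W (\<lambda>a b. g (f a b))"
  by (intro bilinI linear_maps_comp[OF bilinD(1)[OF assms(1)] assms(2)] linear_maps_comp[OF bilinD(2)[OF assms(1)] assms(2)])

lemma bilin_add:
  assumes "module K V" "bilin K A B V f" "bilin K A B V g"
  shows "bilin K A B V (\<lambda>a b. f a b \<oplus>\<^bsub>V\<^esub> g a b)"
  by (intro bilinI linear_maps_add[OF assms(1)] bilinD[OF assms(2)] bilinD[OF assms(3)])

lemma bilin_cong:
  assumes "bilin K A B V f" "\<And>a b. a \<in> carrier A \<Longrightarrow> b \<in> carrier B \<Longrightarrow> f a b = g a b" "module K A" "module K B"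
  shows "bilin K A B V g"
proof -
  interpret A: module K A by fact
  interpret B: module K B by fact
  show ?thesis
    using bilin_simps[OF assms(1)]
    by (intro bilinI linear_mapsI) (auto simp: assms(2)[symmetric])
qed

lemma (in asalg) bilin_mult: "bilin K A A A (\<lambda>a b. a \<otimes> b)"
  by (intro bilinI linear_mult_left linear_mult_right)

lemma bilin_smult:
  assumes "module K V" "f \<in> linear_maps K A (base_algebra K)" "g \<in> linear_maps K B V"
  shows "bilin K A B V (\<lambda>a b. f a \<odot>\<^bsub>V\<^esub> g b)" "bilin K B A V (\<lambda>b a. f a \<odot>\<^bsub>V\<^esub> g b)"
proof -
  interpret V: module K V by fact
  note f = linear_mapsD[OF assms(2), simplified] and g = linear_mapsD[OF assms(3)]
  show "bilin K A B V (\<lambda>a b. f a \<odot>\<^bsub>V\<^esub> g b)" "bilin K B A V (\<lambda>b a. f a \<odot>\<^bsub>V\<^esub> g b)"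
    by (intro bilinI linear_mapsI; simp add: f g V.smult_l_distr V.smult_r_distr V.smult_assoc1[symmetric] V.R.m_comm)+
qed

locale tens = A: asalg K A + B: asalg K B
  for K :: "('k, 'r) ring_scheme" and A :: "('k, 'a, 'c) module_scheme" (structure) and B :: "('k, 'b, 'd) module_scheme"
begin

abbreviation F where "F \<equiv> tensor_free K A B"
abbreviation N where "N \<equiv> tensor_null K A B"
abbreviation T where "T \<equiv> tensor K A B"
abbreviation pt where "pt \<equiv> ptensor K A B"

interpretation AB: monoid "A \<times>\<times> B" by (intro DirProd_monoid A.is_monoid B.is_monoid)

interpretation F: monalg K "A \<times>\<times> B" by unfold_locales

interpretation F: asalg K F unfolding tensor_free_def by (rule F.A_asalg)

lemma prod_sel: "carrier (A \<times>\<times> B) = carrier A \<times> carrier B" "\<one>\<^bsub>A \<times>\<times> B\<^esub> = (\<one>, \<one>\<^bsub>B\<^esub>)"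
  "(a, b) \<otimes>\<^bsub>A \<times>\<times> B\<^esub> (a', b') = (a \<otimes> a', b \<otimes>\<^bsub>B\<^esub> b')"
  by (auto simp: DirProd_def)

lemma delta_in_F [simp]: "a \<in> carrier A \<Longrightarrow> b \<in> carrier B \<Longrightarrow> mdelta K (a, b) \<in> carrier F"
  unfolding tensor_free_def by (rule F.delta_closed) (simp add: prod_sel)

lemma delta_mult_F: "a \<in> carrier A \<Longrightarrow> b \<in> carrier B \<Longrightarrow> a' \<in> carrier A \<Longrightarrow> b' \<in> carrier B \<Longrightarrow>
   mdelta K (a, b) \<otimes>\<^bsub>F\<^esub> mdelta K (a', b') = mdelta K (a \<otimes> a', b \<otimes>\<^bsub>B\<^esub> b')"
  unfolding tensor_free_def by (subst F.delta_mult) (auto simp: prod_sel)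

lemma one_F: "\<one>\<^bsub>F\<^esub> = mdelta K (\<one>, \<one>\<^bsub>B\<^esub>)"
  unfolding tensor_free_def by (simp add: F.ma_sel prod_sel)

lemma relators_carrier: "tensor_relators K A B \<subseteq> carrier F"
  unfolding tensor_relators_def Let_def by auto

lemma relators_cases:
  assumes "x \<in> tensor_relators K A B"
    and "\<And>a a' b. \<lbrakk>a \<in> carrier A; a' \<in> carrier A; b \<in> carrier B;
       x = mdelta K (a \<oplus> a', b) \<ominus>\<^bsub>F\<^esub> (mdelta K (a, b) \<oplus>\<^bsub>F\<^esub> mdelta K (a', b))\<rbrakk> \<Longrightarrow> P"
    and "\<And>a b b'. \<lbrakk>a \<in> carrier A; b \<in> carrier B; b' \<in> carrier B;
       x = mdelta K (a, b \<oplus>\<^bsub>B\<^esub> b') \<ominus>\<^bsub>F\<^esub> (mdelta K (a, b) \<oplus>\<^bsub>F\<^esub> mdelta K (a, b'))\<rbrakk> \<Longrightarrow> P"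
    and "\<And>c a b. \<lbrakk>c \<in> carrier K; a \<in> carrier A; b \<in> carrier B;
       x = mdelta K (c \<odot> a, b) \<ominus>\<^bsub>F\<^esub> (c \<odot>\<^bsub>F\<^esub> mdelta K (a, b))\<rbrakk> \<Longrightarrow> P"
    and "\<And>c a b. \<lbrakk>c \<in> carrier K; a \<in> carrier A; b \<in> carrier B;
       x = mdelta K (a, c \<odot>\<^bsub>B\<^esub> b) \<ominus>\<^bsub>F\<^esub> (c \<odot>\<^bsub>F\<^esub> mdelta K (a, b))\<rbrakk> \<Longrightarrow> P"
  shows P
  using assms unfolding tensor_relators_def Let_def by auto

lemma N_submodule: "submodule N K F"
  unfolding tensor_null_def by (intro lin_span_submodule F.module_axioms relators_carrier)

lemma N_minimal: "submodule S K F \<Longrightarrow> tensor_relators K A B \<subseteq> S \<Longrightarrow> N \<subseteq> S"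
  unfolding tensor_null_def by (rule lin_span_minimal)

lemma N_relator: "x \<in> tensor_relators K A B \<Longrightarrow> x \<in> N"
  unfolding tensor_null_def by (rule subsetD[OF lin_span_superset])

lemma relators:
  shows "\<lbrakk>a \<in> carrier A; a' \<in> carrier A; b \<in> carrier B\<rbrakk> \<Longrightarrow>
       mdelta K (a \<oplus> a', b) \<ominus>\<^bsub>F\<^esub> (mdelta K (a, b) \<oplus>\<^bsub>F\<^esub> mdelta K (a', b)) \<in> N"
    and "\<lbrakk>a \<in> carrier A; b \<in> carrier B; b' \<in> carrier B\<rbrakk> \<Longrightarrow>
       mdelta K (a, b \<oplus>\<^bsub>B\<^esub> b') \<ominus>\<^bsub>F\<^esub> (mdelta K (a, b) \<oplus>\<^bsub>F\<^esub> mdelta K (a, b')) \<in> N"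
    and "\<lbrakk>c \<in> carrier K; a \<in> carrier A; b \<in> carrier B\<rbrakk> \<Longrightarrow>
       mdelta K (c \<odot> a, b) \<ominus>\<^bsub>F\<^esub> (c \<odot>\<^bsub>F\<^esub> mdelta K (a, b)) \<in> N"
    and "\<lbrakk>c \<in> carrier K; a \<in> carrier A; b \<in> carrier B\<rbrakk> \<Longrightarrow>
       mdelta K (a, c \<odot>\<^bsub>B\<^esub> b) \<ominus>\<^bsub>F\<^esub> (c \<odot>\<^bsub>F\<^esub> mdelta K (a, b)) \<in> N"
  by (rule N_relator, unfold tensor_relators_def Let_def, blast)+

lemma F_induct [consumes 1, case_names zero add delta]:
  assumes "r \<in> carrier F" "P \<zero>\<^bsub>F\<^esub>"
    and "\<And>r s. r \<in> carrier F \<Longrightarrow> s \<in> carrier F \<Longrightarrow> P r \<Longrightarrow> P s \<Longrightarrow> P (r \<oplus>\<^bsub>F\<^esub> s)"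
    and "\<And>c a b. c \<in> carrier K \<Longrightarrow> a \<in> carrier A \<Longrightarrow> b \<in> carrier B \<Longrightarrow> P (c \<odot>\<^bsub>F\<^esub> mdelta K (a, b))"
  shows "P r"
  using assms unfolding tensor_free_def by (induction r rule: F.ma_induct) (auto simp: prod_sel)

text \<open>A basis element times a relator is again a relator of the same kind, because the
  multiplication in each factor is bilinear. This makes the span of the relators an ideal and hence
  the tensor product an algebra.\<close>

lemma delta_mult_N:
  assumes cd: "c \<in> carrier A" "d \<in> carrier B" and "x \<in> N"
  shows "mdelta K (c, d) \<otimes>\<^bsub>F\<^esub> x \<in> N \<and> x \<otimes>\<^bsub>F\<^esub> mdelta K (c, d) \<in> N"
proof -
  let ?\<delta> = "mdelta K (c, d)"
  have \<delta>: "?\<delta> \<in> carrier F" using cd by simp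
  have "submodule ({x \<in> carrier F. ?\<delta> \<otimes>\<^bsub>F\<^esub> x \<in> N}) K F" "submodule ({x \<in> carrier F. x \<otimes>\<^bsub>F\<^esub> ?\<delta> \<in> N}) K F"
    using F.linear_mult_left[OF \<delta>] F.linear_mult_right[OF \<delta>]
    by (auto intro!: linear_preimage_submodule[OF F.module_axioms F.module_axioms _ N_submodule])
  moreover have "?\<delta> \<otimes>\<^bsub>F\<^esub> x \<in> N \<and> x \<otimes>\<^bsub>F\<^esub> ?\<delta> \<in> N" if "x \<in> tensor_relators K A B" for x
    using that
  proof (cases x rule: relators_cases)
    case (2 a a' b)
    then show ?thesis using relators(1)[of "c \<otimes> a" "c \<otimes> a'" "d \<otimes>\<^bsub>B\<^esub> b"] relators(1)[of "a \<otimes> c" "a' \<otimes> c" "b \<otimes>\<^bsub>B\<^esub> d"] cd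
      by (simp add: a_minus_def F.r_distr F.l_distr F.r_minus F.l_minus delta_mult_F A.r_distr A.l_distr)
  next
    case (3 a b b')
    then show ?thesis using relators(2)[of "c \<otimes> a" "d \<otimes>\<^bsub>B\<^esub> b" "d \<otimes>\<^bsub>B\<^esub> b'"] relators(2)[of "a \<otimes> c" "b \<otimes>\<^bsub>B\<^esub> d" "b' \<otimes>\<^bsub>B\<^esub> d"] cd
      by (simp add: a_minus_def F.r_distr F.l_distr F.r_minus F.l_minus delta_mult_F B.r_distr B.l_distr)
  next
    case (4 e a b)
    then show ?thesis using relators(3)[of e "c \<otimes> a" "d \<otimes>\<^bsub>B\<^esub> b"] relators(3)[of e "a \<otimes> c" "b \<otimes>\<^bsub>B\<^esub> d"] cd
      by (simp add: a_minus_def F.r_distr F.l_distr F.r_minus F.l_minus delta_mult_F A.smult_l A.smult_r F.smult_l F.smult_r)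
  next
    case (5 e a b)
    then show ?thesis using relators(4)[of e "c \<otimes> a" "d \<otimes>\<^bsub>B\<^esub> b"] relators(4)[of e "a \<otimes> c" "b \<otimes>\<^bsub>B\<^esub> d"] cd
      by (simp add: a_minus_def F.r_distr F.l_distr F.r_minus F.l_minus delta_mult_F B.smult_l B.smult_r F.smult_l F.smult_r)
  qed
  ultimately have "N \<subseteq> {x \<in> carrier F. ?\<delta> \<otimes>\<^bsub>F\<^esub> x \<in> N}" "N \<subseteq> {x \<in> carrier F. x \<otimes>\<^bsub>F\<^esub> ?\<delta> \<in> N}"
    using relators_carrier by - (rule N_minimal, assumption, blast)+
  then show ?thesis using assms(3) by blast
qed

lemma N_ideal: "ideal N F"
proof (rule idealI)
  note NE = F.submoduleE[OF N_submodule]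
  have *: "y \<otimes>\<^bsub>F\<^esub> x \<in> N \<and> x \<otimes>\<^bsub>F\<^esub> y \<in> N" if "x \<in> N" "y \<in> carrier F" for x y
    using that(2)
  proof (induction y rule: F_induct)
    case zero then show ?case using that NE by (auto simp: subset_iff intro!: submodule_zero[OF F.module_axioms N_submodule])
  next
    case (add r s) then show ?case using that NE by (auto simp: F.l_distr F.r_distr subset_iff)
  next
    case (delta c a b)
    then show ?case using delta_mult_N[of a b x] that NE by (auto simp: F.smult_l F.smult_r subset_iff)
  qed
  show "subgroup N (add_monoid F)" using N_submodule submodule.axioms(1) by blast
  show "x \<otimes>\<^bsub>F\<^esub> a \<in> N" "a \<otimes>\<^bsub>F\<^esub> x \<in> N" if "a \<in> N" "x \<in> carrier F" for a x using * that by auto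
qed (rule F.ring_axioms)

interpretation Q: quotient_alg K F N
  by (intro quotient_alg.intro F.asalg_axioms N_ideal)

lemma T_asalg: "asalg K T"
  unfolding tensor_def by (rule Q.q_asalg)

sublocale T: asalg K T by (rule T_asalg)

lemma T_eq: "T = Q.Q" by (simp add: tensor_def)

lemma pt_eq: "pt a b = N +>\<^bsub>F\<^esub> mdelta K (a, b)"
  by (simp add: ptensor_def tensor_class_def)

lemma pt_bilin: "bilin K A B T pt"
proof -
  note NE = F.submoduleE[OF N_submodule]
  show ?thesis
    unfolding pt_eq
    by (intro bilinI linear_mapsI; simp add: T_eq Q.q_closed Q.q_add Q.q_smult Q.q_coset_eq relators)
qed

lemmas pt_simps = bilin_simps[OF pt_bilin]

lemma pt_closed [simp, intro]: "a \<in> carrier A \<Longrightarrow> b \<in> carrier B \<Longrightarrow> pt a b \<in> carrier T"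
  by (rule pt_simps)

lemma pt_mult: "a \<in> carrier A \<Longrightarrow> b \<in> carrier B \<Longrightarrow> a' \<in> carrier A \<Longrightarrow> b' \<in> carrier B \<Longrightarrow>
   pt a b \<otimes>\<^bsub>T\<^esub> pt a' b' = pt (a \<otimes> a') (b \<otimes>\<^bsub>B\<^esub> b')"
  unfolding T_eq pt_eq by (simp add: Q.q_mult delta_mult_F)

lemma T_one: "\<one>\<^bsub>T\<^esub> = pt \<one> \<one>\<^bsub>B\<^esub>"
  unfolding T_eq pt_eq by (simp add: Q.q_sel one_F)

lemma pt_zero: "b \<in> carrier B \<Longrightarrow> pt \<zero> b = \<zero>\<^bsub>T\<^esub>" "a \<in> carrier A \<Longrightarrow> pt a \<zero>\<^bsub>B\<^esub> = \<zero>\<^bsub>T\<^esub>"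
  using linear_maps_zero[OF A.module_axioms T.module_axioms bilinD(2)[OF pt_bilin]]
    linear_maps_zero[OF B.module_axioms T.module_axioms bilinD(1)[OF pt_bilin]] by auto

text \<open>Zero and scalar multiples are covered by the pure case: zero is 0 \<otimes> 0, and a
  scalar moves into the first factor.\<close>

lemma T_induct [consumes 1, case_names add pure]:
  assumes "t \<in> carrier T"
    and add: "\<And>s t. s \<in> carrier T \<Longrightarrow> t \<in> carrier T \<Longrightarrow> P s \<Longrightarrow> P t \<Longrightarrow> P (s \<oplus>\<^bsub>T\<^esub> t)"
    and pure: "\<And>a b. a \<in> carrier A \<Longrightarrow> b \<in> carrier B \<Longrightarrow> P (pt a b)"
  shows "P t"
proof -
  have "P (N +>\<^bsub>F\<^esub> r)" if "r \<in> carrier F" for r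
    using that
  proof (induction r rule: F_induct)
    case zero
    have "N +>\<^bsub>F\<^esub> \<zero>\<^bsub>F\<^esub> = pt \<zero> \<zero>\<^bsub>B\<^esub>"
      by (subst pt_zero(1), simp, simp only: T_eq Q.q_zero)
    then show ?case using pure[of "\<zero>" "\<zero>\<^bsub>B\<^esub>"] by simp
  next
    case (add r s)
    then show ?case using assms(2)[of "N +>\<^bsub>F\<^esub> r" "N +>\<^bsub>F\<^esub> s"] by (simp add: T_eq Q.q_add Q.q_closed)
  next
    case (delta c a b)
    have "N +>\<^bsub>F\<^esub> (c \<odot>\<^bsub>F\<^esub> mdelta K (a, b)) = pt (c \<odot> a) b"
      using delta pt_simps(4)[of a b c] by (simp add: Q.q_smult[symmetric] T_eq pt_eq)
    then show ?case using pure delta by simp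
  qed
  then show ?thesis using assms(1) by (auto simp: T_eq Q.q_mem)
qed

lemma T_linear_eq:
  assumes "module K V" "f \<in> linear_maps K T V" "g \<in> linear_maps K T V"
    and "\<And>a b. a \<in> carrier A \<Longrightarrow> b \<in> carrier B \<Longrightarrow> f (pt a b) = g (pt a b)" "t \<in> carrier T"
  shows "f t = g t"
  using assms(5) by (induction t rule: T_induct) (auto simp: linear_mapsD[OF assms(2)] linear_mapsD[OF assms(3)] assms(4))

context
  fixes V :: "('k, 'v, 'e) module_scheme" and f
  assumes V: "module K V" and f: "bilin K A B V f"
begin

lemma lin_ext_bilin: "lin_ext K V (\<lambda>(a, b). f a b) \<in> linear_maps K F V"
  unfolding tensor_free_def using bilin_simps(1)[OF f]
  by (intro lin_ext_linear V AB.monoid_axioms) (auto simp: prod_sel)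

lemma lin_ext_bilin_null: assumes "x \<in> N" shows "lin_ext K V (\<lambda>(a, b). f a b) x = \<zero>\<^bsub>V\<^esub>"
proof -
  interpret V: module K V by (rule V)
  let ?L = "lin_ext K V (\<lambda>(a, b). f a b)"
  note L = linear_mapsD[OF lin_ext_bilin]
  note L' = linear_maps_minus[OF F.module_axioms V lin_ext_bilin]
  have d: "?L (mdelta K (a, b)) = f a b" if "a \<in> carrier A" "b \<in> carrier B" for a b
    using lin_ext_delta[OF V, of "\<lambda>(a, b). f a b" "(a, b)"] bilin_simps(1)[OF f that] by simp
  have "?L x = \<zero>\<^bsub>V\<^esub>" if "x \<in> tensor_relators K A B" for x
    using that by (cases x rule: relators_cases) (auto simp: L L' d bilin_simps[OF f] V.M.r_neg V.M.minus_eq)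
  then have "N \<subseteq> {x \<in> carrier F. ?L x = \<zero>\<^bsub>V\<^esub>}"
    unfolding tensor_null_def using relators_carrier
    by (intro lin_span_minimal linear_kernel_submodule F.module_axioms V lin_ext_bilin) auto
  then show ?thesis using assms by auto
qed

text \<open>The linear extension of a bilinear map vanishes on the null space, so it has one value
  on the whole class; this value is the only candidate in the definite description of
  \<open>tlift\<close>.\<close>

lemma tlift_class: assumes "r \<in> carrier F" shows "tlift K V f (N +>\<^bsub>F\<^esub> r) = lin_ext K V (\<lambda>(a, b). f a b) r"
proof -
  interpret V: module K V by (rule V)
  let ?L = "lin_ext K V (\<lambda>(a, b). f a b)"
  have "?L s = ?L r" if "s \<in> N +>\<^bsub>F\<^esub> r" for s
  proof -
    have s: "s \<in> carrier F" "s \<ominus>\<^bsub>F\<^esub> r \<in> N"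
      using that coset_mem[OF F.is_abelian_group Q.is_additive_subgroup assms] by auto
    then have "?L (s \<ominus>\<^bsub>F\<^esub> r) = \<zero>\<^bsub>V\<^esub>" by (intro lin_ext_bilin_null)
    then show ?thesis
      using linear_maps_minus[OF F.module_axioms V lin_ext_bilin s(1) assms]
      by (simp add: minus_zero_iff V.M.abelian_group_axioms linear_mapsD(1)[OF lin_ext_bilin] s assms)
  qed
  note * = this
  have r: "r \<in> N +>\<^bsub>F\<^esub> r" using assms by (rule Q.a_rcos_self)
  show ?thesis
    unfolding tlift_def
  proof (rule the_equality)
    show "\<forall>s\<in>N +>\<^bsub>F\<^esub> r. ?L r = ?L s" using *[symmetric] by (rule ballI)
  next
    fix v assume "\<forall>s\<in>N +>\<^bsub>F\<^esub> r. v = ?L s"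
    then show "v = ?L r" using r by (rule bspec)
  qed
qed

lemma tlift_linear: "tlift K V f \<in> linear_maps K T V"
  by (intro linear_mapsI)
    (auto simp: T_eq Q.q_mem Q.q_add Q.q_smult tlift_class linear_mapsD[OF lin_ext_bilin])

lemma tlift_pt: assumes "a \<in> carrier A" "b \<in> carrier B" shows "tlift K V f (pt a b) = f a b"
  using lin_ext_delta[OF V, of "\<lambda>(a, b). f a b" "(a, b)"] bilin_simps(1)[OF f] assms
  by (simp add: pt_eq tlift_class)

lemmas tlift_simps = linear_mapsD[OF tlift_linear] tlift_pt

lemma tlift_comp:
  assumes "module K W" "g \<in> linear_maps K V W" "t \<in> carrier T"
  shows "g (tlift K V f t) = tlift K W (\<lambda>a b. g (f a b)) t"
proof -
  have "bilin K A B W (\<lambda>a b. g (f a b))" by (rule bilin_linear[OF f assms(2)])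
  then show ?thesis
    using tens.tlift_linear[OF tens_axioms assms(1)] tens.tlift_pt[OF tens_axioms assms(1)]
    by (intro T_linear_eq[OF assms(1) linear_maps_comp[OF tlift_linear assms(2)] _ _ assms(3)]) (auto simp: tlift_pt)
qed

lemma tlift_eqI:
  assumes "g \<in> linear_maps K T V" "\<And>a b. a \<in> carrier A \<Longrightarrow> b \<in> carrier B \<Longrightarrow> g (pt a b) = f a b" "t \<in> carrier T"
  shows "tlift K V f t = g t"
  by (rule T_linear_eq[OF V tlift_linear assms(1) _ assms(3)]) (simp add: tlift_pt assms(2))

end

lemma tlift_cong:
  assumes "module K V" "bilin K A B V f" "\<And>a b. a \<in> carrier A \<Longrightarrow> b \<in> carrier B \<Longrightarrow> f a b = g a b" "t \<in> carrier T"
  shows "tlift K V f t = tlift K V g t"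
proof -
  have g: "bilin K A B V g" by (rule bilin_cong[OF assms(2,3) A.module_axioms B.module_axioms])
  show ?thesis
    by (rule tlift_eqI[OF assms(1,2) tlift_linear[OF assms(1) g] _ assms(4)]) (simp add: tlift_pt[OF assms(1) g] assms(3))
qed

lemma tlift_alg_hom:
  assumes "asalg K E" "bilin K A B E f"
    and m: "\<And>a b a' b'. \<lbrakk>a \<in> carrier A; b \<in> carrier B; a' \<in> carrier A; b' \<in> carrier B\<rbrakk> \<Longrightarrow>
        f (a \<otimes> a') (b \<otimes>\<^bsub>B\<^esub> b') = f a b \<otimes>\<^bsub>E\<^esub> f a' b'"
    and one: "f \<one> \<one>\<^bsub>B\<^esub> = \<one>\<^bsub>E\<^esub>"
  shows "tlift K E f \<in> alg_homs K T E"
proof -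
  interpret E: asalg K E by fact
  note t = tlift_simps[OF E.module_axioms assms(2)]
  show ?thesis
  proof (intro alg_homsI tlift_linear[OF E.module_axioms assms(2)])
    show "tlift K E f \<one>\<^bsub>T\<^esub> = \<one>\<^bsub>E\<^esub>" by (simp add: T_one t one)
    fix s u assume "s \<in> carrier T" "u \<in> carrier T"
    then show "tlift K E f (s \<otimes>\<^bsub>T\<^esub> u) = tlift K E f s \<otimes>\<^bsub>E\<^esub> tlift K E f u"
    proof (induction s rule: T_induct)
      case (add s s') then show ?case by (simp add: T.l_distr t E.l_distr)
    next
      case (pure a b)
      show ?case
        using pure(3)
      proof (induction u rule: T_induct)
        case (add s s') then show ?case using pure bilin_simps(1)[OF assms(2)] by (simp add: T.r_distr t E.r_distr)
      next
        case (pure a' b') then show ?case using \<open>a \<in> carrier A\<close> \<open>b \<in> carrier B\<close> by (simp add: pt_mult t m)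
      qed
    qed
  qed
qed

text \<open>The lift of the pure tensor map is the identity. The formula turns the formal
  combinations in \<open>gr_comult_class\<close> into sums of pure tensors.\<close>

lemma tensor_class_eq:
  assumes "r \<in> carrier F"
  shows "tensor_class K A B r = lin_ext K T (\<lambda>(a, b). pt a b) r"
proof -
  have "lin_ext K T (\<lambda>(a, b). pt a b) r = tlift K T pt (N +>\<^bsub>F\<^esub> r)"
    using assms by (simp add: tlift_class[OF T.module_axioms pt_bilin])
  also have "\<dots> = N +>\<^bsub>F\<^esub> r"
    using assms by (intro tlift_eqI[OF T.module_axioms pt_bilin linear_maps_ident]) (auto simp: T_eq Q.q_closed)
  finally show ?thesis by (simp add: tensor_class_def)
qed

end

lemma same_algebra_tensor:
  assumes "same_algebra A A'" "same_algebra B B'"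
  shows "tensor K A B = tensor K A' B'"
  using same_algebraD[OF assms(1)] same_algebraD[OF assms(2)]
  by (simp add: tensor_def tensor_null_def tensor_relators_def tensor_free_def DirProd_def)

lemma same_algebra_ptensor:
  assumes "same_algebra A A'" "same_algebra B B'"
  shows "ptensor K A B = ptensor K A' B'"
  using same_algebraD[OF assms(1)] same_algebraD[OF assms(2)]
  by (intro ext) (simp add: ptensor_def tensor_class_def tensor_null_def tensor_relators_def tensor_free_def DirProd_def)

lemma same_algebra_tlift:
  assumes "same_algebra A A'"
  shows "tlift K A = tlift K A'"
  by (intro ext) (simp add: tlift_def same_algebra_lin_ext[OF assms])

section \<open>Universal enveloping algebras\<close>

text \<open>The defining relations of the enveloping algebra, read in the target \<open>E\<close>.
  They are the condition under which \<open>env_lift\<close> is well defined.\<close>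

definition env_data ::
  "('k, 'r) ring_scheme \<Rightarrow> ('k, 'a, 'c) module_scheme \<Rightarrow> ('a \<Rightarrow> 'a \<Rightarrow> 'a)
    \<Rightarrow> ('k, 'e, 'd) module_scheme \<Rightarrow> ('a \<Rightarrow> 'e) \<Rightarrow> ('a \<Rightarrow> 'e) \<Rightarrow> bool" where
  "env_data K A br E \<alpha> \<beta> \<longleftrightarrow> \<alpha> \<in> linear_maps K A E \<and> \<beta> \<in> linear_maps K A E \<and> \<alpha> \<one>\<^bsub>A\<^esub> = \<one>\<^bsub>E\<^esub> \<and>
     (\<forall>x\<in>carrier A. \<forall>y\<in>carrier A.
        \<alpha> (x \<otimes>\<^bsub>A\<^esub> y) = \<alpha> x \<otimes>\<^bsub>E\<^esub> \<alpha> y \<and>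
        \<beta> (br x y) = \<beta> x \<otimes>\<^bsub>E\<^esub> \<beta> y \<ominus>\<^bsub>E\<^esub> \<beta> y \<otimes>\<^bsub>E\<^esub> \<beta> x \<and>
        \<beta> (x \<otimes>\<^bsub>A\<^esub> y) = \<alpha> y \<otimes>\<^bsub>E\<^esub> \<beta> x \<oplus>\<^bsub>E\<^esub> \<alpha> x \<otimes>\<^bsub>E\<^esub> \<beta> y \<and>
        \<alpha> (br x y) = \<beta> x \<otimes>\<^bsub>E\<^esub> \<alpha> y \<ominus>\<^bsub>E\<^esub> \<alpha> y \<otimes>\<^bsub>E\<^esub> \<beta> x)"

lemma env_dataI:
  assumes "\<alpha> \<in> linear_maps K A E" "\<beta> \<in> linear_maps K A E" "\<alpha> \<one>\<^bsub>A\<^esub> = \<one>\<^bsub>E\<^esub>"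
    and "\<And>x y. x \<in> carrier A \<Longrightarrow> y \<in> carrier A \<Longrightarrow> \<alpha> (x \<otimes>\<^bsub>A\<^esub> y) = \<alpha> x \<otimes>\<^bsub>E\<^esub> \<alpha> y"
    and "\<And>x y. x \<in> carrier A \<Longrightarrow> y \<in> carrier A \<Longrightarrow> \<beta> (br x y) = \<beta> x \<otimes>\<^bsub>E\<^esub> \<beta> y \<ominus>\<^bsub>E\<^esub> \<beta> y \<otimes>\<^bsub>E\<^esub> \<beta> x"
    and "\<And>x y. x \<in> carrier A \<Longrightarrow> y \<in> carrier A \<Longrightarrow> \<beta> (x \<otimes>\<^bsub>A\<^esub> y) = \<alpha> y \<otimes>\<^bsub>E\<^esub> \<beta> x \<oplus>\<^bsub>E\<^esub> \<alpha> x \<otimes>\<^bsub>E\<^esub> \<beta> y"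
    and "\<And>x y. x \<in> carrier A \<Longrightarrow> y \<in> carrier A \<Longrightarrow> \<alpha> (br x y) = \<beta> x \<otimes>\<^bsub>E\<^esub> \<alpha> y \<ominus>\<^bsub>E\<^esub> \<alpha> y \<otimes>\<^bsub>E\<^esub> \<beta> x"
  shows "env_data K A br E \<alpha> \<beta>"
  using assms unfolding env_data_def by blast

lemma env_dataD:
  assumes "env_data K A br E \<alpha> \<beta>"
  shows "\<alpha> \<in> linear_maps K A E" "\<beta> \<in> linear_maps K A E" "\<alpha> \<one>\<^bsub>A\<^esub> = \<one>\<^bsub>E\<^esub>"
    and "x \<in> carrier A \<Longrightarrow> y \<in> carrier A \<Longrightarrow> \<alpha> (x \<otimes>\<^bsub>A\<^esub> y) = \<alpha> x \<otimes>\<^bsub>E\<^esub> \<alpha> y"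
    and "x \<in> carrier A \<Longrightarrow> y \<in> carrier A \<Longrightarrow> \<beta> (br x y) = \<beta> x \<otimes>\<^bsub>E\<^esub> \<beta> y \<ominus>\<^bsub>E\<^esub> \<beta> y \<otimes>\<^bsub>E\<^esub> \<beta> x"
    and "x \<in> carrier A \<Longrightarrow> y \<in> carrier A \<Longrightarrow> \<beta> (x \<otimes>\<^bsub>A\<^esub> y) = \<alpha> y \<otimes>\<^bsub>E\<^esub> \<beta> x \<oplus>\<^bsub>E\<^esub> \<alpha> x \<otimes>\<^bsub>E\<^esub> \<beta> y"
    and "x \<in> carrier A \<Longrightarrow> y \<in> carrier A \<Longrightarrow> \<alpha> (br x y) = \<beta> x \<otimes>\<^bsub>E\<^esub> \<alpha> y \<ominus>\<^bsub>E\<^esub> \<alpha> y \<otimes>\<^bsub>E\<^esub> \<beta> x"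
  using assms unfolding env_data_def by blast+

primrec gen_val :: "('a \<Rightarrow> 'e) \<Rightarrow> ('a \<Rightarrow> 'e) \<Rightarrow> 'a env_gen \<Rightarrow> 'e" where
  "gen_val \<alpha> \<beta> (Mgen a) = \<alpha> a"
| "gen_val \<alpha> \<beta> (Hgen a) = \<beta> a"

primrec word_val :: "('k, 'e, 'd) module_scheme \<Rightarrow> ('a \<Rightarrow> 'e) \<Rightarrow> ('a \<Rightarrow> 'e) \<Rightarrow> 'a env_gen list \<Rightarrow> 'e" where
  "word_val E \<alpha> \<beta> [] = \<one>\<^bsub>E\<^esub>"
| "word_val E \<alpha> \<beta> (g # w) = gen_val \<alpha> \<beta> g \<otimes>\<^bsub>E\<^esub> word_val E \<alpha> \<beta> w"

locale env_alg = asalg K A for K :: "('k, 'r) ring_scheme" and A :: "('k, 'a, 'c) module_scheme" (structure) +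
  fixes br :: "'a \<Rightarrow> 'a \<Rightarrow> 'a"
  assumes br_closed [simp]: "x \<in> carrier A \<Longrightarrow> y \<in> carrier A \<Longrightarrow> br x y \<in> carrier A"
begin

abbreviation EF where "EF \<equiv> env_free K A"
abbreviation EI where "EI \<equiv> env_ideal K A br"
abbreviation E where "E \<equiv> env K A br"
abbreviation m where "m \<equiv> env_m K A br"
abbreviation h where "h \<equiv> env_h K A br"

lemma words_monoid: "monoid (env_words A)"
  unfolding env_words_def by (intro monoidI) auto

interpretation W: monoid "env_words A" by (rule words_monoid)

interpretation F: monalg K "env_words A" by unfold_locales

interpretation F: asalg K EF unfolding env_free_def by (rule F.A_asalg)

lemma words_sel:
  "w \<in> carrier (env_words A) \<longleftrightarrow> w \<in> lists (Mgen ` carrier A \<union> Hgen ` carrier A)"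
  "v \<otimes>\<^bsub>env_words A\<^esub> w = v @ w" "\<one>\<^bsub>env_words A\<^esub> = []"
  by (auto simp: env_words_def)

lemma delta_gen [simp]: "a \<in> carrier A \<Longrightarrow> mdelta K [Mgen a] \<in> carrier EF" "a \<in> carrier A \<Longrightarrow> mdelta K [Hgen a] \<in> carrier EF"
  unfolding env_free_def by (rule F.delta_closed, simp add: words_sel)+

lemmas EF_induct = F.ma_induct[folded env_free_def, consumes 1, case_names zero add delta]

lemma delta_closed [simp]: "w \<in> carrier (env_words A) \<Longrightarrow> mdelta K w \<in> carrier EF"
  unfolding env_free_def by (rule F.delta_closed)

lemma relators_carrier: "env_relators K A br \<subseteq> carrier EF"
  unfolding env_relators_def Let_def by auto

lemma EI_ideal: "ideal EI EF"
  unfolding env_ideal_def by (intro F.genideal_ideal relators_carrier)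

lemma relators_in: "x \<in> env_relators K A br \<Longrightarrow> x \<in> EI"
  unfolding env_ideal_def using F.genideal_self[OF relators_carrier] by (rule subsetD)

interpretation Q: quotient_alg K EF EI
  by (intro quotient_alg.intro F.asalg_axioms EI_ideal)

lemma E_eq: "E = Q.Q" by (simp add: env_def)

lemma E_asalg: "asalg K E"
  unfolding E_eq by (rule Q.q_asalg)

sublocale E: asalg K E by (rule E_asalg)

lemma m_eq: "m a = EI +>\<^bsub>EF\<^esub> mdelta K [Mgen a]" by (simp add: env_m_def)
lemma h_eq: "h a = EI +>\<^bsub>EF\<^esub> mdelta K [Hgen a]" by (simp add: env_h_def)

lemma m_closed [simp]: "a \<in> carrier A \<Longrightarrow> m a \<in> carrier E"
  by (simp add: m_eq E_eq Q.q_closed)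

lemma h_closed [simp]: "a \<in> carrier A \<Longrightarrow> h a \<in> carrier E"
  by (simp add: h_eq E_eq Q.q_closed)

lemma relI:
  assumes "r \<in> carrier EF" "s \<in> carrier EF" "r \<ominus>\<^bsub>EF\<^esub> s \<in> env_relators K A br"
  shows "EI +>\<^bsub>EF\<^esub> r = EI +>\<^bsub>EF\<^esub> s"
  using Q.q_coset_eq[OF assms(1,2)] relators_in[OF assms(3)] by simp

lemma q_minus:
  assumes "r \<in> carrier EF" "s \<in> carrier EF"
  shows "(EI +>\<^bsub>EF\<^esub> r) \<ominus>\<^bsub>E\<^esub> (EI +>\<^bsub>EF\<^esub> s) = EI +>\<^bsub>EF\<^esub> (r \<ominus>\<^bsub>EF\<^esub> s)"
  using linear_maps_minus[OF F.module_axioms E.module_axioms alg_homsD(1)[OF Q.q_class_alg_hom[folded E_eq]] assms] by simp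

lemma relators_mem:
  assumes "x \<in> carrier A" "y \<in> carrier A"
  shows "mdelta K [Mgen (x \<oplus> y)] \<ominus>\<^bsub>EF\<^esub> (mdelta K [Mgen x] \<oplus>\<^bsub>EF\<^esub> mdelta K [Mgen y]) \<in> env_relators K A br"
    "mdelta K [Hgen (x \<oplus> y)] \<ominus>\<^bsub>EF\<^esub> (mdelta K [Hgen x] \<oplus>\<^bsub>EF\<^esub> mdelta K [Hgen y]) \<in> env_relators K A br"
    "mdelta K [Mgen (x \<otimes> y)] \<ominus>\<^bsub>EF\<^esub> (mdelta K [Mgen x] \<otimes>\<^bsub>EF\<^esub> mdelta K [Mgen y]) \<in> env_relators K A br"
    "mdelta K [Hgen (br x y)] \<ominus>\<^bsub>EF\<^esub> (mdelta K [Hgen x] \<otimes>\<^bsub>EF\<^esub> mdelta K [Hgen y] \<ominus>\<^bsub>EF\<^esub> mdelta K [Hgen y] \<otimes>\<^bsub>EF\<^esub> mdelta K [Hgen x]) \<in> env_relators K A br"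
    "mdelta K [Hgen (x \<otimes> y)] \<ominus>\<^bsub>EF\<^esub> (mdelta K [Mgen y] \<otimes>\<^bsub>EF\<^esub> mdelta K [Hgen x] \<oplus>\<^bsub>EF\<^esub> mdelta K [Mgen x] \<otimes>\<^bsub>EF\<^esub> mdelta K [Hgen y]) \<in> env_relators K A br"
    "mdelta K [Mgen (br x y)] \<ominus>\<^bsub>EF\<^esub> (mdelta K [Hgen x] \<otimes>\<^bsub>EF\<^esub> mdelta K [Mgen y] \<ominus>\<^bsub>EF\<^esub> mdelta K [Mgen y] \<otimes>\<^bsub>EF\<^esub> mdelta K [Hgen x]) \<in> env_relators K A br"
  unfolding env_relators_def Let_def
  by (rule UnI1, rule UnI1, rule UN_I[OF assms(1)], rule UN_I[OF assms(2)], simp)+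

lemma relators_mem':
  assumes "c \<in> carrier K" "x \<in> carrier A"
  shows "mdelta K [Mgen (c \<odot> x)] \<ominus>\<^bsub>EF\<^esub> (c \<odot>\<^bsub>EF\<^esub> mdelta K [Mgen x]) \<in> env_relators K A br"
    "mdelta K [Hgen (c \<odot> x)] \<ominus>\<^bsub>EF\<^esub> (c \<odot>\<^bsub>EF\<^esub> mdelta K [Hgen x]) \<in> env_relators K A br"
  unfolding env_relators_def Let_def
  by (rule UnI1, rule UnI2, rule UN_I[OF assms(1)], rule UN_I[OF assms(2)], simp)+

lemma relators_one: "mdelta K [Mgen \<one>] \<ominus>\<^bsub>EF\<^esub> \<one>\<^bsub>EF\<^esub> \<in> env_relators K A br"
  unfolding env_relators_def Let_def by (rule UnI2) simp

lemma env_data_gens: "env_data K A br E m h"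
proof (intro env_dataI linear_mapsI)
  fix x y assume xy: "x \<in> carrier A" "y \<in> carrier A"
  note r = relators_mem[OF xy]
  show "m (x \<oplus> y) = m x \<oplus>\<^bsub>E\<^esub> m y" "h (x \<oplus> y) = h x \<oplus>\<^bsub>E\<^esub> h y"
    "m (x \<otimes> y) = m x \<otimes>\<^bsub>E\<^esub> m y"
    "h (x \<otimes> y) = m y \<otimes>\<^bsub>E\<^esub> h x \<oplus>\<^bsub>E\<^esub> m x \<otimes>\<^bsub>E\<^esub> h y"
    using relI[OF _ _ r(1)] relI[OF _ _ r(2)] relI[OF _ _ r(3)] relI[OF _ _ r(5)] xy
    by (simp_all add: m_eq h_eq E_eq Q.q_mult Q.q_add)
  show "h (br x y) = h x \<otimes>\<^bsub>E\<^esub> h y \<ominus>\<^bsub>E\<^esub> h y \<otimes>\<^bsub>E\<^esub> h x" "m (br x y) = h x \<otimes>\<^bsub>E\<^esub> m y \<ominus>\<^bsub>E\<^esub> m y \<otimes>\<^bsub>E\<^esub> h x"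
    using relI[OF _ _ r(4)] relI[OF _ _ r(6)] xy
    by (simp_all add: m_eq h_eq q_minus[symmetric, unfolded E_eq] E_eq Q.q_mult)
next
  show "m \<one> = \<one>\<^bsub>E\<^esub>" using relI[OF _ _ relators_one] by (simp add: m_eq E_eq Q.q_sel)
next
  fix c x assume cx: "c \<in> carrier K" "x \<in> carrier A"
  show "m (c \<odot> x) = c \<odot>\<^bsub>E\<^esub> m x" "h (c \<odot> x) = c \<odot>\<^bsub>E\<^esub> h x"
    using relI[OF _ _ relators_mem'(1)[OF cx]] relI[OF _ _ relators_mem'(2)[OF cx]] cx
    by (simp_all add: m_eq h_eq E_eq Q.q_smult)
qed auto

lemmas m_linear = env_dataD(1)[OF env_data_gens]
lemmas h_linear = env_dataD(2)[OF env_data_gens]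
lemmas m_one = env_dataD(3)[OF env_data_gens]
lemmas m_mult = env_dataD(4)[OF env_data_gens]
lemmas h_br = env_dataD(5)[OF env_data_gens]
lemmas h_mult = env_dataD(6)[OF env_data_gens]
lemmas m_br = env_dataD(7)[OF env_data_gens]
lemmas m_lin_simps = linear_mapsD[OF m_linear] linear_maps_zero[OF module_axioms E.module_axioms m_linear]
  linear_maps_uminus[OF module_axioms E.module_axioms m_linear]
lemmas h_lin_simps = linear_mapsD[OF h_linear] linear_maps_zero[OF module_axioms E.module_axioms h_linear]
  linear_maps_uminus[OF module_axioms E.module_axioms h_linear]

text \<open>The scalar \<^term>\<open>c\<close> acts as multiplication by the generator of \<^term>\<open>c\<close> times one, so no case for scalars is needed.\<close>

lemma E_induct [consumes 1, case_names one add m h]: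
  assumes "z \<in> carrier E" "P \<one>\<^bsub>E\<^esub>"
    and add: "\<And>z w. z \<in> carrier E \<Longrightarrow> w \<in> carrier E \<Longrightarrow> P z \<Longrightarrow> P w \<Longrightarrow> P (z \<oplus>\<^bsub>E\<^esub> w)"
    and m: "\<And>a z. a \<in> carrier A \<Longrightarrow> z \<in> carrier E \<Longrightarrow> P z \<Longrightarrow> P (m a \<otimes>\<^bsub>E\<^esub> z)"
    and h: "\<And>a z. a \<in> carrier A \<Longrightarrow> z \<in> carrier E \<Longrightarrow> P z \<Longrightarrow> P (h a \<otimes>\<^bsub>E\<^esub> z)"
  shows "P z"
proof -
  have scal: "c \<odot>\<^bsub>E\<^esub> z = m (c \<odot> \<one>) \<otimes>\<^bsub>E\<^esub> z" if "c \<in> carrier K" "z \<in> carrier E" for c z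
    using that by (simp add: m_lin_simps m_one E.smult_l)
  have word: "EI +>\<^bsub>EF\<^esub> mdelta K w \<in> carrier E \<and> P (EI +>\<^bsub>EF\<^esub> mdelta K w)" if "w \<in> carrier (env_words A)" for w
    using that
  proof (induction w)
    case Nil
    have "\<one>\<^bsub>E\<^esub> = EI +>\<^bsub>EF\<^esub> mdelta K []"
      unfolding E_eq Q.q_sel by (simp add: env_free_def F.ma_sel words_sel)
    then show ?case using assms(2) E.one_closed by simp
  next
    case (Cons g w)
    then have gw: "[g] \<in> carrier (env_words A)" "w \<in> carrier (env_words A)" by (auto simp: words_sel)
    have "mdelta K (g # w) = mdelta K [g] \<otimes>\<^bsub>EF\<^esub> mdelta K w"
      unfolding env_free_def F.delta_mult[OF gw] by (simp add: words_sel)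
    then have *: "EI +>\<^bsub>EF\<^esub> mdelta K (g # w) = (EI +>\<^bsub>EF\<^esub> mdelta K [g]) \<otimes>\<^bsub>E\<^esub> (EI +>\<^bsub>EF\<^esub> mdelta K w)"
      using gw by (simp add: E_eq Q.q_mult)
    from gw(1) obtain a where a: "a \<in> carrier A" "g = Mgen a \<or> g = Hgen a" by (auto simp: words_sel)
    show ?case
      using a(2)
    proof
      assume "g = Mgen a"
      then show ?thesis unfolding * using m[OF a(1)] Cons.IH gw(2) m_closed[OF a(1)] by (simp add: m_eq)
    next
      assume "g = Hgen a"
      then show ?thesis unfolding * using h[OF a(1)] Cons.IH gw(2) h_closed[OF a(1)] by (simp add: h_eq)
    qed
  qed
  have "P (EI +>\<^bsub>EF\<^esub> r)" if "r \<in> carrier EF" for r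
    using that
  proof (induction r rule: EF_induct)
    case zero
    have "EI +>\<^bsub>EF\<^esub> \<zero>\<^bsub>EF\<^esub> = \<zero>\<^bsub>E\<^esub>" by (simp add: E_eq Q.q_zero)
    also have "\<dots> = m \<zero> \<otimes>\<^bsub>E\<^esub> \<one>\<^bsub>E\<^esub>" by (simp add: m_lin_simps)
    finally show ?case using m[of "\<zero>" "\<one>\<^bsub>E\<^esub>"] assms(2) by simp
  next
    case (add r s)
    then show ?case using assms(3)[of "EI +>\<^bsub>EF\<^esub> r" "EI +>\<^bsub>EF\<^esub> s"] by (simp add: E_eq Q.q_add Q.q_closed)
  next
    case (delta c w)
    then have "EI +>\<^bsub>EF\<^esub> (c \<odot>\<^bsub>EF\<^esub> mdelta K w) = c \<odot>\<^bsub>E\<^esub> (EI +>\<^bsub>EF\<^esub> mdelta K w)"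
      by (simp add: E_eq Q.q_smult)
    then have "EI +>\<^bsub>EF\<^esub> (c \<odot>\<^bsub>EF\<^esub> mdelta K w) = m (c \<odot> \<one>) \<otimes>\<^bsub>E\<^esub> (EI +>\<^bsub>EF\<^esub> mdelta K w)"
      using scal[OF delta(1)] word[OF delta(2)] by simp
    then show ?case using m[of "c \<odot> \<one>"] word[OF delta(2)] delta(1) by simp
  qed
  then show ?thesis using assms(1) by (auto simp: E_eq Q.q_mem)
qed

lemma E_hom_eq:
  assumes "asalg K E'" "f \<in> alg_homs K E E'" "g \<in> alg_homs K E E'"
    and "\<And>a. a \<in> carrier A \<Longrightarrow> f (m a) = g (m a)" "\<And>a. a \<in> carrier A \<Longrightarrow> f (h a) = g (h a)"
    and "z \<in> carrier E"
  shows "f z = g z"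
proof -
  note f = alg_homsD[OF assms(2)] linear_mapsD[OF alg_homsD(1)[OF assms(2)]]
  note g = alg_homsD[OF assms(3)] linear_mapsD[OF alg_homsD(1)[OF assms(3)]]
  show ?thesis
    using assms(6) by (induction z rule: E_induct) (simp_all add: f g assms(4,5))
qed

context
  fixes E' :: "('k, 'e, 'd) module_scheme" and \<alpha> \<beta>
  assumes E': "asalg K E'" and D: "env_data K A br E' \<alpha> \<beta>"
begin

text \<open>A word is sent to the product of the values of its letters. By \<open>env_data\<close>
  this map kills the relators; its kernel is an ideal and therefore contains the ideal they
  generate.\<close>

lemma lift_exists:
  obtains f where "f \<in> alg_homs K E E'" "\<And>a. a \<in> carrier A \<Longrightarrow> f (m a) = \<alpha> a \<and> f (h a) = \<beta> a"
proof -
  interpret E': asalg K E' by (rule E')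
  note D' = env_dataD[OF D] and \<alpha> = linear_mapsD[OF env_dataD(1)[OF D]] and \<beta> = linear_mapsD[OF env_dataD(2)[OF D]]
  let ?v = "word_val E' \<alpha> \<beta>"
  have v_closed: "?v w \<in> carrier E'" if "w \<in> carrier (env_words A)" for w
    using that by (induction w) (auto simp: words_sel \<alpha> \<beta>)
  have v_app: "?v (u @ w) = ?v u \<otimes>\<^bsub>E'\<^esub> ?v w" if "u \<in> carrier (env_words A)" "w \<in> carrier (env_words A)" for u w
    using that
  proof (induction u)
    case Nil then show ?case by (simp add: v_closed)
  next
    case (Cons g u)
    then have "gen_val \<alpha> \<beta> g \<in> carrier E'" "u \<in> carrier (env_words A)" by (auto simp: words_sel \<alpha> \<beta>)
    then show ?case using Cons by (simp add: v_closed E'.m_assoc)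
  qed
  let ?f = "lin_ext K E' ?v"
  have f: "?f \<in> alg_homs K EF E'"
    unfolding env_free_def using v_closed v_app
    by (intro lin_ext_alg_hom E' words_monoid) (auto simp: words_sel(2,3))
  note fs = alg_homsD[OF f] linear_mapsD[OF alg_homsD(1)[OF f]]
    linear_maps_minus[OF F.module_axioms E'.module_axioms alg_homsD(1)[OF f]]
  have fd: "?f (mdelta K w) = ?v w" if "w \<in> carrier (env_words A)" for w
    using v_closed[OF that] by (rule lin_ext_delta[OF E'.module_axioms])
  have fg: "?f (mdelta K [Mgen a]) = \<alpha> a" "?f (mdelta K [Hgen a]) = \<beta> a" if "a \<in> carrier A" for a
    using that by (simp_all add: fd words_sel \<alpha> \<beta>)
  have "?f x = \<zero>\<^bsub>E'\<^esub>" if "x \<in> env_relators K A br" for x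
  proof -
    have z: "?f (r \<ominus>\<^bsub>EF\<^esub> s) = \<zero>\<^bsub>E'\<^esub>" if "r \<in> carrier EF" "s \<in> carrier EF" "?f r = ?f s" for r s
      using that fs by (simp add: a_minus_def E'.M.r_neg)
    show ?thesis
      using that unfolding env_relators_def Let_def
      by (elim UnE UN_E; elim insertE emptyE; hypsubst; intro z)
        (simp_all add: fs fg \<alpha> \<beta> D')
  qed
  then have "env_relators K A br \<subseteq> {x \<in> carrier EF. ?f x = \<zero>\<^bsub>E'\<^esub>}"
    using relators_carrier by blast
  moreover have "ideal {x \<in> carrier EF. ?f x = \<zero>\<^bsub>E'\<^esub>} EF"
  proof (intro idealI F.ring_axioms)
    show "subgroup {x \<in> carrier EF. ?f x = \<zero>\<^bsub>E'\<^esub>} (add_monoid EF)"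
      using linear_kernel_submodule[OF F.module_axioms E'.module_axioms fs(1)] submodule.axioms(1) by blast
  qed (auto simp: fs)
  ultimately have "EI \<subseteq> {x \<in> carrier EF. ?f x = \<zero>\<^bsub>E'\<^esub>}"
    unfolding env_ideal_def by (intro F.genideal_minimal)
  then have "\<And>x. x \<in> EI \<Longrightarrow> ?f x = \<zero>\<^bsub>E'\<^esub>" by blast
  then obtain G where G: "G \<in> alg_homs K E E'" "\<And>x. x \<in> carrier EF \<Longrightarrow> G (EI +>\<^bsub>EF\<^esub> x) = ?f x"
    using Q.q_lift[OF E' f] unfolding E_eq by blast
  show thesis
    by (rule that[OF G(1)]) (simp add: m_eq h_eq G(2) fg)
qed

text \<open>An algebra map is fixed on the carrier by its values on generators. The requirement of
  extensionality fixes it outside as well, so the definite description singles out the restriction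
  of the lift.\<close>

lemma env_lift_props:
  "env_lift K A br E' \<alpha> \<beta> \<in> alg_homs K E E'"
  "a \<in> carrier A \<Longrightarrow> env_lift K A br E' \<alpha> \<beta> (m a) = \<alpha> a"
  "a \<in> carrier A \<Longrightarrow> env_lift K A br E' \<alpha> \<beta> (h a) = \<beta> a"
proof -
  interpret E': asalg K E' by (rule E')
  obtain f where f: "f \<in> alg_homs K E E'" "\<And>a. a \<in> carrier A \<Longrightarrow> f (m a) = \<alpha> a \<and> f (h a) = \<beta> a"
    using lift_exists by blast
  let ?P = "\<lambda>f. f \<in> extensional (carrier E) \<and> f \<in> alg_homs K E E' \<and>
     (\<forall>a\<in>carrier A. f (m a) = \<alpha> a \<and> f (h a) = \<beta> a)"
  have "restrict f (carrier E) \<in> alg_homs K E E'"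
    using alg_homsD[OF f(1)] linear_mapsD[OF alg_homsD(1)[OF f(1)]]
    by (intro alg_homsI linear_mapsI) simp_all
  then have "?P (restrict f (carrier E))" using f(2) by simp
  moreover have "g = restrict f (carrier E)" if "?P g" for g
    using that f E_hom_eq[OF E', of g f] by (intro extensionalityI[of g "carrier E"]) auto
  ultimately have "?P (THE f. ?P f)" by (rule theI)
  then have *: "?P (env_lift K A br E' \<alpha> \<beta>)" unfolding env_lift_def by simp
  then show "env_lift K A br E' \<alpha> \<beta> \<in> alg_homs K E E'"
    "a \<in> carrier A \<Longrightarrow> env_lift K A br E' \<alpha> \<beta> (m a) = \<alpha> a"
    "a \<in> carrier A \<Longrightarrow> env_lift K A br E' \<alpha> \<beta> (h a) = \<beta> a" by auto
qed

end

end

lemma env_map_data: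
  assumes "env_alg K A brA" "env_alg K B brB" "f \<in> alg_homs K A B"
    and "\<And>x y. x \<in> carrier A \<Longrightarrow> y \<in> carrier A \<Longrightarrow> f (brA x y) = brB (f x) (f y)"
  shows "env_data K A brA (env K B brB) (\<lambda>a. env_m K B brB (f a)) (\<lambda>a. env_h K B brB (f a))"
proof -
  interpret A: env_alg K A brA by fact
  interpret B: env_alg K B brB by fact
  note f = alg_homsD[OF assms(3)] linear_mapsD[OF alg_homsD(1)[OF assms(3)]]
  show ?thesis
    by (intro env_dataI linear_maps_comp[OF f(1) B.m_linear] linear_maps_comp[OF f(1) B.h_linear])
      (simp_all add: f assms(4) B.m_one B.m_mult B.h_br B.h_mult B.m_br)
qed

lemma env_map_props:
  assumes "env_alg K A brA" "env_alg K B brB" "f \<in> alg_homs K A B"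
    and "\<And>x y. x \<in> carrier A \<Longrightarrow> y \<in> carrier A \<Longrightarrow> f (brA x y) = brB (f x) (f y)"
  shows "env_map K A brA B brB f \<in> alg_homs K (env K A brA) (env K B brB)"
    "a \<in> carrier A \<Longrightarrow> env_map K A brA B brB f (env_m K A brA a) = env_m K B brB (f a)"
    "a \<in> carrier A \<Longrightarrow> env_map K A brA B brB f (env_h K A brA a) = env_h K B brB (f a)"
proof -
  have "env_data K A brA (env K B brB) (\<lambda>a. env_m K B brB (f a)) (\<lambda>a. env_h K B brB (f a))"
    by (rule env_map_data[OF assms(1-3)]) (rule assms(4))
  note p = env_alg.env_lift_props[OF assms(1) env_alg.E_asalg[OF assms(2)] this]
  show "env_map K A brA B brB f \<in> alg_homs K (env K A brA) (env K B brB)"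
    "a \<in> carrier A \<Longrightarrow> env_map K A brA B brB f (env_m K A brA a) = env_m K B brB (f a)"
    "a \<in> carrier A \<Longrightarrow> env_map K A brA B brB f (env_h K A brA a) = env_h K B brB (f a)"
    unfolding env_map_def by (fact p)+
qed

section \<open>Poisson algebras\<close>

lemma (in asalg) bilin_commutator: "bilin K A A A (\<lambda>x y. x \<otimes> y \<ominus> y \<otimes> x)"
proof (intro bilinI linear_mapsI)
  fix x y z assume "x \<in> carrier A" "y \<in> carrier A" "z \<in> carrier A"
  then show "x \<otimes> (y \<oplus> z) \<ominus> (y \<oplus> z) \<otimes> x = (x \<otimes> y \<ominus> y \<otimes> x) \<oplus> (x \<otimes> z \<ominus> z \<otimes> x)"
    "(y \<oplus> z) \<otimes> x \<ominus> x \<otimes> (y \<oplus> z) = (y \<otimes> x \<ominus> x \<otimes> y) \<oplus> (z \<otimes> x \<ominus> x \<otimes> z)"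
    by (simp_all add: a_minus_def l_distr r_distr M.minus_add M.a_ac)
next
  fix c x y assume "c \<in> carrier K" "x \<in> carrier A" "y \<in> carrier A"
  then show "x \<otimes> (c \<odot> y) \<ominus> (c \<odot> y) \<otimes> x = c \<odot> (x \<otimes> y \<ominus> y \<otimes> x)"
    "(c \<odot> y) \<otimes> x \<ominus> x \<otimes> (c \<odot> y) = c \<odot> (y \<otimes> x \<ominus> x \<otimes> y)"
    by (simp_all add: a_minus_def smult_l smult_r smult_r_distr smult_r_minus)
qed auto

text \<open>Cancellation in a form that ordered rewriting of sums produces, where a summand and its
  negative are separated by a third term.\<close>

lemma (in abelian_group) r_neg3:
  assumes "x \<in> carrier G" "y \<in> carrier G"
  shows "x \<oplus> (y \<oplus> \<ominus> x) = y" "\<ominus> x \<oplus> (y \<oplus> x) = y"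
proof -
  have "x \<oplus> (\<ominus> x \<oplus> y) = y" "\<ominus> x \<oplus> (x \<oplus> y) = y" using assms by (simp_all add: r_neg1 r_neg2)
  then show "x \<oplus> (y \<oplus> \<ominus> x) = y" "\<ominus> x \<oplus> (y \<oplus> x) = y"
    using assms by (simp_all add: a_comm[of y])
qed

text \<open>Commutator identities are proved in the form x + y = z, where both sides are sums
  without signs and can be brought to a normal form.\<close>

lemma eq_minusI:
  assumes "abelian_group V" "x \<in> carrier V" "y \<in> carrier V" "z \<in> carrier V" "x \<oplus>\<^bsub>V\<^esub> y = z"
  shows "x = z \<ominus>\<^bsub>V\<^esub> y"
proof -
  interpret abelian_group V by fact
  have "x \<oplus>\<^bsub>V\<^esub> y \<ominus>\<^bsub>V\<^esub> y = x" using assms(2-4) by (simp add: a_minus_def a_assoc r_neg)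
  then show ?thesis using assms(5) by simp
qed

lemma tensor_bilin_eq:
  assumes "tens K A B" "tens K A' B'" "module K V"
    and f: "bilin K (tensor K A B) (tensor K A' B') V f" and g: "bilin K (tensor K A B) (tensor K A' B') V g"
    and eq: "\<And>a b a' b'. \<lbrakk>a \<in> carrier A; b \<in> carrier B; a' \<in> carrier A'; b' \<in> carrier B'\<rbrakk> \<Longrightarrow>
      f (ptensor K A B a b) (ptensor K A' B' a' b') = g (ptensor K A B a b) (ptensor K A' B' a' b')"
    and s: "s \<in> carrier (tensor K A B)" and t: "t \<in> carrier (tensor K A' B')"
  shows "f s t = g s t"
proof (rule tens.T_linear_eq[OF assms(1) assms(3) bilinD(2)[OF f t] bilinD(2)[OF g t] _ s])
  fix a b assume ab: "a \<in> carrier A" "b \<in> carrier B"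
  then have p: "ptensor K A B a b \<in> carrier (tensor K A B)" using tens.pt_closed[OF assms(1)] by blast
  show "f (ptensor K A B a b) t = g (ptensor K A B a b) t"
    by (rule tens.T_linear_eq[OF assms(2) assms(3) bilinD(1)[OF f p] bilinD(1)[OF g p] _ t]) (rule eq[OF ab])
qed

locale pois = env_alg K A br for K :: "('k, 'r) ring_scheme" and A :: "('k, 'a, 'c) module_scheme" (structure) and br +
  assumes poisson: "poisson_algebra K A br"
begin

lemma mult_comm: "x \<in> carrier A \<Longrightarrow> y \<in> carrier A \<Longrightarrow> x \<otimes> y = y \<otimes> x"
  using poisson cring.cring_simprules(14)[of A] unfolding poisson_algebra_def algebra_def by blast

lemma mult_lcomm: "x \<in> carrier A \<Longrightarrow> y \<in> carrier A \<Longrightarrow> z \<in> carrier A \<Longrightarrow> x \<otimes> (y \<otimes> z) = y \<otimes> (x \<otimes> z)"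
  by (simp add: mult_comm[of x y] flip: m_assoc)

lemmas mult_ac = m_assoc mult_comm mult_lcomm

lemma br_bilin: "bilin K A A A br"
  using poisson unfolding poisson_algebra_def by (intro bilinI) auto

lemmas br_simps = bilin_simps[OF br_bilin]
lemmas br_zero = linear_maps_zero[OF module_axioms module_axioms bilinD(1)[OF br_bilin]]
  linear_maps_zero[OF module_axioms module_axioms bilinD(2)[OF br_bilin]]
lemmas br_uminus = linear_maps_uminus[OF module_axioms module_axioms bilinD(1)[OF br_bilin]]
  linear_maps_uminus[OF module_axioms module_axioms bilinD(2)[OF br_bilin]]

lemma br_self: "x \<in> carrier A \<Longrightarrow> br x x = \<zero>"
  using poisson unfolding poisson_algebra_def by auto

lemma br_anti: assumes "x \<in> carrier A" "y \<in> carrier A" shows "br y x = \<ominus> br x y"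
proof -
  have "\<zero> = br (x \<oplus> y) (x \<oplus> y)" using assms br_self by simp
  also have "\<dots> = (br x x \<oplus> br x y) \<oplus> (br y x \<oplus> br y y)" using assms by (simp add: br_simps M.a_ac)
  also have "\<dots> = br y x \<oplus> br x y" using assms by (simp add: br_simps br_self M.a_ac)
  finally show ?thesis using assms by (simp add: M.minus_equality)
qed

lemma leibniz: "x \<in> carrier A \<Longrightarrow> y \<in> carrier A \<Longrightarrow> z \<in> carrier A \<Longrightarrow>
    br x (y \<otimes> z) = br x y \<otimes> z \<oplus> y \<otimes> br x z"
  using poisson unfolding poisson_algebra_def by auto

lemma leibniz_left: assumes "x \<in> carrier A" "y \<in> carrier A" "z \<in> carrier A"
  shows "br (y \<otimes> z) x = br y x \<otimes> z \<oplus> y \<otimes> br z x"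
  using assms br_anti[of x "y \<otimes> z"] br_anti[of x y] br_anti[of x z]
  by (simp add: leibniz M.minus_add l_minus r_minus)

lemma jacobi: "x \<in> carrier A \<Longrightarrow> y \<in> carrier A \<Longrightarrow> z \<in> carrier A \<Longrightarrow>
    br x (br y z) \<oplus> br y (br z x) \<oplus> br z (br x y) = \<zero>"
  using poisson unfolding poisson_algebra_def by auto

lemma br_derivation: assumes "x \<in> carrier A" "y \<in> carrier A" "z \<in> carrier A"
  shows "br x (br y z) = br (br x y) z \<oplus> br y (br x z)"
proof -
  have "br y (br z x) = \<ominus> br y (br x z)" "br z (br x y) = \<ominus> br (br x y) z"
    using assms br_anti[of x z] br_anti[of "br x y" z] by (simp_all add: br_uminus)
  then have j: "br x (br y z) \<oplus> (\<ominus> (br (br x y) z \<oplus> br y (br x z))) = \<zero>"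
    using jacobi[OF assms] assms by (simp add: M.minus_add M.a_ac)
  show ?thesis
    by (rule minus_zero_iff[THEN iffD1, OF M.abelian_group_axioms]) (use assms j in \<open>auto simp: a_minus_def\<close>)
qed

sublocale T2: tens K A A by (intro tens.intro asalg_axioms)

abbreviation A2 where "A2 \<equiv> tensor K A A"

lemma tb_inner:
  assumes "a \<in> carrier A" "b \<in> carrier A"
  shows "bilin K A A A2 (\<lambda>c d. ptensor K A A (a \<otimes> c) (br b d) \<oplus>\<^bsub>A2\<^esub> ptensor K A A (br a c) (b \<otimes> d))"
  by (intro bilin_add T2.T.module_axioms bilin_compose[OF T2.pt_bilin] linear_mult_left bilinD(1)[OF br_bilin] assms)

text \<open>\<open>tensor_bracket\<close> nests two lifts. The outer one has a meaning only if the
  inner one is bilinear in \<open>a\<close> and \<open>b\<close>; for fixed \<open>a\<close> and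
  \<open>b\<close> the inner one is linear in \<open>Y\<close>, so this is tested on pure
  tensors.\<close>

lemma tb_outer:
  assumes "Y \<in> carrier A2"
  shows "bilin K A A A2 (\<lambda>a b. tlift K A2 (\<lambda>c d. ptensor K A A (a \<otimes> c) (br b d) \<oplus>\<^bsub>A2\<^esub> ptensor K A A (br a c) (b \<otimes> d)) Y)"
    (is "bilin K A A A2 (\<lambda>a b. ?L a b Y)")
proof -
  note L = T2.tlift_simps[OF T2.T.module_axioms tb_inner]
  have "?L (a \<oplus> a') b Y = ?L a b Y \<oplus>\<^bsub>A2\<^esub> ?L a' b Y" "?L b (a \<oplus> a') Y = ?L b a Y \<oplus>\<^bsub>A2\<^esub> ?L b a' Y"
    if "a \<in> carrier A" "a' \<in> carrier A" "b \<in> carrier A" for a a' b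
    using that assms
    by (intro T2.tlift_eqI[OF T2.T.module_axioms tb_inner] linear_maps_add T2.tlift_linear[OF T2.T.module_axioms tb_inner] T2.T.module_axioms;
      simp add: L T2.pt_simps br_simps l_distr T2.T.M.a_ac)+
  moreover have "?L (e \<odot> a) b Y = e \<odot>\<^bsub>A2\<^esub> ?L a b Y" "?L b (e \<odot> a) Y = e \<odot>\<^bsub>A2\<^esub> ?L b a Y"
    if "e \<in> carrier K" "a \<in> carrier A" "b \<in> carrier A" for e a b
    using that assms
    by (intro T2.tlift_eqI[OF T2.T.module_axioms tb_inner] linear_maps_const_smult T2.tlift_linear[OF T2.T.module_axioms tb_inner] T2.T.module_axioms;
      simp add: L T2.pt_simps br_simps smult_l T2.T.smult_r_distr)+
  ultimately show ?thesis using assms by (intro bilinI linear_mapsI) (simp_all add: L)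
qed

abbreviation tb where "tb \<equiv> tensor_bracket K A br"

lemma tb_pt:
  assumes "a \<in> carrier A" "b \<in> carrier A" "c \<in> carrier A" "d \<in> carrier A"
  shows "tb (ptensor K A A a b) (ptensor K A A c d) =
    ptensor K A A (a \<otimes> c) (br b d) \<oplus>\<^bsub>A2\<^esub> ptensor K A A (br a c) (b \<otimes> d)"
  using assms unfolding tensor_bracket_def Let_def
  by (simp add: T2.tlift_pt[OF T2.T.module_axioms tb_outer] T2.tlift_pt[OF T2.T.module_axioms tb_inner])

lemma tb_bilin: "bilin K A2 A2 A2 tb"
proof -
  let ?L = "\<lambda>a b Y. tlift K A2 (\<lambda>c d. ptensor K A A (a \<otimes> c) (br b d) \<oplus>\<^bsub>A2\<^esub> ptensor K A A (br a c) (b \<otimes> d)) Y"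
  have tb: "tb X Y = tlift K A2 (\<lambda>a b. ?L a b Y) X" for X Y
    by (simp add: tensor_bracket_def Let_def)
  note L = T2.tlift_simps[OF T2.T.module_axioms tb_inner]
  note O = T2.tlift_simps[OF T2.T.module_axioms tb_outer]
  have lin: "(\<lambda>X. tb X Y) \<in> linear_maps K A2 A2" if "Y \<in> carrier A2" for Y
    unfolding tb using T2.tlift_linear[OF T2.T.module_axioms tb_outer[OF that]] .
  have "tb X (Y \<oplus>\<^bsub>A2\<^esub> Z) = tb X Y \<oplus>\<^bsub>A2\<^esub> tb X Z" if "X \<in> carrier A2" "Y \<in> carrier A2" "Z \<in> carrier A2" for X Y Z
    by (rule T2.T_linear_eq[OF T2.T.module_axioms lin linear_maps_add[OF T2.T.module_axioms lin lin] _ that(1)])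
      (use that in \<open>simp_all add: tb O L\<close>)
  moreover have "tb X (c \<odot>\<^bsub>A2\<^esub> Y) = c \<odot>\<^bsub>A2\<^esub> tb X Y" if "X \<in> carrier A2" "Y \<in> carrier A2" "c \<in> carrier K" for X Y c
    by (rule T2.T_linear_eq[OF T2.T.module_axioms lin linear_maps_const_smult[OF T2.T.module_axioms lin] _ that(1)])
      (use that in \<open>simp_all add: tb O L\<close>)
  ultimately show ?thesis
    using linear_mapsD(1)[OF lin] by (intro bilinI lin linear_mapsI) simp_all
qed

sublocale E2: tens K E E by (intro tens.intro E_asalg)

abbreviation EE where "EE \<equiv> tensor K E E"
abbreviation ept where "ept \<equiv> ptensor K E E"

text \<open>Applied to the coproduct of a, \<mu> and \<eta> give the coproducts of the generators
  m_a and h_a of the enveloping algebra.\<close>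

abbreviation \<mu> where "\<mu> \<equiv> tlift K EE (\<lambda>b c. ept (m b) (m c))"
abbreviation \<eta> where "\<eta> \<equiv> tlift K EE (\<lambda>b c. ept (m b) (h c) \<oplus>\<^bsub>EE\<^esub> ept (h b) (m c))"

lemma \<mu>_bilin: "bilin K A A EE (\<lambda>b c. ept (m b) (m c))"
  by (rule bilin_compose[OF E2.pt_bilin m_linear m_linear])

lemma \<eta>_bilin: "bilin K A A EE (\<lambda>b c. ept (m b) (h c) \<oplus>\<^bsub>EE\<^esub> ept (h b) (m c))"
  by (intro bilin_add E2.T.module_axioms bilin_compose[OF E2.pt_bilin m_linear h_linear] bilin_compose[OF E2.pt_bilin h_linear m_linear])

lemmas \<mu>_linear = T2.tlift_linear[OF E2.T.module_axioms \<mu>_bilin]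
lemmas \<eta>_linear = T2.tlift_linear[OF E2.T.module_axioms \<eta>_bilin]
lemmas \<mu>_simps = T2.tlift_simps[OF E2.T.module_axioms \<mu>_bilin]
lemmas \<eta>_simps = T2.tlift_simps[OF E2.T.module_axioms \<eta>_bilin]

lemma \<mu>_hom: "\<mu> \<in> alg_homs K A2 EE"
  by (rule T2.tlift_alg_hom[OF E2.T_asalg \<mu>_bilin]) (simp_all add: m_mult E2.pt_mult m_one E2.T_one)

text \<open>The commutator relations as rewrite rules: each moves the factor that belongs to c to
  the front. The second one rests on antisymmetry of the bracket.\<close>

lemma hm_swap: assumes "a \<in> carrier A" "c \<in> carrier A"
  shows "h a \<otimes>\<^bsub>E\<^esub> m c = m c \<otimes>\<^bsub>E\<^esub> h a \<oplus>\<^bsub>E\<^esub> m (br a c)"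
    and "m a \<otimes>\<^bsub>E\<^esub> h c = h c \<otimes>\<^bsub>E\<^esub> m a \<oplus>\<^bsub>E\<^esub> m (br a c)"
    and "h a \<otimes>\<^bsub>E\<^esub> h c = h c \<otimes>\<^bsub>E\<^esub> h a \<oplus>\<^bsub>E\<^esub> h (br a c)"
proof -
  have "m (br a c) = \<ominus>\<^bsub>E\<^esub> (h c \<otimes>\<^bsub>E\<^esub> m a \<ominus>\<^bsub>E\<^esub> m a \<otimes>\<^bsub>E\<^esub> h c)"
    using assms br_anti[of c a] by (simp add: m_lin_simps(5) flip: m_br)
  then show "m a \<otimes>\<^bsub>E\<^esub> h c = h c \<otimes>\<^bsub>E\<^esub> m a \<oplus>\<^bsub>E\<^esub> m (br a c)"
    using assms by (simp add: a_minus_def E.M.a_ac E.M.minus_add E.M.r_neg2 E.M.r_neg3)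
qed (use assms in \<open>simp_all add: m_br h_br a_minus_def E.M.a_ac E.M.r_neg E.M.r_neg2 E.M.r_neg3\<close>)

text \<open>The product rule with the factor of c in front, the order in which products occur in
  \<eta>(t) \<eta>(s).\<close>

lemma h_mult': assumes "a \<in> carrier A" "c \<in> carrier A"
  shows "h (a \<otimes> c) = m c \<otimes>\<^bsub>E\<^esub> h a \<oplus>\<^bsub>E\<^esub> (h c \<otimes>\<^bsub>E\<^esub> m a \<oplus>\<^bsub>E\<^esub> m (br a c))"
  using assms by (simp add: h_mult hm_swap(2)[of a c])

text \<open>This and the next two lemmas are the relations that the coproduct on the generators has
  to satisfy. Bilinearity reduces them to pure tensors, where all products are brought into one
  order.\<close>

lemma \<eta>_tb: assumes "s \<in> carrier A2" "t \<in> carrier A2"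
  shows "\<eta> (tb s t) = \<eta> s \<otimes>\<^bsub>EE\<^esub> \<eta> t \<ominus>\<^bsub>EE\<^esub> \<eta> t \<otimes>\<^bsub>EE\<^esub> \<eta> s"
proof (rule tensor_bilin_eq[where f = "\<lambda>s t. \<eta> (tb s t)" and g = "\<lambda>s t. \<eta> s \<otimes>\<^bsub>EE\<^esub> \<eta> t \<ominus>\<^bsub>EE\<^esub> \<eta> t \<otimes>\<^bsub>EE\<^esub> \<eta> s", OF T2.tens_axioms T2.tens_axioms E2.T.module_axioms _ _ _ assms])
  show "bilin K A2 A2 EE (\<lambda>s t. \<eta> (tb s t))" by (rule bilin_linear[OF tb_bilin \<eta>_linear])
  show "bilin K A2 A2 EE (\<lambda>s t. \<eta> s \<otimes>\<^bsub>EE\<^esub> \<eta> t \<ominus>\<^bsub>EE\<^esub> \<eta> t \<otimes>\<^bsub>EE\<^esub> \<eta> s)"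
    by (rule bilin_compose[OF E2.T.bilin_commutator \<eta>_linear \<eta>_linear])
  fix a b c d assume abcd: "a \<in> carrier A" "b \<in> carrier A" "c \<in> carrier A" "d \<in> carrier A"
  show "\<eta> (tb (ptensor K A A a b) (ptensor K A A c d)) =
    \<eta> (ptensor K A A a b) \<otimes>\<^bsub>EE\<^esub> \<eta> (ptensor K A A c d) \<ominus>\<^bsub>EE\<^esub> \<eta> (ptensor K A A c d) \<otimes>\<^bsub>EE\<^esub> \<eta> (ptensor K A A a b)"
    using abcd
    apply (intro eq_minusI[OF E2.T.M.abelian_group_axioms])
       apply (simp_all add: tb_pt \<eta>_simps)
    apply (simp add: E2.T.l_distr E2.T.r_distr E2.pt_mult hm_swap[of a c] hm_swap[of b d] h_mult'[of a c] h_mult'[of b d]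
      E2.pt_simps m_mult[symmetric] mult_comm[of c a] mult_comm[of d b] E2.T.M.a_ac)
    done
qed

lemma \<mu>_tb: assumes "s \<in> carrier A2" "t \<in> carrier A2"
  shows "\<mu> (tb s t) = \<eta> s \<otimes>\<^bsub>EE\<^esub> \<mu> t \<ominus>\<^bsub>EE\<^esub> \<mu> t \<otimes>\<^bsub>EE\<^esub> \<eta> s"
proof (rule tensor_bilin_eq[where f = "\<lambda>s t. \<mu> (tb s t)" and g = "\<lambda>s t. \<eta> s \<otimes>\<^bsub>EE\<^esub> \<mu> t \<ominus>\<^bsub>EE\<^esub> \<mu> t \<otimes>\<^bsub>EE\<^esub> \<eta> s", OF T2.tens_axioms T2.tens_axioms E2.T.module_axioms _ _ _ assms])
  show "bilin K A2 A2 EE (\<lambda>s t. \<mu> (tb s t))" by (rule bilin_linear[OF tb_bilin \<mu>_linear])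
  show "bilin K A2 A2 EE (\<lambda>s t. \<eta> s \<otimes>\<^bsub>EE\<^esub> \<mu> t \<ominus>\<^bsub>EE\<^esub> \<mu> t \<otimes>\<^bsub>EE\<^esub> \<eta> s)"
    by (rule bilin_compose[OF E2.T.bilin_commutator \<eta>_linear \<mu>_linear])
  fix a b c d assume abcd: "a \<in> carrier A" "b \<in> carrier A" "c \<in> carrier A" "d \<in> carrier A"
  show "\<mu> (tb (ptensor K A A a b) (ptensor K A A c d)) =
    \<eta> (ptensor K A A a b) \<otimes>\<^bsub>EE\<^esub> \<mu> (ptensor K A A c d) \<ominus>\<^bsub>EE\<^esub> \<mu> (ptensor K A A c d) \<otimes>\<^bsub>EE\<^esub> \<eta> (ptensor K A A a b)"
    using abcd
    apply (intro eq_minusI[OF E2.T.M.abelian_group_axioms])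
       apply (simp_all add: tb_pt \<eta>_simps \<mu>_simps)
    apply (simp add: E2.T.l_distr E2.T.r_distr E2.pt_mult hm_swap[of a c] hm_swap[of b d]
      E2.pt_simps m_mult[symmetric] mult_comm[of c a] mult_comm[of d b] E2.T.M.a_ac)
    done
qed

lemma \<eta>_mult: assumes "s \<in> carrier A2" "t \<in> carrier A2"
  shows "\<eta> (s \<otimes>\<^bsub>A2\<^esub> t) = \<mu> t \<otimes>\<^bsub>EE\<^esub> \<eta> s \<oplus>\<^bsub>EE\<^esub> \<mu> s \<otimes>\<^bsub>EE\<^esub> \<eta> t"
proof (rule tensor_bilin_eq[where f = "\<lambda>s t. \<eta> (s \<otimes>\<^bsub>A2\<^esub> t)" and g = "\<lambda>s t. \<mu> t \<otimes>\<^bsub>EE\<^esub> \<eta> s \<oplus>\<^bsub>EE\<^esub> \<mu> s \<otimes>\<^bsub>EE\<^esub> \<eta> t", OF T2.tens_axioms T2.tens_axioms E2.T.module_axioms _ _ _ assms])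
  show "bilin K A2 A2 EE (\<lambda>s t. \<eta> (s \<otimes>\<^bsub>A2\<^esub> t))" by (rule bilin_linear[OF T2.T.bilin_mult \<eta>_linear])
  show "bilin K A2 A2 EE (\<lambda>s t. \<mu> t \<otimes>\<^bsub>EE\<^esub> \<eta> s \<oplus>\<^bsub>EE\<^esub> \<mu> s \<otimes>\<^bsub>EE\<^esub> \<eta> t)"
    using bilin_compose[OF E2.T.bilin_mult \<mu>_linear \<eta>_linear] unfolding bilin_def
    by (intro conjI ballI linear_maps_add E2.T.module_axioms) auto
  fix a b c d assume abcd: "a \<in> carrier A" "b \<in> carrier A" "c \<in> carrier A" "d \<in> carrier A"
  then show "\<eta> (ptensor K A A a b \<otimes>\<^bsub>A2\<^esub> ptensor K A A c d) =
    \<mu> (ptensor K A A c d) \<otimes>\<^bsub>EE\<^esub> \<eta> (ptensor K A A a b) \<oplus>\<^bsub>EE\<^esub> \<mu> (ptensor K A A a b) \<otimes>\<^bsub>EE\<^esub> \<eta> (ptensor K A A c d)"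
    by (simp add: T2.pt_mult \<eta>_simps \<mu>_simps E2.T.r_distr E2.pt_mult E2.pt_simps h_mult
      m_mult[symmetric] mult_comm[of c a] mult_comm[of d b] E2.T.M.a_ac)
qed

end

lemma poisI: assumes "poisson_algebra K A br" shows "pois K A br"
proof -
  from assms have "algebra K A" "\<And>x. x \<in> carrier A \<Longrightarrow> br x \<in> linear_maps K A A"
    unfolding poisson_algebra_def by auto
  note * = this
  show ?thesis
  proof (intro pois.intro env_alg.intro algebra_asalg env_alg_axioms.intro pois_axioms.intro)
    show "br x y \<in> carrier A" if "x \<in> carrier A" "y \<in> carrier A" for x y
      using linear_mapsD(1)[OF *(2)] that by simp
  qed (rule *(1), rule assms)
qed

text \<open>Isolates the data on which the coproduct of an enveloping algebra rests. It is
  instantiated by the group algebra, by B and by gr B; for gr B these properties are proved directly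
  from the filtration.\<close>

locale pois_comult = pois K A br for K :: "('k, 'r) ring_scheme" and A :: "('k, 'a, 'c) hopf_scheme" (structure) and br +
  assumes comult_hom: "comult A \<in> alg_homs K A (tensor K A A)"
    and comult_br: "x \<in> carrier A \<Longrightarrow> y \<in> carrier A \<Longrightarrow> comult A (br x y) = tensor_bracket K A br (comult A x) (comult A y)"
begin

lemmas comult_simps = alg_homsD[OF comult_hom] linear_mapsD[OF alg_homsD(1)[OF comult_hom]]

lemma env_comult_data: "env_data K A br EE (\<lambda>a. \<mu> (comult A a)) (\<lambda>a. \<eta> (comult A a))"
  by (intro env_dataI linear_maps_comp[OF comult_simps(1) \<mu>_linear] linear_maps_comp[OF comult_simps(1) \<eta>_linear])
    (simp_all add: comult_simps comult_br \<mu>_tb \<eta>_tb \<eta>_mult alg_homsD[OF \<mu>_hom])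

abbreviation \<Delta>E where "\<Delta>E \<equiv> env_comult K A br"

lemma \<Delta>E_hom: "\<Delta>E \<in> alg_homs K E EE"
  unfolding env_comult_def Let_def by (rule env_lift_props(1)[OF E2.T_asalg env_comult_data])

lemma \<Delta>E_m: "a \<in> carrier A \<Longrightarrow> \<Delta>E (m a) = \<mu> (comult A a)"
  unfolding env_comult_def Let_def by (rule env_lift_props(2)[OF E2.T_asalg env_comult_data])

lemma \<Delta>E_h: "a \<in> carrier A \<Longrightarrow> \<Delta>E (h a) = \<eta> (comult A a)"
  unfolding env_comult_def Let_def by (rule env_lift_props(3)[OF E2.T_asalg env_comult_data])

lemmas \<Delta>E_simps = alg_homsD[OF \<Delta>E_hom] linear_mapsD[OF alg_homsD(1)[OF \<Delta>E_hom]]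

lemma \<Delta>E_grouplike: assumes "g \<in> carrier A" "comult A g = ptensor K A A g g"
  shows "\<Delta>E (m g) = ept (m g) (m g)" "\<Delta>E (h g) = ept (m g) (h g) \<oplus>\<^bsub>EE\<^esub> ept (h g) (m g)"
  using assms by (simp_all add: \<Delta>E_m \<Delta>E_h \<mu>_simps \<eta>_simps)

end

lemma (in tens) tlift_pt_mult:
  assumes "module K V" "bilin K A B V f" "u \<in> carrier A" "v \<in> carrier B" "t \<in> carrier T"
  shows "tlift K V f (pt u v \<otimes>\<^bsub>T\<^esub> t) = tlift K V (\<lambda>a b. f (u \<otimes>\<^bsub>A\<^esub> a) (v \<otimes>\<^bsub>B\<^esub> b)) t"
proof (rule tlift_eqI[symmetric, OF assms(1) bilin_compose[OF assms(2) A.linear_mult_left[OF assms(3)] B.linear_mult_left[OF assms(4)]] _ _ assms(5)])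
  show "(\<lambda>t. tlift K V f (pt u v \<otimes>\<^bsub>T\<^esub> t)) \<in> linear_maps K T V"
    by (rule linear_maps_comp[OF T.linear_mult_left tlift_linear[OF assms(1,2)]]) (simp add: assms)
qed (simp add: pt_mult tlift_pt[OF assms(1,2)] assms)

section \<open>The enveloping algebra of a group algebra with zero bracket\<close>

locale grp_env = K: cring K + G: comm_group G for K :: "('k, 'r) ring_scheme" and G :: "('g, 's) monoid_scheme"
begin

abbreviation kA where "kA \<equiv> monoid_algebra K G"
abbreviation kG where "kG \<equiv> group_algebra K G"
abbreviation br0 where "br0 \<equiv> (\<lambda>_ _. \<zero>\<^bsub>kG\<^esub>)"
abbreviation \<delta> where "\<delta> \<equiv> mdelta K"

interpretation MA: monalg K G by unfold_locales

lemma kG_same: "same_algebra kA kG"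
  by (simp add: same_algebra_def group_algebra_def Let_def module.defs hopf.defs)

lemma kG_sel:
  "comult kG = lin_ext K (tensor K kA kA) (\<lambda>g. ptensor K kA kA (\<delta> g) (\<delta> g))"
  "counit kG = lin_ext K (base_algebra K) (\<lambda>g. \<one>\<^bsub>K\<^esub>)"
  "antipode kG = lin_ext K kA (\<lambda>g. \<delta> (inv\<^bsub>G\<^esub> g))"
  by (simp_all add: group_algebra_def Let_def module.defs hopf.defs)

lemma kG_asalg: "asalg K kG"
  by (rule same_algebra_asalg[OF kG_same MA.A_asalg])

sublocale kG: asalg K kG by (rule kG_asalg)

lemma \<delta>_closed [simp]: "g \<in> carrier G \<Longrightarrow> \<delta> g \<in> carrier kG"
  using MA.delta_closed same_algebraD(1)[OF kG_same] by blast

lemma \<delta>_mult: "g \<in> carrier G \<Longrightarrow> t \<in> carrier G \<Longrightarrow> \<delta> g \<otimes>\<^bsub>kG\<^esub> \<delta> t = \<delta> (g \<otimes>\<^bsub>G\<^esub> t)"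
  using MA.delta_mult same_algebraD(2)[OF kG_same] by metis

lemma kG_one: "\<one>\<^bsub>kG\<^esub> = \<delta> \<one>\<^bsub>G\<^esub>"
  using MA.ma_sel(4) same_algebraD(3)[OF kG_same] by metis

lemma kG_linear_eq:
  assumes "module K V" "f \<in> linear_maps K kG V" "f' \<in> linear_maps K kG V"
    "\<And>g. g \<in> carrier G \<Longrightarrow> f (\<delta> g) = f' (\<delta> g)" "a \<in> carrier kG"
  shows "f a = f' a"
proof -
  have s: "linear_maps K kA V = linear_maps K kG V"
    by (rule same_algebra_linear_maps[OF kG_same]) (simp add: same_algebra_def)
  have *: "f \<in> linear_maps K kA V" "f' \<in> linear_maps K kA V" "a \<in> carrier kA"
    using assms(2,3,5) s same_algebraD(1)[OF kG_same] by simp_all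
  show ?thesis
    by (rule monoid_algebra_linear_eq[OF K.cring_axioms G.is_monoid assms(1) *(1,2) _ *(3)]) (rule assms(4))
qed

lemma kG_comm: assumes "a \<in> carrier kG" "b \<in> carrier kG" shows "a \<otimes>\<^bsub>kG\<^esub> b = b \<otimes>\<^bsub>kG\<^esub> a"
proof (rule kG_linear_eq[OF kG.module_axioms kG.linear_mult_right[OF assms(2)] kG.linear_mult_left[OF assms(2)] _ assms(1)])
  fix g assume g: "g \<in> carrier G"
  show "\<delta> g \<otimes>\<^bsub>kG\<^esub> b = b \<otimes>\<^bsub>kG\<^esub> \<delta> g"
    by (rule kG_linear_eq[OF kG.module_axioms kG.linear_mult_left kG.linear_mult_right _ assms(2)])
      (use g in \<open>simp_all add: \<delta>_mult G.m_comm\<close>)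
qed

lemma kG_lin_ext_hom:
  assumes "asalg K E'" "f \<in> carrier G \<rightarrow> carrier E'"
    "\<And>x y. x \<in> carrier G \<Longrightarrow> y \<in> carrier G \<Longrightarrow> f (x \<otimes>\<^bsub>G\<^esub> y) = f x \<otimes>\<^bsub>E'\<^esub> f y" "f \<one>\<^bsub>G\<^esub> = \<one>\<^bsub>E'\<^esub>"
  shows "lin_ext K E' f \<in> alg_homs K kG E'"
proof -
  have s: "alg_homs K kA E' = alg_homs K kG E'"
    by (rule same_algebra_alg_homs[OF kG_same]) (simp add: same_algebra_def)
  show ?thesis unfolding s[symmetric] by (rule lin_ext_alg_hom[OF assms(1) G.is_monoid assms(2-4)])
qed

lemma kG_lin_ext_\<delta>:
  assumes "asalg K E'" "f \<in> carrier G \<rightarrow> carrier E'" "g \<in> carrier G"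
  shows "lin_ext K E' f (\<delta> g) = f g"
proof -
  interpret E': asalg K E' by fact
  show ?thesis using assms(2,3) by (intro lin_ext_delta E'.module_axioms) auto
qed

lemma kG_poisson: "poisson_algebra K kG br0"
  unfolding poisson_algebra_def
  using asalg_algebra[OF kG_asalg kG_comm] linear_maps_zero_map[OF kG.module_axioms] by auto

sublocale H: pois K kG br0 by (rule poisI[OF kG_poisson])

lemma kG_comult_eq: "comult kG = lin_ext K (tensor K kG kG) (\<lambda>g. ptensor K kG kG (\<delta> g) (\<delta> g))"
  unfolding kG_sel same_algebra_tensor[OF kG_same kG_same] same_algebra_ptensor[OF kG_same kG_same] ..

lemma kG_comult_hom: "comult kG \<in> alg_homs K kG (tensor K kG kG)"
  unfolding kG_comult_eq
  by (rule kG_lin_ext_hom[OF H.T2.T_asalg]) (auto simp: H.T2.pt_mult \<delta>_mult H.T2.T_one kG_one)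

lemma kG_comult_\<delta>: "g \<in> carrier G \<Longrightarrow> comult kG (\<delta> g) = ptensor K kG kG (\<delta> g) (\<delta> g)"
  unfolding kG_comult_eq by (subst kG_lin_ext_\<delta>[OF H.T2.T_asalg]) auto

lemma kG_tb: assumes "s \<in> carrier (tensor K kG kG)" "t \<in> carrier (tensor K kG kG)"
  shows "tensor_bracket K kG br0 s t = \<zero>\<^bsub>tensor K kG kG\<^esub>"
proof (rule tensor_bilin_eq[where g = "\<lambda>s t. \<zero>\<^bsub>tensor K kG kG\<^esub>", OF H.T2.tens_axioms H.T2.tens_axioms H.T2.T.module_axioms H.tb_bilin _ _ assms])
  show "bilin K (tensor K kG kG) (tensor K kG kG) (tensor K kG kG) (\<lambda>s t. \<zero>\<^bsub>tensor K kG kG\<^esub>)"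
    by (intro bilinI linear_maps_zero_map H.T2.T.module_axioms)
qed (simp add: H.tb_pt H.T2.pt_zero)

sublocale H: pois_comult K kG br0
proof
  show "comult kG \<in> alg_homs K kG (tensor K kG kG)" by (rule kG_comult_hom)
  fix x y assume xy: "x \<in> carrier kG" "y \<in> carrier kG"
  note l = alg_homsD(1)[OF kG_comult_hom]
  show "comult kG (br0 x y) = tensor_bracket K kG br0 (comult kG x) (comult kG y)"
    using linear_maps_zero[OF kG.module_axioms H.T2.T.module_axioms l] linear_mapsD(1)[OF l] xy
    by (simp add: kG_tb)
qed

section \<open>Generators of (kG)^e and its commutativity\<close>

abbreviation (input) HE_mult (infixl "\<cdot>" 70) where "x \<cdot> y \<equiv> x \<otimes>\<^bsub>H.E\<^esub> y"

abbreviation gH where "gH g \<equiv> H.m (\<delta> g)"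
abbreviation hH where "hH g \<equiv> H.h (\<delta> g)"

lemma gH_one: "gH \<one>\<^bsub>G\<^esub> = \<one>\<^bsub>H.E\<^esub>"
  using H.m_one kG_one by simp

lemma gH_mult: "g \<in> carrier G \<Longrightarrow> t \<in> carrier G \<Longrightarrow> gH g \<cdot> gH t = gH (g \<otimes>\<^bsub>G\<^esub> t)"
  by (simp add: \<delta>_mult flip: H.m_mult)

lemma hH_mult: "g \<in> carrier G \<Longrightarrow> t \<in> carrier G \<Longrightarrow> hH (g \<otimes>\<^bsub>G\<^esub> t) = gH t \<cdot> hH g \<oplus>\<^bsub>H.E\<^esub> gH g \<cdot> hH t"
  by (simp add: H.h_mult flip: \<delta>_mult)

lemma gH_inv: "g \<in> carrier G \<Longrightarrow> gH g \<cdot> gH (inv\<^bsub>G\<^esub> g) = \<one>\<^bsub>H.E\<^esub>" "g \<in> carrier G \<Longrightarrow> gH (inv\<^bsub>G\<^esub> g) \<cdot> gH g = \<one>\<^bsub>H.E\<^esub>"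
  by (simp_all add: gH_mult gH_one)

lemma hH_one: "hH \<one>\<^bsub>G\<^esub> = \<zero>\<^bsub>H.E\<^esub>"
proof -
  have "hH \<one>\<^bsub>G\<^esub> = hH \<one>\<^bsub>G\<^esub> \<oplus>\<^bsub>H.E\<^esub> hH \<one>\<^bsub>G\<^esub>" using hH_mult[of "\<one>\<^bsub>G\<^esub>" "\<one>\<^bsub>G\<^esub>"] by (simp add: gH_one)
  then show ?thesis by (metis H.E.M.add.r_cancel_one' H.h_closed \<delta>_closed G.one_closed)
qed

text \<open>The product rule applied to g g^-1 = 1. It is the antipode axiom at h_g for the map that
  sends h_g to the generator of g^-1.\<close>

lemma hH_inv: "g \<in> carrier G \<Longrightarrow> gH g \<cdot> hH (inv\<^bsub>G\<^esub> g) \<oplus>\<^bsub>H.E\<^esub> gH (inv\<^bsub>G\<^esub> g) \<cdot> hH g = \<zero>\<^bsub>H.E\<^esub>"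
  using hH_mult[of g "inv\<^bsub>G\<^esub> g"] by (simp add: hH_one H.E.M.a_comm)

lemma kG_induct [consumes 1, case_names zero add delta]:
  assumes "a \<in> carrier kG" "P \<zero>\<^bsub>kG\<^esub>"
    and "\<And>r s. r \<in> carrier kG \<Longrightarrow> s \<in> carrier kG \<Longrightarrow> P r \<Longrightarrow> P s \<Longrightarrow> P (r \<oplus>\<^bsub>kG\<^esub> s)"
    and "\<And>c x. c \<in> carrier K \<Longrightarrow> x \<in> carrier G \<Longrightarrow> P (c \<odot>\<^bsub>kG\<^esub> \<delta> x)"
  shows "P a"
  using assms unfolding same_algebraD[OF kG_same, symmetric] by (rule MA.ma_induct)

lemma H_induct [consumes 1, case_names one add smult g h]:
  assumes "z \<in> carrier H.E" "P \<one>\<^bsub>H.E\<^esub>"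
    and add: "\<And>z w. z \<in> carrier H.E \<Longrightarrow> w \<in> carrier H.E \<Longrightarrow> P z \<Longrightarrow> P w \<Longrightarrow> P (z \<oplus>\<^bsub>H.E\<^esub> w)"
    and smult: "\<And>c z. c \<in> carrier K \<Longrightarrow> z \<in> carrier H.E \<Longrightarrow> P z \<Longrightarrow> P (c \<odot>\<^bsub>H.E\<^esub> z)"
    and g: "\<And>g z. g \<in> carrier G \<Longrightarrow> z \<in> carrier H.E \<Longrightarrow> P z \<Longrightarrow> P (gH g \<cdot> z)"
    and h: "\<And>g z. g \<in> carrier G \<Longrightarrow> z \<in> carrier H.E \<Longrightarrow> P z \<Longrightarrow> P (hH g \<cdot> z)"
  shows "P z"
proof -
  have z0: "P \<zero>\<^bsub>H.E\<^esub>" using smult[of "\<zero>\<^bsub>K\<^esub>" "\<one>\<^bsub>H.E\<^esub>"] assms(2) by simp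
  show ?thesis
    using assms(1)
  proof (induction z rule: H.E_induct)
    case one show ?case by (rule assms(2))
  next
    case (add z w) then show ?case by (rule assms(3))
  next
    case (m a z)
    show ?case
      using m(1)
    proof (induction a rule: kG_induct)
      case zero then show ?case using m z0 by (simp add: H.m_lin_simps)
    next
      case (add r s) then show ?case using m assms(3) by (simp add: H.m_lin_simps H.E.l_distr)
    next
      case (delta c x) then show ?case using m g smult by (simp add: H.m_lin_simps H.E.smult_l)
    qed
  next
    case (h a z)
    show ?case
      using h(1)
    proof (induction a rule: kG_induct)
      case zero then show ?case using h z0 by (simp add: H.h_lin_simps)
    next
      case (add r s) then show ?case using h assms(3) by (simp add: H.h_lin_simps H.E.l_distr)
    next
      case (delta c x) then show ?case using h(2,3) assms(6) smult by (simp add: H.h_lin_simps H.E.smult_l)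
    qed
  qed
qed

lemma H_gens_comm:
  assumes "a \<in> carrier kG" "b \<in> carrier kG"
  shows "H.m a \<cdot> H.m b = H.m b \<cdot> H.m a" "H.h a \<cdot> H.m b = H.m b \<cdot> H.h a"
    "H.h a \<cdot> H.h b = H.h b \<cdot> H.h a"
  using H.hm_swap(1)[OF assms] H.hm_swap(3)[OF assms] assms
  by (simp_all add: kG_comm[of a b] H.m_lin_simps H.h_lin_simps flip: H.m_mult)

text \<open>Any two generators commute because kG is commutative with zero bracket. Two nested
  inductions carry this to all elements.\<close>

lemma H_comm: assumes "z \<in> carrier H.E" "w \<in> carrier H.E" shows "z \<cdot> w = w \<cdot> z"
proof -
  have step: "(u \<cdot> z) \<cdot> w = w \<cdot> (u \<cdot> z)"
    if "u \<in> carrier H.E" "z \<in> carrier H.E" "w \<in> carrier H.E" "u \<cdot> w = w \<cdot> u" "z \<cdot> w = w \<cdot> z" for u z w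
  proof -
    have "(u \<cdot> z) \<cdot> w = u \<cdot> (w \<cdot> z)" using that by (simp add: H.E.m_assoc)
    also have "\<dots> = (w \<cdot> u) \<cdot> z" using that(1-3) by (simp add: that(4) flip: H.E.m_assoc)
    finally show ?thesis using that(1-3) by (simp add: H.E.m_assoc)
  qed
  have gen: "H.m a \<cdot> w = w \<cdot> H.m a \<and> H.h a \<cdot> w = w \<cdot> H.h a" if "a \<in> carrier kG" for a
    using assms(2)
  proof (induction w rule: H.E_induct)
    case one then show ?case using that by simp
  next
    case (add z w) then show ?case using that by (simp add: H.E.l_distr H.E.r_distr)
  next
    case (m b z)
    show ?case
      by (intro conjI step[symmetric] H.m_closed H.h_closed H_gens_comm H_gens_comm(2)[symmetric] m(1,2) that
          conjunct1[OF m(3), symmetric] conjunct2[OF m(3), symmetric])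
  next
    case (h b z)
    show ?case
      by (intro conjI step[symmetric] H.m_closed H.h_closed H_gens_comm H_gens_comm(2)[symmetric] h(1,2) that
          conjunct1[OF h(3), symmetric] conjunct2[OF h(3), symmetric])
  qed
  show ?thesis
    using assms(1)
  proof (induction z rule: H.E_induct)
    case one then show ?case using assms by simp
  next
    case (add z z') then show ?case using assms by (simp add: H.E.l_distr H.E.r_distr)
  next
    case (m a z) show ?case by (rule step[OF H.m_closed[OF m(1)] m(2) assms(2) conjunct1[OF gen[OF m(1)]] m(3)])
  next
    case (h a z) show ?case by (rule step[OF H.h_closed[OF h(1)] h(2) assms(2) conjunct2[OF gen[OF h(1)]] h(3)])
  qed
qed

lemma \<Delta>H_gH: "g \<in> carrier G \<Longrightarrow> H.\<Delta>E (gH g) = H.ept (gH g) (gH g)"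
  using H.\<Delta>E_grouplike(1)[OF \<delta>_closed kG_comult_\<delta>] by blast

lemma \<Delta>H_hH: "g \<in> carrier G \<Longrightarrow> H.\<Delta>E (hH g) = H.ept (gH g) (hH g) \<oplus>\<^bsub>H.EE\<^esub> H.ept (hH g) (gH g)"
  using H.\<Delta>E_grouplike(2)[OF \<delta>_closed kG_comult_\<delta>] by blast

lemma base_algebra_a_inv: "a_inv (base_algebra K) = a_inv K"
  by (intro ext) (simp add: a_inv_def m_inv_def)

section \<open>Counit and antipode of (kG)^e\<close>

abbreviation \<epsilon>H where "\<epsilon>H \<equiv> env_counit K kG br0"

lemma counit_hom: "counit kG \<in> alg_homs K kG (base_algebra K)"
  unfolding kG_sel by (rule kG_lin_ext_hom[OF base_algebra_asalg[OF K.cring_axioms]]) auto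

lemma counit_\<delta>: "g \<in> carrier G \<Longrightarrow> counit kG (\<delta> g) = \<one>\<^bsub>K\<^esub>"
  unfolding kG_sel by (subst kG_lin_ext_\<delta>[OF base_algebra_asalg[OF K.cring_axioms]]) auto

lemma \<epsilon>H_data: "env_data K kG br0 (base_algebra K) (counit kG) (\<lambda>a. \<zero>\<^bsub>K\<^esub>)"
proof -
  interpret k: asalg K "base_algebra K" by (rule base_algebra_asalg[OF K.cring_axioms])
  note l = alg_homsD[OF counit_hom] linear_mapsD[OF alg_homsD(1)[OF counit_hom], simplified]
    linear_maps_zero[OF kG.module_axioms k.module_axioms alg_homsD(1)[OF counit_hom]]
  show ?thesis
    using linear_maps_zero_map[OF k.module_axioms, of kG]
    by (intro env_dataI) (use l in \<open>simp_all add: a_minus_def base_algebra_a_inv\<close>)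
qed

lemma \<epsilon>H_hom: "\<epsilon>H \<in> alg_homs K H.E (base_algebra K)"
  unfolding env_counit_def by (rule H.env_lift_props(1)[OF base_algebra_asalg[OF K.cring_axioms] \<epsilon>H_data])

lemma \<epsilon>H_gH: "g \<in> carrier G \<Longrightarrow> \<epsilon>H (gH g) = \<one>\<^bsub>K\<^esub>"
  unfolding env_counit_def using H.env_lift_props(2)[OF base_algebra_asalg[OF K.cring_axioms] \<epsilon>H_data, of "\<delta> g"]
  by (simp add: counit_\<delta>)

lemma \<epsilon>H_hH: "g \<in> carrier G \<Longrightarrow> \<epsilon>H (hH g) = \<zero>\<^bsub>K\<^esub>"
  unfolding env_counit_def using H.env_lift_props(3)[OF base_algebra_asalg[OF K.cring_axioms] \<epsilon>H_data, of "\<delta> g"]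
  by simp

lemmas \<epsilon>H_simps = alg_homsD[OF \<epsilon>H_hom, simplified] linear_mapsD[OF alg_homsD(1)[OF \<epsilon>H_hom], simplified]

text \<open>The candidate for the antipode. An antipode reverses products; since (kG)^e is
  commutative, the algebra map induced by the antipode of kG does so too.\<close>

definition S0 where "S0 = env_map K kG br0 kG br0 (antipode kG)"

lemma antipode_hom: "antipode kG \<in> alg_homs K kG kG"
  unfolding kG_sel same_algebra_lin_ext[OF kG_same]
  by (rule kG_lin_ext_hom[OF kG_asalg]) (auto simp: \<delta>_mult G.inv_mult kG_one)

lemma antipode_\<delta>: "g \<in> carrier G \<Longrightarrow> antipode kG (\<delta> g) = \<delta> (inv\<^bsub>G\<^esub> g)"
  unfolding kG_sel same_algebra_lin_ext[OF kG_same] by (subst kG_lin_ext_\<delta>[OF kG_asalg]) auto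

lemma antipode_zero: "antipode kG \<zero>\<^bsub>kG\<^esub> = \<zero>\<^bsub>kG\<^esub>"
  using linear_maps_zero[OF kG.module_axioms kG.module_axioms alg_homsD(1)[OF antipode_hom]] .

lemma S0_hom: "S0 \<in> alg_homs K H.E H.E"
  unfolding S0_def by (rule env_map_props(1)[OF H.env_alg_axioms H.env_alg_axioms antipode_hom]) (rule antipode_zero)

lemma S0_gH: "g \<in> carrier G \<Longrightarrow> S0 (gH g) = gH (inv\<^bsub>G\<^esub> g)"
  unfolding S0_def by (subst env_map_props(2)[OF H.env_alg_axioms H.env_alg_axioms antipode_hom])
    (simp_all add: antipode_zero antipode_\<delta>)

lemma S0_hH: "g \<in> carrier G \<Longrightarrow> S0 (hH g) = hH (inv\<^bsub>G\<^esub> g)"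
  unfolding S0_def by (subst env_map_props(3)[OF H.env_alg_axioms H.env_alg_axioms antipode_hom])
    (simp_all add: antipode_zero antipode_\<delta>)

lemmas S0_simps = alg_homsD[OF S0_hom] linear_mapsD[OF alg_homsD(1)[OF S0_hom]]

lemma gens_hom_eq:
  assumes "asalg K E'" "f \<in> alg_homs K H.E E'" "f' \<in> alg_homs K H.E E'"
    and "\<And>g. g \<in> carrier G \<Longrightarrow> f (gH g) = f' (gH g)" "\<And>g. g \<in> carrier G \<Longrightarrow> f (hH g) = f' (hH g)"
    and "z \<in> carrier H.E"
  shows "f z = f' z"
proof -
  interpret E': asalg K E' by fact
  show ?thesis
  proof (rule H.E_hom_eq[OF assms(1-3) _ _ assms(6)])
    fix a assume a: "a \<in> carrier kG"
    note l = linear_maps_comp[OF H.m_linear alg_homsD(1)] linear_maps_comp[OF H.h_linear alg_homsD(1)]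
    show "f (H.m a) = f' (H.m a)"
      by (rule kG_linear_eq[OF E'.module_axioms l(1)[OF assms(2)] l(1)[OF assms(3)] assms(4) a])
    show "f (H.h a) = f' (H.h a)"
      by (rule kG_linear_eq[OF E'.module_axioms l(2)[OF assms(2)] l(2)[OF assms(3)] assms(5) a])
  qed
qed

lemma S0_left: "bilin K H.E H.E H.E (\<lambda>a b. S0 a \<cdot> b)"
  by (rule bilin_compose[OF H.E.bilin_mult alg_homsD(1)[OF S0_hom] linear_maps_ident])

lemma S0_right: "bilin K H.E H.E H.E (\<lambda>a b. a \<cdot> S0 b)"
  by (rule bilin_compose[OF H.E.bilin_mult linear_maps_ident alg_homsD(1)[OF S0_hom]])

lemma H_swap4: assumes "a \<in> carrier H.E" "b \<in> carrier H.E" "c \<in> carrier H.E" "d \<in> carrier H.E"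
  shows "(a \<cdot> b) \<cdot> (c \<cdot> d) = (a \<cdot> c) \<cdot> (b \<cdot> d)"
proof -
  have "b \<cdot> (c \<cdot> d) = c \<cdot> (b \<cdot> d)"
    using assms by (simp add: H_comm[of b c] flip: H.E.m_assoc)
  then show ?thesis using assms by (simp add: H.E.m_assoc)
qed

text \<open>As \<^term>\<open>H.E\<close> is commutative, convolution of algebra maps yields algebra maps, so the antipode
  axioms need only be checked on generators.\<close>

lemma S0_antipode: "is_antipode K H.E H.\<Delta>E \<epsilon>H S0"
proof -
  have left: "tlift K H.E (\<lambda>a b. S0 a \<cdot> b) \<in> alg_homs K H.EE H.E"
    by (rule H.E2.tlift_alg_hom[OF H.E_asalg S0_left]) (simp_all add: S0_simps H_swap4)
  have right: "tlift K H.E (\<lambda>a b. a \<cdot> S0 b) \<in> alg_homs K H.EE H.E"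
    by (rule H.E2.tlift_alg_hom[OF H.E_asalg S0_right]) (simp_all add: S0_simps H_swap4)
  have eps: "(\<lambda>x. \<epsilon>H x \<odot>\<^bsub>H.E\<^esub> \<one>\<^bsub>H.E\<^esub>) \<in> alg_homs K H.E H.E"
    by (intro alg_homsI linear_mapsI)
      (simp_all add: \<epsilon>H_simps H.E.smult_l_distr H.E.smult_l H.E.smult_assoc1)
  note l = H.E2.tlift_simps[OF H.E.module_axioms S0_left] and r = H.E2.tlift_simps[OF H.E.module_axioms S0_right]
  show ?thesis
    unfolding is_antipode_def
  proof (intro conjI ballI alg_homsD(1)[OF S0_hom])
    fix x assume x: "x \<in> carrier H.E"
    show "tlift K H.E (\<lambda>a b. S0 a \<cdot> b) (H.\<Delta>E x) = \<epsilon>H x \<odot>\<^bsub>H.E\<^esub> \<one>\<^bsub>H.E\<^esub>"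
      by (rule gens_hom_eq[OF H.E_asalg alg_homs_comp[OF H.\<Delta>E_hom left] eps _ _ x])
        (simp_all add: \<Delta>H_gH \<Delta>H_hH l S0_gH S0_hH \<epsilon>H_gH \<epsilon>H_hH gH_inv hH_inv H_comm[of "hH (inv\<^bsub>G\<^esub> _)"] H.E.M.a_comm)
    show "tlift K H.E (\<lambda>a b. a \<cdot> S0 b) (H.\<Delta>E x) = \<epsilon>H x \<odot>\<^bsub>H.E\<^esub> \<one>\<^bsub>H.E\<^esub>"
      by (rule gens_hom_eq[OF H.E_asalg alg_homs_comp[OF H.\<Delta>E_hom right] eps _ _ x])
        (simp_all add: \<Delta>H_gH \<Delta>H_hH r S0_gH S0_hH \<epsilon>H_gH \<epsilon>H_hH gH_inv hH_inv H_comm[of "hH _" "gH (inv\<^bsub>G\<^esub> _)"])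
  qed
qed

text \<open>The elements \<open>\<Delta>(x) (a \<otimes> y)\<close> span \<open>H \<otimes> H\<close>; this replaces the usual convolution argument for the
  uniqueness of the antipode.\<close>

lemma convolution_inverse_zero:
  assumes D: "D \<in> linear_maps K H.E H.E"
    and D0: "\<And>x. x \<in> carrier H.E \<Longrightarrow> tlift K H.E (\<lambda>a b. D a \<cdot> b) (H.\<Delta>E x) = \<zero>\<^bsub>H.E\<^esub>"
    and z: "z \<in> carrier H.E"
  shows "D z = \<zero>\<^bsub>H.E\<^esub>"
proof -
  let ?f = "\<lambda>a b. D a \<cdot> b" let ?\<Gamma> = "tlift K H.E ?f"
  have f: "bilin K H.E H.E H.E ?f"
    by (rule bilin_compose[OF H.E.bilin_mult D linear_maps_ident])
  note D' = linear_mapsD[OF D]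
  note \<Gamma> = H.E2.tlift_simps[OF H.E.module_axioms f]
  note \<Gamma>l = H.E2.tlift_linear[OF H.E.module_axioms f]
  note \<Gamma>m = linear_maps_minus[OF H.E2.T.module_axioms H.E.module_axioms \<Gamma>l]
  have mult_one: "?\<Gamma> (t \<otimes>\<^bsub>H.EE\<^esub> H.ept \<one>\<^bsub>H.E\<^esub> y) = ?\<Gamma> t \<cdot> y" if "t \<in> carrier H.EE" "y \<in> carrier H.E" for t y
    by (rule H.E2.T_linear_eq[OF H.E.module_axioms linear_maps_comp[OF H.E2.T.linear_mult_right \<Gamma>l]
          linear_maps_comp[OF \<Gamma>l H.E.linear_mult_right] _ that(1)])
      (use that in \<open>simp_all add: H.E2.pt_mult \<Gamma> D' H.E.m_assoc\<close>)
  \<comment> \<open>The claim is made for all x and y because the induction on a moves factors into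
    the argument of the coproduct and into y.\<close>
  have key: "\<forall>x\<in>carrier H.E. \<forall>y\<in>carrier H.E. ?\<Gamma> (H.\<Delta>E x \<otimes>\<^bsub>H.EE\<^esub> H.ept a y) = \<zero>\<^bsub>H.E\<^esub>" if "a \<in> carrier H.E" for a
    using that
  proof (induction a rule: H_induct)
    case one
    show ?case
    proof (intro ballI)
      fix x y assume xy: "x \<in> carrier H.E" "y \<in> carrier H.E"
      then have "?\<Gamma> (H.\<Delta>E x \<otimes>\<^bsub>H.EE\<^esub> H.ept \<one>\<^bsub>H.E\<^esub> y) = ?\<Gamma> (H.\<Delta>E x) \<cdot> y"
        by (intro mult_one H.\<Delta>E_simps(4))
      then show "?\<Gamma> (H.\<Delta>E x \<otimes>\<^bsub>H.EE\<^esub> H.ept \<one>\<^bsub>H.E\<^esub> y) = \<zero>\<^bsub>H.E\<^esub>" using xy D0[OF xy(1)] by simp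
    qed
  next
    case (add z w) then show ?case by (simp add: H.E2.pt_simps H.E2.T.r_distr \<Gamma> H.\<Delta>E_simps)
  next
    case (smult c z) then show ?case by (simp add: H.E2.pt_simps H.E2.T.smult_r \<Gamma> H.\<Delta>E_simps)
  next
    case (g t z)
    show ?case
    proof (intro ballI)
      fix x y assume xy: "x \<in> carrier H.E" "y \<in> carrier H.E"
      \<comment> \<open>The factor t in front of z is completed to t \<otimes> t, the coproduct of
        t, at the cost of t^-1 in front of y.\<close>
      have "H.ept (gH t \<cdot> z) y = H.\<Delta>E (gH t) \<otimes>\<^bsub>H.EE\<^esub> H.ept z (gH (inv\<^bsub>G\<^esub> t) \<cdot> y)"
        using g xy by (simp add: \<Delta>H_gH H.E2.pt_mult gH_inv flip: H.E.m_assoc)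
      then have "H.\<Delta>E x \<otimes>\<^bsub>H.EE\<^esub> H.ept (gH t \<cdot> z) y = H.\<Delta>E (x \<cdot> gH t) \<otimes>\<^bsub>H.EE\<^esub> H.ept z (gH (inv\<^bsub>G\<^esub> t) \<cdot> y)"
        using g xy by (simp add: H.\<Delta>E_simps H.E2.T.m_assoc)
      then show "?\<Gamma> (H.\<Delta>E x \<otimes>\<^bsub>H.EE\<^esub> H.ept (gH t \<cdot> z) y) = \<zero>\<^bsub>H.E\<^esub>" using g xy by simp
    qed
  next
    case (h t z)
    \<comment> \<open>The correction term below has t instead of h_t in front of z; it vanishes by
      the induction hypothesis for z, as in the preceding case.\<close>
    have gz: "?\<Gamma> (H.\<Delta>E x \<otimes>\<^bsub>H.EE\<^esub> H.ept (gH t \<cdot> z) y) = \<zero>\<^bsub>H.E\<^esub>" if xy: "x \<in> carrier H.E" "y \<in> carrier H.E" for x y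
    proof -
      have "H.ept (gH t \<cdot> z) y = H.\<Delta>E (gH t) \<otimes>\<^bsub>H.EE\<^esub> H.ept z (gH (inv\<^bsub>G\<^esub> t) \<cdot> y)"
        using h xy by (simp add: \<Delta>H_gH H.E2.pt_mult gH_inv flip: H.E.m_assoc)
      then have "H.\<Delta>E x \<otimes>\<^bsub>H.EE\<^esub> H.ept (gH t \<cdot> z) y = H.\<Delta>E (x \<cdot> gH t) \<otimes>\<^bsub>H.EE\<^esub> H.ept z (gH (inv\<^bsub>G\<^esub> t) \<cdot> y)"
        using h xy by (simp add: H.\<Delta>E_simps H.E2.T.m_assoc)
      then show ?thesis using h xy by simp
    qed
    show ?case
    proof (intro ballI)
      fix x y assume xy: "x \<in> carrier H.E" "y \<in> carrier H.E"
      let ?y = "gH (inv\<^bsub>G\<^esub> t) \<cdot> y"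
      have y: "?y \<in> carrier H.E" using h xy by simp
      \<comment> \<open>The coproduct of h_t has two summands. One yields the wanted tensor, the
        other is of the form treated in \<open>gz\<close>.\<close>
      have "H.ept (hH t \<cdot> z) y \<oplus>\<^bsub>H.EE\<^esub> H.ept (gH t \<cdot> z) (hH t \<cdot> ?y) = H.\<Delta>E (hH t) \<otimes>\<^bsub>H.EE\<^esub> H.ept z ?y"
        using h xy y
        by (simp add: \<Delta>H_hH H.E2.pt_mult H.E2.T.l_distr H.E2.T.M.a_comm)
          (simp add: gH_inv flip: H.E.m_assoc)
      then have *: "H.ept (hH t \<cdot> z) y = H.\<Delta>E (hH t) \<otimes>\<^bsub>H.EE\<^esub> H.ept z ?y \<ominus>\<^bsub>H.EE\<^esub> H.ept (gH t \<cdot> z) (hH t \<cdot> ?y)"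
        using h xy y by (intro eq_minusI[OF H.E2.T.M.abelian_group_axioms]) (simp_all add: H.\<Delta>E_simps)
      have "H.\<Delta>E x \<otimes>\<^bsub>H.EE\<^esub> H.ept (hH t \<cdot> z) y =
          H.\<Delta>E (x \<cdot> hH t) \<otimes>\<^bsub>H.EE\<^esub> H.ept z ?y \<ominus>\<^bsub>H.EE\<^esub> H.\<Delta>E x \<otimes>\<^bsub>H.EE\<^esub> H.ept (gH t \<cdot> z) (hH t \<cdot> ?y)"
        unfolding * using h xy y
        by (simp add: H.\<Delta>E_simps H.E2.T.m_assoc a_minus_def H.E2.T.r_distr H.E2.T.r_minus)
      then have "?\<Gamma> (H.\<Delta>E x \<otimes>\<^bsub>H.EE\<^esub> H.ept (hH t \<cdot> z) y) =
          ?\<Gamma> (H.\<Delta>E (x \<cdot> hH t) \<otimes>\<^bsub>H.EE\<^esub> H.ept z ?y) \<ominus>\<^bsub>H.E\<^esub> ?\<Gamma> (H.\<Delta>E x \<otimes>\<^bsub>H.EE\<^esub> H.ept (gH t \<cdot> z) (hH t \<cdot> ?y))"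
        using h xy y by (simp add: \<Gamma>m H.\<Delta>E_simps)
      then show "?\<Gamma> (H.\<Delta>E x \<otimes>\<^bsub>H.EE\<^esub> H.ept (hH t \<cdot> z) y) = \<zero>\<^bsub>H.E\<^esub>"
        using h xy y gz by (simp add: a_minus_def)
    qed
  qed
  \<comment> \<open>For x = y = 1 the expression is D z, since the coproduct preserves the
    unit.\<close>
  have "?\<Gamma> (H.\<Delta>E \<one>\<^bsub>H.E\<^esub> \<otimes>\<^bsub>H.EE\<^esub> H.ept z \<one>\<^bsub>H.E\<^esub>) = \<zero>\<^bsub>H.E\<^esub>" using key[OF z] by simp
  then show ?thesis using z by (simp add: H.\<Delta>E_simps \<Gamma> D')
qed

text \<open>Both maps satisfy the left antipode axiom, so the convolution of their difference with
  the identity is zero and \<open>convolution_inverse_zero\<close> applies.\<close>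

lemma antipode_unique:
  assumes S: "is_antipode K H.E H.\<Delta>E \<epsilon>H S" and z: "z \<in> carrier H.E"
  shows "S z = S0 z"
proof -
  have SL: "S \<in> linear_maps K H.E H.E" and SA: "\<And>x. x \<in> carrier H.E \<Longrightarrow> tlift K H.E (\<lambda>a b. S a \<cdot> b) (H.\<Delta>E x) = \<epsilon>H x \<odot>\<^bsub>H.E\<^esub> \<one>\<^bsub>H.E\<^esub>"
    using S unfolding is_antipode_def by auto
  have S0A: "\<And>x. x \<in> carrier H.E \<Longrightarrow> tlift K H.E (\<lambda>a b. S0 a \<cdot> b) (H.\<Delta>E x) = \<epsilon>H x \<odot>\<^bsub>H.E\<^esub> \<one>\<^bsub>H.E\<^esub>"
    using S0_antipode unfolding is_antipode_def by auto
  have Sb: "bilin K H.E H.E H.E (\<lambda>a b. S a \<cdot> b)"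
    by (rule bilin_compose[OF H.E.bilin_mult SL linear_maps_ident])
  let ?D = "\<lambda>a. S a \<oplus>\<^bsub>H.E\<^esub> (\<ominus>\<^bsub>K\<^esub> \<one>\<^bsub>K\<^esub>) \<odot>\<^bsub>H.E\<^esub> S0 a"
  have D: "?D \<in> linear_maps K H.E H.E"
    by (intro linear_maps_add linear_maps_const_smult SL alg_homsD(1)[OF S0_hom] H.E.module_axioms) simp
  have Db: "bilin K H.E H.E H.E (\<lambda>a b. ?D a \<cdot> b)"
    by (rule bilin_compose[OF H.E.bilin_mult D linear_maps_ident])
  note Sc = linear_mapsD(1)[OF SL]
  have "tlift K H.E (\<lambda>a b. ?D a \<cdot> b) (H.\<Delta>E x) = \<zero>\<^bsub>H.E\<^esub>" if "x \<in> carrier H.E" for x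
  proof -
    have "tlift K H.E (\<lambda>a b. ?D a \<cdot> b) (H.\<Delta>E x) =
      tlift K H.E (\<lambda>a b. S a \<cdot> b) (H.\<Delta>E x) \<oplus>\<^bsub>H.E\<^esub> (\<ominus>\<^bsub>K\<^esub> \<one>\<^bsub>K\<^esub>) \<odot>\<^bsub>H.E\<^esub> tlift K H.E (\<lambda>a b. S0 a \<cdot> b) (H.\<Delta>E x)"
      by (rule H.E2.tlift_eqI[OF H.E.module_axioms Db linear_maps_add[OF H.E.module_axioms
            H.E2.tlift_linear[OF H.E.module_axioms Sb] linear_maps_const_smult[OF H.E.module_axioms H.E2.tlift_linear[OF H.E.module_axioms S0_left]]]])
        (use that in \<open>simp_all add: H.E2.tlift_pt[OF H.E.module_axioms Sb] H.E2.tlift_pt[OF H.E.module_axioms S0_left]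
            H.E.l_distr H.E.smult_l Sc S0_simps H.\<Delta>E_simps\<close>)
    then show ?thesis using that by (simp add: SA S0A H.E.smult_l_minus H.E.M.r_neg \<epsilon>H_simps)
  qed
  from convolution_inverse_zero[OF D this z] have "S z \<ominus>\<^bsub>H.E\<^esub> S0 z = \<zero>\<^bsub>H.E\<^esub>"
    using z by (simp add: H.E.smult_l_minus a_minus_def S0_simps)
  then show ?thesis using minus_zero_iff[OF H.E.M.abelian_group_axioms, of "S z" "S0 z"] z Sc S0_simps by simp
qed

abbreviation SH where "SH \<equiv> env_antipode K kG br0"

text \<open>The definite description asks for an extensional map, hence the restriction. The lifts
  in the antipode axioms only see values on the carrier, so restricting does not change
  them.\<close>

lemma SH_eq: "SH = restrict S0 (carrier H.E)"
  unfolding env_antipode_def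
proof (rule the_equality)
  have "is_antipode K H.E H.\<Delta>E \<epsilon>H (restrict S0 (carrier H.E))"
  proof -
    have lin: "restrict S0 (carrier H.E) \<in> linear_maps K H.E H.E"
      by (intro linear_mapsI) (simp_all add: S0_simps)
    have "tlift K H.E (\<lambda>a b. restrict S0 (carrier H.E) a \<cdot> b) t = tlift K H.E (\<lambda>a b. S0 a \<cdot> b) t"
      "tlift K H.E (\<lambda>a b. a \<cdot> restrict S0 (carrier H.E) b) t = tlift K H.E (\<lambda>a b. a \<cdot> S0 b) t"
      if "t \<in> carrier H.EE" for t
      using that by (auto intro!: H.E2.tlift_cong[OF H.E.module_axioms S0_left, symmetric] H.E2.tlift_cong[OF H.E.module_axioms S0_right, symmetric])
    then show ?thesis using S0_antipode lin unfolding is_antipode_def by (simp add: H.\<Delta>E_simps)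
  qed
  then show "restrict S0 (carrier H.E) \<in> extensional (carrier H.E) \<and> is_antipode K H.E H.\<Delta>E \<epsilon>H (restrict S0 (carrier H.E))"
    by simp
next
  fix S assume "S \<in> extensional (carrier H.E) \<and> is_antipode K H.E H.\<Delta>E \<epsilon>H S"
  then show "S = restrict S0 (carrier H.E)"
    using antipode_unique by (intro extensionalityI[of S "carrier H.E"]) simp_all
qed

lemma SH_hom: "SH \<in> alg_homs K H.E H.E"
  unfolding SH_eq by (intro alg_homsI linear_mapsI) (simp_all add: S0_simps)

lemma SH_gH: "g \<in> carrier G \<Longrightarrow> SH (gH g) = gH (inv\<^bsub>G\<^esub> g)"
  by (simp add: SH_eq S0_gH)

lemma SH_hH: "g \<in> carrier G \<Longrightarrow> SH (hH g) = hH (inv\<^bsub>G\<^esub> g)"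
  by (simp add: SH_eq S0_hH)

lemmas SH_simps = alg_homsD[OF SH_hom] linear_mapsD[OF alg_homsD(1)[OF SH_hom]]

end

lemma env_hopf_same: "same_algebra (env K A br) (env_hopf K A br)"
  by (simp add: same_algebra_def env_hopf_def module.defs hopf.defs)

lemma env_hopf_sel:
  "comult (env_hopf K A br) = env_comult K A br"
  "counit (env_hopf K A br) = env_counit K A br"
  "antipode (env_hopf K A br) = env_antipode K A br"
  by (simp_all add: env_hopf_def module.defs hopf.defs)

section \<open>Dual numbers and endomorphism algebras\<close>

text \<open>Pairs (a, b) stand for a + b t with t^2 = 0. An algebra map into this algebra whose
  first component is the identity has a derivation as second component, so \<open>env_lift\<close>
  can produce derivations.\<close>

definition dual_numbers :: "('k, 'a, 'c) module_scheme \<Rightarrow> ('k, 'a \<times> 'a) module" where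
  "dual_numbers E = \<lparr>carrier = carrier E \<times> carrier E,
     mult = (\<lambda>x y. (fst x \<otimes>\<^bsub>E\<^esub> fst y, fst x \<otimes>\<^bsub>E\<^esub> snd y \<oplus>\<^bsub>E\<^esub> snd x \<otimes>\<^bsub>E\<^esub> fst y)),
     one = (\<one>\<^bsub>E\<^esub>, \<zero>\<^bsub>E\<^esub>), zero = (\<zero>\<^bsub>E\<^esub>, \<zero>\<^bsub>E\<^esub>),
     add = (\<lambda>x y. (fst x \<oplus>\<^bsub>E\<^esub> fst y, snd x \<oplus>\<^bsub>E\<^esub> snd y)),
     smult = (\<lambda>c x. (c \<odot>\<^bsub>E\<^esub> fst x, c \<odot>\<^bsub>E\<^esub> snd x))\<rparr>"

lemma dual_numbers_sel [simp]:
  "carrier (dual_numbers E) = carrier E \<times> carrier E"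
  "x \<otimes>\<^bsub>dual_numbers E\<^esub> y = (fst x \<otimes>\<^bsub>E\<^esub> fst y, fst x \<otimes>\<^bsub>E\<^esub> snd y \<oplus>\<^bsub>E\<^esub> snd x \<otimes>\<^bsub>E\<^esub> fst y)"
  "\<one>\<^bsub>dual_numbers E\<^esub> = (\<one>\<^bsub>E\<^esub>, \<zero>\<^bsub>E\<^esub>)" "\<zero>\<^bsub>dual_numbers E\<^esub> = (\<zero>\<^bsub>E\<^esub>, \<zero>\<^bsub>E\<^esub>)"
  "x \<oplus>\<^bsub>dual_numbers E\<^esub> y = (fst x \<oplus>\<^bsub>E\<^esub> fst y, snd x \<oplus>\<^bsub>E\<^esub> snd y)"
  "c \<odot>\<^bsub>dual_numbers E\<^esub> x = (c \<odot>\<^bsub>E\<^esub> fst x, c \<odot>\<^bsub>E\<^esub> snd x)"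
  by (simp_all add: dual_numbers_def)

lemma (in asalg) dual_numbers_asalg: "asalg K (dual_numbers A)"
proof (intro asalgI moduleI abelian_groupI monoidI R.cring_axioms)
  fix x assume "x \<in> carrier (dual_numbers A)"
  then show "\<exists>y\<in>carrier (dual_numbers A). y \<oplus>\<^bsub>dual_numbers A\<^esub> x = \<zero>\<^bsub>dual_numbers A\<^esub>"
    by (intro bexI[of _ "(\<ominus>\<^bsub>A\<^esub> fst x, \<ominus>\<^bsub>A\<^esub> snd x)"]) (auto simp: M.l_neg)
qed (auto simp: M.a_ac m_assoc l_distr r_distr smult_l_distr smult_r_distr smult_assoc1 smult_l smult_r)

text \<open>Extensional maps are used so that equality of elements is pointwise equality on the
  carrier. An algebra map into this algebra is a representation on \<open>V\<close>, which lets
  \<open>env_lift\<close> produce an action.\<close>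

definition end_algebra :: "('k, 'r) ring_scheme \<Rightarrow> ('k, 'v, 'c) module_scheme \<Rightarrow> ('k, 'v \<Rightarrow> 'v) module" where
  "end_algebra K V = \<lparr>carrier = extensional (carrier V) \<inter> linear_maps K V V,
     mult = (\<lambda>f g. restrict (\<lambda>x. f (g x)) (carrier V)),
     one = restrict (\<lambda>x. x) (carrier V), zero = restrict (\<lambda>x. \<zero>\<^bsub>V\<^esub>) (carrier V),
     add = (\<lambda>f g. restrict (\<lambda>x. f x \<oplus>\<^bsub>V\<^esub> g x) (carrier V)),
     smult = (\<lambda>c f. restrict (\<lambda>x. c \<odot>\<^bsub>V\<^esub> f x) (carrier V))\<rparr>"

lemma end_algebra_sel:
  "carrier (end_algebra K V) = extensional (carrier V) \<inter> linear_maps K V V"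
  "f \<otimes>\<^bsub>end_algebra K V\<^esub> g = restrict (\<lambda>x. f (g x)) (carrier V)"
  "\<one>\<^bsub>end_algebra K V\<^esub> = restrict (\<lambda>x. x) (carrier V)" "\<zero>\<^bsub>end_algebra K V\<^esub> = restrict (\<lambda>x. \<zero>\<^bsub>V\<^esub>) (carrier V)"
  "f \<oplus>\<^bsub>end_algebra K V\<^esub> g = restrict (\<lambda>x. f x \<oplus>\<^bsub>V\<^esub> g x) (carrier V)"
  "c \<odot>\<^bsub>end_algebra K V\<^esub> f = restrict (\<lambda>x. c \<odot>\<^bsub>V\<^esub> f x) (carrier V)"
  by (simp_all add: end_algebra_def)

lemma restrict_linear: "module K V \<Longrightarrow> f \<in> linear_maps K V W \<Longrightarrow> restrict f (carrier V) \<in> linear_maps K V W"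
proof -
  assume "module K V" and f: "f \<in> linear_maps K V W"
  then interpret V: module K V by simp
  show ?thesis using linear_mapsD[OF f] by (intro linear_mapsI) simp_all
qed

lemma end_algebra_asalg:
  assumes "module K V" shows "asalg K (end_algebra K V)"
proof -
  interpret V: module K V by fact
  let ?E = "end_algebra K V"
  have lin: "f \<in> linear_maps K V V" if "f \<in> carrier ?E" for f using that by (simp add: end_algebra_sel)
  have closed: "restrict f (carrier V) \<in> carrier ?E" if "f \<in> linear_maps K V V" for f
    using restrict_linear[OF assms that] by (simp add: end_algebra_sel)
  have fc [simp]: "f x \<in> carrier V" if "f \<in> carrier ?E" "x \<in> carrier V" for f x
    using linear_mapsD(1)[OF lin[OF that(1)] that(2)] .
  have extI: "f = g" if "f \<in> carrier ?E" "g \<in> carrier ?E" "\<And>x. x \<in> carrier V \<Longrightarrow> f x = g x" for f g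
    using that by (intro extensionalityI[of f "carrier V" g]) (simp_all add: end_algebra_sel)
  have c [simp]: "f \<otimes>\<^bsub>?E\<^esub> g \<in> carrier ?E" "f \<oplus>\<^bsub>?E\<^esub> g \<in> carrier ?E" if "f \<in> carrier ?E" "g \<in> carrier ?E" for f g
    unfolding end_algebra_sel(2,5)
    by (intro closed linear_maps_comp[OF lin[OF that(2)] lin[OF that(1)]] linear_maps_add[OF assms lin[OF that(1)] lin[OF that(2)]])+
  have c1 [simp]: "\<one>\<^bsub>?E\<^esub> \<in> carrier ?E" "\<zero>\<^bsub>?E\<^esub> \<in> carrier ?E"
    unfolding end_algebra_sel(3,4) by (intro closed linear_maps_ident linear_maps_zero_map assms)+
  have cs [simp]: "k \<odot>\<^bsub>?E\<^esub> f \<in> carrier ?E" if "k \<in> carrier K" "f \<in> carrier ?E" for k f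
    unfolding end_algebra_sel(6) by (intro closed linear_maps_const_smult assms that lin)
  have ev [simp]: "(f \<otimes>\<^bsub>?E\<^esub> g) x = f (g x)" "(f \<oplus>\<^bsub>?E\<^esub> g) x = f x \<oplus>\<^bsub>V\<^esub> g x" "(k \<odot>\<^bsub>?E\<^esub> f) x = k \<odot>\<^bsub>V\<^esub> f x"
    "\<one>\<^bsub>?E\<^esub> x = x" "\<zero>\<^bsub>?E\<^esub> x = \<zero>\<^bsub>V\<^esub>" if "x \<in> carrier V" for f g k x
    using that by (simp_all add: end_algebra_sel)
  have fl [simp]: "f (x \<oplus>\<^bsub>V\<^esub> y) = f x \<oplus>\<^bsub>V\<^esub> f y" "k \<in> carrier K \<Longrightarrow> f (k \<odot>\<^bsub>V\<^esub> x) = k \<odot>\<^bsub>V\<^esub> f x"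
    if "f \<in> carrier ?E" "x \<in> carrier V" "y \<in> carrier V" for f x y k
    using linear_mapsD(2,3)[OF lin[OF that(1)]] that by auto
  show ?thesis
  proof (intro asalgI moduleI abelian_groupI monoidI V.R.cring_axioms)
    fix f assume f: "f \<in> carrier ?E"
    show "\<exists>g\<in>carrier ?E. g \<oplus>\<^bsub>?E\<^esub> f = \<zero>\<^bsub>?E\<^esub>"
      by (intro bexI[of _ "(\<ominus>\<^bsub>K\<^esub> \<one>\<^bsub>K\<^esub>) \<odot>\<^bsub>?E\<^esub> f"] extI) (use f in \<open>simp_all add: V.smult_l_minus V.M.l_neg\<close>)
  qed ((rule extI; simp add: V.M.a_ac V.smult_l_distr V.smult_r_distr V.smult_assoc1) | (simp; fail))+
qed

lemma (in grp_env) kG_bilin_eq: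
  assumes "module K V" "bilin K kG kG V f" "bilin K kG kG V f'"
    and "\<And>g t. g \<in> carrier G \<Longrightarrow> t \<in> carrier G \<Longrightarrow> f (\<delta> g) (\<delta> t) = f' (\<delta> g) (\<delta> t)"
    and "a \<in> carrier kG" "b \<in> carrier kG"
  shows "f a b = f' a b"
proof (rule kG_linear_eq[OF assms(1) bilinD(2)[OF assms(2,6)] bilinD(2)[OF assms(3,6)] _ assms(5)])
  fix g assume g: "g \<in> carrier G"
  show "f (\<delta> g) b = f' (\<delta> g) b"
    by (rule kG_linear_eq[OF assms(1) bilinD(1)[OF assms(2)] bilinD(1)[OF assms(3)] _ assms(6)])
      (use g assms(4) in auto)
qed

section \<open>Poisson derivations and module algebras\<close>

text \<open>A Poisson derivation \<^term>\<open>d g\<close> of \<open>R\<close> induces a derivation \<open>D g\<close> of \<open>R\<^sup>e\<close> and an automorphism \<open>\<phi> g\<close>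
  fixing \<open>R\<close>; then \<open>g\<close> acts as \<open>\<phi> g\<close> and the primitive element \<open>g\<^sup>-\<^sup>1 h\<^sub>g\<close> as \<open>D g\<close>.\<close>

locale deriv_action = R: pois K R br + GE: grp_env K G
  for K :: "('k, 'r) ring_scheme" and R :: "('k, 'a, 'c) module_scheme" and br and G :: "('g, 's) monoid_scheme" +
  fixes d :: "'g \<Rightarrow> 'a \<Rightarrow> 'a"
  assumes d_lin: "g \<in> carrier G \<Longrightarrow> d g \<in> linear_maps K R R"
    and d_mult: "\<lbrakk>g \<in> carrier G; x \<in> carrier R; y \<in> carrier R\<rbrakk> \<Longrightarrow> d g (x \<otimes>\<^bsub>R\<^esub> y) = d g x \<otimes>\<^bsub>R\<^esub> y \<oplus>\<^bsub>R\<^esub> x \<otimes>\<^bsub>R\<^esub> d g y"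
    and d_br: "\<lbrakk>g \<in> carrier G; x \<in> carrier R; y \<in> carrier R\<rbrakk> \<Longrightarrow> d g (br x y) = br (d g x) y \<oplus>\<^bsub>R\<^esub> br x (d g y)"
    and d_add: "\<lbrakk>g \<in> carrier G; t \<in> carrier G; x \<in> carrier R\<rbrakk> \<Longrightarrow> d (g \<otimes>\<^bsub>G\<^esub> t) x = d g x \<oplus>\<^bsub>R\<^esub> d t x"
    and d_comm: "\<lbrakk>g \<in> carrier G; t \<in> carrier G; x \<in> carrier R\<rbrakk> \<Longrightarrow> d g (d t x) = d t (d g x)"
begin

abbreviation Re where "Re \<equiv> R.E"
abbreviation m where "m \<equiv> R.m"
abbreviation h where "h \<equiv> R.h"

lemma d_closed [simp]: "g \<in> carrier G \<Longrightarrow> x \<in> carrier R \<Longrightarrow> d g x \<in> carrier R"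
  using linear_mapsD(1)[OF d_lin] .

lemma d_one: "g \<in> carrier G \<Longrightarrow> d g \<one>\<^bsub>R\<^esub> = \<zero>\<^bsub>R\<^esub>"
proof -
  assume g: "g \<in> carrier G"
  then have "d g \<one>\<^bsub>R\<^esub> = d g \<one>\<^bsub>R\<^esub> \<oplus>\<^bsub>R\<^esub> d g \<one>\<^bsub>R\<^esub>" using d_mult[of g "\<one>\<^bsub>R\<^esub>" "\<one>\<^bsub>R\<^esub>"] by simp
  then show ?thesis using g by (metis R.M.add.r_cancel_one' d_closed R.one_closed)
qed

lemma d_group_one: "x \<in> carrier R \<Longrightarrow> d \<one>\<^bsub>G\<^esub> x = \<zero>\<^bsub>R\<^esub>"
proof -
  assume x: "x \<in> carrier R"
  then have "d \<one>\<^bsub>G\<^esub> x = d \<one>\<^bsub>G\<^esub> x \<oplus>\<^bsub>R\<^esub> d \<one>\<^bsub>G\<^esub> x" using d_add[of "\<one>\<^bsub>G\<^esub>" "\<one>\<^bsub>G\<^esub>" x] by simp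
  then show ?thesis using x by (metis R.M.add.r_cancel_one' d_closed GE.G.one_closed)
qed

text \<open>In the commutator of h_x + d x and h_y + d y the mixed terms give {x, d y} + {d x, y},
  which is d {x, y} because d is a derivation of the bracket. The product relation is the Leibniz
  rule for d.\<close>

lemma \<phi>_data:
  assumes g: "g \<in> carrier G"
  shows "env_data K R br Re m (\<lambda>y. h y \<oplus>\<^bsub>Re\<^esub> m (d g y))"
proof (intro env_dataI R.m_linear linear_maps_add R.h_linear linear_maps_comp[OF d_lin[OF g] R.m_linear] R.E.module_axioms)
  fix x y assume xy: "x \<in> carrier R" "y \<in> carrier R"
  show "h (br x y) \<oplus>\<^bsub>Re\<^esub> m (d g (br x y)) = (h x \<oplus>\<^bsub>Re\<^esub> m (d g x)) \<otimes>\<^bsub>Re\<^esub> (h y \<oplus>\<^bsub>Re\<^esub> m (d g y)) \<ominus>\<^bsub>Re\<^esub>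
      (h y \<oplus>\<^bsub>Re\<^esub> m (d g y)) \<otimes>\<^bsub>Re\<^esub> (h x \<oplus>\<^bsub>Re\<^esub> m (d g x))"
    using g xy
    apply (intro eq_minusI[OF R.E.M.abelian_group_axioms])
       apply simp_all
    apply (simp add: R.E.l_distr R.E.r_distr R.hm_swap[of x y] R.hm_swap(1)[of x "d g y"] R.hm_swap(2)[of "d g x" y]
        d_br R.m_lin_simps R.m_mult[symmetric] R.mult_comm[of "d g y" "d g x"] R.E.M.a_ac)
    done
  show "h (x \<otimes>\<^bsub>R\<^esub> y) \<oplus>\<^bsub>Re\<^esub> m (d g (x \<otimes>\<^bsub>R\<^esub> y)) =
       m y \<otimes>\<^bsub>Re\<^esub> (h x \<oplus>\<^bsub>Re\<^esub> m (d g x)) \<oplus>\<^bsub>Re\<^esub> m x \<otimes>\<^bsub>Re\<^esub> (h y \<oplus>\<^bsub>Re\<^esub> m (d g y))"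
    using g xy by (simp add: R.h_mult d_mult R.m_lin_simps R.E.r_distr R.E.M.a_ac R.mult_comm[of y] flip: R.m_mult)
  show "m (br x y) = (h x \<oplus>\<^bsub>Re\<^esub> m (d g x)) \<otimes>\<^bsub>Re\<^esub> m y \<ominus>\<^bsub>Re\<^esub> m y \<otimes>\<^bsub>Re\<^esub> (h x \<oplus>\<^bsub>Re\<^esub> m (d g x))"
    using g xy
    apply (intro eq_minusI[OF R.E.M.abelian_group_axioms])
       apply simp_all
    apply (simp add: R.E.l_distr R.E.r_distr R.hm_swap(1)[of x y] R.m_mult[symmetric] R.mult_comm[of y] R.E.M.a_ac)
    done
qed (simp_all add: R.m_one R.m_mult)

definition \<phi> where "\<phi> g = env_lift K R br Re m (\<lambda>y. h y \<oplus>\<^bsub>Re\<^esub> m (d g y))"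

lemma \<phi>_hom: "g \<in> carrier G \<Longrightarrow> \<phi> g \<in> alg_homs K Re Re"
  and \<phi>_m: "g \<in> carrier G \<Longrightarrow> y \<in> carrier R \<Longrightarrow> \<phi> g (m y) = m y"
  and \<phi>_h: "g \<in> carrier G \<Longrightarrow> y \<in> carrier R \<Longrightarrow> \<phi> g (h y) = h y \<oplus>\<^bsub>Re\<^esub> m (d g y)"
  unfolding \<phi>_def by (simp_all add: R.env_lift_props[OF R.E_asalg \<phi>_data])

lemma \<phi>_simps:
  assumes "g \<in> carrier G"
  shows "z \<in> carrier Re \<Longrightarrow> w \<in> carrier Re \<Longrightarrow> \<phi> g (z \<otimes>\<^bsub>Re\<^esub> w) = \<phi> g z \<otimes>\<^bsub>Re\<^esub> \<phi> g w"
    "\<phi> g \<one>\<^bsub>Re\<^esub> = \<one>\<^bsub>Re\<^esub>" "z \<in> carrier Re \<Longrightarrow> \<phi> g z \<in> carrier Re"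
    "z \<in> carrier Re \<Longrightarrow> w \<in> carrier Re \<Longrightarrow> \<phi> g (z \<oplus>\<^bsub>Re\<^esub> w) = \<phi> g z \<oplus>\<^bsub>Re\<^esub> \<phi> g w"
    "c \<in> carrier K \<Longrightarrow> z \<in> carrier Re \<Longrightarrow> \<phi> g (c \<odot>\<^bsub>Re\<^esub> z) = c \<odot>\<^bsub>Re\<^esub> \<phi> g z"
  using alg_homsD[OF \<phi>_hom[OF assms]] linear_mapsD[OF alg_homsD(1)[OF \<phi>_hom[OF assms]]] by simp_all

text \<open>The second components of the relations are the relations of R^e differentiated along d,
  which holds because d is a derivation of both operations.\<close>

lemma D_data:
  assumes g: "g \<in> carrier G"
  shows "env_data K R br (dual_numbers Re) (\<lambda>y. (m y, m (d g y))) (\<lambda>y. (h y, h (d g y)))"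
proof (intro env_dataI)
  note dl = linear_mapsD[OF d_lin[OF g]]
  show "(\<lambda>y. (m y, m (d g y))) \<in> linear_maps K R (dual_numbers Re)" "(\<lambda>y. (h y, h (d g y))) \<in> linear_maps K R (dual_numbers Re)"
    using g by (intro linear_mapsI; simp add: dl R.m_lin_simps R.h_lin_simps)+
  interpret Du: asalg K "dual_numbers Re" by (rule R.E.dual_numbers_asalg)
  fix x y assume xy: "x \<in> carrier R" "y \<in> carrier R"
  show "(h (br x y), h (d g (br x y))) = (h x, h (d g x)) \<otimes>\<^bsub>dual_numbers Re\<^esub> (h y, h (d g y)) \<ominus>\<^bsub>dual_numbers Re\<^esub>
      (h y, h (d g y)) \<otimes>\<^bsub>dual_numbers Re\<^esub> (h x, h (d g x))"
    using g xy
    apply (intro eq_minusI[OF Du.M.abelian_group_axioms])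
       apply simp_all
    apply (simp add: R.hm_swap(3)[of x y] R.hm_swap(3)[of x "d g y"] R.hm_swap(3)[of "d g x" y] d_br R.h_lin_simps R.E.M.a_ac)
    done
  show "(m (br x y), m (d g (br x y))) = (h x, h (d g x)) \<otimes>\<^bsub>dual_numbers Re\<^esub> (m y, m (d g y)) \<ominus>\<^bsub>dual_numbers Re\<^esub>
      (m y, m (d g y)) \<otimes>\<^bsub>dual_numbers Re\<^esub> (h x, h (d g x))"
    using g xy
    apply (intro eq_minusI[OF Du.M.abelian_group_axioms])
       apply simp_all
    apply (simp add: R.hm_swap(1)[of x y] R.hm_swap(1)[of x "d g y"] R.hm_swap(1)[of "d g x" y] d_br R.m_lin_simps R.E.M.a_ac)
    done
  show "(m (x \<otimes>\<^bsub>R\<^esub> y), m (d g (x \<otimes>\<^bsub>R\<^esub> y))) = (m x, m (d g x)) \<otimes>\<^bsub>dual_numbers Re\<^esub> (m y, m (d g y))"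
    using g xy by (simp add: d_mult R.m_lin_simps R.m_mult R.E.M.a_comm)
  show "(h (x \<otimes>\<^bsub>R\<^esub> y), h (d g (x \<otimes>\<^bsub>R\<^esub> y))) = (m y, m (d g y)) \<otimes>\<^bsub>dual_numbers Re\<^esub> (h x, h (d g x)) \<oplus>\<^bsub>dual_numbers Re\<^esub>
      (m x, m (d g x)) \<otimes>\<^bsub>dual_numbers Re\<^esub> (h y, h (d g y))"
    using g xy by (simp add: d_mult R.h_lin_simps R.h_mult R.E.M.a_ac)
qed (use g in \<open>simp add: R.m_one d_one R.m_lin_simps\<close>)

definition \<Phi>D where "\<Phi>D g = env_lift K R br (dual_numbers Re) (\<lambda>y. (m y, m (d g y))) (\<lambda>y. (h y, h (d g y)))"

definition D where "D g z = snd (\<Phi>D g z)"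

lemma \<Phi>D_hom: "g \<in> carrier G \<Longrightarrow> \<Phi>D g \<in> alg_homs K Re (dual_numbers Re)"
  and \<Phi>D_m: "g \<in> carrier G \<Longrightarrow> y \<in> carrier R \<Longrightarrow> \<Phi>D g (m y) = (m y, m (d g y))"
  and \<Phi>D_h: "g \<in> carrier G \<Longrightarrow> y \<in> carrier R \<Longrightarrow> \<Phi>D g (h y) = (h y, h (d g y))"
  unfolding \<Phi>D_def by (simp_all add: R.env_lift_props[OF R.E.dual_numbers_asalg D_data])

lemma \<Phi>D_simps:
  assumes "g \<in> carrier G"
  shows "z \<in> carrier Re \<Longrightarrow> w \<in> carrier Re \<Longrightarrow> \<Phi>D g (z \<otimes>\<^bsub>Re\<^esub> w) = \<Phi>D g z \<otimes>\<^bsub>dual_numbers Re\<^esub> \<Phi>D g w"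
    "\<Phi>D g \<one>\<^bsub>Re\<^esub> = (\<one>\<^bsub>Re\<^esub>, \<zero>\<^bsub>Re\<^esub>)" "z \<in> carrier Re \<Longrightarrow> \<Phi>D g z \<in> carrier Re \<times> carrier Re"
    "z \<in> carrier Re \<Longrightarrow> w \<in> carrier Re \<Longrightarrow> \<Phi>D g (z \<oplus>\<^bsub>Re\<^esub> w) = \<Phi>D g z \<oplus>\<^bsub>dual_numbers Re\<^esub> \<Phi>D g w"
    "c \<in> carrier K \<Longrightarrow> z \<in> carrier Re \<Longrightarrow> \<Phi>D g (c \<odot>\<^bsub>Re\<^esub> z) = c \<odot>\<^bsub>dual_numbers Re\<^esub> \<Phi>D g z"
  using alg_homsD[OF \<Phi>D_hom[OF assms]] linear_mapsD[OF alg_homsD(1)[OF \<Phi>D_hom[OF assms]]] by simp_all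

lemma D_closed [simp]: "g \<in> carrier G \<Longrightarrow> z \<in> carrier Re \<Longrightarrow> D g z \<in> carrier Re"
  using \<Phi>D_simps(3)[of g z] by (auto simp: D_def)

lemma fst_\<Phi>D: assumes "g \<in> carrier G" "z \<in> carrier Re" shows "fst (\<Phi>D g z) = z"
  using assms(2) by (induction z rule: R.E_induct) (simp_all add: assms(1) \<Phi>D_simps \<Phi>D_m \<Phi>D_h)

lemma D_simps:
  assumes "g \<in> carrier G"
  shows "z \<in> carrier Re \<Longrightarrow> w \<in> carrier Re \<Longrightarrow> D g (z \<otimes>\<^bsub>Re\<^esub> w) = z \<otimes>\<^bsub>Re\<^esub> D g w \<oplus>\<^bsub>Re\<^esub> D g z \<otimes>\<^bsub>Re\<^esub> w"
    "D g \<one>\<^bsub>Re\<^esub> = \<zero>\<^bsub>Re\<^esub>"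
    "z \<in> carrier Re \<Longrightarrow> w \<in> carrier Re \<Longrightarrow> D g (z \<oplus>\<^bsub>Re\<^esub> w) = D g z \<oplus>\<^bsub>Re\<^esub> D g w"
    "c \<in> carrier K \<Longrightarrow> z \<in> carrier Re \<Longrightarrow> D g (c \<odot>\<^bsub>Re\<^esub> z) = c \<odot>\<^bsub>Re\<^esub> D g z"
    "y \<in> carrier R \<Longrightarrow> D g (m y) = m (d g y)" "y \<in> carrier R \<Longrightarrow> D g (h y) = h (d g y)"
  using assms by (simp_all add: D_def \<Phi>D_simps \<Phi>D_m \<Phi>D_h fst_\<Phi>D)

lemma D_linear: "g \<in> carrier G \<Longrightarrow> D g \<in> linear_maps K Re Re"
  by (intro linear_mapsI) (simp_all add: D_simps)

lemma \<phi>_mult: assumes "g \<in> carrier G" "t \<in> carrier G" "z \<in> carrier Re" shows "\<phi> (g \<otimes>\<^bsub>G\<^esub> t) z = \<phi> g (\<phi> t z)"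
  using assms(3) by (induction z rule: R.E_induct)
    (simp_all add: assms(1,2) \<phi>_simps \<phi>_m \<phi>_h d_add R.m_lin_simps R.E.M.a_ac)

lemma \<phi>_one: "z \<in> carrier Re \<Longrightarrow> \<phi> \<one>\<^bsub>G\<^esub> z = z"
  by (induction z rule: R.E_induct) (simp_all add: \<phi>_simps \<phi>_m \<phi>_h d_group_one R.m_lin_simps)

lemma D_mult: assumes "g \<in> carrier G" "t \<in> carrier G" "z \<in> carrier Re" shows "D (g \<otimes>\<^bsub>G\<^esub> t) z = D g z \<oplus>\<^bsub>Re\<^esub> D t z"
  using assms(3) by (induction z rule: R.E_induct)
    (simp_all add: assms(1,2) D_simps d_add R.m_lin_simps R.h_lin_simps R.E.l_distr R.E.r_distr R.E.M.a_ac)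

lemma D_\<phi>: assumes "g \<in> carrier G" "t \<in> carrier G" "z \<in> carrier Re" shows "D g (\<phi> t z) = \<phi> t (D g z)"
  using assms(3) by (induction z rule: R.E_induct)
    (simp_all add: assms(1,2) D_simps \<phi>_simps \<phi>_m \<phi>_h R.m_lin_simps R.h_lin_simps R.E.l_distr R.E.r_distr R.E.M.a_ac
      d_comm[OF assms(1,2)] linear_maps_zero[OF R.E.module_axioms R.E.module_axioms alg_homsD(1)[OF \<phi>_hom]])

lemma D_comm: assumes "g \<in> carrier G" "t \<in> carrier G" "z \<in> carrier Re" shows "D g (D t z) = D t (D g z)"
  using assms(3) by (induction z rule: R.E_induct)
    (simp_all add: assms(1,2) D_simps R.E.l_distr R.E.r_distr R.E.M.a_ac
      d_comm[OF assms(1,2)] linear_maps_zero[OF R.E.module_axioms R.E.module_axioms D_linear])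

abbreviation En where "En \<equiv> end_algebra K Re"

sublocale En: asalg K En by (rule end_algebra_asalg[OF R.E.module_axioms])

definition \<phi>r where "\<phi>r g = restrict (\<phi> g) (carrier Re)"
text \<open>h_g is g times the primitive element g^-1 h_g, so it acts by the derivation followed by
  the automorphism.\<close>

definition Dr where "Dr g = restrict (\<lambda>z. \<phi> g (D g z)) (carrier Re)"

lemma \<phi>r_En [simp]: "g \<in> carrier G \<Longrightarrow> \<phi>r g \<in> carrier En"
  unfolding \<phi>r_def end_algebra_sel using restrict_linear[OF R.E.module_axioms alg_homsD(1)[OF \<phi>_hom]] by simp

lemma Dr_En [simp]: "g \<in> carrier G \<Longrightarrow> Dr g \<in> carrier En"
  unfolding Dr_def end_algebra_sel
  using restrict_linear[OF R.E.module_axioms linear_maps_comp[OF D_linear alg_homsD(1)[OF \<phi>_hom]]] by simp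

lemma \<phi>r_mult: "g \<in> carrier G \<Longrightarrow> t \<in> carrier G \<Longrightarrow> \<phi>r (g \<otimes>\<^bsub>G\<^esub> t) = \<phi>r g \<otimes>\<^bsub>En\<^esub> \<phi>r t"
  unfolding \<phi>r_def end_algebra_sel by (intro restrict_ext) (simp add: \<phi>_mult \<phi>_simps)

lemma \<phi>r_one: "\<phi>r \<one>\<^bsub>G\<^esub> = \<one>\<^bsub>En\<^esub>"
  unfolding \<phi>r_def end_algebra_sel by (intro restrict_ext) (simp add: \<phi>_one)

text \<open>The automorphisms commute, so the product rule for h amounts to additivity of the
  derivations in the group element.\<close>

lemma Dr_mult: "g \<in> carrier G \<Longrightarrow> t \<in> carrier G \<Longrightarrow> Dr (g \<otimes>\<^bsub>G\<^esub> t) = \<phi>r t \<otimes>\<^bsub>En\<^esub> Dr g \<oplus>\<^bsub>En\<^esub> \<phi>r g \<otimes>\<^bsub>En\<^esub> Dr t"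
  unfolding \<phi>r_def Dr_def end_algebra_sel
  by (intro restrict_ext) (simp add: \<phi>_mult[symmetric] D_mult \<phi>_simps GE.G.m_comm[of t g])

lemma Dr_\<phi>r: "g \<in> carrier G \<Longrightarrow> t \<in> carrier G \<Longrightarrow> Dr g \<otimes>\<^bsub>En\<^esub> \<phi>r t = \<phi>r t \<otimes>\<^bsub>En\<^esub> Dr g"
  unfolding \<phi>r_def Dr_def end_algebra_sel
  by (intro restrict_ext) (simp add: D_\<phi> \<phi>_simps \<phi>_mult[symmetric] GE.G.m_comm[of t g])

lemma Dr_Dr: "g \<in> carrier G \<Longrightarrow> t \<in> carrier G \<Longrightarrow> Dr g \<otimes>\<^bsub>En\<^esub> Dr t = Dr t \<otimes>\<^bsub>En\<^esub> Dr g"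
proof -
  assume gt: "g \<in> carrier G" "t \<in> carrier G"
  have "\<phi> g (\<phi> t w) = \<phi> t (\<phi> g w)" if "w \<in> carrier Re" for w
    using gt that by (simp add: \<phi>_mult[symmetric] GE.G.m_comm[of t g])
  then show ?thesis
    unfolding Dr_def end_algebra_sel
    by (intro restrict_ext) (use gt in \<open>simp add: D_\<phi> \<phi>_simps D_comm[of g t]\<close>)
qed

definition \<alpha>E where "\<alpha>E = lin_ext K En \<phi>r"
definition \<beta>E where "\<beta>E = lin_ext K En Dr"

lemma \<alpha>E_hom: "\<alpha>E \<in> alg_homs K GE.kG En"
  unfolding \<alpha>E_def by (rule GE.kG_lin_ext_hom[OF En.asalg_axioms]) (auto simp: \<phi>r_mult \<phi>r_one simp del: end_algebra_sel)

lemma \<alpha>E_\<delta>: "g \<in> carrier G \<Longrightarrow> \<alpha>E (GE.\<delta> g) = \<phi>r g"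
  unfolding \<alpha>E_def by (rule GE.kG_lin_ext_\<delta>[OF En.asalg_axioms]) auto

lemma \<beta>E_lin: "\<beta>E \<in> linear_maps K GE.kG En"
proof -
  have s: "linear_maps K GE.kA En = linear_maps K GE.kG En"
    by (rule same_algebra_linear_maps[OF GE.kG_same]) (simp add: same_algebra_def)
  show ?thesis
    unfolding \<beta>E_def s[symmetric] by (rule lin_ext_linear[OF En.module_axioms]) (auto intro: GE.G.is_monoid)
qed

lemma \<beta>E_\<delta>: "g \<in> carrier G \<Longrightarrow> \<beta>E (GE.\<delta> g) = Dr g"
  unfolding \<beta>E_def by (rule GE.kG_lin_ext_\<delta>[OF En.asalg_axioms]) auto

text \<open>As kG has zero bracket, the relations for brackets say that the operators commute. These
  and the product rule for h are bilinear in kG and are tested on group elements.\<close>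

lemma action_data: "env_data K GE.kG GE.br0 En \<alpha>E \<beta>E"
proof -
  note a = alg_homsD[OF \<alpha>E_hom] linear_mapsD[OF alg_homsD(1)[OF \<alpha>E_hom]]
    linear_maps_zero[OF GE.kG.module_axioms En.module_axioms alg_homsD(1)[OF \<alpha>E_hom]]
  note b = linear_mapsD[OF \<beta>E_lin] linear_maps_zero[OF GE.kG.module_axioms En.module_axioms \<beta>E_lin]
  have zb: "bilin K GE.kG GE.kG En (\<lambda>x y. \<zero>\<^bsub>En\<^esub>)" by (intro bilinI linear_maps_zero_map En.module_axioms)
  show ?thesis
  proof (intro env_dataI a(1) \<beta>E_lin a(3))
    fix x y assume xy: "x \<in> carrier GE.kG" "y \<in> carrier GE.kG"
    show "\<alpha>E (x \<otimes>\<^bsub>GE.kG\<^esub> y) = \<alpha>E x \<otimes>\<^bsub>En\<^esub> \<alpha>E y" using xy by (rule a(2))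
    have "\<beta>E x \<otimes>\<^bsub>En\<^esub> \<beta>E y \<ominus>\<^bsub>En\<^esub> \<beta>E y \<otimes>\<^bsub>En\<^esub> \<beta>E x = \<zero>\<^bsub>En\<^esub>"
      by (rule GE.kG_bilin_eq[OF En.module_axioms bilin_compose[OF En.bilin_commutator \<beta>E_lin \<beta>E_lin] zb _ xy])
        (simp add: \<beta>E_\<delta> Dr_Dr minus_zero_iff[OF En.M.abelian_group_axioms])
    then show "\<beta>E (GE.br0 x y) = \<beta>E x \<otimes>\<^bsub>En\<^esub> \<beta>E y \<ominus>\<^bsub>En\<^esub> \<beta>E y \<otimes>\<^bsub>En\<^esub> \<beta>E x" by (simp only: b)
    have "\<beta>E x \<otimes>\<^bsub>En\<^esub> \<alpha>E y \<ominus>\<^bsub>En\<^esub> \<alpha>E y \<otimes>\<^bsub>En\<^esub> \<beta>E x = \<zero>\<^bsub>En\<^esub>"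
      by (rule GE.kG_bilin_eq[OF En.module_axioms bilin_compose[OF En.bilin_commutator \<beta>E_lin a(1)] zb _ xy])
        (simp add: \<beta>E_\<delta> \<alpha>E_\<delta> Dr_\<phi>r minus_zero_iff[OF En.M.abelian_group_axioms])
    then show "\<alpha>E (GE.br0 x y) = \<beta>E x \<otimes>\<^bsub>En\<^esub> \<alpha>E y \<ominus>\<^bsub>En\<^esub> \<alpha>E y \<otimes>\<^bsub>En\<^esub> \<beta>E x" by (simp only: a)
    have 1: "bilin K GE.kG GE.kG En (\<lambda>x y. \<beta>E (x \<otimes>\<^bsub>GE.kG\<^esub> y))" by (rule bilin_linear[OF GE.kG.bilin_mult \<beta>E_lin])
    have "bilin K GE.kG GE.kG En (\<lambda>y x. \<alpha>E y \<otimes>\<^bsub>En\<^esub> \<beta>E x)" by (rule bilin_compose[OF En.bilin_mult a(1) \<beta>E_lin])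
    then have "bilin K GE.kG GE.kG En (\<lambda>x y. \<alpha>E y \<otimes>\<^bsub>En\<^esub> \<beta>E x)" unfolding bilin_def by blast
    then have 2: "bilin K GE.kG GE.kG En (\<lambda>x y. \<alpha>E y \<otimes>\<^bsub>En\<^esub> \<beta>E x \<oplus>\<^bsub>En\<^esub> \<alpha>E x \<otimes>\<^bsub>En\<^esub> \<beta>E y)"
      by (intro bilin_add En.module_axioms bilin_compose[OF En.bilin_mult a(1) \<beta>E_lin])
    show "\<beta>E (x \<otimes>\<^bsub>GE.kG\<^esub> y) = \<alpha>E y \<otimes>\<^bsub>En\<^esub> \<beta>E x \<oplus>\<^bsub>En\<^esub> \<alpha>E x \<otimes>\<^bsub>En\<^esub> \<beta>E y"
      by (rule GE.kG_bilin_eq[OF En.module_axioms 1 2 _ xy]) (simp add: GE.\<delta>_mult \<beta>E_\<delta> \<alpha>E_\<delta> Dr_mult)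
  qed
qed

definition act where "act = env_lift K GE.kG GE.br0 En \<alpha>E \<beta>E"

lemma act_hom: "act \<in> alg_homs K GE.H.E En"
  unfolding act_def by (rule GE.H.env_lift_props(1)[OF En.asalg_axioms action_data])

lemma act_gens:
  assumes "g \<in> carrier G" shows "act (GE.gH g) = \<phi>r g" "act (GE.hH g) = Dr g"
  unfolding act_def using assms by (simp_all add: GE.H.env_lift_props(2,3)[OF En.asalg_axioms action_data] \<alpha>E_\<delta> \<beta>E_\<delta>)

lemmas act_simps = alg_homsD[OF act_hom] linear_mapsD[OF alg_homsD(1)[OF act_hom]]

lemma act_linear: "a \<in> carrier GE.H.E \<Longrightarrow> act a \<in> linear_maps K Re Re"
  using act_simps(4)[of a] unfolding end_algebra_sel by simp

lemma act_linear': "z \<in> carrier Re \<Longrightarrow> (\<lambda>a. act a z) \<in> linear_maps K GE.H.E Re"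
  using linear_mapsD(1)[OF act_linear] by (intro linear_mapsI) (simp_all add: act_simps end_algebra_sel)

lemma act_eval:
  assumes "z \<in> carrier Re"
  shows "act \<one>\<^bsub>GE.H.E\<^esub> z = z"
    "a \<in> carrier GE.H.E \<Longrightarrow> b \<in> carrier GE.H.E \<Longrightarrow> act (a \<otimes>\<^bsub>GE.H.E\<^esub> b) z = act a (act b z)"
    "g \<in> carrier G \<Longrightarrow> act (GE.gH g) z = \<phi> g z" "g \<in> carrier G \<Longrightarrow> act (GE.hH g) z = \<phi> g (D g z)"
    "a \<in> carrier GE.H.E \<Longrightarrow> act a z \<in> carrier Re"
  using assms linear_mapsD(1)[OF act_linear] by (simp_all add: act_simps end_algebra_sel act_gens \<phi>r_def Dr_def)

lemma act_bilin:
  assumes "x \<in> carrier Re" "y \<in> carrier Re"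
  shows "bilin K GE.H.E GE.H.E Re (\<lambda>b c. act b x \<otimes>\<^bsub>Re\<^esub> act c y)"
  by (rule bilin_compose[OF R.E.bilin_mult act_linear'[OF assms(1)] act_linear'[OF assms(2)]])

text \<open>Induction over the generators of (kG)^e: multiplying a by g or h_g multiplies its
  coproduct on the left, and the two rules below translate this into the automorphism and the
  derivation.\<close>

lemma act_mult:
  assumes a: "a \<in> carrier GE.H.E" and x: "x \<in> carrier Re" and y: "y \<in> carrier Re"
  shows "act a (x \<otimes>\<^bsub>Re\<^esub> y) = tlift K Re (\<lambda>b c. act b x \<otimes>\<^bsub>Re\<^esub> act c y) (GE.H.\<Delta>E a)"
proof -
  let ?f = "\<lambda>b c. act b x \<otimes>\<^bsub>Re\<^esub> act c y" let ?L = "tlift K Re ?f"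
  note f = act_bilin[OF x y]
  note L = GE.H.E2.tlift_simps[OF R.E.module_axioms f]
  note \<Delta> = GE.H.\<Delta>E_simps
  \<comment> \<open>g has coproduct g \<otimes> g, and it acts by an algebra automorphism.\<close>
  have \<phi>f: "\<phi> g (?L t) = ?L (GE.H.ept (GE.gH g) (GE.gH g) \<otimes>\<^bsub>GE.H.EE\<^esub> t)" if "g \<in> carrier G" "t \<in> carrier GE.H.EE" for g t
    unfolding GE.H.E2.tlift_comp[OF R.E.module_axioms f R.E.module_axioms alg_homsD(1)[OF \<phi>_hom[OF that(1)]] that(2)]
      GE.H.E2.tlift_pt_mult[OF R.E.module_axioms f GE.H.m_closed[OF GE.\<delta>_closed[OF that(1)]] GE.H.m_closed[OF GE.\<delta>_closed[OF that(1)]] that(2)]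
    by (rule GE.H.E2.tlift_cong[OF R.E.module_axioms bilin_linear[OF f alg_homsD(1)[OF \<phi>_hom[OF that(1)]]] _ that(2)])
      (use that x y in \<open>simp add: act_eval \<phi>_simps\<close>)
  \<comment> \<open>The Leibniz rule for the derivation, followed by the automorphism, reproduces
    the two summands of the coproduct of h_g.\<close>
  have Df: "\<phi> g (D g (?L t)) = ?L ((GE.H.ept (GE.gH g) (GE.hH g) \<oplus>\<^bsub>GE.H.EE\<^esub> GE.H.ept (GE.hH g) (GE.gH g)) \<otimes>\<^bsub>GE.H.EE\<^esub> t)"
    if "g \<in> carrier G" "t \<in> carrier GE.H.EE" for g t
  proof (rule GE.H.E2.T_linear_eq[OF R.E.module_axioms _ _ _ that(2)])
    show "(\<lambda>t. \<phi> g (D g (?L t))) \<in> linear_maps K GE.H.EE Re"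
      by (rule linear_maps_comp[OF GE.H.E2.tlift_linear[OF R.E.module_axioms f] linear_maps_comp[OF D_linear[OF that(1)] alg_homsD(1)[OF \<phi>_hom[OF that(1)]]]])
    show "(\<lambda>t. ?L ((GE.H.ept (GE.gH g) (GE.hH g) \<oplus>\<^bsub>GE.H.EE\<^esub> GE.H.ept (GE.hH g) (GE.gH g)) \<otimes>\<^bsub>GE.H.EE\<^esub> t)) \<in> linear_maps K GE.H.EE Re"
      by (rule linear_maps_comp[OF GE.H.E2.T.linear_mult_left GE.H.E2.tlift_linear[OF R.E.module_axioms f]]) (use that in simp)
  qed (use that x y in \<open>simp add: L GE.H.E2.T.l_distr GE.H.E2.pt_mult act_eval D_simps \<phi>_simps\<close>)
  show ?thesis
    using a
  proof (induction a rule: GE.H_induct)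
    case one then show ?case using x y by (simp add: \<Delta> GE.H.E2.T_one L act_eval)
  next
    case (add z w) then show ?case using x y by (simp add: \<Delta> L linear_mapsD[OF act_linear'])
  next
    case (smult c z) then show ?case using x y by (simp add: \<Delta> L linear_mapsD[OF act_linear'])
  next
    case (g g z) then show ?case using x y by (simp add: \<Delta> GE.\<Delta>H_gH act_eval \<phi>f L(1))
  next
    case (h g z) then show ?case using x y by (simp add: \<Delta> GE.\<Delta>H_hH act_eval Df L(1))
  qed
qed

lemma act_one: "a \<in> carrier GE.H.E \<Longrightarrow> act a \<one>\<^bsub>Re\<^esub> = GE.\<epsilon>H a \<odot>\<^bsub>Re\<^esub> \<one>\<^bsub>Re\<^esub>"
proof (induction a rule: GE.H_induct)
  case one then show ?case by (simp add: act_eval GE.\<epsilon>H_simps)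
next
  case (add z w) then show ?case by (simp add: linear_mapsD[OF act_linear'] GE.\<epsilon>H_simps R.E.smult_l_distr)
next
  case (smult c z) then show ?case by (simp add: linear_mapsD[OF act_linear'] GE.\<epsilon>H_simps R.E.smult_assoc1)
next
  case (g g z) then show ?case by (simp add: act_eval GE.\<epsilon>H_simps GE.\<epsilon>H_gH \<phi>_simps)
next
  case (h g z)
  then show ?case
    by (simp add: act_eval GE.\<epsilon>H_simps GE.\<epsilon>H_hH D_simps linear_maps_zero[OF R.E.module_axioms R.E.module_axioms alg_homsD(1)[OF \<phi>_hom]])
qed

text \<open>On a generator h_y the derivation gives the generator of d y, and the automorphism then
  adds d d y. The double bracket of the statement is this element d d y by
  \<open>br_e_br\<close>.\<close>

lemma module_algebra_exists:
  "\<exists>act. module_algebra K (env_hopf K GE.kG GE.br0) Re act \<and>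
    (\<forall>g\<in>carrier G. \<forall>y\<in>carrier R.
       act (GE.gH g) (m y) = m y \<and>
       act (GE.gH g) (h y) = h y \<oplus>\<^bsub>Re\<^esub> m (d g y) \<and>
       act (GE.hH g) (m y) = m (d g y) \<and>
       act (GE.hH g) (h y) = h (d g y) \<oplus>\<^bsub>Re\<^esub> m (d g (d g y)))"
proof (intro exI[of _ act] conjI ballI)
  note s = same_algebraD[OF env_hopf_same[of K GE.kG GE.br0], symmetric]
  have sl: "linear_maps K (env_hopf K GE.kG GE.br0) Re = linear_maps K GE.H.E Re"
    by (rule same_algebra_linear_maps[OF same_algebra_sym[OF env_hopf_same]]) (simp add: same_algebra_def)
  have "left_module K (env_hopf K GE.kG GE.br0) Re act"
    unfolding left_module_def s sl
    by (intro conjI ballI R.E.module_axioms act_linear act_linear' act_eval)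
  then show "module_algebra K (env_hopf K GE.kG GE.br0) Re act"
    unfolding module_algebra_def assoc_algebra_iff s env_hopf_sel
    by (intro conjI ballI R.E_asalg act_mult act_one)
qed (simp_all add: act_eval \<phi>_m \<phi>_h D_simps \<phi>_simps)

end

section \<open>Coinvariants and the adjoint action\<close>

lemma right_coinvariants_sel:
  "carrier (right_coinvariants K A H p) = {x \<in> carrier A. tlift K (tensor K A H) (\<lambda>a b. ptensor K A H a (p b)) (comult A x)
      = ptensor K A H x \<one>\<^bsub>H\<^esub>}"
  "mult (right_coinvariants K A H p) = mult A" "one (right_coinvariants K A H p) = one A"
  "zero (right_coinvariants K A H p) = zero A" "add (right_coinvariants K A H p) = add A"
  "smult (right_coinvariants K A H p) = smult A"
  by (simp_all add: right_coinvariants_def module.defs)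

lemma subalgebra_asalg:
  fixes A :: "('k, 'a, 'c) module_scheme" and A' :: "('k, 'a, 'd) module_scheme"
  assumes "asalg K A" "carrier A' \<subseteq> carrier A" "mult A' = mult A" "one A' = one A"
     "zero A' = zero A" "add A' = add A" "smult A' = smult A"
    and closed: "\<one>\<^bsub>A\<^esub> \<in> carrier A'" "\<And>x y. x \<in> carrier A' \<Longrightarrow> y \<in> carrier A' \<Longrightarrow> x \<oplus>\<^bsub>A\<^esub> y \<in> carrier A'"
      "\<And>x y. x \<in> carrier A' \<Longrightarrow> y \<in> carrier A' \<Longrightarrow> x \<otimes>\<^bsub>A\<^esub> y \<in> carrier A'"
      "\<And>c x. c \<in> carrier K \<Longrightarrow> x \<in> carrier A' \<Longrightarrow> c \<odot>\<^bsub>A\<^esub> x \<in> carrier A'"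
  shows "asalg K A'"
proof -
  interpret A: asalg K A by fact
  have sub: "x \<in> carrier A" if "x \<in> carrier A'" for x using assms(2) that by blast
  have z: "\<zero>\<^bsub>A\<^esub> \<in> carrier A'" using closed(4)[of "\<zero>\<^bsub>K\<^esub>" "\<one>\<^bsub>A\<^esub>"] closed(1) by simp
  show ?thesis
  proof (intro asalgI moduleI abelian_groupI monoidI A.R.cring_axioms; unfold assms(3-7))
    fix x assume x: "x \<in> carrier A'"
    then have "\<ominus>\<^bsub>A\<^esub> x \<in> carrier A'" using closed(4)[of "\<ominus>\<^bsub>K\<^esub> \<one>\<^bsub>K\<^esub>" x] by (simp add: sub A.smult_l_minus)
    then show "\<exists>y\<in>carrier A'. y \<oplus>\<^bsub>A\<^esub> x = \<zero>\<^bsub>A\<^esub>"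
      using x by (intro bexI[of _ "\<ominus>\<^bsub>A\<^esub> x"]) (simp_all add: sub A.M.l_neg)
  qed (simp_all add: sub closed z A.M.a_ac A.m_assoc A.l_distr A.r_distr A.smult_l A.smult_r
      A.smult_l_distr A.smult_r_distr A.smult_assoc1)
qed

text \<open>The setting of a bosonization R # kG, without reference to a filtration: kG is embedded
  by \<iota> and split off by \<pi>. That \<pi> is a Poisson map to kG with zero bracket is
  expressed by \<pi> killing brackets.\<close>

locale boson = C: pois_comult K C brC + GE: grp_env K G
  for K :: "('k, 'r) ring_scheme" and C :: "('k, 'a, 'c) hopf_scheme" (structure) and brC and G :: "('g, 's) monoid_scheme" +
  fixes \<iota> :: "('g \<Rightarrow> 'k) \<Rightarrow> 'a" and \<pi> :: "'a \<Rightarrow> 'g \<Rightarrow> 'k"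
  assumes \<iota>_hom: "\<iota> \<in> alg_homs K GE.kG C" and \<pi>_hom: "\<pi> \<in> alg_homs K C GE.kG"
    and \<pi>_\<iota>: "a \<in> carrier GE.kG \<Longrightarrow> \<pi> (\<iota> a) = a"
    and \<iota>_br: "a \<in> carrier GE.kG \<Longrightarrow> b \<in> carrier GE.kG \<Longrightarrow> brC (\<iota> a) (\<iota> b) = \<zero>"
    and \<pi>_br: "x \<in> carrier C \<Longrightarrow> y \<in> carrier C \<Longrightarrow> \<pi> (brC x y) = \<zero>\<^bsub>GE.kG\<^esub>"
    and \<iota>_comult: "g \<in> carrier G \<Longrightarrow> comult C (\<iota> (GE.\<delta> g)) = ptensor K C C (\<iota> (GE.\<delta> g)) (\<iota> (GE.\<delta> g))"
begin

abbreviation kG where "kG \<equiv> GE.kG"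
abbreviation \<delta> where "\<delta> \<equiv> GE.\<delta>"
abbreviation e where "e g \<equiv> \<iota> (\<delta> g)"

lemmas \<iota>_simps = alg_homsD[OF \<iota>_hom] linear_mapsD[OF alg_homsD(1)[OF \<iota>_hom]]
lemmas \<pi>_simps = alg_homsD[OF \<pi>_hom] linear_mapsD[OF alg_homsD(1)[OF \<pi>_hom]]

lemma e_closed [simp]: "g \<in> carrier G \<Longrightarrow> e g \<in> carrier C"
  by (rule \<iota>_simps(4)) simp

lemma e_mult: "g \<in> carrier G \<Longrightarrow> t \<in> carrier G \<Longrightarrow> e g \<otimes> e t = e (g \<otimes>\<^bsub>G\<^esub> t)"
  using \<iota>_simps(2)[of "\<delta> g" "\<delta> t"] by (simp add: GE.\<delta>_mult)

lemma e_one: "e \<one>\<^bsub>G\<^esub> = \<one>"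
  using \<iota>_simps(3) by (simp add: GE.kG_one)

lemma e_inv: "g \<in> carrier G \<Longrightarrow> e g \<otimes> e (inv\<^bsub>G\<^esub> g) = \<one>" "g \<in> carrier G \<Longrightarrow> e (inv\<^bsub>G\<^esub> g) \<otimes> e g = \<one>"
  by (simp_all add: e_mult e_one)

lemma e_br: "g \<in> carrier G \<Longrightarrow> t \<in> carrier G \<Longrightarrow> brC (e g) (e t) = \<zero>"
  by (simp add: \<iota>_br)

lemma m_inv_e: "g \<in> carrier G \<Longrightarrow> inv (e g) = e (inv\<^bsub>G\<^esub> g)"
  by (intro C.inv_unique'[symmetric]) (simp_all add: e_inv)

lemma br_one: assumes "y \<in> carrier C" shows "brC \<one> y = \<zero>"
proof -
  have "brC \<one> y = brC \<one> y \<oplus> brC \<one> y" using C.leibniz_left[of y "\<one>" "\<one>"] assms by simp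
  then show ?thesis using assms by (metis C.M.add.r_cancel_one' C.br_closed C.one_closed)
qed

text \<open>Differentiating g g^-1 = 1 gives {g^-1, y} = - g^-2 {g, y}.\<close>

lemma br_e_inv: assumes "g \<in> carrier G" "y \<in> carrier C"
  shows "brC (e (inv\<^bsub>G\<^esub> g)) y = \<ominus> (e (inv\<^bsub>G\<^esub> g) \<otimes> (e (inv\<^bsub>G\<^esub> g) \<otimes> brC (e g) y))"
proof -
  have "brC (e (inv\<^bsub>G\<^esub> g)) y \<otimes> e g \<oplus> e (inv\<^bsub>G\<^esub> g) \<otimes> brC (e g) y = \<zero>"
    using C.leibniz_left[of y "e (inv\<^bsub>G\<^esub> g)" "e g"] assms by (simp add: e_inv br_one)
  then have "brC (e (inv\<^bsub>G\<^esub> g)) y \<otimes> e g = \<ominus> (e (inv\<^bsub>G\<^esub> g) \<otimes> brC (e g) y)"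
    using assms by (simp add: C.M.minus_equality)
  then have "(brC (e (inv\<^bsub>G\<^esub> g)) y \<otimes> e g) \<otimes> e (inv\<^bsub>G\<^esub> g) = \<ominus> (e (inv\<^bsub>G\<^esub> g) \<otimes> brC (e g) y) \<otimes> e (inv\<^bsub>G\<^esub> g)"
    by simp
  then show ?thesis
    using assms by (simp add: C.m_assoc e_inv C.l_minus C.mult_comm[of "brC (e g) y" "e (inv\<^bsub>G\<^esub> g)"])
qed

text \<open>The logarithmic derivative, formally the bracket with log g. This explains why it is a
  derivation of product and bracket, additive in g, and why any two of these operators
  commute.\<close>

definition d where "d g y = e (inv\<^bsub>G\<^esub> g) \<otimes> brC (e g) y"

lemma d_closed [simp]: "g \<in> carrier G \<Longrightarrow> y \<in> carrier C \<Longrightarrow> d g y \<in> carrier C"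
  by (simp add: d_def)

lemma d_linear: "g \<in> carrier G \<Longrightarrow> d g \<in> linear_maps K C C"
  unfolding d_def by (intro linear_maps_comp[OF bilinD(1)[OF C.br_bilin] C.linear_mult_left]) simp_all

lemma d_mult: "\<lbrakk>g \<in> carrier G; x \<in> carrier C; y \<in> carrier C\<rbrakk> \<Longrightarrow> d g (x \<otimes> y) = d g x \<otimes> y \<oplus> x \<otimes> d g y"
  unfolding d_def by (simp add: C.leibniz C.r_distr C.mult_ac)

text \<open>Besides the Jacobi identity, the factor g^-1 enters a bracket with the other argument.
  This contributes - g^-2 {g, x} {g, y} to one summand and the opposite to the other, so the
  contributions cancel.\<close>

lemma d_br: assumes "g \<in> carrier G" "x \<in> carrier C" "y \<in> carrier C"
  shows "d g (brC x y) = brC (d g x) y \<oplus> brC x (d g y)"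
proof -
  let ?f = "e (inv\<^bsub>G\<^esub> g)" and ?X = "brC (e g) x" and ?Y = "brC (e g) y"
  have xf: "brC x ?f = ?f \<otimes> (?f \<otimes> ?X)"
    using assms C.br_anti[of ?f x] by (simp add: br_e_inv)
  have 1: "brC (d g x) y = \<ominus> (?f \<otimes> (?f \<otimes> (?X \<otimes> ?Y))) \<oplus> ?f \<otimes> brC ?X y"
    unfolding d_def using assms by (simp add: C.leibniz_left br_e_inv C.l_minus C.m_assoc C.mult_comm[of ?Y ?X])
  have 2: "brC x (d g y) = ?f \<otimes> (?f \<otimes> (?X \<otimes> ?Y)) \<oplus> ?f \<otimes> brC x ?Y"
    unfolding d_def using assms by (simp add: C.leibniz xf C.m_assoc)
  have "d g (brC x y) = ?f \<otimes> brC ?X y \<oplus> ?f \<otimes> brC x ?Y"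
    unfolding d_def using assms by (simp add: C.br_derivation[of "e g" x y] C.r_distr)
  also have "\<dots> = brC (d g x) y \<oplus> brC x (d g y)"
  proof -
    have cancel: "a \<oplus> b = (\<ominus> c \<oplus> a) \<oplus> (c \<oplus> b)" if "a \<in> carrier C" "b \<in> carrier C" "c \<in> carrier C" for a b c
    proof -
      have "(\<ominus> c \<oplus> a) \<oplus> (c \<oplus> b) = (\<ominus> c \<oplus> c) \<oplus> (a \<oplus> b)"
        using that by (simp add: C.M.a_ac)
      then show ?thesis using that by (simp add: C.M.l_neg)
    qed
    show ?thesis unfolding 1 2 using assms by (intro cancel) simp_all
  qed
  finally show ?thesis .
qed

lemma d_add: "\<lbrakk>g \<in> carrier G; t \<in> carrier G; x \<in> carrier C\<rbrakk> \<Longrightarrow> d (g \<otimes>\<^bsub>G\<^esub> t) x = d g x \<oplus> d t x"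
proof -
  assume a: "g \<in> carrier G" "t \<in> carrier G" "x \<in> carrier C"
  have "d (g \<otimes>\<^bsub>G\<^esub> t) x = (e (inv\<^bsub>G\<^esub> g) \<otimes> e (inv\<^bsub>G\<^esub> t)) \<otimes> (brC (e g) x \<otimes> e t \<oplus> e g \<otimes> brC (e t) x)"
    unfolding d_def using a by (simp add: GE.G.inv_mult C.leibniz_left flip: e_mult)
  also have "\<dots> = e (inv\<^bsub>G\<^esub> g) \<otimes> ((e (inv\<^bsub>G\<^esub> t) \<otimes> e t) \<otimes> brC (e g) x) \<oplus>
      e (inv\<^bsub>G\<^esub> t) \<otimes> ((e (inv\<^bsub>G\<^esub> g) \<otimes> e g) \<otimes> brC (e t) x)"
    using a by (simp add: C.r_distr C.mult_ac)
  finally show ?thesis using a by (simp add: e_inv d_def)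
qed

lemma br_e_comm: "\<lbrakk>g \<in> carrier G; t \<in> carrier G; x \<in> carrier C\<rbrakk> \<Longrightarrow> brC (e g) (brC (e t) x) = brC (e t) (brC (e g) x)"
  by (simp add: C.br_derivation[of "e g" "e t" x] e_br C.br_zero)

lemma d_d: "\<lbrakk>g \<in> carrier G; t \<in> carrier G; x \<in> carrier C\<rbrakk> \<Longrightarrow>
    d g (d t x) = (e (inv\<^bsub>G\<^esub> g) \<otimes> e (inv\<^bsub>G\<^esub> t)) \<otimes> brC (e g) (brC (e t) x)"
  unfolding d_def by (simp add: C.leibniz e_br C.m_assoc)

lemma d_comm: "\<lbrakk>g \<in> carrier G; t \<in> carrier G; x \<in> carrier C\<rbrakk> \<Longrightarrow> d g (d t x) = d t (d g x)"
  by (simp add: d_d br_e_comm[of t g] C.mult_comm[of "e (inv\<^bsub>G\<^esub> t)"])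

text \<open>Since {y, g^-1} = g^-2 {g, y} and g has zero bracket with g^-1, both sides are g^-2 {g,
  {g, y}}. This links the last formula of the statement to the derivation.\<close>

lemma br_e_br: "\<lbrakk>g \<in> carrier G; y \<in> carrier C\<rbrakk> \<Longrightarrow> brC (e g) (brC y (e (inv\<^bsub>G\<^esub> g))) = d g (d g y)"
  by (simp add: d_d C.br_anti[of "e (inv\<^bsub>G\<^esub> g)" y] br_e_inv C.leibniz e_br C.m_assoc)

section \<open>The coaction of kG on C and its coinvariants R\<close>

sublocale TC: tens K C kG by (intro tens.intro C.asalg_axioms GE.kG_asalg)

abbreviation \<theta> where "\<theta> \<equiv> tlift K TC.T (\<lambda>a b. TC.pt a (\<pi> b))"

lemma \<theta>_bilin: "bilin K C C TC.T (\<lambda>a b. TC.pt a (\<pi> b))"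
  by (rule bilin_compose[OF TC.pt_bilin linear_maps_ident \<pi>_simps(1)])

lemma \<theta>_hom: "\<theta> \<in> alg_homs K C.A2 TC.T"
  by (rule C.T2.tlift_alg_hom[OF TC.T_asalg \<theta>_bilin]) (simp_all add: TC.pt_mult \<pi>_simps TC.T_one)

lemmas \<theta>_simps = C.T2.tlift_simps[OF TC.T.module_axioms \<theta>_bilin] alg_homsD(2,3)[OF \<theta>_hom]

text \<open>The right coaction of kG on C, an algebra map. Elements with \<rho>(x) = x \<otimes> g
  behave as homogeneous of degree g, and R is the part of degree 1.\<close>

abbreviation \<rho> where "\<rho> x \<equiv> \<theta> (comult C x)"

lemma \<rho>_hom: "\<rho> \<in> alg_homs K C TC.T"
  by (rule alg_homs_comp[OF C.comult_hom \<theta>_hom])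

lemmas \<rho>_simps = alg_homsD[OF \<rho>_hom] linear_mapsD[OF alg_homsD(1)[OF \<rho>_hom]]

abbreviation R where "R \<equiv> right_coinvariants K C kG \<pi>"

lemmas R_sel = right_coinvariants_sel[of K C kG \<pi>]

lemma R_mem: "x \<in> carrier R \<longleftrightarrow> x \<in> carrier C \<and> \<rho> x = TC.pt x \<one>\<^bsub>kG\<^esub>"
  by (simp add: R_sel)

lemma \<rho>_e: "g \<in> carrier G \<Longrightarrow> \<rho> (e g) = TC.pt (e g) (\<delta> g)"
  by (simp add: \<iota>_comult \<theta>_simps \<pi>_\<iota>)

text \<open>Of the two summands of the bracket of tensors, the one with a bracket in the second
  factor is killed by \<pi>. In the other, coinvariance of y replaces its second factor by
  1.\<close>

lemma \<rho>_br: assumes "x \<in> carrier C" "y \<in> carrier R"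
  shows "\<rho> (brC x y) = tlift K TC.T (\<lambda>a u. TC.pt (brC a y) u) (\<rho> x)"
proof -
  have y: "y \<in> carrier C" "\<rho> y = TC.pt y \<one>\<^bsub>kG\<^esub>" using assms(2) by (auto simp: R_mem)
  have M: "bilin K C kG TC.T (\<lambda>a u. TC.pt (brC a y) u)"
    by (rule bilin_compose[OF TC.pt_bilin bilinD(2)[OF C.br_bilin y(1)] linear_maps_ident])
  note Ml = TC.tlift_linear[OF TC.T.module_axioms M]
  have "\<theta> (C.tb s (comult C y)) = tlift K TC.T (\<lambda>a u. TC.pt (brC a y) u) (\<theta> s)" if "s \<in> carrier C.A2" for s
  proof (rule C.T2.T_linear_eq[OF TC.T.module_axioms linear_maps_comp[OF bilinD(2)[OF C.tb_bilin] C.T2.tlift_linear[OF TC.T.module_axioms \<theta>_bilin]]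
        linear_maps_comp[OF C.T2.tlift_linear[OF TC.T.module_axioms \<theta>_bilin] Ml] _ that])
    show "comult C y \<in> carrier C.A2" using y C.comult_simps by simp
    fix a b assume ab: "a \<in> carrier C" "b \<in> carrier C"
    have L: "bilin K C kG TC.T (\<lambda>c v. TC.pt (brC a c) (\<pi> b \<otimes>\<^bsub>kG\<^esub> v))"
      by (rule bilin_compose[OF TC.pt_bilin bilinD(1)[OF C.br_bilin ab(1)] GE.kG.linear_mult_left]) (simp add: \<pi>_simps ab)
    note Ls = TC.tlift_simps[OF TC.T.module_axioms L]
    have p: "C.T2.pt a b \<in> carrier C.A2" using ab by simp
    have "\<theta> (C.tb (C.T2.pt a b) t) = tlift K TC.T (\<lambda>c v. TC.pt (brC a c) (\<pi> b \<otimes>\<^bsub>kG\<^esub> v)) (\<theta> t)" if "t \<in> carrier C.A2" for t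
      by (rule C.T2.T_linear_eq[OF TC.T.module_axioms linear_maps_comp[OF bilinD(1)[OF C.tb_bilin p] C.T2.tlift_linear[OF TC.T.module_axioms \<theta>_bilin]]
        linear_maps_comp[OF C.T2.tlift_linear[OF TC.T.module_axioms \<theta>_bilin] TC.tlift_linear[OF TC.T.module_axioms L]] _ that])
        (use ab in \<open>simp add: C.tb_pt \<theta>_simps \<pi>_br \<pi>_simps TC.pt_zero Ls\<close>)
    then show "\<theta> (C.tb (C.T2.pt a b) (comult C y)) = tlift K TC.T (\<lambda>a u. TC.pt (brC a y) u) (\<theta> (C.T2.pt a b))"
      using ab y C.comult_simps by (simp add: Ls \<theta>_simps TC.tlift_pt[OF TC.T.module_axioms M] \<pi>_simps)
  qed
  then show ?thesis using assms(1) y(1) by (simp add: C.comult_br C.comult_simps)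
qed

lemma \<rho>_br_R: assumes "x \<in> carrier R" "y \<in> carrier R" shows "\<rho> (brC x y) = TC.pt (brC x y) \<one>\<^bsub>kG\<^esub>"
proof -
  have xy: "x \<in> carrier C" "y \<in> carrier C" "\<rho> x = TC.pt x \<one>\<^bsub>kG\<^esub>" using assms by (auto simp: R_mem)
  have M: "bilin K C kG TC.T (\<lambda>a u. TC.pt (brC a y) u)"
    by (rule bilin_compose[OF TC.pt_bilin bilinD(2)[OF C.br_bilin xy(2)] linear_maps_ident])
  show ?thesis using \<rho>_br[OF xy(1) assms(2)] xy by (simp add: TC.tlift_pt[OF TC.T.module_axioms M])
qed

lemma \<rho>_br_e: assumes "g \<in> carrier G" "y \<in> carrier R" shows "\<rho> (brC (e g) y) = TC.pt (brC (e g) y) (\<delta> g)"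
proof -
  have y: "y \<in> carrier C" using assms by (auto simp: R_mem)
  have M: "bilin K C kG TC.T (\<lambda>a u. TC.pt (brC a y) u)"
    by (rule bilin_compose[OF TC.pt_bilin bilinD(2)[OF C.br_bilin y] linear_maps_ident])
  show ?thesis using \<rho>_br[of "e g" y] assms by (simp add: TC.tlift_pt[OF TC.T.module_axioms M] \<rho>_e)
qed

lemma R_sub: "x \<in> carrier R \<Longrightarrow> x \<in> carrier C" by (simp add: R_sel)

text \<open>Under the coaction {g, y} has degree g and g^-1 has degree g^-1, so their product has
  degree 1.\<close>

lemma R_d: assumes "g \<in> carrier G" "y \<in> carrier R" shows "d g y \<in> carrier R"
  unfolding R_mem using assms R_sub[OF assms(2)]
  by (simp add: d_def \<rho>_simps \<rho>_e \<rho>_br_e TC.pt_mult GE.\<delta>_mult GE.kG_one)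

lemma R_br: "x \<in> carrier R \<Longrightarrow> y \<in> carrier R \<Longrightarrow> brC x y \<in> carrier R"
  unfolding R_mem[of "brC x y"] using R_sub by (simp add: \<rho>_br_R)

lemma R_asalg: "asalg K R"
proof (rule subalgebra_asalg[OF C.asalg_axioms _ R_sel(2-6)])
  show "carrier R \<subseteq> carrier C" using R_sub by blast
qed (auto simp: R_mem \<rho>_simps TC.T_one TC.pt_simps TC.pt_mult)

lemma R_poisson: "poisson_algebra K R brC"
proof -
  have "algebra K R"
    by (rule asalg_algebra[OF R_asalg]) (simp add: R_sel(2) R_sub C.mult_comm)
  then show ?thesis
    unfolding poisson_algebra_def
    by (intro conjI ballI linear_mapsI; simp add: R_br R_sel(2-6) R_sub C.br_simps C.br_self C.jacobi C.leibniz)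
qed

sublocale R: pois K R brC by (rule poisI[OF R_poisson])

sublocale DA: deriv_action K R brC G d
proof (unfold_locales)
  show "d g \<in> linear_maps K R R" if "g \<in> carrier G" for g
    using that linear_mapsD[OF d_linear[OF that]] by (intro linear_mapsI) (simp_all add: R_d R_sel(2-6) R_sub)
qed (simp_all add: R_sel(2-6) R_sub d_mult d_br d_add d_comm)

section \<open>The coaction of (kG)^e on C^e\<close>

abbreviation CE where "CE \<equiv> C.E"
abbreviation HE where "HE \<equiv> GE.H.E"
abbreviation \<iota>e where "\<iota>e \<equiv> env_map K kG GE.br0 C brC \<iota>"
abbreviation \<pi>e where "\<pi>e \<equiv> env_map K C brC kG GE.br0 \<pi>"

lemma \<iota>_bracket: "x \<in> carrier kG \<Longrightarrow> y \<in> carrier kG \<Longrightarrow> \<iota> (GE.br0 x y) = brC (\<iota> x) (\<iota> y)"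
  by (simp add: \<iota>_br linear_maps_zero[OF GE.kG.module_axioms C.module_axioms \<iota>_simps(1)])

lemma \<iota>e_hom: "\<iota>e \<in> alg_homs K HE CE"
  by (rule env_map_props(1)[OF GE.H.env_alg_axioms C.env_alg_axioms \<iota>_hom]) (rule \<iota>_bracket)

lemma \<iota>e_gens: "g \<in> carrier G \<Longrightarrow> \<iota>e (GE.gH g) = C.m (e g)" "g \<in> carrier G \<Longrightarrow> \<iota>e (GE.hH g) = C.h (e g)"
proof -
  assume g: "g \<in> carrier G"
  show "\<iota>e (GE.gH g) = C.m (e g)"
    by (rule env_map_props(2)[OF GE.H.env_alg_axioms C.env_alg_axioms \<iota>_hom]) (rule \<iota>_bracket, assumption+, simp add: g)
  show "\<iota>e (GE.hH g) = C.h (e g)"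
    by (rule env_map_props(3)[OF GE.H.env_alg_axioms C.env_alg_axioms \<iota>_hom]) (rule \<iota>_bracket, assumption+, simp add: g)
qed

lemma \<pi>e_hom: "\<pi>e \<in> alg_homs K CE HE"
  by (rule env_map_props(1)[OF C.env_alg_axioms GE.H.env_alg_axioms \<pi>_hom]) (rule \<pi>_br)

lemma \<pi>e_gens: "x \<in> carrier C \<Longrightarrow> \<pi>e (C.m x) = GE.H.m (\<pi> x)" "x \<in> carrier C \<Longrightarrow> \<pi>e (C.h x) = GE.H.h (\<pi> x)"
  by (rule env_map_props(2,3)[OF C.env_alg_axioms GE.H.env_alg_axioms \<pi>_hom]; simp add: \<pi>_br)+

lemmas \<iota>e_simps = alg_homsD[OF \<iota>e_hom] linear_mapsD[OF alg_homsD(1)[OF \<iota>e_hom]]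
lemmas \<pi>e_simps = alg_homsD[OF \<pi>e_hom] linear_mapsD[OF alg_homsD(1)[OF \<pi>e_hom]]

sublocale TE: tens K CE HE by (intro tens.intro C.E_asalg GE.H.E_asalg)

abbreviation \<Theta> where "\<Theta> \<equiv> tlift K TE.T (\<lambda>a b. TE.pt a (\<pi>e b))"

lemma \<Theta>_bilin: "bilin K CE CE TE.T (\<lambda>a b. TE.pt a (\<pi>e b))"
  by (rule bilin_compose[OF TE.pt_bilin linear_maps_ident \<pi>e_simps(1)])

lemma \<Theta>_hom: "\<Theta> \<in> alg_homs K C.EE TE.T"
  by (rule C.E2.tlift_alg_hom[OF TE.T_asalg \<Theta>_bilin]) (simp_all add: TE.pt_mult \<pi>e_simps TE.T_one)

lemmas \<Theta>_simps = C.E2.tlift_simps[OF TE.T.module_axioms \<Theta>_bilin]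

abbreviation \<rho>e where "\<rho>e z \<equiv> \<Theta> (C.\<Delta>E z)"

lemma \<rho>e_hom: "\<rho>e \<in> alg_homs K CE TE.T"
  by (rule alg_homs_comp[OF C.\<Delta>E_hom \<Theta>_hom])

lemmas \<rho>e_simps = alg_homsD[OF \<rho>e_hom] linear_mapsD[OF alg_homsD(1)[OF \<rho>e_hom]]

lemma \<rho>e_gens:
  assumes "g \<in> carrier G"
  shows "\<rho>e (C.m (e g)) = TE.pt (C.m (e g)) (GE.gH g)"
    "\<rho>e (C.h (e g)) = TE.pt (C.m (e g)) (GE.hH g) \<oplus>\<^bsub>TE.T\<^esub> TE.pt (C.h (e g)) (GE.gH g)"
  using assms by (simp_all add: C.\<Delta>E_grouplike[OF e_closed \<iota>_comult] \<Theta>_simps \<pi>e_gens \<pi>_\<iota>)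

text \<open>Projecting the second factor of \<mu> or \<eta> factors through the coaction \<theta> on
  C, so the values follow from \<rho>(x) = x \<otimes> 1. For h_x the additional summand contains
  h_1, which is zero.\<close>

lemma \<rho>e_R:
  assumes "x \<in> carrier R"
  shows "\<rho>e (C.m x) = TE.pt (C.m x) \<one>\<^bsub>HE\<^esub>" "\<rho>e (C.h x) = TE.pt (C.h x) \<one>\<^bsub>HE\<^esub>"
proof -
  have x: "x \<in> carrier C" "\<rho> x = TC.pt x \<one>\<^bsub>kG\<^esub>" "comult C x \<in> carrier C.A2"
    using assms C.comult_simps by (auto simp: R_mem)
  have N: "bilin K C kG TE.T (\<lambda>a u. TE.pt (C.m a) (GE.H.m u))"
    by (rule bilin_compose[OF TE.pt_bilin C.m_linear GE.H.m_linear])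
  have N': "bilin K C kG TE.T (\<lambda>a u. TE.pt (C.m a) (GE.H.h u) \<oplus>\<^bsub>TE.T\<^esub> TE.pt (C.h a) (GE.H.m u))"
    by (intro bilin_add TE.T.module_axioms bilin_compose[OF TE.pt_bilin C.m_linear GE.H.h_linear]
        bilin_compose[OF TE.pt_bilin C.h_linear GE.H.m_linear])
  note \<theta>l = C.T2.tlift_linear[OF TC.T.module_axioms \<theta>_bilin] and \<Theta>l = C.E2.tlift_linear[OF TE.T.module_axioms \<Theta>_bilin]
  have 1: "\<Theta> (C.\<mu> t) = tlift K TE.T (\<lambda>a u. TE.pt (C.m a) (GE.H.m u)) (\<theta> t)" if "t \<in> carrier C.A2" for t
    by (rule C.T2.T_linear_eq[OF TE.T.module_axioms linear_maps_comp[OF C.\<mu>_linear \<Theta>l]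
          linear_maps_comp[OF \<theta>l TC.tlift_linear[OF TE.T.module_axioms N]] _ that])
      (simp add: C.\<mu>_simps \<Theta>_simps \<theta>_simps TC.tlift_pt[OF TE.T.module_axioms N] \<pi>_simps \<pi>e_gens)
  have 2: "\<Theta> (C.\<eta> t) = tlift K TE.T (\<lambda>a u. TE.pt (C.m a) (GE.H.h u) \<oplus>\<^bsub>TE.T\<^esub> TE.pt (C.h a) (GE.H.m u)) (\<theta> t)"
    if "t \<in> carrier C.A2" for t
    by (rule C.T2.T_linear_eq[OF TE.T.module_axioms linear_maps_comp[OF C.\<eta>_linear \<Theta>l]
          linear_maps_comp[OF \<theta>l TC.tlift_linear[OF TE.T.module_axioms N']] _ that])
      (simp add: C.\<eta>_simps \<Theta>_simps \<theta>_simps TC.tlift_pt[OF TE.T.module_axioms N'] \<pi>_simps \<pi>e_gens)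
  show "\<rho>e (C.m x) = TE.pt (C.m x) \<one>\<^bsub>HE\<^esub>"
    using x 1[OF x(3)] by (simp add: C.\<Delta>E_m TC.tlift_pt[OF TE.T.module_axioms N] GE.H.m_one)
  have "GE.H.h \<one>\<^bsub>kG\<^esub> = \<zero>\<^bsub>HE\<^esub>" using GE.hH_one GE.kG_one by simp
  then show "\<rho>e (C.h x) = TE.pt (C.h x) \<one>\<^bsub>HE\<^esub>"
    using x 2[OF x(3)] by (simp add: C.\<Delta>E_h TC.tlift_pt[OF TE.T.module_axioms N'] GE.H.m_one TE.pt_zero)
qed

section \<open>The adjoint action of (kG)^e on C^e and on T\<close>

abbreviation (input) CE_mult (infixl "\<^bold>*" 70) where "x \<^bold>* y \<equiv> x \<otimes>\<^bsub>CE\<^esub> y"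
abbreviation (input) CE_add (infixl "\<^bold>+" 65) where "x \<^bold>+ y \<equiv> x \<oplus>\<^bsub>CE\<^esub> y"

text \<open>The adjoint action on all of C^e, freed from the record fields of the Hopf algebras.
  Working on C^e lets the generators m_y and h_y of every y in C be treated alike; stability of T is
  shown separately.\<close>

definition adE where "adE a z = tlift K CE (\<lambda>b c. \<iota>e b \<^bold>* z \<^bold>* \<iota>e (GE.SH c)) (GE.H.\<Delta>E a)"

abbreviation P where "P g \<equiv> C.m (e g)"
abbreviation Q where "Q g \<equiv> C.m (e (inv\<^bsub>G\<^esub> g))"
abbreviation U where "U g \<equiv> C.h (e g)"
abbreviation V where "V g \<equiv> C.h (e (inv\<^bsub>G\<^esub> g))"

lemma ad_bilin: assumes "z \<in> carrier CE" shows "bilin K HE HE CE (\<lambda>b c. \<iota>e b \<^bold>* z \<^bold>* \<iota>e (GE.SH c))"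
  by (rule bilin_compose[OF C.E.bilin_mult linear_maps_comp[OF \<iota>e_simps(1) C.E.linear_mult_right[OF assms]]
        linear_maps_comp[OF GE.SH_simps(1) \<iota>e_simps(1)]])

lemma adE_closed [simp]: "a \<in> carrier HE \<Longrightarrow> z \<in> carrier CE \<Longrightarrow> adE a z \<in> carrier CE"
  unfolding adE_def by (simp add: GE.H.E2.tlift_simps(1)[OF C.E.module_axioms ad_bilin] GE.H.\<Delta>E_simps)

lemma adE_linear': "z \<in> carrier CE \<Longrightarrow> (\<lambda>a. adE a z) \<in> linear_maps K HE CE"
  unfolding adE_def
  by (rule linear_maps_comp[OF GE.H.\<Delta>E_simps(1) GE.H.E2.tlift_linear[OF C.E.module_axioms ad_bilin]])

lemma adE_linear: assumes "a \<in> carrier HE" shows "adE a \<in> linear_maps K CE CE"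
proof (intro linear_mapsI)
  note L = GE.H.E2.tlift_linear[OF C.E.module_axioms ad_bilin] and Lp = GE.H.E2.tlift_pt[OF C.E.module_axioms ad_bilin]
  have \<Delta>: "GE.H.\<Delta>E a \<in> carrier GE.H.EE" using assms GE.H.\<Delta>E_simps by simp
  fix z assume z: "z \<in> carrier CE"
  show "adE a z \<in> carrier CE" using assms z by simp
  fix w assume w: "w \<in> carrier CE"
  show "adE a (z \<^bold>+ w) = adE a z \<^bold>+ adE a w"
    unfolding adE_def
    by (rule GE.H.E2.tlift_eqI[OF C.E.module_axioms ad_bilin linear_maps_add[OF C.E.module_axioms L L] _ \<Delta>])
      (use z w in \<open>simp_all add: Lp C.E.l_distr C.E.r_distr \<iota>e_simps GE.SH_simps\<close>)
next
  note L = GE.H.E2.tlift_linear[OF C.E.module_axioms ad_bilin] and Lp = GE.H.E2.tlift_pt[OF C.E.module_axioms ad_bilin]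
  have \<Delta>: "GE.H.\<Delta>E a \<in> carrier GE.H.EE" using assms GE.H.\<Delta>E_simps by simp
  fix c z assume z: "z \<in> carrier CE" and c: "c \<in> carrier K"
  show "adE a (c \<odot>\<^bsub>CE\<^esub> z) = c \<odot>\<^bsub>CE\<^esub> adE a z"
    unfolding adE_def
    by (rule GE.H.E2.tlift_eqI[OF C.E.module_axioms ad_bilin linear_maps_const_smult[OF C.E.module_axioms L] _ \<Delta>])
      (use z c in \<open>simp_all add: Lp C.E.smult_l C.E.smult_r \<iota>e_simps GE.SH_simps\<close>)
qed

text \<open>(kG)^e is commutative and its antipode multiplicative, so S(v c) = S(c) S(v) and both
  new factors come out at the two ends. This gives the multiplicativity of the adjoint action on
  generators.\<close>

lemma ad_shift:
  assumes "u \<in> carrier HE" "v \<in> carrier HE" "t \<in> carrier GE.H.EE" "z \<in> carrier CE"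
  shows "tlift K CE (\<lambda>b c. \<iota>e b \<^bold>* z \<^bold>* \<iota>e (GE.SH c)) (GE.H.ept u v \<otimes>\<^bsub>GE.H.EE\<^esub> t) =
    \<iota>e u \<^bold>* tlift K CE (\<lambda>b c. \<iota>e b \<^bold>* z \<^bold>* \<iota>e (GE.SH c)) t \<^bold>* \<iota>e (GE.SH v)"
proof -
  let ?L = "tlift K CE (\<lambda>b c. \<iota>e b \<^bold>* z \<^bold>* \<iota>e (GE.SH c))"
  note L = GE.H.E2.tlift_linear[OF C.E.module_axioms ad_bilin[OF assms(4)]]
    and Ls = GE.H.E2.tlift_simps[OF C.E.module_axioms ad_bilin[OF assms(4)]]
  have uv: "\<iota>e u \<in> carrier CE" "\<iota>e (GE.SH v) \<in> carrier CE" using assms by (simp_all add: \<iota>e_simps GE.SH_simps)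
  show ?thesis
  proof (rule GE.H.E2.T_linear_eq[OF C.E.module_axioms linear_maps_comp[OF GE.H.E2.T.linear_mult_left L]
        linear_maps_comp[OF linear_maps_comp[OF L C.E.linear_mult_left[OF uv(1)]] C.E.linear_mult_right[OF uv(2)]] _ assms(3)])
    show "GE.H.ept u v \<in> carrier GE.H.EE" using assms by simp
    fix b c assume bc: "b \<in> carrier HE" "c \<in> carrier HE"
    have "v \<otimes>\<^bsub>HE\<^esub> c = c \<otimes>\<^bsub>HE\<^esub> v" using assms bc by (simp add: GE.H_comm)
    then show "?L (GE.H.ept u v \<otimes>\<^bsub>GE.H.EE\<^esub> GE.H.ept b c) = \<iota>e u \<^bold>* ?L (GE.H.ept b c) \<^bold>* \<iota>e (GE.SH v)"
      using assms bc by (simp add: GE.H.E2.pt_mult Ls \<iota>e_simps GE.SH_simps C.E.m_assoc)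
  qed
qed

definition adg where "adg g w = P g \<^bold>* w \<^bold>* Q g"
definition adh where "adh g w = P g \<^bold>* w \<^bold>* V g \<^bold>+ U g \<^bold>* w \<^bold>* Q g"

lemma adE_gens:
  assumes "g \<in> carrier G" "a \<in> carrier HE" "z \<in> carrier CE"
  shows "adE (GE.gH g \<otimes>\<^bsub>HE\<^esub> a) z = adg g (adE a z)" "adE (GE.hH g \<otimes>\<^bsub>HE\<^esub> a) z = adh g (adE a z)"
  using assms unfolding adE_def adg_def adh_def
  by (simp_all add: GE.H.\<Delta>E_simps GE.\<Delta>H_gH GE.\<Delta>H_hH GE.H.E2.T.l_distr ad_shift
      GE.H.E2.tlift_simps[OF C.E.module_axioms ad_bilin] \<iota>e_gens GE.SH_gH GE.SH_hH)

lemma adE_one: "z \<in> carrier CE \<Longrightarrow> adE \<one>\<^bsub>HE\<^esub> z = z"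
  unfolding adE_def
  by (simp add: GE.H.\<Delta>E_simps GE.H.E2.T_one GE.H.E2.tlift_simps[OF C.E.module_axioms ad_bilin] \<iota>e_simps GE.SH_simps)

lemma adE_mult:
  assumes "a \<in> carrier HE" "b \<in> carrier HE" "z \<in> carrier CE"
  shows "adE (a \<otimes>\<^bsub>HE\<^esub> b) z = adE a (adE b z)"
  using assms(1)
  by (induction a rule: GE.H_induct)
    (simp_all add: assms(2,3) adE_one adE_gens GE.H.E.l_distr GE.H.E.smult_l GE.H.E.m_assoc linear_mapsD[OF adE_linear'])

abbreviation Ceh where "Ceh \<equiv> env_hopf K C brC"
abbreviation Hh where "Hh \<equiv> env_hopf K kG GE.br0"
abbreviation T where "T \<equiv> right_coinvariants K Ceh Hh \<pi>e"

lemmas Ce_sel = same_algebraD[OF env_hopf_same[of K C brC], symmetric]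
lemmas H_sel = same_algebraD[OF env_hopf_same[of K kG GE.br0], symmetric]

lemma Ceh_tensor:
  "tensor K Ceh Hh = TE.T" "ptensor K Ceh Hh = TE.pt"
  by (rule same_algebra_tensor[symmetric] same_algebra_ptensor[symmetric]; rule env_hopf_same)+

lemma T_sel: "carrier T = {z \<in> carrier CE. \<rho>e z = TE.pt z \<one>\<^bsub>HE\<^esub>}"
  "mult T = mult CE" "one T = one CE" "zero T = zero CE" "add T = add CE" "smult T = smult CE"
  unfolding right_coinvariants_sel Ceh_tensor Ce_sel H_sel env_hopf_sel by simp_all

lemma T_mem: "z \<in> carrier T \<longleftrightarrow> z \<in> carrier CE \<and> \<rho>e z = TE.pt z \<one>\<^bsub>HE\<^esub>"
  by (simp add: T_sel)

lemma T_sub: "z \<in> carrier T \<Longrightarrow> z \<in> carrier CE" by (simp add: T_mem)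

lemma T_closed:
  "\<one>\<^bsub>CE\<^esub> \<in> carrier T"
  "z \<in> carrier T \<Longrightarrow> w \<in> carrier T \<Longrightarrow> z \<^bold>+ w \<in> carrier T"
  "z \<in> carrier T \<Longrightarrow> w \<in> carrier T \<Longrightarrow> z \<^bold>* w \<in> carrier T"
  "c \<in> carrier K \<Longrightarrow> z \<in> carrier T \<Longrightarrow> c \<odot>\<^bsub>CE\<^esub> z \<in> carrier T"
  by (auto simp: T_mem \<rho>e_simps TE.T_one TE.pt_simps TE.pt_mult)

lemma T_gens: "y \<in> carrier R \<Longrightarrow> C.m y \<in> carrier T" "y \<in> carrier R \<Longrightarrow> C.h y \<in> carrier T"
  by (simp_all add: T_mem \<rho>e_R R_sub)

lemma T_asalg: "asalg K T"
proof (rule subalgebra_asalg[OF C.E_asalg _ T_sel(2-6)])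
  show "carrier T \<subseteq> carrier CE" using T_sub by blast
qed (auto intro: T_closed)

sublocale T: asalg K T by (rule T_asalg)

lemma PQ: assumes "g \<in> carrier G"
  shows "P g \<^bold>* Q g = \<one>\<^bsub>CE\<^esub>" "Q g \<^bold>* P g = \<one>\<^bsub>CE\<^esub>"
  using assms by (simp_all add: e_inv C.m_one flip: C.m_mult)

lemma PQ_l: assumes "g \<in> carrier G" "w \<in> carrier CE"
  shows "P g \<^bold>* (Q g \<^bold>* w) = w" "Q g \<^bold>* (P g \<^bold>* w) = w"
  using assms by (simp_all add: PQ flip: C.E.m_assoc)

lemma h_one: "C.h \<one> = \<zero>\<^bsub>CE\<^esub>"
proof -
  have "C.h \<one> = C.h \<one> \<^bold>+ C.h \<one>" using C.h_mult[of "\<one>" "\<one>"] by (simp add: C.m_one)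
  then show ?thesis by (metis C.E.M.add.r_cancel_one' C.h_closed C.one_closed)
qed

text \<open>Both identities are the product rule for h applied to g g^-1 = 1. The order of the
  factors can be changed because g and g^-1 have zero bracket.\<close>

lemma PV: assumes "g \<in> carrier G"
  shows "P g \<^bold>* V g \<^bold>+ U g \<^bold>* Q g = \<zero>\<^bsub>CE\<^esub>" "Q g \<^bold>* U g \<^bold>+ V g \<^bold>* P g = \<zero>\<^bsub>CE\<^esub>"
proof -
  have "C.h (e g \<otimes> e (inv\<^bsub>G\<^esub> g)) = \<zero>\<^bsub>CE\<^esub>" "C.h (e (inv\<^bsub>G\<^esub> g) \<otimes> e g) = \<zero>\<^bsub>CE\<^esub>"
    using assms by (simp_all add: e_inv h_one)
  then have "Q g \<^bold>* U g \<^bold>+ P g \<^bold>* V g = \<zero>\<^bsub>CE\<^esub>" "P g \<^bold>* V g \<^bold>+ Q g \<^bold>* U g = \<zero>\<^bsub>CE\<^esub>"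
    using assms by (simp_all add: C.h_mult)
  moreover have "U g \<^bold>* Q g = Q g \<^bold>* U g" "V g \<^bold>* P g = P g \<^bold>* V g"
    using assms C.hm_swap(1)[of "e g" "e (inv\<^bsub>G\<^esub> g)"] C.hm_swap(1)[of "e (inv\<^bsub>G\<^esub> g)" "e g"] by (simp_all add: e_br C.m_lin_simps)
  ultimately show "P g \<^bold>* V g \<^bold>+ U g \<^bold>* Q g = \<zero>\<^bsub>CE\<^esub>" "Q g \<^bold>* U g \<^bold>+ V g \<^bold>* P g = \<zero>\<^bsub>CE\<^esub>"
    by simp_all
qed

lemma adg_T: assumes "g \<in> carrier G" "w \<in> carrier T" shows "adg g w \<in> carrier T"
  using assms T_sub[OF assms(2)] unfolding T_mem
  by (simp add: adg_def \<rho>e_simps \<rho>e_gens TE.pt_mult GE.gH_inv)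

text \<open>The terms with a generator h in the second factor have the same first factor g w g^-1,
  and their second factors add up to zero by \<open>hH_inv\<close>. The rest is the element itself
  tensored with 1.\<close>

lemma adh_T: assumes g: "g \<in> carrier G" and w: "w \<in> carrier T" shows "adh g w \<in> carrier T"
proof -
  have w': "w \<in> carrier CE" "\<rho>e w = TE.pt w \<one>\<^bsub>HE\<^esub>" using w by (simp_all add: T_mem)
  have V: "\<rho>e (V g) = TE.pt (Q g) (GE.hH (inv\<^bsub>G\<^esub> g)) \<oplus>\<^bsub>TE.T\<^esub> TE.pt (V g) (GE.gH (inv\<^bsub>G\<^esub> g))"
    and Q: "\<rho>e (Q g) = TE.pt (Q g) (GE.gH (inv\<^bsub>G\<^esub> g))"
    using g \<rho>e_gens[of "inv\<^bsub>G\<^esub> g"] by simp_all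
  let ?x = "P g \<^bold>* w \<^bold>* Q g" and ?y = "P g \<^bold>* w \<^bold>* V g" and ?z = "U g \<^bold>* w \<^bold>* Q g"
  have "\<rho>e (adh g w) = (TE.pt ?x (GE.gH g \<otimes>\<^bsub>HE\<^esub> GE.hH (inv\<^bsub>G\<^esub> g)) \<oplus>\<^bsub>TE.T\<^esub> TE.pt ?y \<one>\<^bsub>HE\<^esub>) \<oplus>\<^bsub>TE.T\<^esub>
      (TE.pt ?x (GE.hH g \<otimes>\<^bsub>HE\<^esub> GE.gH (inv\<^bsub>G\<^esub> g)) \<oplus>\<^bsub>TE.T\<^esub> TE.pt ?z \<one>\<^bsub>HE\<^esub>)"
    unfolding adh_def using g w'
    by (simp add: \<rho>e_simps \<rho>e_gens V Q TE.pt_mult TE.T.l_distr TE.T.r_distr GE.gH_inv)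
  also have "\<dots> = TE.pt ?x (GE.gH g \<otimes>\<^bsub>HE\<^esub> GE.hH (inv\<^bsub>G\<^esub> g) \<oplus>\<^bsub>HE\<^esub> GE.hH g \<otimes>\<^bsub>HE\<^esub> GE.gH (inv\<^bsub>G\<^esub> g)) \<oplus>\<^bsub>TE.T\<^esub>
      TE.pt (?y \<^bold>+ ?z) \<one>\<^bsub>HE\<^esub>"
    using g w' by (simp add: TE.pt_simps TE.T.M.a_ac)
  also have "GE.gH g \<otimes>\<^bsub>HE\<^esub> GE.hH (inv\<^bsub>G\<^esub> g) \<oplus>\<^bsub>HE\<^esub> GE.hH g \<otimes>\<^bsub>HE\<^esub> GE.gH (inv\<^bsub>G\<^esub> g) = \<zero>\<^bsub>HE\<^esub>"
    using g GE.hH_inv[OF g] by (simp add: GE.H_comm[of "GE.hH g"])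
  finally show ?thesis using g w' unfolding T_mem by (simp add: TE.pt_zero adh_def)
qed

lemma adE_T: assumes "a \<in> carrier HE" "z \<in> carrier T" shows "adE a z \<in> carrier T"
  using assms(1)
  by (induction a rule: GE.H_induct)
    (simp_all add: assms(2) T_sub adE_one adE_gens adg_T adh_T T_closed linear_mapsD[OF adE_linear'])

abbreviation ad where "ad \<equiv> adjoint_action K Hh Ceh \<iota>e"

lemma ad_eq: "ad a z = adE a z"
  unfolding adjoint_action_def adE_def env_hopf_sel Ce_sel same_algebra_tlift[OF env_hopf_same, symmetric] ..

lemma linear_maps_Hh: "linear_maps K Hh W = linear_maps K HE W"
  by (rule same_algebra_linear_maps[OF same_algebra_sym[OF env_hopf_same]]) (simp add: same_algebra_def)

lemma T_left_module: "left_module K Hh T ad"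
  unfolding left_module_def linear_maps_Hh H_sel ad_eq
proof (intro conjI ballI T.module_axioms)
  show "adE a \<in> linear_maps K T T" if "a \<in> carrier HE" for a
    using that linear_mapsD[OF adE_linear[OF that]] by (intro linear_mapsI) (simp_all add: T_sel(2-6) adE_T T_sub)
  show "(\<lambda>a. adE a v) \<in> linear_maps K HE T" if "v \<in> carrier T" for v
    using that linear_mapsD[OF adE_linear'[OF T_sub[OF that]]] by (intro linear_mapsI) (simp_all add: T_sel(2-6) adE_T)
qed (simp_all add: adE_one adE_mult T_sub)

section \<open>The map from R^e to T and its compatibility with the actions\<close>

abbreviation \<Psi> where "\<Psi> \<equiv> env_map K R brC C brC (\<lambda>y. y)"

lemma inclusion_hom: "(\<lambda>y. y) \<in> alg_homs K R C"
  by (intro alg_homsI linear_mapsI) (simp_all add: R_sel(2-6) R_sub)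

lemma \<Psi>_hom: "\<Psi> \<in> alg_homs K R.E CE"
  by (rule env_map_props(1)[OF R.env_alg_axioms C.env_alg_axioms inclusion_hom]) (rule refl)

lemma \<Psi>_gens: "y \<in> carrier R \<Longrightarrow> \<Psi> (R.m y) = C.m y" "y \<in> carrier R \<Longrightarrow> \<Psi> (R.h y) = C.h y"
proof -
  assume y: "y \<in> carrier R"
  show "\<Psi> (R.m y) = C.m y"
    by (rule env_map_props(2)[OF R.env_alg_axioms C.env_alg_axioms inclusion_hom _ y]) (rule refl)
  show "\<Psi> (R.h y) = C.h y"
    by (rule env_map_props(3)[OF R.env_alg_axioms C.env_alg_axioms inclusion_hom _ y]) (rule refl)
qed

lemmas \<Psi>_simps = alg_homsD[OF \<Psi>_hom] linear_mapsD[OF alg_homsD(1)[OF \<Psi>_hom]]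

lemma \<Psi>_T: "v \<in> carrier R.E \<Longrightarrow> \<Psi> v \<in> carrier T"
  by (induction v rule: R.E_induct) (simp_all add: \<Psi>_simps \<Psi>_gens T_closed T_gens)

lemma \<Psi>_linear: "\<Psi> \<in> linear_maps K R.E T"
  by (intro linear_mapsI) (simp_all add: T_sel(2-6) \<Psi>_T \<Psi>_simps)

text \<open>Conjugation by g is an automorphism. It fixes m_y as C is commutative, and moving g past
  h_y leaves the bracket {g, y}, which the factor g^-1 turns into d y.\<close>

lemma adg_simps:
  assumes "g \<in> carrier G"
  shows "adg g \<one>\<^bsub>CE\<^esub> = \<one>\<^bsub>CE\<^esub>"
    "u \<in> carrier CE \<Longrightarrow> w \<in> carrier CE \<Longrightarrow> adg g (u \<^bold>* w) = adg g u \<^bold>* adg g w"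
    "u \<in> carrier CE \<Longrightarrow> w \<in> carrier CE \<Longrightarrow> adg g (u \<^bold>+ w) = adg g u \<^bold>+ adg g w"
    "y \<in> carrier C \<Longrightarrow> adg g (C.m y) = C.m y"
    "y \<in> carrier C \<Longrightarrow> adg g (C.h y) = C.h y \<^bold>+ C.m (d g y)"
proof -
  show "adg g \<one>\<^bsub>CE\<^esub> = \<one>\<^bsub>CE\<^esub>" using assms by (simp add: adg_def PQ)
  show "u \<in> carrier CE \<Longrightarrow> w \<in> carrier CE \<Longrightarrow> adg g (u \<^bold>* w) = adg g u \<^bold>* adg g w"
    using assms by (simp add: adg_def C.E.m_assoc PQ_l)
  show "u \<in> carrier CE \<Longrightarrow> w \<in> carrier CE \<Longrightarrow> adg g (u \<^bold>+ w) = adg g u \<^bold>+ adg g w"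
    using assms by (simp add: adg_def C.E.l_distr C.E.r_distr)
  show "adg g (C.m y) = C.m y" if y: "y \<in> carrier C"
  proof -
    have "P g \<^bold>* C.m y = C.m y \<^bold>* P g"
      using assms y by (simp add: C.mult_comm[of "e g" y] flip: C.m_mult)
    then show ?thesis using assms y by (simp add: adg_def C.E.m_assoc PQ)
  qed
  show "adg g (C.h y) = C.h y \<^bold>+ C.m (d g y)" if y: "y \<in> carrier C"
    using assms y C.hm_swap(2)[of "e g" y]
    by (simp add: adg_def C.E.l_distr C.E.m_assoc d_def C.mult_comm[of "e (inv\<^bsub>G\<^esub> g)"] e_inv C.m_one flip: C.m_mult)
qed

text \<open>By \<open>PV\<close> the terms with y or h_y in front of the generators of g cancel, so
  only commutators contribute to the values on generators.\<close>

lemma adh_simps: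
  assumes g: "g \<in> carrier G"
  shows "adh g \<one>\<^bsub>CE\<^esub> = \<zero>\<^bsub>CE\<^esub>"
    "u \<in> carrier CE \<Longrightarrow> w \<in> carrier CE \<Longrightarrow> adh g (u \<^bold>* w) = adg g u \<^bold>* adh g w \<^bold>+ adh g u \<^bold>* adg g w"
    "u \<in> carrier CE \<Longrightarrow> w \<in> carrier CE \<Longrightarrow> adh g (u \<^bold>+ w) = adh g u \<^bold>+ adh g w"
    "y \<in> carrier C \<Longrightarrow> adh g (C.m y) = C.m (d g y)"
    "y \<in> carrier C \<Longrightarrow> adh g (C.h y) = C.h (d g y) \<^bold>+ C.m (brC (e g) (brC y (e (inv\<^bsub>G\<^esub> g))))"
proof -
  show "adh g \<one>\<^bsub>CE\<^esub> = \<zero>\<^bsub>CE\<^esub>" using g by (simp add: adh_def PV)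
  show "u \<in> carrier CE \<Longrightarrow> w \<in> carrier CE \<Longrightarrow> adh g (u \<^bold>+ w) = adh g u \<^bold>+ adh g w"
    using g by (simp add: adh_def C.E.l_distr C.E.r_distr C.E.M.a_ac)
  show "adh g (u \<^bold>* w) = adg g u \<^bold>* adh g w \<^bold>+ adh g u \<^bold>* adg g w"
    if uw: "u \<in> carrier CE" "w \<in> carrier CE"
  proof -
    \<comment> \<open>The element g^-1 h_g + h_{g^-1} g, which is zero, is placed between u and w.
      Its two terms are the cross terms of the product rule.\<close>
    have "P g \<^bold>* (u \<^bold>* ((Q g \<^bold>* U g \<^bold>+ V g \<^bold>* P g) \<^bold>* (w \<^bold>* Q g))) = \<zero>\<^bsub>CE\<^esub>"
      using g uw by (simp only: PV) simp
    then have z: "P g \<^bold>* (u \<^bold>* (Q g \<^bold>* (U g \<^bold>* (w \<^bold>* Q g)))) \<^bold>+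
        P g \<^bold>* (u \<^bold>* (V g \<^bold>* (P g \<^bold>* (w \<^bold>* Q g)))) = \<zero>\<^bsub>CE\<^esub>" (is "?a \<^bold>+ ?b = _")
      using g uw by (simp add: C.E.l_distr C.E.r_distr C.E.m_assoc)
    let ?c = "P g \<^bold>* (u \<^bold>* (w \<^bold>* V g))" and ?f = "U g \<^bold>* (u \<^bold>* (w \<^bold>* Q g))"
    have "adg g u \<^bold>* adh g w \<^bold>+ adh g u \<^bold>* adg g w = (?c \<^bold>+ ?a) \<^bold>+ (?b \<^bold>+ ?f)"
      using g uw by (simp add: adg_def adh_def C.E.l_distr C.E.r_distr C.E.m_assoc PQ_l)
    also have "\<dots> = ?c \<^bold>+ (?a \<^bold>+ ?b) \<^bold>+ ?f" using g uw by (simp add: C.E.M.a_assoc)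
    also have "\<dots> = ?c \<^bold>+ ?f" unfolding z using g uw by simp
    also have "\<dots> = adh g (u \<^bold>* w)" using g uw by (simp add: adh_def C.E.m_assoc)
    finally show ?thesis by simp
  qed
  show "adh g (C.m y) = C.m (d g y)" if y: "y \<in> carrier C"
  proof -
    have 1: "P g \<^bold>* C.m y = C.m y \<^bold>* P g"
      using g y by (simp add: C.mult_comm[of "e g" y] flip: C.m_mult)
    \<comment> \<open>g commutes with m_y, and moving h_g past m_y produces {g, y}; the terms that
      begin with m_y cancel by \<open>PV\<close>.\<close>
    have "adh g (C.m y) = C.m y \<^bold>* (P g \<^bold>* V g \<^bold>+ U g \<^bold>* Q g) \<^bold>+ C.m (brC (e g) y) \<^bold>* Q g"
      using g y by (simp add: adh_def 1 C.hm_swap(1)[of "e g" y] C.E.l_distr C.E.r_distr C.E.m_assoc C.E.M.a_assoc)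
    also have "\<dots> = C.m (brC (e g) y) \<^bold>* Q g" using g y by (simp add: PV)
    also have "\<dots> = C.m (d g y)" using g y by (simp add: d_def C.mult_comm[of "e (inv\<^bsub>G\<^esub> g)"] flip: C.m_mult)
    finally show ?thesis .
  qed
  show "adh g (C.h y) = C.h (d g y) \<^bold>+ C.m (brC (e g) (brC y (e (inv\<^bsub>G\<^esub> g))))" if y: "y \<in> carrier C"
  proof -
    let ?Y = "brC (e g) y" and ?f = "e (inv\<^bsub>G\<^esub> g)"
    have fY: "brC ?Y ?f = brC (e g) (brC y ?f)"
      using g y by (simp add: C.br_derivation[of "e g" y ?f] e_br C.br_zero)
    have "adh g (C.h y) = C.h y \<^bold>* (P g \<^bold>* V g \<^bold>+ U g \<^bold>* Q g) \<^bold>+ (C.m ?Y \<^bold>* V g \<^bold>+ C.h ?Y \<^bold>* Q g)"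
      using g y by (simp add: adh_def C.hm_swap(2)[of "e g" y] C.hm_swap(3)[of "e g" y] C.E.l_distr C.E.r_distr C.E.m_assoc C.E.M.a_ac)
    also have "\<dots> = C.m ?Y \<^bold>* V g \<^bold>+ C.h ?Y \<^bold>* Q g" using g y by (simp add: PV)
    \<comment> \<open>Moving g^-1 in front of the generator h of {g, y} costs the bracket of {g, y}
      with g^-1. The remaining two terms are the product rule for h of g^-1 {g, y}.\<close>
    also have "\<dots> = (C.m ?Y \<^bold>* C.h ?f \<^bold>+ C.m ?f \<^bold>* C.h ?Y) \<^bold>+ C.m (brC ?Y ?f)"
      using g y by (simp add: C.hm_swap(1)[of ?Y ?f] C.E.M.a_ac)
    also have "C.m ?Y \<^bold>* C.h ?f \<^bold>+ C.m ?f \<^bold>* C.h ?Y = C.h (d g y)"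
      unfolding d_def using g y by (simp add: C.h_mult)
    finally show ?thesis by (simp only: fY)
  qed
qed

definition acts where
  "acts act \<longleftrightarrow> module_algebra K Hh R.E act \<and>
      (\<forall>g\<in>carrier G. \<forall>y\<in>carrier R.
         act (GE.gH g) (R.m y) = R.m y \<and>
         act (GE.gH g) (R.h y) = R.h y \<oplus>\<^bsub>R.E\<^esub> R.m (d g y) \<and>
         act (GE.hH g) (R.m y) = R.m (d g y) \<and>
         act (GE.hH g) (R.h y) = R.h (d g y) \<oplus>\<^bsub>R.E\<^esub> R.m (brC (e g) (brC y (inv (e g)))))"

lemma acts_exists: "\<exists>act. acts act"
  using DA.module_algebra_exists unfolding acts_def by (simp add: m_inv_e br_e_br R_sub)

text \<open>The action is arbitrary, but the product rule of a module algebra determines the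
  operators of g and h_g on R^e from their values on generators. They are matched with
  \<open>adg\<close> and \<open>adh\<close> by induction over R^e, and an induction over (kG)^e
  gives the rest.\<close>

lemma acts_module_hom:
  assumes "acts act"
  shows "\<Psi> \<in> module_homs K Hh R.E act T ad"
proof -
  have ma: "module_algebra K Hh R.E act" using assms unfolding acts_def by (rule conjunct1)
  note ma' = ma[unfolded module_algebra_def H_sel env_hopf_sel]
  note lm = ma'[THEN conjunct2, THEN conjunct1, unfolded left_module_def H_sel linear_maps_Hh, THEN conjunct2]
  have lin: "act a \<in> linear_maps K R.E R.E" if "a \<in> carrier HE" for a
    by (rule lm[THEN conjunct1, THEN bspec, OF that])
  have lin': "(\<lambda>a. act a v) \<in> linear_maps K HE R.E" if "v \<in> carrier R.E" for v
    by (rule lm[THEN conjunct2, THEN conjunct1, THEN bspec, OF that])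
  have act1: "act \<one>\<^bsub>HE\<^esub> v = v" if "v \<in> carrier R.E" for v
    by (rule lm[THEN conjunct2, THEN conjunct2, THEN conjunct1, THEN bspec, OF that])
  have actm: "act (a \<otimes>\<^bsub>HE\<^esub> b) v = act a (act b v)" if "a \<in> carrier HE" "b \<in> carrier HE" "v \<in> carrier R.E" for a b v
    by (rule lm[THEN conjunct2, THEN conjunct2, THEN conjunct2, THEN bspec, THEN bspec, THEN bspec, OF that])
  note ma2 = ma'[THEN conjunct2, THEN conjunct2]
  have actp: "act a (x \<otimes>\<^bsub>R.E\<^esub> y) = tlift K R.E (\<lambda>b c. act b x \<otimes>\<^bsub>R.E\<^esub> act c y) (GE.H.\<Delta>E a)"
    if "a \<in> carrier HE" "x \<in> carrier R.E" "y \<in> carrier R.E" for a x y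
    by (rule ma2[THEN conjunct1, THEN bspec, THEN bspec, THEN bspec, OF that])
  have acto: "act a \<one>\<^bsub>R.E\<^esub> = GE.\<epsilon>H a \<odot>\<^bsub>R.E\<^esub> \<one>\<^bsub>R.E\<^esub>" if "a \<in> carrier HE" for a
    by (rule ma2[THEN conjunct2, THEN bspec, OF that])
  have gens: "act (GE.gH g) (R.m y) = R.m y" "act (GE.gH g) (R.h y) = R.h y \<oplus>\<^bsub>R.E\<^esub> R.m (d g y)"
     "act (GE.hH g) (R.m y) = R.m (d g y)"
     "act (GE.hH g) (R.h y) = R.h (d g y) \<oplus>\<^bsub>R.E\<^esub> R.m (brC (e g) (brC y (e (inv\<^bsub>G\<^esub> g))))"
    if "g \<in> carrier G" "y \<in> carrier R" for g y
    using assms that unfolding acts_def by (simp_all add: m_inv_e)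
  have bil: "bilin K HE HE R.E (\<lambda>b c. act b x \<otimes>\<^bsub>R.E\<^esub> act c y)" if "x \<in> carrier R.E" "y \<in> carrier R.E" for x y
    by (rule bilin_compose[OF R.E.bilin_mult lin'[OF that(1)] lin'[OF that(2)]])
  note closed = linear_mapsD(1)[OF lin]
  \<comment> \<open>The coproducts of g and h_g turn the module algebra axiom into the same product
    rules that hold for \<open>adg\<close> and \<open>adh\<close>.\<close>
  have prods: "act (GE.gH g) (x \<otimes>\<^bsub>R.E\<^esub> y) = act (GE.gH g) x \<otimes>\<^bsub>R.E\<^esub> act (GE.gH g) y"
    "act (GE.hH g) (x \<otimes>\<^bsub>R.E\<^esub> y) = act (GE.gH g) x \<otimes>\<^bsub>R.E\<^esub> act (GE.hH g) y \<oplus>\<^bsub>R.E\<^esub> act (GE.hH g) x \<otimes>\<^bsub>R.E\<^esub> act (GE.gH g) y"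
    if "g \<in> carrier G" "x \<in> carrier R.E" "y \<in> carrier R.E" for g x y
    using that by (simp_all add: actp GE.\<Delta>H_gH GE.\<Delta>H_hH GE.H.E2.tlift_simps[OF R.E.module_axioms bil])
  have q: "brC (e g) (brC y (e (inv\<^bsub>G\<^esub> g))) \<in> carrier R" if "g \<in> carrier G" "y \<in> carrier R" for g y
    using that by (simp add: br_e_br R_sub R_d)
  have g: "\<Psi> (act (GE.gH g) v) = adg g (\<Psi> v)" if "g \<in> carrier G" "v \<in> carrier R.E" for g v
    using that(2)
  proof (induction v rule: R.E_induct)
    case one then show ?case using that by (simp add: acto GE.\<epsilon>H_gH \<Psi>_simps adg_simps)
  next
    case (add z w) then show ?case using that by (simp add: linear_mapsD[OF lin] \<Psi>_simps adg_simps)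
  next
    case (m y z) then show ?case using that by (simp add: prods gens closed \<Psi>_simps \<Psi>_gens adg_simps R_sub)
  next
    case (h y z) then show ?case using that by (simp add: prods gens closed \<Psi>_simps \<Psi>_gens adg_simps R_sub R_d)
  qed
  have h: "\<Psi> (act (GE.hH g) v) = adh g (\<Psi> v)" if "g \<in> carrier G" "v \<in> carrier R.E" for g v
    using that(2)
  proof (induction v rule: R.E_induct)
    case one
    then show ?case
      using that by (simp add: acto GE.\<epsilon>H_hH \<Psi>_simps adh_simps linear_maps_zero[OF R.E.module_axioms C.E.module_axioms \<Psi>_simps(1)])
  next
    case (add z w) then show ?case using that by (simp add: linear_mapsD[OF lin] \<Psi>_simps adh_simps)
  next
    case (m y z) then show ?case using that by (simp add: prods gens closed \<Psi>_simps \<Psi>_gens adg_simps adh_simps R_sub R_d g)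
  next
    case (h y z) then show ?case using that by (simp add: prods gens closed \<Psi>_simps \<Psi>_gens adg_simps adh_simps R_sub R_d q g)
  qed
  have "\<Psi> (act a v) = adE a (\<Psi> v)" if "a \<in> carrier HE" "v \<in> carrier R.E" for a v
    using that(1)
  proof (induction a rule: GE.H_induct)
    case one then show ?case using that by (simp add: act1 adE_one \<Psi>_simps)
  next
    case (add z w)
    then show ?case using that by (simp add: linear_mapsD[OF lin'] linear_mapsD[OF adE_linear'] \<Psi>_simps)
  next
    case (smult c z)
    then show ?case using that by (simp add: linear_mapsD[OF lin'] linear_mapsD[OF adE_linear'] \<Psi>_simps)
  next
    case (g t z) then show ?case using that by (simp add: actm adE_gens closed \<open>\<And>g v. g \<in> carrier G \<Longrightarrow> v \<in> carrier R.E \<Longrightarrow> \<Psi> (act (GE.gH g) v) = adg g (\<Psi> v)\<close> \<Psi>_simps)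
  next
    case (h t z) then show ?case using that by (simp add: actm adE_gens closed \<open>\<And>g v. g \<in> carrier G \<Longrightarrow> v \<in> carrier R.E \<Longrightarrow> \<Psi> (act (GE.hH g) v) = adh g (\<Psi> v)\<close> \<Psi>_simps)
  qed
  then show ?thesis
    unfolding module_homs_def H_sel using \<Psi>_linear by (simp add: ad_eq)
qed

theorem boson_main:
  "(\<exists>act. acts act) \<and> left_module K Hh T ad \<and> (\<forall>act. acts act \<longrightarrow> \<Psi> \<in> module_homs K Hh R.E act T ad)"
  using acts_exists T_left_module acts_module_hom by blast

end

section \<open>Retractions and separating functionals\<close>

context
  fixes K :: "('k, 'r) ring_scheme" and V :: "('k, 'v, 'c) module_scheme" (structure)
  assumes V_module: "module K V"
begin

interpretation module K V by (rule V_module)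

text \<open>The enlargement step in the Zorn argument. With a zero or finitely spanned submodule it
  also yields lines and spans of lists.\<close>

lemma submodule_sum_line:
  assumes "submodule M K V" "x \<in> carrier V"
  shows "submodule {m \<oplus> c \<odot> x | m c. m \<in> M \<and> c \<in> carrier K} K V"
proof -
  note ME = submoduleE[OF assms(1)]
  have sub: "m \<in> carrier V" if "m \<in> M" for m using ME that by blast
  show ?thesis
  proof (rule submoduleI)
    show "{m \<oplus> c \<odot> x | m c. m \<in> M \<and> c \<in> carrier K} \<subseteq> carrier V" using sub assms(2) by auto
    have "\<zero> = \<zero> \<oplus> \<zero>\<^bsub>K\<^esub> \<odot> x" using assms(2) by simp
    then show "\<zero> \<in> {m \<oplus> c \<odot> x | m c. m \<in> M \<and> c \<in> carrier K}"
      using submodule_zero[OF V_module assms(1)] R.zero_closed by blast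
  next
    fix a assume "a \<in> {m \<oplus> c \<odot> x | m c. m \<in> M \<and> c \<in> carrier K}"
    then obtain m c where a: "a = m \<oplus> c \<odot> x" "m \<in> M" "c \<in> carrier K" by blast
    then have "\<ominus> a = (\<ominus> m) \<oplus> (\<ominus>\<^bsub>K\<^esub> c) \<odot> x"
      using sub assms(2) by (simp add: M.minus_add smult_l_minus)
    then show "\<ominus> a \<in> {m \<oplus> c \<odot> x | m c. m \<in> M \<and> c \<in> carrier K}"
      using ME(3)[OF a(2)] R.a_inv_closed[OF a(3)] by blast
  next
    fix a b assume "a \<in> {m \<oplus> c \<odot> x | m c. m \<in> M \<and> c \<in> carrier K}"
      "b \<in> {m \<oplus> c \<odot> x | m c. m \<in> M \<and> c \<in> carrier K}"
    then obtain m c m' c' where a: "a = m \<oplus> c \<odot> x" "m \<in> M" "c \<in> carrier K"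
      and b: "b = m' \<oplus> c' \<odot> x" "m' \<in> M" "c' \<in> carrier K" by blast
    have "a \<oplus> b = (m \<oplus> m') \<oplus> (c \<oplus>\<^bsub>K\<^esub> c') \<odot> x"
      using a b sub assms(2) by (simp add: smult_l_distr M.a_ac)
    then show "a \<oplus> b \<in> {m \<oplus> c \<odot> x | m c. m \<in> M \<and> c \<in> carrier K}"
      using ME(5)[OF a(2) b(2)] R.a_closed[OF a(3) b(3)] by blast
  next
    fix k a assume k: "k \<in> carrier K" and "a \<in> {m \<oplus> c \<odot> x | m c. m \<in> M \<and> c \<in> carrier K}"
    then obtain m c where a: "a = m \<oplus> c \<odot> x" "m \<in> M" "c \<in> carrier K" by blast
    have "k \<odot> a = (k \<odot> m) \<oplus> (k \<otimes>\<^bsub>K\<^esub> c) \<odot> x"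
      using a k sub assms(2) by (simp add: smult_r_distr smult_assoc1)
    then show "k \<odot> a \<in> {m \<oplus> c \<odot> x | m c. m \<in> M \<and> c \<in> carrier K}"
      using ME(4)[OF k a(2)] R.m_closed[OF k a(3)] by blast
  qed
qed

lemma Union_chain_submodule:
  assumes "subset.chain {M. submodule M K V} Ch" "Ch \<noteq> {}"
  shows "submodule (\<Union>Ch) K V"
proof -
  have sm: "submodule M K V" if "M \<in> Ch" for M
    using assms(1) that unfolding subset.chain_def by blast
  show ?thesis
  proof (rule submoduleI)
    show "\<Union>Ch \<subseteq> carrier V" using submoduleE(1)[OF sm] by blast
    show "\<zero> \<in> \<Union>Ch" using submodule_zero[OF V_module sm] assms(2) by blast
    show "\<ominus> a \<in> \<Union>Ch" if "a \<in> \<Union>Ch" for a using that submoduleE(3)[OF sm] by blast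
    show "k \<odot> a \<in> \<Union>Ch" if "k \<in> carrier K" "a \<in> \<Union>Ch" for k a using that submoduleE(4)[OF sm] by blast
    show "a \<oplus> b \<in> \<Union>Ch" if "a \<in> \<Union>Ch" "b \<in> \<Union>Ch" for a b
    proof -
      from that obtain M N where MN: "M \<in> Ch" "a \<in> M" "N \<in> Ch" "b \<in> N" by blast
      then have "M \<subseteq> N \<or> N \<subseteq> M" using assms(1) unfolding subset.chain_def by blast
      then obtain L where "L \<in> Ch" "a \<in> L" "b \<in> L" using MN by blast
      then show ?thesis using submoduleE(5)[OF sm] by blast
    qed
  qed
qed

end

context
  fixes K :: "('k, 'r) ring_scheme" and V :: "('k, 'v, 'c) module_scheme" (structure)
  assumes K_field: "field K" and V_module: "module K V"
begin

interpretation K: field K by (rule K_field)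
interpretation module K V by (rule V_module)

lemma smult_eq_zero:
  assumes "c \<in> carrier K" "x \<in> carrier V" "c \<odot> x = \<zero>" "c \<noteq> \<zero>\<^bsub>K\<^esub>"
  shows "x = \<zero>"
proof -
  have c: "c \<in> Units K" using assms(1) assms(4) K.field_Units by simp
  have "x = (inv\<^bsub>K\<^esub> c \<otimes>\<^bsub>K\<^esub> c) \<odot> x" using assms(2) c by simp
  also have "\<dots> = inv\<^bsub>K\<^esub> c \<odot> (c \<odot> x)"
    using assms(1) assms(2) c by (intro smult_assoc1) simp_all
  finally show ?thesis using assms(3) c by simp
qed

text \<open>Zorn gives a maximal submodule that meets \<open>N\<close> only in zero. If some x were
  not in its sum with \<open>N\<close>, adjoining the line of x would give a larger such
  submodule.\<close>

lemma complement_exists: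
  assumes "submodule N K V"
  obtains M where "submodule M K V" "M \<inter> N = {\<zero>}" "\<And>x. x \<in> carrier V \<Longrightarrow> \<exists>m\<in>M. \<exists>n\<in>N. x = m \<oplus> n"
proof -
  note NE = submoduleE[OF assms(1)]
  let ?A = "{M. submodule M K V \<and> M \<inter> N = {\<zero>}}"
  have "\<exists>M\<in>?A. \<forall>X\<in>?A. M \<subseteq> X \<longrightarrow> X = M"
  proof (rule subset_Zorn_nonempty)
    have "{\<zero>} \<in> ?A" using zero_submodule[OF V_module] submodule_zero[OF V_module assms(1)] by auto
    then show "?A \<noteq> {}" by blast
    fix Ch assume Ch: "Ch \<noteq> {}" "subset.chain ?A Ch"
    have "subset.chain {M. submodule M K V} Ch" using Ch(2) unfolding subset.chain_def by blast
    then have "submodule (\<Union>Ch) K V" using Union_chain_submodule[OF V_module] Ch(1) by blast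
    moreover have "\<Union>Ch \<inter> N = {\<zero>}" using Ch unfolding subset.chain_def by blast
    ultimately show "\<Union>Ch \<in> ?A" by simp
  qed
  then obtain M where M0: "M \<in> ?A" "\<forall>X\<in>?A. M \<subseteq> X \<longrightarrow> X = M" by (rule bexE)
  then have M: "submodule M K V" "M \<inter> N = {\<zero>}" by simp_all
  have max: "X = M" if "submodule X K V" "X \<inter> N = {\<zero>}" "M \<subseteq> X" for X
    using M0(2)[THEN bspec, of X] that by simp
  note ME = submoduleE[OF M(1)]
  have subM: "m \<in> carrier V" if "m \<in> M" for m using ME(1) that by blast
  have subN: "m \<in> carrier V" if "m \<in> N" for m using NE(1) that by blast
  have "\<exists>m\<in>M. \<exists>n\<in>N. x = m \<oplus> n" if x: "x \<in> carrier V" for x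
  proof (rule ccontr)
    assume no: "\<not> ?thesis"
    let ?X = "{m \<oplus> c \<odot> x | m c. m \<in> M \<and> c \<in> carrier K}"
    have sX: "submodule ?X K V" by (rule submodule_sum_line[OF V_module M(1) x])
    have MX: "M \<subseteq> ?X"
    proof
      fix m assume m: "m \<in> M"
      then have "m = m \<oplus> \<zero>\<^bsub>K\<^esub> \<odot> x" using x subM by simp
      then show "m \<in> ?X" using m K.zero_closed by blast
    qed
    have "y = \<zero>" if y: "y \<in> ?X" "y \<in> N" for y
    proof -
      obtain m c where mc: "y = m \<oplus> c \<odot> x" "m \<in> M" "c \<in> carrier K" using y by blast
      show ?thesis
      proof (cases "c = \<zero>\<^bsub>K\<^esub>")
        case True
        then have "y = m" using mc x subM by simp
        then show ?thesis using y mc M(2) by blast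
      next
        case False
        then have c: "c \<in> Units K" using mc K.field_Units by simp
        let ?i = "inv\<^bsub>K\<^esub> c"
        have i: "?i \<in> carrier K" using c by simp
        \<comment> \<open>With an invertible coefficient the equation can be solved for x, which
          would then be a sum of elements of the two submodules, against \<open>no\<close>.\<close>
        have "(\<ominus> m) \<oplus> y = c \<odot> x"
          using mc x subM by (simp add: M.r_neg1)
        moreover have "?i \<odot> ((\<ominus> m) \<oplus> y) = ?i \<odot> (\<ominus> m) \<oplus> ?i \<odot> y"
          using i subM[OF mc(2)] subN[OF y(2)] by (simp add: smult_r_distr)
        ultimately have "?i \<odot> (c \<odot> x) = ?i \<odot> (\<ominus> m) \<oplus> ?i \<odot> y" by simp
        moreover have "?i \<odot> (c \<odot> x) = x"
          using i c x mc by (simp add: smult_assoc1[symmetric])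
        ultimately have "x = ?i \<odot> (\<ominus> m) \<oplus> ?i \<odot> y" by simp
        then show ?thesis using no ME(3)[OF mc(2)] ME(4)[OF i] NE(4)[OF i y(2)] by blast
      qed
    qed
    then have "?X \<inter> N = {\<zero>}" using submodule_zero[OF V_module sX] submodule_zero[OF V_module assms(1)] by blast
    from max[OF sX this MX] have XM: "?X = M" .
    have "x = \<zero> \<oplus> \<one>\<^bsub>K\<^esub> \<odot> x" using x by simp
    then have "x \<in> ?X" using submodule_zero[OF V_module M(1)] K.one_closed by blast
    then have "x \<in> M" using XM by blast
    moreover have "x = x \<oplus> \<zero>" using x by simp
    ultimately show False using no submodule_zero[OF V_module assms(1)] by blast
  qed
  then show thesis using that M by blast
qed

text \<open>The projection along a complement; the component in \<open>N\<close> is unique because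
  the complement meets \<open>N\<close> only in zero.\<close>

lemma retraction_exists:
  assumes "submodule N K V"
  obtains p where "p \<in> linear_maps K V V" "\<And>x. x \<in> carrier V \<Longrightarrow> p x \<in> N" "\<And>x. x \<in> N \<Longrightarrow> p x = x"
proof -
  obtain M where M: "submodule M K V" "M \<inter> N = {\<zero>}" "\<And>x. x \<in> carrier V \<Longrightarrow> \<exists>m\<in>M. \<exists>n\<in>N. x = m \<oplus> n"
    using complement_exists[OF assms] by blast
  note NE = submoduleE[OF assms(1)] and ME = submoduleE[OF M(1)]
  have subM: "m \<in> carrier V" if "m \<in> M" for m using ME(1) that by blast
  have subN: "m \<in> carrier V" if "m \<in> N" for m using NE(1) that by blast
  define p where "p x = (SOME n. n \<in> N \<and> (\<exists>m\<in>M. x = m \<oplus> n))" for x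
  have p: "p x \<in> N \<and> (\<exists>m\<in>M. x = m \<oplus> p x)" if "x \<in> carrier V" for x
    unfolding p_def by (rule someI_ex) (use M(3)[OF that] in blast)
  have uniq: "n = n'" if "m \<in> M" "n \<in> N" "m' \<in> M" "n' \<in> N" "m \<oplus> n = m' \<oplus> n'" for m n m' n'
  proof -
    have "\<ominus> m \<oplus> (m \<oplus> n) = n" using subM[OF that(1)] subN[OF that(2)] by (simp add: M.r_neg1)
    then have "n \<ominus> n' = (\<ominus> m \<oplus> (m \<oplus> n)) \<ominus> n'" by simp
    also have "\<dots> = \<ominus> m \<oplus> m'" unfolding that(5)
      using that(1-4) subM subN by (simp add: a_minus_def M.a_assoc M.r_neg)
    finally have "n \<ominus> n' \<in> M" using ME(3,5) that by simp
    moreover have "n \<ominus> n' \<in> N" using submodule_minus[OF V_module assms(1)] that by blast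
    ultimately have "n \<ominus> n' = \<zero>" using M(2) by blast
    then show ?thesis using minus_zero_iff[OF M.abelian_group_axioms] that subN by blast
  qed
  have pI: "p x = n" if "x = m \<oplus> n" "m \<in> M" "n \<in> N" for x m n
  proof -
    have "x \<in> carrier V" using that subM subN by simp
    from p[OF this] obtain m' where m': "p x \<in> N" "m' \<in> M" "x = m' \<oplus> p x" by blast
    have "m' \<oplus> p x = m \<oplus> n" using m'(3) that(1) by simp
    from uniq[OF m'(2,1) that(2,3) this] show ?thesis .
  qed
  show thesis
  proof (rule that[of p])
    show "p x \<in> N" if "x \<in> carrier V" for x using p[OF that] by blast
    show "p x = x" if "x \<in> N" for x
      by (rule pI[of _ "\<zero>"]) (use that subN submodule_zero[OF V_module M(1)] in auto)
    show "p \<in> linear_maps K V V"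
    proof (intro linear_mapsI)
      show "p x \<in> carrier V" if "x \<in> carrier V" for x using p[OF that] subN by blast
      fix x y assume xy: "x \<in> carrier V" "y \<in> carrier V"
      obtain m where m: "m \<in> M" "x = m \<oplus> p x" "p x \<in> N" using p[OF xy(1)] by blast
      obtain m' where m': "m' \<in> M" "y = m' \<oplus> p y" "p y \<in> N" using p[OF xy(2)] by blast
      have "x \<oplus> y = (m \<oplus> p x) \<oplus> (m' \<oplus> p y)" using m(2) m'(2) by simp
      also have "\<dots> = (m \<oplus> m') \<oplus> (p x \<oplus> p y)" using m(1,3) m'(1,3) subM subN by (simp add: M.a_ac)
      finally show "p (x \<oplus> y) = p x \<oplus> p y"
        by (rule pI) (use m m' ME(5) NE(5) in simp_all)
    next
      fix c x assume cx: "c \<in> carrier K" "x \<in> carrier V"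
      obtain m where m: "m \<in> M" "x = m \<oplus> p x" "p x \<in> N" using p[OF cx(2)] by blast
      have "c \<odot> x = c \<odot> (m \<oplus> p x)" using m(2) by simp
      also have "\<dots> = c \<odot> m \<oplus> c \<odot> p x"
        using cx(1) subM[OF m(1)] subN[OF m(3)] by (rule smult_r_distr)
      finally show "p (c \<odot> x) = c \<odot> p x"
        by (rule pI) (use m cx ME(4) NE(4) in simp_all)
    qed
  qed
qed

text \<open>Let p retract onto \<open>N\<close>. The element r = x - p x is nonzero, and the
  functional is the coefficient of r in the image of y - p y under a retraction onto the line of
  r.\<close>

lemma functional_exists:
  assumes "submodule N K V" "x \<in> carrier V" "x \<notin> N"
  obtains f where "f \<in> linear_maps K V (base_algebra K)" "\<And>y. y \<in> N \<Longrightarrow> f y = \<zero>\<^bsub>K\<^esub>" "f x = \<one>\<^bsub>K\<^esub>"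
proof -
  obtain p where p: "p \<in> linear_maps K V V" "\<And>x. x \<in> carrier V \<Longrightarrow> p x \<in> N" "\<And>x. x \<in> N \<Longrightarrow> p x = x"
    using retraction_exists[OF assms(1)] by blast
  note pl = linear_mapsD[OF p(1)]
  have subN: "y \<in> carrier V" if "y \<in> N" for y using submoduleE(1)[OF assms(1)] that by blast
  define r where "r = x \<ominus> p x"
  have pN: "p x \<in> N" "p x \<in> carrier V" using p(2)[OF assms(2)] subN by blast+
  then have "x \<noteq> p x" using assms(3) by metis
  then have r: "r \<in> carrier V" "r \<noteq> \<zero>"
    unfolding r_def minus_zero_iff[OF M.abelian_group_axioms assms(2) pN(2)] using assms(2) pN(2) by simp_all
  let ?L = "{\<zero> \<oplus> c \<odot> r | m c. m \<in> {\<zero>} \<and> c \<in> carrier K}"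
  have "?L = {m \<oplus> c \<odot> r | m c. m \<in> {\<zero>} \<and> c \<in> carrier K}" by blast
  then have "submodule ?L K V" using submodule_sum_line[OF V_module zero_submodule[OF V_module] r(1)] by simp
  then obtain q where q: "q \<in> linear_maps K V V" "\<And>x. x \<in> carrier V \<Longrightarrow> q x \<in> ?L" "\<And>x. x \<in> ?L \<Longrightarrow> q x = x"
    using retraction_exists by blast
  note ql = linear_mapsD[OF q(1)]
  have uniq: "c = c'" if "c \<odot> r = c' \<odot> r" "c \<in> carrier K" "c' \<in> carrier K" for c c'
  proof (rule ccontr)
    assume "c \<noteq> c'"
    then have "c \<ominus>\<^bsub>K\<^esub> c' \<noteq> \<zero>\<^bsub>K\<^esub>" using that minus_zero_iff[OF K.abelian_group_axioms] by blast
    moreover have "(c \<ominus>\<^bsub>K\<^esub> c') \<odot> r = \<zero>"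
      using that r by (simp add: a_minus_def smult_l_distr smult_l_minus M.r_neg)
    ultimately show False using smult_eq_zero[of "c \<ominus>\<^bsub>K\<^esub> c'" r] r that by simp
  qed
  define f where "f y = (SOME c. c \<in> carrier K \<and> q (y \<ominus> p y) = c \<odot> r)" for y
  have f: "f y \<in> carrier K \<and> q (y \<ominus> p y) = f y \<odot> r" if "y \<in> carrier V" for y
  proof -
    have "q (y \<ominus> p y) \<in> ?L" using that p(2) subN by (intro q(2)) simp
    then have "\<exists>c. c \<in> carrier K \<and> q (y \<ominus> p y) = c \<odot> r" using r by auto
    then show ?thesis unfolding f_def by (rule someI_ex)
  qed
  have fI: "f y = c" if "y \<in> carrier V" "c \<in> carrier K" "q (y \<ominus> p y) = c \<odot> r" for y c
    using uniq[of "f y" c] f[OF that(1)] that by simp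
  show thesis
  proof (rule that[of f])
    have "r \<in> ?L"
    proof -
      have "r = \<zero> \<oplus> \<one>\<^bsub>K\<^esub> \<odot> r" using r by simp
      then show ?thesis using K.one_closed by blast
    qed
    then have "q r = \<one>\<^bsub>K\<^esub> \<odot> r" using q(3) r by simp
    then show "f x = \<one>\<^bsub>K\<^esub>" using assms(2) by (intro fI) (simp_all add: r_def[symmetric])
    show "f y = \<zero>\<^bsub>K\<^esub>" if "y \<in> N" for y
    proof (rule fI)
      have "q \<zero> = \<zero>" by (rule linear_maps_zero[OF V_module V_module q(1)])
      then show "q (y \<ominus> p y) = \<zero>\<^bsub>K\<^esub> \<odot> r" using that r p(3)[OF that] subN by (simp add: a_minus_def M.r_neg)
    qed (use that subN in simp_all)
    show "f \<in> linear_maps K V (base_algebra K)"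
    proof (intro linear_mapsI; simp)
      show "f y \<in> carrier K" if "y \<in> carrier V" for y using f[OF that] by blast
      fix y z assume yz: "y \<in> carrier V" "z \<in> carrier V"
      have "(y \<oplus> z) \<ominus> p (y \<oplus> z) = (y \<ominus> p y) \<oplus> (z \<ominus> p z)"
        using yz pl by (simp add: a_minus_def M.minus_add M.a_ac)
      then have "q ((y \<oplus> z) \<ominus> p (y \<oplus> z)) = f y \<odot> r \<oplus> f z \<odot> r"
        using yz pl ql f[OF yz(1)] f[OF yz(2)] by simp
      then show "f (y \<oplus> z) = f y \<oplus>\<^bsub>K\<^esub> f z"
        using yz f[OF yz(1)] f[OF yz(2)] r by (intro fI) (simp_all add: smult_l_distr)
    next
      fix c y assume cy: "c \<in> carrier K" "y \<in> carrier V"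
      have "c \<odot> y \<ominus> p (c \<odot> y) = c \<odot> (y \<ominus> p y)"
        using cy pl by (simp add: a_minus_def smult_r_distr smult_r_minus)
      then have "q (c \<odot> y \<ominus> p (c \<odot> y)) = c \<odot> (f y \<odot> r)"
        using cy pl ql f[OF cy(2)] by simp
      then show "f (c \<odot> y) = c \<otimes>\<^bsub>K\<^esub> f y"
        using cy f[OF cy(2)] r by (intro fI) (simp_all add: smult_assoc1)
    qed
  qed
qed

lemma submodule_functionals:
  assumes "submodule N K V" "x \<in> carrier V"
    and "\<And>f. f \<in> linear_maps K V (base_algebra K) \<Longrightarrow> (\<And>y. y \<in> N \<Longrightarrow> f y = \<zero>\<^bsub>K\<^esub>) \<Longrightarrow> f x = \<zero>\<^bsub>K\<^esub>"
  shows "x \<in> N"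
proof (rule ccontr)
  assume "x \<notin> N"
  then obtain f where "f \<in> linear_maps K V (base_algebra K)" "\<And>y. y \<in> N \<Longrightarrow> f y = \<zero>\<^bsub>K\<^esub>" "f x = \<one>\<^bsub>K\<^esub>"
    using functional_exists[OF assms(1) assms(2)] by blast
  then show False using assms(3)[of f] by simp
qed

end

section \<open>Separation of tensors by functionals\<close>

context tens
begin

text \<open>Together with \<open>tensor_sums\<close> this records tensors by an explicit list of
  second factors, so that \<open>separation\<close> can be proved by induction on the number of
  terms.\<close>

primrec list_span :: "'b list \<Rightarrow> 'b set" where
  "list_span [] = {\<zero>\<^bsub>B\<^esub>}"
| "list_span (b # bs) = {u \<oplus>\<^bsub>B\<^esub> c \<odot>\<^bsub>B\<^esub> b | u c. u \<in> list_span bs \<and> c \<in> carrier K}"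

primrec tensor_sums :: "'b list \<Rightarrow> ('a \<times> 'b \<Rightarrow> 'k) set set" where
  "tensor_sums [] = {\<zero>\<^bsub>T\<^esub>}"
| "tensor_sums (b # bs) = {pt a b \<oplus>\<^bsub>T\<^esub> s | a s. a \<in> carrier A \<and> s \<in> tensor_sums bs}"

lemma list_span_submodule: "set bs \<subseteq> carrier B \<Longrightarrow> submodule (list_span bs) K B"
  by (induction bs) (simp_all add: zero_submodule[OF B.module_axioms] submodule_sum_line[OF B.module_axioms])

lemma tensor_sums_sub: "set bs \<subseteq> carrier B \<Longrightarrow> tensor_sums bs \<subseteq> carrier T"
  by (induction bs) auto

lemma tensor_sums_append:
  assumes "set bs \<subseteq> carrier B" "set cs \<subseteq> carrier B" "s \<in> tensor_sums bs" "t \<in> tensor_sums cs"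
  shows "s \<oplus>\<^bsub>T\<^esub> t \<in> tensor_sums (bs @ cs)"
  using assms(1,3)
proof (induction bs arbitrary: s)
  case Nil then show ?case using assms(4) tensor_sums_sub[OF assms(2)] by auto
next
  case (Cons b bs)
  then obtain a s' where s: "s = pt a b \<oplus>\<^bsub>T\<^esub> s'" "a \<in> carrier A" "s' \<in> tensor_sums bs" by auto
  have c: "s' \<in> carrier T" "t \<in> carrier T" "b \<in> carrier B"
    using s(3) assms(2,4) Cons.prems tensor_sums_sub[of bs] tensor_sums_sub[of cs] by auto
  have "s \<oplus>\<^bsub>T\<^esub> t = pt a b \<oplus>\<^bsub>T\<^esub> (s' \<oplus>\<^bsub>T\<^esub> t)" using s c by (simp add: T.M.a_assoc)
  moreover have "s' \<oplus>\<^bsub>T\<^esub> t \<in> tensor_sums (bs @ cs)" using Cons s by simp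
  ultimately show ?case using s(2) by auto
qed

lemma tensor_sums_add:
  assumes "set bs \<subseteq> carrier B" "s \<in> tensor_sums bs" "t \<in> tensor_sums bs"
  shows "s \<oplus>\<^bsub>T\<^esub> t \<in> tensor_sums bs"
  using assms
proof (induction bs arbitrary: s t)
  case (Cons b bs)
  then obtain a s' where s: "s = pt a b \<oplus>\<^bsub>T\<^esub> s'" "a \<in> carrier A" "s' \<in> tensor_sums bs" by auto
  from Cons obtain a' t' where t: "t = pt a' b \<oplus>\<^bsub>T\<^esub> t'" "a' \<in> carrier A" "t' \<in> tensor_sums bs" by auto
  have c: "s' \<in> carrier T" "t' \<in> carrier T" "b \<in> carrier B"
    using s(3) t(3) Cons.prems tensor_sums_sub[of bs] by auto
  have "s \<oplus>\<^bsub>T\<^esub> t = pt (a \<oplus>\<^bsub>A\<^esub> a') b \<oplus>\<^bsub>T\<^esub> (s' \<oplus>\<^bsub>T\<^esub> t')" using s t c by (simp add: T.M.a_ac pt_simps)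
  moreover have "s' \<oplus>\<^bsub>T\<^esub> t' \<in> tensor_sums bs" using Cons s t by simp
  ultimately show ?case using s(2) t(2) by auto
qed simp

lemma tensor_sums_pt:
  assumes "set bs \<subseteq> carrier B" "u \<in> list_span bs" "a \<in> carrier A"
  shows "pt a u \<in> tensor_sums bs"
  using assms
proof (induction bs arbitrary: u a)
  case (Cons b bs)
  then obtain u' c where u: "u = u' \<oplus>\<^bsub>B\<^esub> c \<odot>\<^bsub>B\<^esub> b" "u' \<in> list_span bs" "c \<in> carrier K" by auto
  have u': "u' \<in> carrier B" "b \<in> carrier B" using u(2) Cons.prems B.submoduleE(1)[OF list_span_submodule[of bs]] by auto
  have "pt a u = pt (c \<odot>\<^bsub>A\<^esub> a) b \<oplus>\<^bsub>T\<^esub> pt a u'" using u u' Cons.prems by (simp add: pt_simps T.M.a_comm)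
  moreover have "pt a u' \<in> tensor_sums bs" using Cons u by simp
  ultimately show ?case using u(3) Cons.prems by (auto intro!: exI[of _ "c \<odot>\<^bsub>A\<^esub> a"] exI[of _ "pt a u'"])
qed (simp add: pt_zero)

lemma tensor_sums_exists: assumes "t \<in> carrier T" shows "\<exists>bs. set bs \<subseteq> carrier B \<and> t \<in> tensor_sums bs"
  using assms
proof (induction t rule: T_induct)
  case (add s t) then show ?case using tensor_sums_append by (metis Un_least set_append)
next
  case (pure a b)
  have "pt a b \<in> tensor_sums [b]" using pure by (auto intro!: exI[of _ a])
  then show ?case using pure by (intro exI[of _ "[b]"]) simp
qed

text \<open>Induction on the list of second factors. If the head depends linearly on the tail, its
  term is absorbed there. Otherwise a functional that kills the tail and is 1 at the head shows that
  the first factor of that term is zero.\<close>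

lemma separation:
  assumes "field K" "t \<in> carrier T"
    and "\<And>v. v \<in> linear_maps K B (base_algebra K) \<Longrightarrow> tlift K A (\<lambda>a b. v b \<odot>\<^bsub>A\<^esub> a) t = \<zero>\<^bsub>A\<^esub>"
  shows "t = \<zero>\<^bsub>T\<^esub>"
proof -
  interpret K: field K by fact
  have bil: "bilin K A B A (\<lambda>a b. v b \<odot>\<^bsub>A\<^esub> a)" if "v \<in> linear_maps K B (base_algebra K)" for v
    by (rule bilin_smult(2)[OF A.module_axioms that linear_maps_ident])
  note l = tlift_simps[OF A.module_axioms bil]
  have kills: "tlift K A (\<lambda>a b. v b \<odot>\<^bsub>A\<^esub> a) s = \<zero>\<^bsub>A\<^esub>"
    if v: "v \<in> linear_maps K B (base_algebra K)" and "set bs \<subseteq> carrier B" "\<And>y. y \<in> set bs \<Longrightarrow> v y = \<zero>\<^bsub>K\<^esub>" "s \<in> tensor_sums bs" for v bs s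
    using that(2-4)
  proof (induction bs arbitrary: s)
    case Nil
    then show ?case
      using linear_maps_zero[OF T.module_axioms A.module_axioms tlift_linear[OF A.module_axioms bil[OF v]]] by simp
  next
    case (Cons b bs)
    then obtain a s' where s: "s = pt a b \<oplus>\<^bsub>T\<^esub> s'" "a \<in> carrier A" "s' \<in> tensor_sums bs" by auto
    have "s' \<in> carrier T" using s(3) Cons.prems tensor_sums_sub[of bs] by auto
    then show ?case using s Cons by (simp add: l[OF v])
  qed
  have mem_span: "y \<in> list_span bs" if "y \<in> set bs" "set bs \<subseteq> carrier B" for y bs
    using that
  proof (induction bs)
    case (Cons b bs)
    have z: "\<zero>\<^bsub>B\<^esub> \<in> list_span bs" using Cons.prems submodule_zero[OF B.module_axioms list_span_submodule] by simp
    have sub: "list_span bs \<subseteq> carrier B" using Cons.prems B.submoduleE(1)[OF list_span_submodule] by simp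
    show ?case
    proof (cases "y \<in> set bs")
      case True
      then have y: "y \<in> list_span bs" using Cons by simp
      then have "y = y \<oplus>\<^bsub>B\<^esub> \<zero>\<^bsub>K\<^esub> \<odot>\<^bsub>B\<^esub> b" using Cons.prems sub by auto
      then show ?thesis using y A.R.zero_closed by auto
    next
      case False
      then have "y = b" using Cons.prems by simp
      then have "y = \<zero>\<^bsub>B\<^esub> \<oplus>\<^bsub>B\<^esub> \<one>\<^bsub>K\<^esub> \<odot>\<^bsub>B\<^esub> b" using Cons.prems by simp
      then show ?thesis using z A.R.one_closed by auto
    qed
  qed simp
  have main: "s = \<zero>\<^bsub>T\<^esub>" if "set bs \<subseteq> carrier B" "s \<in> tensor_sums bs"
    "\<And>v. v \<in> linear_maps K B (base_algebra K) \<Longrightarrow> tlift K A (\<lambda>a b. v b \<odot>\<^bsub>A\<^esub> a) s = \<zero>\<^bsub>A\<^esub>" for bs s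
    using that
  proof (induction bs arbitrary: s)
    case (Cons b bs)
    then obtain a s' where s: "s = pt a b \<oplus>\<^bsub>T\<^esub> s'" "a \<in> carrier A" "s' \<in> tensor_sums bs" by auto
    have bs: "set bs \<subseteq> carrier B" "b \<in> carrier B" using Cons.prems by auto
    have s': "s' \<in> carrier T" using s(3) bs tensor_sums_sub[of bs] by auto
    show ?case
    proof (cases "b \<in> list_span bs")
      case True
      have "s \<in> tensor_sums bs"
        unfolding s(1) using tensor_sums_add[OF bs(1) tensor_sums_pt[OF bs(1) True s(2)] s(3)] .
      then show ?thesis using Cons.IH[OF bs(1)] Cons.prems(3) by blast
    next
      case False
      obtain v where v: "v \<in> linear_maps K B (base_algebra K)" "\<And>y. y \<in> list_span bs \<Longrightarrow> v y = \<zero>\<^bsub>K\<^esub>" "v b = \<one>\<^bsub>K\<^esub>"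
        using functional_exists[OF assms(1) B.module_axioms list_span_submodule[OF bs(1)] bs(2) False] by blast
      have "tlift K A (\<lambda>a b. v b \<odot>\<^bsub>A\<^esub> a) s' = \<zero>\<^bsub>A\<^esub>"
        by (rule kills[OF v(1) bs(1) _ s(3)]) (use v(2) mem_span bs(1) in blast)
      then have "\<zero>\<^bsub>A\<^esub> = a" using Cons.prems(3)[OF v(1)] s s' v(3) bs by (simp add: l[OF v(1)])
      then have "s = s'" using s(1) s' bs by (simp add: pt_zero flip: \<open>\<zero>\<^bsub>A\<^esub> = a\<close>)
      then show ?thesis using Cons.IH[OF bs(1) s(3)] Cons.prems(3) by simp
    qed
  qed simp
  show ?thesis using tensor_sums_exists[OF assms(2)] main assms(3) by blast
qed

end

lemma lin_span_linear:
  assumes "module K V" "module K W" "f \<in> linear_maps K V W" "X \<subseteq> carrier V" "submodule N K W"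
    and "\<And>x. x \<in> X \<Longrightarrow> f x \<in> N" "t \<in> lin_span K V X"
  shows "f t \<in> N"
proof -
  have "lin_span K V X \<subseteq> {x \<in> carrier V. f x \<in> N}"
    using assms(4,6) by (intro lin_span_minimal linear_preimage_submodule[OF assms(1-3,5)]) auto
  then show ?thesis using assms(7) by blast
qed

lemma lin_span_carrier: assumes "module K V" "X \<subseteq> carrier V" shows "lin_span K V X \<subseteq> carrier V"
  using module.submoduleE(1)[OF assms(1) lin_span_submodule[OF assms]] .

lemma bilin_span:
  assumes "module K V" "module K V'" "module K W" "bilin K V V' W F" "X \<subseteq> carrier V" "Y \<subseteq> carrier V'" "submodule N K W"
    and "\<And>x y. x \<in> X \<Longrightarrow> y \<in> Y \<Longrightarrow> F x y \<in> N" "s \<in> lin_span K V X" "t \<in> lin_span K V' Y"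
  shows "F s t \<in> N"
proof -
  have t: "t \<in> carrier V'" using lin_span_carrier[OF assms(2,6)] assms(10) by blast
  show ?thesis
  proof (rule lin_span_linear[OF assms(1,3) bilinD(2)[OF assms(4) t] assms(5,7) _ assms(9)])
    fix x assume x: "x \<in> X"
    then have "x \<in> carrier V" using assms(5) by blast
    then show "F x t \<in> N"
      by (rule lin_span_linear[OF assms(2,3) bilinD(1)[OF assms(4)] assms(6,7) _ assms(10)]) (rule assms(8)[OF x])
  qed
qed

lemma linear_span_eq:
  assumes "module K V" "module K W" "f \<in> linear_maps K V W" "g \<in> linear_maps K V W" "X \<subseteq> carrier V"
    and "\<And>x. x \<in> X \<Longrightarrow> f x = g x" "x \<in> lin_span K V X"
  shows "f x = g x"
  using assms(1,5,7)
proof (induction rule: lin_span_induct)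
  case zero
  show ?case using linear_maps_zero[OF assms(1,2,3)] linear_maps_zero[OF assms(1,2,4)] by simp
next
  case (base x) then show ?case by (rule assms(6))
next
  case (add x y)
  then show ?case using lin_span_carrier[OF assms(1,5)]
    by (simp add: linear_mapsD(2)[OF assms(3)] linear_mapsD(2)[OF assms(4)] subset_iff)
next
  case (smult c x)
  then show ?case using lin_span_carrier[OF assms(1,5)]
    by (simp add: linear_mapsD(3)[OF assms(3)] linear_mapsD(3)[OF assms(4)] subset_iff)
qed

lemma bilin_span_eq:
  assumes "module K V" "module K V'" "module K W" "bilin K V V' W F" "bilin K V V' W H"
    and "X \<subseteq> carrier V" "Y \<subseteq> carrier V'" "\<And>x y. x \<in> X \<Longrightarrow> y \<in> Y \<Longrightarrow> F x y = H x y"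
    and "s \<in> lin_span K V X" "t \<in> lin_span K V' Y"
  shows "F s t = H s t"
proof -
  have t: "t \<in> carrier V'" using lin_span_carrier[OF assms(2,7)] assms(10) by blast
  show ?thesis
  proof (rule linear_span_eq[OF assms(1,3) bilinD(2)[OF assms(4) t] bilinD(2)[OF assms(5) t] assms(6) _ assms(9)])
    fix x assume x: "x \<in> X"
    then have "x \<in> carrier V" using assms(6) by blast
    then show "F x t = H x t"
      by (intro linear_span_eq[OF assms(2,3) bilinD(1)[OF assms(4)] bilinD(1)[OF assms(5)] assms(7) _ assms(10)] assms(8)[OF x])
  qed
qed

context tens
begin

lemma F_module: "module K F" and
  F_carrier: "r \<in> carrier F \<longleftrightarrow> (\<forall>x. r x \<in> carrier K) \<and> finite (supp K r) \<and> supp K r \<subseteq> carrier A \<times> carrier B" and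
  F_sel: "r \<oplus>\<^bsub>F\<^esub> s = (\<lambda>z. r z \<oplus>\<^bsub>K\<^esub> s z)" "\<zero>\<^bsub>F\<^esub> = (\<lambda>z. \<zero>\<^bsub>K\<^esub>)" "c \<odot>\<^bsub>F\<^esub> r = (\<lambda>z. c \<otimes>\<^bsub>K\<^esub> r z)"
proof -
  interpret AB: monoid "A \<times>\<times> B" by (intro DirProd_monoid A.is_monoid B.is_monoid)
  interpret FM: monalg K "A \<times>\<times> B" by unfold_locales
  show "module K F" "r \<in> carrier F \<longleftrightarrow> (\<forall>x. r x \<in> carrier K) \<and> finite (supp K r) \<and> supp K r \<subseteq> carrier A \<times> carrier B"
    "r \<oplus>\<^bsub>F\<^esub> s = (\<lambda>z. r z \<oplus>\<^bsub>K\<^esub> s z)" "\<zero>\<^bsub>F\<^esub> = (\<lambda>z. \<zero>\<^bsub>K\<^esub>)" "c \<odot>\<^bsub>F\<^esub> r = (\<lambda>z. c \<otimes>\<^bsub>K\<^esub> r z)"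
    unfolding tensor_free_def by (rule FM.A_module, simp_all only: FM.ma_carrier FM.ma_sel prod_sel)
qed

lemma tensor_class_linear: "tensor_class K A B \<in> linear_maps K F T"
proof -
  have "lin_ext K T (\<lambda>(a, b). pt a b) \<in> linear_maps K F T"
    by (rule lin_ext_bilin[OF T.module_axioms pt_bilin])
  note l = linear_mapsD[OF this]
  interpret F: module K F by (rule F_module)
  show ?thesis by (intro linear_mapsI) (simp_all add: tensor_class_eq l)
qed

end

section \<open>The coradical filtration of a pointed Poisson Hopf algebra\<close>

locale pointed_poisson_hopf =
  fixes K :: "('k, 'r) ring_scheme" and B :: "('k, 'b) hopf" (structure) and br :: "'b \<Rightarrow> 'b \<Rightarrow> 'b"
  assumes K_field: "field K" and B_hopf: "poisson_hopf_algebra K B br" and B_pointed: "pointed K B"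
    and gl_br: "g \<in> grouplikes K B \<Longrightarrow> t \<in> grouplikes K B \<Longrightarrow> br g t = \<zero>"
begin

sublocale K: field K by (rule K_field)

lemma B_parts:
  "bialgebra K B" "is_antipode K B (comult B) (counit B) (antipode B)" "poisson_algebra K B br"
  "x \<in> carrier B \<Longrightarrow> y \<in> carrier B \<Longrightarrow> comult B (br x y) = tensor_bracket K B br (comult B x) (comult B y)"
  using B_hopf unfolding poisson_hopf_algebra_def hopf_algebra_def by auto

sublocale B: pois_comult K B br
proof (intro pois_comult.intro poisI B_parts pois_comult_axioms.intro)
  show "comult B \<in> alg_homs K B (tensor K B B)" using B_parts(1) unfolding bialgebra_def Let_def by (elim conjE)
qed

abbreviation BB where "BB \<equiv> B.A2"
abbreviation pt where "pt \<equiv> ptensor K B B"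
abbreviation \<Delta> where "\<Delta> \<equiv> comult B"
abbreviation \<epsilon> where "\<epsilon> \<equiv> counit B"
abbreviation G where "G \<equiv> grouplikes K B"
abbreviation B0 where "B0 \<equiv> coradical K B"
abbreviation fil where "fil \<equiv> corad_filt K B"
abbreviation low where "low \<equiv> corad_low K B"
abbreviation dual where "dual \<equiv> linear_maps K B (base_algebra K)"
abbreviation J where "J \<equiv> {f \<in> dual. \<forall>y\<in>B0. f y = \<zero>\<^bsub>K\<^esub>}"

lemmas \<Delta>_simps = B.comult_simps

lemma \<epsilon>_hom: "\<epsilon> \<in> alg_homs K B (base_algebra K)"
  using B_parts(1) unfolding bialgebra_def Let_def by (elim conjE)

lemmas \<epsilon>_simps = alg_homsD[OF \<epsilon>_hom, simplified] linear_mapsD[OF alg_homsD(1)[OF \<epsilon>_hom], simplified]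

abbreviation B3 where "B3 \<equiv> tensor K B BB"

sublocale T3: tens K B BB by (intro tens.intro B.asalg_axioms B.T2.T_asalg)

lemma coassoc:
  assumes "x \<in> carrier B"
  shows "tlift K B3 (\<lambda>a b. T3.pt a (\<Delta> b)) (\<Delta> x) =
    tlift K B3 (\<lambda>a b. tlift K B3 (\<lambda>c d. T3.pt c (pt d b)) (\<Delta> a)) (\<Delta> x)"
  using B_parts(1) unfolding bialgebra_def Let_def by (elim conjE) (erule bspec[OF _ assms])

lemma counit_law:
  assumes "x \<in> carrier B"
  shows "tlift K B (\<lambda>a b. \<epsilon> a \<odot> b) (\<Delta> x) = x" "tlift K B (\<lambda>a b. \<epsilon> b \<odot> a) (\<Delta> x) = x"
proof -
  note b = B_parts(1)[unfolded bialgebra_def Let_def, THEN conjunct2, THEN conjunct2, THEN conjunct2, THEN conjunct2]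
  show "tlift K B (\<lambda>a b. \<epsilon> a \<odot> b) (\<Delta> x) = x" by (rule b[THEN conjunct1, THEN bspec, OF assms])
  show "tlift K B (\<lambda>a b. \<epsilon> b \<odot> a) (\<Delta> x) = x" by (rule b[THEN conjunct2, THEN bspec, OF assms])
qed

section \<open>Contraction of the coproduct by functionals\<close>

definition L where "L f x = tlift K B (\<lambda>a b. f a \<odot> b) (\<Delta> x)"
text \<open>\<open>L\<close> contracts the first tensor factor and \<open>Rr\<close> the second.
  They replace statements about tensors by statements about linear maps of B into itself.\<close>

definition Rr where "Rr v x = tlift K B (\<lambda>a b. v b \<odot> a) (\<Delta> x)"

lemma L_bilin: "f \<in> dual \<Longrightarrow> bilin K B B B (\<lambda>a b. f a \<odot> b)"
  by (rule bilin_smult(1)[OF B.module_axioms _ linear_maps_ident])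

lemma R_bilin: "f \<in> dual \<Longrightarrow> bilin K B B B (\<lambda>a b. f b \<odot> a)"
  by (rule bilin_smult(2)[OF B.module_axioms _ linear_maps_ident])

lemma \<Delta>_linear: "\<Delta> \<in> linear_maps K B BB" by (rule \<Delta>_simps(1))

lemma \<Delta>_closed [simp]: "x \<in> carrier B \<Longrightarrow> \<Delta> x \<in> carrier BB" by (rule \<Delta>_simps(4))

lemma L_linear: "f \<in> dual \<Longrightarrow> L f \<in> linear_maps K B B"
  unfolding L_def by (intro linear_maps_comp[OF \<Delta>_linear B.T2.tlift_linear[OF B.module_axioms L_bilin]])

lemma Rr_linear: "f \<in> dual \<Longrightarrow> Rr f \<in> linear_maps K B B"
  unfolding Rr_def by (intro linear_maps_comp[OF \<Delta>_linear B.T2.tlift_linear[OF B.module_axioms R_bilin]])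

lemmas L_simps = linear_mapsD[OF L_linear]
lemmas Rr_simps = linear_mapsD[OF Rr_linear]

lemma dual_closed: "f \<in> dual \<Longrightarrow> x \<in> carrier B \<Longrightarrow> f x \<in> carrier K"
  using linear_mapsD(1)[of f K B "base_algebra K" x] by simp

text \<open>Coassociativity with f applied to the first of the three tensor factors.\<close>

lemma \<Delta>_L:
  assumes f: "f \<in> dual" and x: "x \<in> carrier B"
  shows "\<Delta> (L f x) = tlift K BB (\<lambda>a b. pt (L f a) b) (\<Delta> x)"
proof -
  \<comment> \<open>Contracts the first factor of B \<otimes> (B \<otimes> B) with f; the two sides
    of \<open>coassoc\<close> are compared under this map.\<close>
  let ?G = "tlift K BB (\<lambda>c s. f c \<odot>\<^bsub>BB\<^esub> s)"
  have Gb: "bilin K B BB BB (\<lambda>c s. f c \<odot>\<^bsub>BB\<^esub> s)"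
    by (rule bilin_smult(1)[OF B.T2.T.module_axioms f linear_maps_ident])
  note Gl = T3.tlift_linear[OF B.T2.T.module_axioms Gb] and Gp = T3.tlift_pt[OF B.T2.T.module_axioms Gb]
  have b1: "bilin K B B B3 (\<lambda>a b. T3.pt a (\<Delta> b))"
    by (rule bilin_compose[OF T3.pt_bilin linear_maps_ident \<Delta>_linear])
  have inner: "bilin K B B B3 (\<lambda>c d. T3.pt c (pt d b))" if "b \<in> carrier B" for b
    by (rule bilin_compose[OF T3.pt_bilin linear_maps_ident bilinD(2)[OF B.T2.pt_bilin that]])
  note il = B.T2.tlift_linear[OF T3.T.module_axioms inner] and ip = B.T2.tlift_pt[OF T3.T.module_axioms inner]
  note ic = linear_mapsD[OF il]
  let ?F = "\<lambda>a b. tlift K B3 (\<lambda>c d. T3.pt c (pt d b)) (\<Delta> a)"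
  have b2: "bilin K B B B3 ?F"
  proof (rule bilinI)
    show "(\<lambda>a. ?F a b) \<in> linear_maps K B B3" if "b \<in> carrier B" for b
      by (rule linear_maps_comp[OF \<Delta>_linear il[OF that]])
    show "?F a \<in> linear_maps K B B3" if a: "a \<in> carrier B" for a
    proof (rule linear_mapsI)
      show "?F a b \<in> carrier B3" if "b \<in> carrier B" for b using ic(1)[OF that] a by simp
      fix b b' assume bb: "b \<in> carrier B" "b' \<in> carrier B"
      show "?F a (b \<oplus> b') = ?F a b \<oplus>\<^bsub>B3\<^esub> ?F a b'"
        by (rule B.T2.tlift_eqI[OF T3.T.module_axioms inner linear_maps_add[OF T3.T.module_axioms il[OF bb(1)] il[OF bb(2)]]])
          (use a bb in \<open>simp_all add: ip B.T2.pt_simps T3.pt_simps\<close>)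
    next
      fix k b assume kb: "k \<in> carrier K" "b \<in> carrier B"
      show "?F a (k \<odot> b) = k \<odot>\<^bsub>B3\<^esub> ?F a b"
        by (rule B.T2.tlift_eqI[OF T3.T.module_axioms inner linear_maps_const_smult[OF T3.T.module_axioms il[OF kb(2)] kb(1)]])
          (use a kb in \<open>simp_all add: ip B.T2.pt_simps T3.pt_simps\<close>)
    qed
  qed
  have "\<Delta> (L f x) = tlift K BB (\<lambda>a b. \<Delta> (f a \<odot> b)) (\<Delta> x)"
    unfolding L_def by (rule B.T2.tlift_comp[OF B.module_axioms L_bilin[OF f] B.T2.T.module_axioms \<Delta>_linear \<Delta>_closed[OF x]])
  also have "\<dots> = tlift K BB (\<lambda>a b. ?G (T3.pt a (\<Delta> b))) (\<Delta> x)"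
    by (rule B.T2.tlift_cong[OF B.T2.T.module_axioms bilin_linear[OF L_bilin[OF f] \<Delta>_linear] _ \<Delta>_closed[OF x]])
      (simp add: Gp \<Delta>_simps dual_closed[OF f])
  also have "\<dots> = ?G (tlift K B3 (\<lambda>a b. T3.pt a (\<Delta> b)) (\<Delta> x))"
    by (rule B.T2.tlift_comp[OF T3.T.module_axioms b1 B.T2.T.module_axioms Gl \<Delta>_closed[OF x], symmetric])
  also have "\<dots> = ?G (tlift K B3 ?F (\<Delta> x))" by (simp only: coassoc[OF x])
  also have "\<dots> = tlift K BB (\<lambda>a b. ?G (?F a b)) (\<Delta> x)"
    by (rule B.T2.tlift_comp[OF T3.T.module_axioms b2 B.T2.T.module_axioms Gl \<Delta>_closed[OF x]])
  also have "\<dots> = tlift K BB (\<lambda>a b. pt (L f a) b) (\<Delta> x)"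
  proof (rule B.T2.tlift_cong[OF B.T2.T.module_axioms bilin_linear[OF b2 Gl] _ \<Delta>_closed[OF x]])
    fix a b assume ab: "a \<in> carrier B" "b \<in> carrier B"
    have "?G (?F a b) = tlift K BB (\<lambda>c d. ?G (T3.pt c (pt d b))) (\<Delta> a)"
      by (rule B.T2.tlift_comp[OF T3.T.module_axioms inner[OF ab(2)] B.T2.T.module_axioms Gl \<Delta>_closed[OF ab(1)]])
    also have "\<dots> = tlift K BB (\<lambda>c d. pt (f c \<odot> d) b) (\<Delta> a)"
      by (rule B.T2.tlift_cong[OF B.T2.T.module_axioms bilin_linear[OF inner[OF ab(2)] Gl] _ \<Delta>_closed[OF ab(1)]])
        (use ab in \<open>simp add: Gp B.T2.pt_simps dual_closed[OF f]\<close>)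
    also have "\<dots> = pt (L f a) b"
      unfolding L_def
      by (rule B.T2.tlift_comp[OF B.module_axioms L_bilin[OF f] B.T2.T.module_axioms bilinD(2)[OF B.T2.pt_bilin ab(2)] \<Delta>_closed[OF ab(1)], symmetric])
    finally show "?G (?F a b) = pt (L f a) b" .
  qed
  finally show ?thesis .
qed

lemma tlift_L:
  assumes "module K W" "bilin K B B W F" "f \<in> dual" "x \<in> carrier B"
  shows "tlift K W F (\<Delta> (L f x)) = tlift K W (\<lambda>a b. F (L f a) b) (\<Delta> x)"
proof -
  have b: "bilin K B B BB (\<lambda>a b. pt (L f a) b)"
    by (rule bilin_compose[OF B.T2.pt_bilin L_linear[OF assms(3)] linear_maps_ident])
  have "tlift K W F (\<Delta> (L f x)) = tlift K W (\<lambda>a b. tlift K W F (pt (L f a) b)) (\<Delta> x)"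
    unfolding \<Delta>_L[OF assms(3,4)]
    by (rule B.T2.tlift_comp[OF B.T2.T.module_axioms b assms(1) B.T2.tlift_linear[OF assms(1,2)] \<Delta>_closed[OF assms(4)]])
  also have "\<dots> = tlift K W (\<lambda>a b. F (L f a) b) (\<Delta> x)"
    by (rule B.T2.tlift_cong[OF assms(1) bilin_linear[OF b B.T2.tlift_linear[OF assms(1,2)]] _ \<Delta>_closed[OF assms(4)]])
      (simp add: B.T2.tlift_pt[OF assms(1,2)] L_simps(1)[OF assms(3)])
  finally show ?thesis .
qed

text \<open>f after \<open>L h\<close> is the convolution product of h and f, so the left
  contractions are closed under composition.\<close>

lemma L_L: "f \<in> dual \<Longrightarrow> h \<in> dual \<Longrightarrow> x \<in> carrier B \<Longrightarrow> L f (L h x) = L (\<lambda>a. f (L h a)) x"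
  using tlift_L[OF B.module_axioms L_bilin, of f h x] by (simp add: L_def[of f] L_def[of "\<lambda>a. f (L h a)"])

lemma dual_L: "f \<in> dual \<Longrightarrow> h \<in> dual \<Longrightarrow> (\<lambda>a. f (L h a)) \<in> dual"
  by (rule linear_maps_comp[OF L_linear])

lemma Rr_L:
  assumes "v \<in> dual" "h \<in> dual" "x \<in> carrier B"
  shows "Rr v (L h x) = L h (Rr v x)"
proof -
  have "Rr v (L h x) = tlift K B (\<lambda>a b. v b \<odot> L h a) (\<Delta> x)"
    unfolding Rr_def using tlift_L[OF B.module_axioms R_bilin assms(2,3)] assms(1) by simp
  also have "\<dots> = tlift K B (\<lambda>a b. L h (v b \<odot> a)) (\<Delta> x)"
    by (rule B.T2.tlift_cong[OF B.module_axioms bilin_compose[OF R_bilin[OF assms(1)] L_linear[OF assms(2)] linear_maps_ident] _ \<Delta>_closed[OF assms(3)]])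
      (simp add: L_simps(3)[OF assms(2)] dual_closed[OF assms(1)])
  also have "\<dots> = L h (Rr v x)"
    unfolding Rr_def by (rule B.T2.tlift_comp[OF B.module_axioms R_bilin[OF assms(1)] B.module_axioms L_linear[OF assms(2)] \<Delta>_closed[OF assms(3)], symmetric])
  finally show ?thesis .
qed

lemma k_asalg: "asalg K (base_algebra K)" by (rule base_algebra_asalg[OF K.cring_axioms])

lemma k_module: "module K (base_algebra K)"
  using k_asalg unfolding asalg_def by blast

text \<open>Both sides are f(x_1) v(x_2).\<close>

lemma f_Rr:
  assumes "v \<in> dual" "f \<in> dual" "x \<in> carrier B"
  shows "f (Rr v x) = v (L f x)"
proof -
  have "f (Rr v x) = tlift K (base_algebra K) (\<lambda>a b. f (v b \<odot> a)) (\<Delta> x)"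
    unfolding Rr_def by (rule B.T2.tlift_comp[OF B.module_axioms R_bilin[OF assms(1)] k_module assms(2) \<Delta>_closed[OF assms(3)]])
  also have "\<dots> = tlift K (base_algebra K) (\<lambda>a b. v (f a \<odot> b)) (\<Delta> x)"
    by (rule B.T2.tlift_cong[OF k_module bilin_linear[OF R_bilin[OF assms(1)] assms(2)] _ \<Delta>_closed[OF assms(3)]])
      (use linear_mapsD(3)[OF assms(1)] linear_mapsD(3)[OF assms(2)] dual_closed[OF assms(1)] dual_closed[OF assms(2)]
        in \<open>simp add: K.m_comm\<close>)
  also have "\<dots> = v (L f x)"
    unfolding L_def by (rule B.T2.tlift_comp[OF B.module_axioms L_bilin[OF assms(2)] k_module assms(1) \<Delta>_closed[OF assms(3)], symmetric])
  finally show ?thesis .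
qed

lemma \<epsilon>_dual: "\<epsilon> \<in> dual" by (rule \<epsilon>_simps(1))

lemma \<epsilon>_L: "f \<in> dual \<Longrightarrow> x \<in> carrier B \<Longrightarrow> \<epsilon> (L f x) = f x"
  using f_Rr[OF _ \<epsilon>_dual, of f x] f_Rr[OF \<epsilon>_dual, of f x] counit_law[of x] by (simp add: Rr_def)

lemma functional_eq:
  assumes "x \<in> carrier B" "\<And>f. f \<in> dual \<Longrightarrow> f x = \<zero>\<^bsub>K\<^esub>"
  shows "x = \<zero>"
  using submodule_functionals[OF K_field B.module_axioms zero_submodule[OF B.module_axioms] assms(1)] assms(2) by blast

section \<open>Group-like elements and the coradical\<close>

lemma gl: "g \<in> G \<Longrightarrow> g \<in> carrier B" "g \<in> G \<Longrightarrow> \<Delta> g = pt g g" "g \<in> G \<Longrightarrow> \<epsilon> g = \<one>\<^bsub>K\<^esub>"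
  unfolding grouplikes_def by simp_all

lemma G_sub: "G \<subseteq> carrier B" using gl by blast

lemma gl_nonzero: assumes "g \<in> G" shows "g \<noteq> \<zero>"
proof
  assume "g = \<zero>"
  then have "\<epsilon> g = \<zero>\<^bsub>K\<^esub>" using linear_maps_zero[OF B.module_axioms k_module \<epsilon>_dual] by simp
  then show False using gl(3)[OF assms] by simp
qed

lemma L_gl: "f \<in> dual \<Longrightarrow> g \<in> G \<Longrightarrow> L f g = f g \<odot> g"
  unfolding L_def by (simp add: gl B.T2.tlift_pt[OF B.module_axioms L_bilin])

lemma line_submodule: assumes "d \<in> carrier B" shows "submodule {c \<odot> d | c. c \<in> carrier K} K B"
proof -
  have "{m \<oplus> c \<odot> d | m c. m \<in> {\<zero>} \<and> c \<in> carrier K} = {c \<odot> d | c. c \<in> carrier K}"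
  proof (intro equalityI subsetI)
    fix x assume "x \<in> {m \<oplus> c \<odot> d | m c. m \<in> {\<zero>} \<and> c \<in> carrier K}"
    then obtain c where "c \<in> carrier K" "x = \<zero> \<oplus> c \<odot> d" by auto
    then show "x \<in> {c \<odot> d | c. c \<in> carrier K}" using assms by auto
  next
    fix x assume "x \<in> {c \<odot> d | c. c \<in> carrier K}"
    then obtain c where c: "c \<in> carrier K" "x = c \<odot> d" by auto
    then have "x = \<zero> \<oplus> c \<odot> d" using assms by simp
    then show "x \<in> {m \<oplus> c \<odot> d | m c. m \<in> {\<zero>} \<and> c \<in> carrier K}" using c(1) by blast
  qed
  then show ?thesis using submodule_sum_line[OF B.module_axioms zero_submodule[OF B.module_axioms] assms] by simp
qed

lemma ts_gens: "U \<subseteq> carrier B \<Longrightarrow> V \<subseteq> carrier B \<Longrightarrow> {pt u v | u v. u \<in> U \<and> v \<in> V} \<subseteq> carrier BB"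
  by auto

text \<open>On a line spanned by d the coproduct of d is c (d \<otimes> d). The counit axiom gives c
  \<epsilon>(d) = 1, so c d is group-like and spans the line.\<close>

lemma simple_line_grouplike:
  assumes D: "simple_subcoalgebra K B D" and d: "d \<in> D" "d \<noteq> \<zero>" "D = {c \<odot> d | c. c \<in> carrier K}"
  shows "D \<subseteq> lin_span K B G"
proof -
  have sD: "submodule D K B" and \<Delta>D: "\<And>x. x \<in> D \<Longrightarrow> \<Delta> x \<in> tensor_subspace K B D D"
    using D unfolding simple_subcoalgebra_def subcoalgebra_def by auto
  have dB: "d \<in> carrier B" using B.submoduleE(1)[OF sD] d(1) by blast
  have DB: "D \<subseteq> carrier B" by (rule B.submoduleE(1)[OF sD])
  have "\<exists>c\<in>carrier K. t = c \<odot>\<^bsub>BB\<^esub> pt d d" if "t \<in> lin_span K BB {pt u v | u v. u \<in> D \<and> v \<in> D}" for t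
    using B.T2.T.module_axioms ts_gens[OF DB DB] that
  proof (induction rule: lin_span_induct)
    case zero then show ?case using dB by (intro bexI[of _ "\<zero>\<^bsub>K\<^esub>"]) simp_all
  next
    case (base x)
    then obtain u v where uv: "x = pt u v" "u \<in> D" "v \<in> D" by blast
    then obtain c c' where "u = c \<odot> d" "v = c' \<odot> d" "c \<in> carrier K" "c' \<in> carrier K" using d(3) by blast
    then show ?case using uv dB
      by (intro bexI[of _ "c' \<otimes>\<^bsub>K\<^esub> c"]) (simp_all add: B.T2.pt_simps B.T2.T.smult_assoc1)
  next
    case (add x y)
    then obtain c c' where "x = c \<odot>\<^bsub>BB\<^esub> pt d d" "y = c' \<odot>\<^bsub>BB\<^esub> pt d d" "c \<in> carrier K" "c' \<in> carrier K" by blast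
    then show ?case using dB by (intro bexI[of _ "c \<oplus>\<^bsub>K\<^esub> c'"]) (simp_all add: B.T2.T.smult_l_distr)
  next
    case (smult k x)
    then obtain c where "x = c \<odot>\<^bsub>BB\<^esub> pt d d" "c \<in> carrier K" by blast
    then show ?case using dB smult by (intro bexI[of _ "k \<otimes>\<^bsub>K\<^esub> c"]) (simp_all add: B.T2.T.smult_assoc1)
  qed
  then obtain c where c: "c \<in> carrier K" "\<Delta> d = c \<odot>\<^bsub>BB\<^esub> pt d d"
    using \<Delta>D[OF d(1)] unfolding tensor_subspace_def by blast
  have \<epsilon>d: "\<epsilon> d \<in> carrier K" using dB \<epsilon>_simps by simp
  have cd: "(c \<otimes>\<^bsub>K\<^esub> \<epsilon> d) \<odot> d = d"
    using counit_law(1)[OF dB] c dB \<epsilon>d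
    by (simp add: B.T2.tlift_simps[OF B.module_axioms L_bilin[OF \<epsilon>_dual]] B.smult_assoc1)
  have "(c \<otimes>\<^bsub>K\<^esub> \<epsilon> d) \<ominus>\<^bsub>K\<^esub> \<one>\<^bsub>K\<^esub> = \<zero>\<^bsub>K\<^esub>"
  proof (rule ccontr)
    assume n: "(c \<otimes>\<^bsub>K\<^esub> \<epsilon> d) \<ominus>\<^bsub>K\<^esub> \<one>\<^bsub>K\<^esub> \<noteq> \<zero>\<^bsub>K\<^esub>"
    have "((c \<otimes>\<^bsub>K\<^esub> \<epsilon> d) \<ominus>\<^bsub>K\<^esub> \<one>\<^bsub>K\<^esub>) \<odot> d = \<zero>"
      using cd c \<epsilon>d dB by (simp add: a_minus_def B.smult_l_distr B.smult_l_minus B.M.r_neg)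
    then show False using smult_eq_zero[OF K_field B.module_axioms _ dB _ n] c \<epsilon>d d(2) by simp
  qed
  then have one: "c \<otimes>\<^bsub>K\<^esub> \<epsilon> d = \<one>\<^bsub>K\<^esub>" using minus_zero_iff[OF K.abelian_group_axioms] c \<epsilon>d by simp
  let ?g = "c \<odot> d"
  have g: "?g \<in> G"
    unfolding grouplikes_def using c dB one
    by (simp add: \<Delta>_simps \<epsilon>_simps B.T2.pt_simps)
  have "\<epsilon> d \<odot> ?g = d"
    using cd c \<epsilon>d dB by (simp add: K.m_comm[of "\<epsilon> d" c] flip: B.smult_assoc1)
  moreover have "\<epsilon> d \<odot> ?g \<in> lin_span K B G"
    using B.submoduleE(4)[OF lin_span_submodule[OF B.module_axioms G_sub]] lin_span_superset[of G K B] g \<epsilon>d by blast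
  ultimately have "d \<in> lin_span K B G" by simp
  then show ?thesis
    unfolding d(3) using B.submoduleE(4)[OF lin_span_submodule[OF B.module_axioms G_sub]] by blast
qed

lemma gl_line_simple:
  assumes g: "g \<in> G" shows "simple_subcoalgebra K B {c \<odot> g | c. c \<in> carrier K}"
proof -
  let ?D = "{c \<odot> g | c. c \<in> carrier K}"
  note gB = gl(1)[OF g]
  have gD: "g \<in> ?D" using gB K.one_closed B.smult_one[of g] by (metis (mono_tags, lifting) mem_Collect_eq)
  have sD: "submodule ?D K B" by (rule line_submodule[OF gB])
  have "\<Delta> x \<in> tensor_subspace K B ?D ?D" if x: "x \<in> ?D" for x
  proof -
    obtain c where c: "x = c \<odot> g" "c \<in> carrier K" using x by blast
    then have "\<Delta> x = pt x g" using gB gl(2)[OF g] by (simp add: \<Delta>_simps B.T2.pt_simps)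
    then show ?thesis unfolding tensor_subspace_def
      using x gD by (intro subsetD[OF lin_span_superset]) blast
  qed
  then have sub: "subcoalgebra K B ?D" unfolding subcoalgebra_def using sD by blast
  have "E = ?D" if E: "subcoalgebra K B E" "E \<subseteq> ?D" "E \<noteq> {\<zero>}" for E
  proof -
    have sE: "submodule E K B" using E(1) unfolding subcoalgebra_def by blast
    note EE = B.submoduleE[OF sE]
    obtain y where y: "y \<in> E" "y \<noteq> \<zero>" using E(3) submodule_zero[OF B.module_axioms sE] by blast
    then obtain c where c: "y = c \<odot> g" "c \<in> carrier K" using E(2) by blast
    have "c \<noteq> \<zero>\<^bsub>K\<^esub>" using y c gB by auto
    then have cu: "c \<in> Units K" using c K.field_Units by simp
    have "inv\<^bsub>K\<^esub> c \<odot> y = g" using c cu gB by (simp flip: B.smult_assoc1)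
    then have "g \<in> E" using EE(4)[of "inv\<^bsub>K\<^esub> c" y] y cu by simp
    then have "?D \<subseteq> E" using EE(4) by blast
    then show ?thesis using E(2) by blast
  qed
  moreover have "?D \<noteq> {\<zero>}" using gD gl_nonzero[OF g] by blast
  ultimately show ?thesis unfolding simple_subcoalgebra_def using sub by blast
qed

text \<open>Pointedness makes every simple subcoalgebra a line, hence spanned by a group-like
  element; conversely the line of a group-like element is a simple subcoalgebra.\<close>

lemma coradical_eq: "B0 = lin_span K B G"
proof
  have "\<Union>{D. simple_subcoalgebra K B D} \<subseteq> lin_span K B G"
  proof (rule Union_least)
    fix D assume "D \<in> {D. simple_subcoalgebra K B D}"
    then have D: "simple_subcoalgebra K B D" by simp
    then obtain d where "d \<in> D" "d \<noteq> \<zero>" "D = {c \<odot> d | c. c \<in> carrier K}"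
      using B_pointed unfolding pointed_def by blast
    then show "D \<subseteq> lin_span K B G" by (rule simple_line_grouplike[OF D])
  qed
  then show "B0 \<subseteq> lin_span K B G"
    unfolding coradical_def by (intro lin_span_minimal lin_span_submodule B.module_axioms G_sub)
  have "G \<subseteq> \<Union>{D. simple_subcoalgebra K B D}"
  proof
    fix g assume g: "g \<in> G"
    have "g = \<one>\<^bsub>K\<^esub> \<odot> g" using gl(1)[OF g] by simp
    then have "g \<in> {c \<odot> g | c. c \<in> carrier K}" using K.one_closed by blast
    then show "g \<in> \<Union>{D. simple_subcoalgebra K B D}" using gl_line_simple[OF g] by blast
  qed
  then show "lin_span K B G \<subseteq> B0" unfolding coradical_def by (rule lin_span_mono)
qed

lemma B0_submodule: "submodule B0 K B"
  unfolding coradical_eq by (rule lin_span_submodule[OF B.module_axioms G_sub])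

lemma B0_sub: "x \<in> B0 \<Longrightarrow> x \<in> carrier B" using B.submoduleE(1)[OF B0_submodule] by blast

lemma G_B0: "g \<in> G \<Longrightarrow> g \<in> B0" unfolding coradical_eq by (rule subsetD[OF lin_span_superset])

lemma L_B0: assumes "f \<in> dual" "x \<in> B0" shows "L f x \<in> B0"
proof (rule lin_span_linear[OF B.module_axioms B.module_axioms L_linear[OF assms(1)] G_sub B0_submodule])
  show "L f g \<in> B0" if "g \<in> G" for g
    using that B.submoduleE(4)[OF B0_submodule dual_closed[OF assms(1) gl(1)] G_B0] by (simp add: L_gl[OF assms(1)])
  show "x \<in> lin_span K B G" using assms(2) unfolding coradical_eq .
qed

lemma L_B0_J: assumes "f \<in> J" "x \<in> B0" shows "L f x = \<zero>"
proof -
  have f: "f \<in> dual" using assms by simp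
  have "L f x \<in> {\<zero>}"
  proof (rule lin_span_linear[OF B.module_axioms B.module_axioms L_linear[OF f] G_sub zero_submodule[OF B.module_axioms]])
    show "L f g \<in> {\<zero>}" if "g \<in> G" for g
      using that assms(1) G_B0[OF that] gl(1)[OF that] by (simp add: L_gl)
    show "x \<in> lin_span K B G" using assms(2) unfolding coradical_eq .
  qed
  then show ?thesis by simp
qed

lemma J_separates: "x \<in> carrier B \<Longrightarrow> (\<And>f. f \<in> J \<Longrightarrow> f x = \<zero>\<^bsub>K\<^esub>) \<Longrightarrow> x \<in> B0"
  using submodule_functionals[OF K_field B.module_axioms B0_submodule] by simp

section \<open>The filtration described by functionals that vanish on the coradical\<close>

lemma low_0: "low 0 = {\<zero>}" and low_Suc: "low (Suc n) = fil n"
  by (simp_all add: corad_low_def)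

lemma ts_linear:
  assumes "module K W" "F \<in> linear_maps K BB W" "U \<subseteq> carrier B" "V \<subseteq> carrier B" "submodule N K W"
    "\<And>u v. u \<in> U \<Longrightarrow> v \<in> V \<Longrightarrow> F (pt u v) \<in> N" "t \<in> tensor_subspace K B U V"
  shows "F t \<in> N"
  by (rule lin_span_linear[OF B.T2.T.module_axioms assms(1,2) ts_gens[OF assms(3,4)] assms(5) _ assms(7)[unfolded tensor_subspace_def]])
    (use assms(6) in blast)

lemma ts_submodule: "U \<subseteq> carrier B \<Longrightarrow> V \<subseteq> carrier B \<Longrightarrow> submodule (tensor_subspace K B U V) K BB"
  unfolding tensor_subspace_def by (intro lin_span_submodule B.T2.T.module_axioms ts_gens)

lemma ts_pt: "u \<in> U \<Longrightarrow> v \<in> V \<Longrightarrow> pt u v \<in> tensor_subspace K B U V"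
  unfolding tensor_subspace_def by (intro subsetD[OF lin_span_superset]) blast

abbreviation tmap where "tmap \<phi> \<psi> \<equiv> tlift K BB (\<lambda>a b. pt (\<phi> a) (\<psi> b))"

lemma tmap_bilin: "\<phi> \<in> linear_maps K B B \<Longrightarrow> \<psi> \<in> linear_maps K B B \<Longrightarrow> bilin K B B BB (\<lambda>a b. pt (\<phi> a) (\<psi> b))"
  by (rule bilin_compose[OF B.T2.pt_bilin])

lemmas tmap_linear = B.T2.tlift_linear[OF B.T2.T.module_axioms tmap_bilin]
lemmas tmap_simps = B.T2.tlift_simps[OF B.T2.T.module_axioms tmap_bilin]

lemma tmap_span:
  assumes \<phi>: "\<phi> \<in> linear_maps K B B" and \<psi>: "\<psi> \<in> linear_maps K B B" and N: "submodule N K BB"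
    and "\<And>a b. a \<in> carrier B \<Longrightarrow> b \<in> carrier B \<Longrightarrow> pt (\<phi> a) (\<psi> b) \<in> N" and t: "t \<in> carrier BB"
  shows "tmap \<phi> \<psi> t \<in> N"
  using t by (induction t rule: B.T2.T_induct) (simp_all add: tmap_simps[OF \<phi> \<psi>] assms(4) B.T2.T.submoduleE(5)[OF N])

text \<open>By \<open>separation\<close> it is enough to contract the second factor with each
  functional v. The result is \<phi> applied to the right contraction of x by v after
  \<psi>.\<close>

lemma tmap_\<Delta>_zero:
  assumes \<phi>: "\<phi> \<in> linear_maps K B B" and \<psi>: "\<psi> \<in> linear_maps K B B" and x: "x \<in> carrier B"
    and z: "\<And>v. v \<in> dual \<Longrightarrow> \<phi> (Rr (\<lambda>b. v (\<psi> b)) x) = \<zero>"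
  shows "tmap \<phi> \<psi> (\<Delta> x) = \<zero>\<^bsub>BB\<^esub>"
proof (rule B.T2.separation[OF K_field])
  show "tmap \<phi> \<psi> (\<Delta> x) \<in> carrier BB" using x by (simp add: tmap_simps[OF \<phi> \<psi>])
  fix v assume v: "v \<in> dual"
  have v': "(\<lambda>b. v (\<psi> b)) \<in> dual" by (rule linear_maps_comp[OF \<psi> v])
  note \<phi>s = linear_mapsD[OF \<phi>] and \<psi>s = linear_mapsD[OF \<psi>]
  have "tlift K B (\<lambda>a b. v b \<odot> a) (tmap \<phi> \<psi> (\<Delta> x)) = tlift K B (\<lambda>a b. tlift K B (\<lambda>a b. v b \<odot> a) (pt (\<phi> a) (\<psi> b))) (\<Delta> x)"
    by (rule B.T2.tlift_comp[OF B.T2.T.module_axioms tmap_bilin[OF \<phi> \<psi>] B.module_axioms B.T2.tlift_linear[OF B.module_axioms R_bilin[OF v]] \<Delta>_closed[OF x]])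
  also have "\<dots> = tlift K B (\<lambda>a b. \<phi> (v (\<psi> b) \<odot> a)) (\<Delta> x)"
    by (rule B.T2.tlift_cong[OF B.module_axioms bilin_linear[OF tmap_bilin[OF \<phi> \<psi>] B.T2.tlift_linear[OF B.module_axioms R_bilin[OF v]]] _ \<Delta>_closed[OF x]])
      (simp add: B.T2.tlift_pt[OF B.module_axioms R_bilin[OF v]] \<phi>s \<psi>s dual_closed[OF v])
  also have "\<dots> = \<phi> (Rr (\<lambda>b. v (\<psi> b)) x)"
    unfolding Rr_def by (rule B.T2.tlift_comp[OF B.module_axioms R_bilin[OF v'] B.module_axioms \<phi> \<Delta>_closed[OF x], symmetric])
  finally show "tlift K B (\<lambda>a b. v b \<odot> a) (tmap \<phi> \<psi> (\<Delta> x)) = \<zero>" using z[OF v] by simp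
qed

lemma preimage_J_submodule:
  assumes "submodule N K B"
  shows "submodule {x \<in> carrier B. \<forall>f\<in>J. L f x \<in> N} K B"
proof (rule B.submoduleI)
  note NE = B.submoduleE[OF assms]
  have l: "L f \<in> linear_maps K B B" if "f \<in> J" for f using that L_linear by simp
  show "\<zero> \<in> {x \<in> carrier B. \<forall>f\<in>J. L f x \<in> N}"
    using linear_maps_zero[OF B.module_axioms B.module_axioms l] submodule_zero[OF B.module_axioms assms] by simp
qed (use B.submoduleE[OF assms] in \<open>auto simp: L_simps linear_maps_uminus[OF B.module_axioms B.module_axioms L_linear]\<close>)

lemma retract:
  assumes "submodule N K B"
  obtains p where "p \<in> linear_maps K B B" "\<And>x. x \<in> carrier B \<Longrightarrow> p x \<in> N" "\<And>x. x \<in> N \<Longrightarrow> p x = x"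
  using retraction_exists[OF K_field B.module_axioms assms] by blast

text \<open>The complementary map 1 - p, written with the scalar -1 so that the closure rules for
  linear maps apply.\<close>

lemma compl_linear:
  assumes "p \<in> linear_maps K B B" shows "(\<lambda>x. x \<oplus> (\<ominus>\<^bsub>K\<^esub> \<one>\<^bsub>K\<^esub>) \<odot> p x) \<in> linear_maps K B B"
  by (intro linear_maps_add linear_maps_ident linear_maps_const_smult assms B.module_axioms) simp

lemma compl_zero:
  assumes "p x = x" "x \<in> carrier B" shows "x \<oplus> (\<ominus>\<^bsub>K\<^esub> \<one>\<^bsub>K\<^esub>) \<odot> p x = \<zero>"
  using assms by (simp add: B.smult_l_minus B.M.r_neg)

lemma compl_add:
  assumes "p x \<in> carrier B" "x \<in> carrier B" shows "p x \<oplus> (x \<oplus> (\<ominus>\<^bsub>K\<^esub> \<one>\<^bsub>K\<^esub>) \<odot> p x) = x"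
  using assms by (simp add: B.smult_l_minus B.M.r_neg3)

text \<open>For one inclusion, f kills B_0 \<otimes> B and contracts B \<otimes> B_n into B_n. For
  the other, retractions p onto B_0 and q onto B_n split 1 \<otimes> 1 into p \<otimes> 1, (1 - p)
  \<otimes> q and (1 - p) \<otimes> (1 - q). The first two parts of the coproduct of x lie in the
  required spaces and the last one vanishes.\<close>

lemma fil_step:
  assumes sub: "submodule (fil n) K B"
  shows "fil (Suc n) = {x \<in> carrier B. \<forall>f\<in>J. L f x \<in> fil n}"
proof
  let ?TN = "tensor_subspace K B (carrier B) (fil n)" and ?T0 = "tensor_subspace K B B0 (carrier B)"
  have filB: "fil n \<subseteq> carrier B" by (rule B.submoduleE(1)[OF sub])
  have B0B: "B0 \<subseteq> carrier B" by (rule B.submoduleE(1)[OF B0_submodule])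
  have TN: "submodule ?TN K BB" by (rule ts_submodule[OF subset_refl filB])
  have T0: "submodule ?T0 K BB" by (rule ts_submodule[OF B0B subset_refl])
  have TNc: "s \<in> carrier BB" if "s \<in> ?TN" for s using B.T2.T.submoduleE(1)[OF TN] that by blast
  have T0c: "s \<in> carrier BB" if "s \<in> ?T0" for s using B.T2.T.submoduleE(1)[OF T0] that by blast
  show "fil (Suc n) \<subseteq> {x \<in> carrier B. \<forall>f\<in>J. L f x \<in> fil n}"
  proof (intro subsetI CollectI conjI ballI)
    fix x assume x: "x \<in> fil (Suc n)"
    then show xB: "x \<in> carrier B" by simp
    from x obtain s t where st: "s \<in> ?TN" "t \<in> ?T0" "\<Delta> x = s \<oplus>\<^bsub>BB\<^esub> t"
      by (auto simp: set_add_def set_mult_def)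
    fix f assume f: "f \<in> J"
    then have fd: "f \<in> dual" by simp
    let ?l = "tlift K B (\<lambda>a b. f a \<odot> b)"
    note l = B.T2.tlift_simps[OF B.module_axioms L_bilin[OF fd]] and ll = B.T2.tlift_linear[OF B.module_axioms L_bilin[OF fd]]
    have "?l s \<in> fil n"
      by (rule ts_linear[OF B.module_axioms ll subset_refl filB sub _ st(1)])
        (use filB B.submoduleE(4)[OF sub] dual_closed[OF fd] l in auto)
    moreover have "?l t \<in> {\<zero>}"
      by (rule ts_linear[OF B.module_axioms ll B0B subset_refl zero_submodule[OF B.module_axioms] _ st(2)])
        (use B0_sub f l in auto)
    ultimately show "L f x \<in> fil n"
      unfolding L_def st(3) using TNc[OF st(1)] T0c[OF st(2)] filB by (auto simp: l)
  qed
  show "{x \<in> carrier B. \<forall>f\<in>J. L f x \<in> fil n} \<subseteq> fil (Suc n)"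
  proof
    fix x assume "x \<in> {x \<in> carrier B. \<forall>f\<in>J. L f x \<in> fil n}"
    then have x: "x \<in> carrier B" and fx: "\<And>f. f \<in> J \<Longrightarrow> L f x \<in> fil n" by auto
    obtain p where p: "p \<in> linear_maps K B B" "\<And>x. x \<in> carrier B \<Longrightarrow> p x \<in> B0" "\<And>x. x \<in> B0 \<Longrightarrow> p x = x"
      using retract[OF B0_submodule] by blast
    obtain q where q: "q \<in> linear_maps K B B" "\<And>x. x \<in> carrier B \<Longrightarrow> q x \<in> fil n" "\<And>x. x \<in> fil n \<Longrightarrow> q x = x"
      using retract[OF sub] by blast
    let ?p = "\<lambda>x. x \<oplus> (\<ominus>\<^bsub>K\<^esub> \<one>\<^bsub>K\<^esub>) \<odot> p x" and ?q = "\<lambda>x. x \<oplus> (\<ominus>\<^bsub>K\<^esub> \<one>\<^bsub>K\<^esub>) \<odot> q x"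
    note p' = compl_linear[OF p(1)] and q' = compl_linear[OF q(1)]
    note pc = linear_mapsD(1)[OF p(1)] and qc = linear_mapsD(1)[OF q(1)]
    note pc' = linear_mapsD(1)[OF p'] and qc' = linear_mapsD(1)[OF q']
    have "tmap ?p ?q (\<Delta> x) = \<zero>\<^bsub>BB\<^esub>"
    proof (rule tmap_\<Delta>_zero[OF p' q' x])
      fix v assume v: "v \<in> dual"
      have v': "(\<lambda>b. v (?q b)) \<in> dual" by (rule linear_maps_comp[OF q' v])
      \<comment> \<open>A functional f in \<open>J\<close> takes on this element the value of v at
        (1 - q)(L f x), which is zero because L f x lies in B_n.\<close>
      have "Rr (\<lambda>b. v (?q b)) x \<in> B0"
      proof (rule J_separates)
        show "Rr (\<lambda>b. v (?q b)) x \<in> carrier B" using Rr_simps(1)[OF v' x] .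
        fix f assume f: "f \<in> J"
        have "f (Rr (\<lambda>b. v (?q b)) x) = v (?q (L f x))" using f_Rr[OF v' _ x, of f] f by simp
        also have "?q (L f x) = \<zero>" using compl_zero[where p = q, OF q(3)[OF fx[OF f]]] fx[OF f] filB by blast
        finally show "f (Rr (\<lambda>b. v (?q b)) x) = \<zero>\<^bsub>K\<^esub>"
          using linear_maps_zero[OF B.module_axioms k_module v] by simp
      qed
      then show "?p (Rr (\<lambda>b. v (?q b)) x) = \<zero>" using compl_zero[where p = p, OF p(3)] B0_sub by blast
    qed
    moreover have "\<Delta> x = tmap p (\<lambda>x. x) (\<Delta> x) \<oplus>\<^bsub>BB\<^esub> (tmap ?p q (\<Delta> x) \<oplus>\<^bsub>BB\<^esub> tmap ?p ?q (\<Delta> x))"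
    proof (rule B.T2.T_linear_eq[OF B.T2.T.module_axioms linear_maps_ident
          linear_maps_add[OF B.T2.T.module_axioms tmap_linear[OF p(1) linear_maps_ident]
            linear_maps_add[OF B.T2.T.module_axioms tmap_linear[OF p' q(1)] tmap_linear[OF p' q']]] _ \<Delta>_closed[OF x]])
      fix a b assume ab: "a \<in> carrier B" "b \<in> carrier B"
      have "tmap ?p q (pt a b) \<oplus>\<^bsub>BB\<^esub> tmap ?p ?q (pt a b) = pt (?p a) (q b) \<oplus>\<^bsub>BB\<^esub> pt (?p a) (?q b)"
        using ab by (simp only: tmap_simps(4)[OF p' q(1)] tmap_simps(4)[OF p' q'])
      also have "\<dots> = pt (?p a) (q b \<oplus> ?q b)"
        by (rule B.T2.pt_simps(3)[symmetric, OF pc'[OF ab(1)] qc[OF ab(2)] qc'[OF ab(2)]])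
      also have "q b \<oplus> ?q b = b" by (rule compl_add[where p = q, OF qc[OF ab(2)] ab(2)])
      finally have 1: "tmap ?p q (pt a b) \<oplus>\<^bsub>BB\<^esub> tmap ?p ?q (pt a b) = pt (?p a) b" .
      have "tmap p (\<lambda>x. x) (pt a b) \<oplus>\<^bsub>BB\<^esub> pt (?p a) b = pt (p a) b \<oplus>\<^bsub>BB\<^esub> pt (?p a) b"
        using ab by (simp only: tmap_simps(4)[OF p(1) linear_maps_ident])
      also have "\<dots> = pt (p a \<oplus> ?p a) b"
        by (rule B.T2.pt_simps(2)[symmetric, OF pc[OF ab(1)] ab(2) pc'[OF ab(1)]])
      also have "p a \<oplus> ?p a = a" by (rule compl_add[where p = p, OF pc[OF ab(1)] ab(1)])
      finally show "pt a b = tmap p (\<lambda>x. x) (pt a b) \<oplus>\<^bsub>BB\<^esub> (tmap ?p q (pt a b) \<oplus>\<^bsub>BB\<^esub> tmap ?p ?q (pt a b))"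
        by (simp only: 1)
    qed
    ultimately have "\<Delta> x = tmap p (\<lambda>x. x) (\<Delta> x) \<oplus>\<^bsub>BB\<^esub> (tmap ?p q (\<Delta> x) \<oplus>\<^bsub>BB\<^esub> \<zero>\<^bsub>BB\<^esub>)" by (simp only:)
    then have "\<Delta> x = tmap p (\<lambda>x. x) (\<Delta> x) \<oplus>\<^bsub>BB\<^esub> tmap ?p q (\<Delta> x)"
      using B.T2.T.M.r_zero[OF tmap_simps(1)[OF p' q(1) \<Delta>_closed[OF x]]] by (simp only:)
    moreover have 0: "tmap p (\<lambda>x. x) (\<Delta> x) \<in> ?T0"
      by (rule tmap_span[OF p(1) linear_maps_ident T0 _ \<Delta>_closed[OF x]]) (rule ts_pt; simp add: p(2))
    moreover have 1: "tmap ?p q (\<Delta> x) \<in> ?TN"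
      by (rule tmap_span[OF p' q(1) TN _ \<Delta>_closed[OF x]]) (rule ts_pt; simp add: q(2) pc')
    ultimately have "\<Delta> x = tmap ?p q (\<Delta> x) \<oplus>\<^bsub>BB\<^esub> tmap p (\<lambda>x. x) (\<Delta> x)"
      using B.T2.T.M.a_comm[OF T0c[OF 0] TNc[OF 1]] by (simp only:)
    then have "\<exists>s\<in>?TN. \<exists>t\<in>?T0. \<Delta> x = s \<oplus>\<^bsub>BB\<^esub> t" using 0 1 by blast
    then have "\<Delta> x \<in> ?TN <+>\<^bsub>BB\<^esub> ?T0" by (simp add: set_add_def set_mult_def)
    then show "x \<in> fil (Suc n)" using x by simp
  qed
qed

lemma fil_submodule: "submodule (fil n) K B"
proof (induction n)
  case 0 then show ?case using B0_submodule by simp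
next
  case (Suc n) show ?case unfolding fil_step[OF Suc] by (rule preimage_J_submodule[OF Suc])
qed

lemma low_submodule: "submodule (low n) K B"
  by (cases n) (simp_all only: low_0 low_Suc fil_submodule zero_submodule[OF B.module_axioms])

lemma fil_sub [simp]: "x \<in> fil n \<Longrightarrow> x \<in> carrier B"
  using B.submoduleE(1)[OF fil_submodule] by blast

lemma low_sub: "x \<in> low n \<Longrightarrow> x \<in> carrier B"
  using B.submoduleE(1)[OF low_submodule] by blast

lemmas filE = B.submoduleE(3-5)[OF fil_submodule] submodule_zero[OF B.module_axioms fil_submodule]
lemmas lowE = B.submoduleE(3-5)[OF low_submodule] submodule_zero[OF B.module_axioms low_submodule]

text \<open>With B_{-1} = 0 the description also covers n = 0: if L f x vanishes for all f in
  \<open>J\<close>, the counit gives f(x) = 0 for all of them, and so x lies in B_0.\<close>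

lemma fil_low: "fil n = {x \<in> carrier B. \<forall>f\<in>J. L f x \<in> low n}"
proof (cases n)
  case 0
  have "x \<in> B0" if "x \<in> carrier B" "\<forall>f\<in>J. L f x \<in> {\<zero>}" for x
  proof (rule J_separates[OF that(1)])
    fix f assume f: "f \<in> J"
    then have "L f x = \<zero>" using that(2) by blast
    then show "f x = \<zero>\<^bsub>K\<^esub>"
      using \<epsilon>_L[of f x] f that(1) linear_maps_zero[OF B.module_axioms k_module \<epsilon>_dual] by simp
  qed
  then show ?thesis using 0 L_B0_J B0_sub by (auto simp: low_0)
next
  case (Suc m) then show ?thesis using fil_step[OF fil_submodule, of m] by (simp only: low_Suc)
qed

lemma fil_Suc_mono: "fil n \<subseteq> fil (Suc n)"
proof (induction n)
  case 0
  show ?case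
  proof
    fix x assume x: "x \<in> fil 0"
    then have "L f x \<in> fil 0" if "f \<in> J" for f using L_B0_J[OF that] filE(4)[of 0] by simp
    then show "x \<in> fil (Suc 0)" unfolding fil_step[OF fil_submodule] using fil_sub[OF x] by blast
  qed
next
  case (Suc n)
  then show ?case unfolding fil_low[of "Suc n"] fil_low[of "Suc (Suc n)"] low_Suc by blast
qed

lemma low_Suc_mono: "low n \<subseteq> low (Suc n)"
proof (cases n)
  case 0 then show ?thesis using filE(4)[of 0] by (simp only: low_0 low_Suc) blast
next
  case (Suc m) then show ?thesis using fil_Suc_mono[of m] by (simp only: low_Suc)
qed

lemma low_mono: "m \<le> n \<Longrightarrow> low m \<subseteq> low n"
  using lift_Suc_mono_le[of low] low_Suc_mono by blast

text \<open>\<open>L h\<close> maps B_0 into itself, so f after \<open>L h\<close> is again in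
  \<open>J\<close> and the description of B_n by \<open>J\<close> applies to it.\<close>

lemma L_fil: assumes "h \<in> dual" "x \<in> fil n" shows "L h x \<in> fil n"
  using assms
proof (induction n arbitrary: h)
  case 0 then show ?case using L_B0 by simp
next
  case (Suc n)
  have x: "x \<in> carrier B" using Suc.prems(2) by (rule fil_sub)
  have "L f (L h x) \<in> fil n" if f: "f \<in> J" for f
  proof -
    have fd: "f \<in> dual" using f by simp
    have "(\<lambda>a. f (L h a)) \<in> J" using dual_L[OF fd Suc.prems(1)] f L_B0[OF Suc.prems(1)] by simp
    then have "L (\<lambda>a. f (L h a)) x \<in> fil n"
      using Suc.prems(2) unfolding fil_step[OF fil_submodule] by blast
    then show ?thesis by (simp only: L_L[OF fd Suc.prems(1) x])
  qed
  then show ?case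
    unfolding fil_step[OF fil_submodule] using L_simps(1)[OF Suc.prems(1) x] by blast
qed

text \<open>\<open>low k\<close> is B_{k-1}, so B_n is sent to B_{n-k}. For f in \<open>J\<close>
  the operator \<open>L f\<close> commutes with \<open>Rr v\<close> and lowers n by one, which
  drives the induction. In the extreme case k = n + 1 every functional f takes the value v(L f x) =
  0, as L f x stays in B_n.\<close>

lemma Rr_low:
  assumes "v \<in> dual" "\<And>y. y \<in> low k \<Longrightarrow> v y = \<zero>\<^bsub>K\<^esub>" "k \<le> Suc n" "x \<in> fil n"
  shows "Rr v x \<in> low (Suc n - k)"
  using assms(3,4)
proof (induction n arbitrary: x)
  case 0
  have x: "x \<in> carrier B" using 0(2) by (rule fil_sub)
  show ?case
  proof (cases "k = Suc 0")
    case True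
    have "Rr v x = \<zero>"
    proof (rule functional_eq[OF Rr_simps(1)[OF assms(1) x]])
      fix f assume f: "f \<in> dual"
      show "f (Rr v x) = \<zero>\<^bsub>K\<^esub>"
        unfolding f_Rr[OF assms(1) f x] using assms(2) L_fil[OF f 0(2)] by (simp only: True low_Suc)
    qed
    then show ?thesis by (simp add: True low_0)
  next
    case False
    then have k: "k = 0" using 0(1) by simp
    have "L f (Rr v x) \<in> low 0" if f: "f \<in> J" for f
    proof -
      have fd: "f \<in> dual" using f by simp
      have "L f (Rr v x) = Rr v (L f x)" by (rule Rr_L[OF assms(1) fd x, symmetric])
      also have "L f x = \<zero>" using L_B0_J[OF f] 0(2) by simp
      also have "Rr v \<zero> = \<zero>" by (rule linear_maps_zero[OF B.module_axioms B.module_axioms Rr_linear[OF assms(1)]])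
      finally show ?thesis by (simp add: low_0)
    qed
    then have "Rr v x \<in> fil 0" unfolding fil_low using Rr_simps(1)[OF assms(1) x] by blast
    then show ?thesis unfolding k by (simp only: low_Suc diff_zero)
  qed
next
  case (Suc n)
  have x: "x \<in> carrier B" using Suc(3) by (rule fil_sub)
  show ?case
  proof (cases "k = Suc (Suc n)")
    case True
    have "Rr v x = \<zero>"
    proof (rule functional_eq[OF Rr_simps(1)[OF assms(1) x]])
      fix f assume f: "f \<in> dual"
      show "f (Rr v x) = \<zero>\<^bsub>K\<^esub>"
        unfolding f_Rr[OF assms(1) f x] using assms(2) L_fil[OF f Suc(3)] by (simp only: True low_Suc)
    qed
    then show ?thesis by (simp add: True low_0)
  next
    case False
    then have k: "k \<le> Suc n" using Suc(2) by simp
    have "L f (Rr v x) \<in> low (Suc n - k)" if f: "f \<in> J" for f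
    proof -
      have fd: "f \<in> dual" using f by simp
      have "L f x \<in> fil n" using Suc(3) f unfolding fil_step[OF fil_submodule] by blast
      then have "Rr v (L f x) \<in> low (Suc n - k)" by (rule Suc.IH[OF k])
      then show ?thesis by (simp only: Rr_L[OF assms(1) fd x])
    qed
    then have "Rr v x \<in> fil (Suc n - k)" unfolding fil_low using Rr_simps(1)[OF assms(1) x] by blast
    then show ?thesis using k by (simp only: low_Suc Suc_diff_le)
  qed
qed

text \<open>A fixed retraction onto B_{n-1} for each n. It serves in the telescoping sum of
  \<open>\<Delta>_fil\<close> and in the symbol maps \<open>p\<close>.\<close>

definition ret where
  "ret n = (SOME p. p \<in> linear_maps K B B \<and> (\<forall>x\<in>carrier B. p x \<in> low n) \<and> (\<forall>x\<in>low n. p x = x))"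

lemma ret_props: "ret n \<in> linear_maps K B B \<and> (\<forall>x\<in>carrier B. ret n x \<in> low n) \<and> (\<forall>x\<in>low n. ret n x = x)"
proof -
  obtain p where "p \<in> linear_maps K B B" "\<And>x. x \<in> carrier B \<Longrightarrow> p x \<in> low n" "\<And>x. x \<in> low n \<Longrightarrow> p x = x"
    using retract[OF low_submodule] by blast
  then have "p \<in> linear_maps K B B \<and> (\<forall>x\<in>carrier B. p x \<in> low n) \<and> (\<forall>x\<in>low n. p x = x)" by blast
  then show ?thesis unfolding ret_def by (rule someI[where P = "\<lambda>p. p \<in> linear_maps K B B \<and> (\<forall>x\<in>carrier B. p x \<in> low n) \<and> (\<forall>x\<in>low n. p x = x)"])
qed

lemma ret: "ret n \<in> linear_maps K B B" "x \<in> carrier B \<Longrightarrow> ret n x \<in> low n" "x \<in> low n \<Longrightarrow> ret n x = x"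
  using ret_props[of n] by blast+

lemma ret_closed [simp]: "x \<in> carrier B \<Longrightarrow> ret n x \<in> carrier B"
  by (rule linear_mapsD(1)[OF ret(1)])

section \<open>Compatibility of the coproduct with the filtration\<close>

definition filt_gens where "filt_gens n = (\<Union>i\<le>n. {pt a b | a b. a \<in> fil i \<and> b \<in> fil (n - i)})"
definition F2 where "F2 n = lin_span K BB (filt_gens n)"

lemma filt_gens_sub: "filt_gens n \<subseteq> carrier BB"
  unfolding filt_gens_def by auto

lemma F2_submodule: "submodule (F2 n) K BB"
  unfolding F2_def by (rule lin_span_submodule[OF B.T2.T.module_axioms filt_gens_sub])

lemma F2_sub: "t \<in> F2 n \<Longrightarrow> t \<in> carrier BB"
  using B.T2.T.submoduleE(1)[OF F2_submodule] by blast

lemma F2_pt: "a \<in> fil i \<Longrightarrow> b \<in> fil (n - i) \<Longrightarrow> i \<le> n \<Longrightarrow> pt a b \<in> F2 n"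
  unfolding F2_def filt_gens_def by (intro subsetD[OF lin_span_superset]) blast

text \<open>With retractions onto the \<open>B\<^sub>m\<close> the identity is the telescoping sum of the differences \<open>q\<^sub>m\<close>, and
  \<open>(1 \<otimes> q\<^sub>m)\<Delta>(x)\<close> lies in \<open>B\<^sub>n\<^sub>-\<^sub>m \<otimes> B\<^sub>m\<close>.\<close>

lemma \<Delta>_fil: assumes "x \<in> fil n" shows "\<Delta> x \<in> F2 n"
proof -
  have x: "x \<in> carrier B" using assms by (rule fil_sub)
  have cl: "(\<lambda>x. x \<oplus> (\<ominus>\<^bsub>K\<^esub> \<one>\<^bsub>K\<^esub>) \<odot> ret m x) \<in> linear_maps K B B" for m by (rule compl_linear[OF ret(1)])
  have part: "tmap (\<lambda>x. x) (ret m) (\<Delta> x) \<in> F2 n" if "m \<le> Suc n" for m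
    using that
  proof (induction m)
    case 0
    have "tmap (\<lambda>x. x) (ret 0) (\<Delta> x) \<in> {\<zero>\<^bsub>BB\<^esub>}"
    proof (rule tmap_span[OF linear_maps_ident ret(1) zero_submodule[OF B.T2.T.module_axioms] _ \<Delta>_closed[OF x]])
      fix a b assume "a \<in> carrier B" "b \<in> carrier B"
      moreover from this have "ret 0 b = \<zero>" using ret(2)[of b 0] by (simp add: low_0)
      ultimately show "pt a (ret 0 b) \<in> {\<zero>\<^bsub>BB\<^esub>}" by (simp add: B.T2.pt_zero)
    qed
    then show ?case using submodule_zero[OF B.T2.T.module_axioms F2_submodule] by simp
  next
    case (Suc m)
    then have m: "m \<le> n" and IH: "tmap (\<lambda>x. x) (ret m) (\<Delta> x) \<in> F2 n" by simp_all
    let ?q = "\<lambda>y. ret (Suc m) y \<oplus> (\<ominus>\<^bsub>K\<^esub> \<one>\<^bsub>K\<^esub>) \<odot> ret m y"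
    \<comment> \<open>\<open>low (Suc n - m)\<close> is B_{n-m}, the first factor that goes with a
      second factor in B_m.\<close>
    let ?r = "ret (Suc n - m)"
    let ?c = "\<lambda>x. x \<oplus> (\<ominus>\<^bsub>K\<^esub> \<one>\<^bsub>K\<^esub>) \<odot> ?r x"
    have q: "?q \<in> linear_maps K B B"
      by (intro linear_maps_add linear_maps_const_smult ret(1) B.module_axioms) simp
    note qc = linear_mapsD(1)[OF q]
    have q0: "?q y = \<zero>" if "y \<in> low m" for y
    proof -
      have "y \<in> low (Suc m)" using that low_Suc_mono by blast
      then show ?thesis using that low_sub[OF that] by (simp add: ret(3) B.smult_l_minus B.M.r_neg)
    qed
    have qfil: "?q y \<in> fil m" if "y \<in> carrier B" for y
    proof -
      have "ret (Suc m) y \<in> fil m" "ret m y \<in> fil m"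
        using ret(2)[OF that, of "Suc m"] ret(2)[OF that, of m] low_Suc_mono[of m] by (auto simp only: low_Suc)
      then show ?thesis using filE(2)[of "\<ominus>\<^bsub>K\<^esub> \<one>\<^bsub>K\<^esub>" "ret m y" m] filE(3) by simp
    qed
    have z: "tmap ?c ?q (\<Delta> x) = \<zero>\<^bsub>BB\<^esub>"
    proof (rule tmap_\<Delta>_zero[OF cl q x])
      fix v assume v: "v \<in> dual"
      have v': "(\<lambda>b. v (?q b)) \<in> dual" by (rule linear_maps_comp[OF q v])
      have vk: "v (?q y) = \<zero>\<^bsub>K\<^esub>" if "y \<in> low m" for y
        using q0[OF that] linear_maps_zero[OF B.module_axioms k_module v] by simp
      have "Rr (\<lambda>b. v (?q b)) x \<in> low (Suc n - m)" by (rule Rr_low[OF v' vk _ assms]) (use m in simp_all)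
      then show "?c (Rr (\<lambda>b. v (?q b)) x) = \<zero>"
        using compl_zero[where p = ?r, OF ret(3)] low_sub by blast
    qed
    have split: "tmap (\<lambda>x. x) (ret (Suc m)) (\<Delta> x) =
      tmap (\<lambda>x. x) (ret m) (\<Delta> x) \<oplus>\<^bsub>BB\<^esub> (tmap ?r ?q (\<Delta> x) \<oplus>\<^bsub>BB\<^esub> tmap ?c ?q (\<Delta> x))"
    proof (rule B.T2.T_linear_eq[OF B.T2.T.module_axioms tmap_linear[OF linear_maps_ident ret(1)]
          linear_maps_add[OF B.T2.T.module_axioms tmap_linear[OF linear_maps_ident ret(1)]
            linear_maps_add[OF B.T2.T.module_axioms tmap_linear[OF ret(1) q] tmap_linear[OF cl q]]] _ \<Delta>_closed[OF x]])
      fix a b assume ab: "a \<in> carrier B" "b \<in> carrier B"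
      note cc = linear_mapsD(1)[OF cl]
      have "tmap ?r ?q (pt a b) \<oplus>\<^bsub>BB\<^esub> tmap ?c ?q (pt a b) = pt (?r a) (?q b) \<oplus>\<^bsub>BB\<^esub> pt (?c a) (?q b)"
        using ab by (simp only: tmap_simps(4)[OF ret(1) q] tmap_simps(4)[OF cl q])
      also have "\<dots> = pt (?r a \<oplus> ?c a) (?q b)"
        by (rule B.T2.pt_simps(2)[symmetric, OF ret_closed[OF ab(1)] qc[OF ab(2)] cc[OF ab(1)]])
      also have "?r a \<oplus> ?c a = a" by (rule compl_add[where p = ?r, OF ret_closed[OF ab(1)] ab(1)])
      finally have 1: "tmap ?r ?q (pt a b) \<oplus>\<^bsub>BB\<^esub> tmap ?c ?q (pt a b) = pt a (?q b)" .
      have "ret (Suc m) b = ret m b \<oplus> ?q b"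
        using ab by (simp add: B.smult_l_minus B.M.r_neg3)
      then have "pt a (ret (Suc m) b) = pt a (ret m b) \<oplus>\<^bsub>BB\<^esub> pt a (?q b)"
        using B.T2.pt_simps(3)[OF ab(1) ret_closed[OF ab(2), where n = m] qc[OF ab(2)]] by (simp only:)
      then show "tmap (\<lambda>x. x) (ret (Suc m)) (pt a b) =
        tmap (\<lambda>x. x) (ret m) (pt a b) \<oplus>\<^bsub>BB\<^esub> (tmap ?r ?q (pt a b) \<oplus>\<^bsub>BB\<^esub> tmap ?c ?q (pt a b))"
        unfolding 1 using ab by (simp only: tmap_simps(4)[OF linear_maps_ident ret(1)])
    qed
    have "tmap ?r ?q (\<Delta> x) \<in> F2 n"
    proof (rule tmap_span[OF ret(1) q F2_submodule _ \<Delta>_closed[OF x]])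
      fix a b assume ab: "a \<in> carrier B" "b \<in> carrier B"
      have "?r a \<in> fil (n - m)" using ret(2)[OF ab(1), of "Suc n - m"] m by (simp only: Suc_diff_le low_Suc)
      moreover have "?q b \<in> fil (n - (n - m))" using qfil[OF ab(2)] m by simp
      ultimately show "pt (?r a) (?q b) \<in> F2 n" by (rule F2_pt) simp
    qed
    then show ?case
      unfolding split z using IH B.T2.T.submoduleE(5)[OF F2_submodule] F2_sub by simp
  qed
  \<comment> \<open>What is left after the retraction onto B_n. Here k = n + 1, so
    \<open>Rr_low\<close> lands in \<open>low 0\<close>, which is zero.\<close>
  have "tmap (\<lambda>x. x) (\<lambda>x. x \<oplus> (\<ominus>\<^bsub>K\<^esub> \<one>\<^bsub>K\<^esub>) \<odot> ret (Suc n) x) (\<Delta> x) = \<zero>\<^bsub>BB\<^esub>"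
  proof (rule tmap_\<Delta>_zero[OF linear_maps_ident cl x])
    fix v assume v: "v \<in> dual"
    let ?c = "\<lambda>x. x \<oplus> (\<ominus>\<^bsub>K\<^esub> \<one>\<^bsub>K\<^esub>) \<odot> ret (Suc n) x"
    have v': "(\<lambda>b. v (?c b)) \<in> dual" by (rule linear_maps_comp[OF cl v])
    have vk: "v (?c y) = \<zero>\<^bsub>K\<^esub>" if "y \<in> low (Suc n)" for y
      using compl_zero[where p = "ret (Suc n)", OF ret(3)[OF that] low_sub[OF that]] linear_maps_zero[OF B.module_axioms k_module v] by simp
    have "Rr (\<lambda>b. v (?c b)) x \<in> low (Suc n - Suc n)" by (rule Rr_low[OF v' vk _ assms]) simp_all
    then show "Rr (\<lambda>b. v (?c b)) x = \<zero>" by (simp only: diff_self_eq_0 low_0 singleton_iff)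
  qed
  moreover have "\<Delta> x = tmap (\<lambda>x. x) (ret (Suc n)) (\<Delta> x) \<oplus>\<^bsub>BB\<^esub> tmap (\<lambda>x. x) (\<lambda>x. x \<oplus> (\<ominus>\<^bsub>K\<^esub> \<one>\<^bsub>K\<^esub>) \<odot> ret (Suc n) x) (\<Delta> x)"
  proof (rule B.T2.T_linear_eq[OF B.T2.T.module_axioms linear_maps_ident
        linear_maps_add[OF B.T2.T.module_axioms tmap_linear[OF linear_maps_ident ret(1)] tmap_linear[OF linear_maps_ident cl]] _ \<Delta>_closed[OF x]])
    fix a b assume ab: "a \<in> carrier B" "b \<in> carrier B"
    let ?c = "\<lambda>x. x \<oplus> (\<ominus>\<^bsub>K\<^esub> \<one>\<^bsub>K\<^esub>) \<odot> ret (Suc n) x"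
    have "pt a (ret (Suc n) b) \<oplus>\<^bsub>BB\<^esub> pt a (?c b) = pt a (ret (Suc n) b \<oplus> ?c b)"
      by (rule B.T2.pt_simps(3)[symmetric, OF ab(1) ret_closed[OF ab(2)] linear_mapsD(1)[OF cl ab(2)]])
    also have "ret (Suc n) b \<oplus> ?c b = b" by (rule compl_add[where p = "ret (Suc n)", OF ret_closed[OF ab(2)] ab(2)])
    finally show "pt a b = tmap (\<lambda>x. x) (ret (Suc n)) (pt a b) \<oplus>\<^bsub>BB\<^esub> tmap (\<lambda>x. x) ?c (pt a b)"
      using ab by (simp only: tmap_simps(4)[OF linear_maps_ident ret(1)] tmap_simps(4)[OF linear_maps_ident cl])
  qed
  ultimately show ?thesis
    using part[of "Suc n"] F2_sub[OF part[of "Suc n"]] by simp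
qed

section \<open>Products and brackets in the filtration\<close>

lemma gl_mult: assumes "g \<in> G" "t \<in> G" shows "g \<otimes> t \<in> G"
  unfolding grouplikes_def
  by (simp add: gl[OF assms(1)] gl[OF assms(2)] \<Delta>_simps \<epsilon>_simps B.T2.pt_mult)

lemma gl_one: "\<one> \<in> G"
  unfolding grouplikes_def by (simp add: \<Delta>_simps \<epsilon>_simps B.T2.T_one)

lemma B0_mult: assumes "x \<in> B0" "y \<in> B0" shows "x \<otimes> y \<in> B0"
  using assms unfolding coradical_eq
  by (rule bilin_span[OF B.module_axioms B.module_axioms B.module_axioms B.bilin_mult G_sub G_sub lin_span_submodule[OF B.module_axioms G_sub], rotated])
    (intro subsetD[OF lin_span_superset] gl_mult)

lemma B0_br: assumes "x \<in> B0" "y \<in> B0" shows "br x y = \<zero>"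
proof -
  have "br x y \<in> {\<zero>}"
    using assms unfolding coradical_eq
    by (rule bilin_span[OF B.module_axioms B.module_axioms B.module_axioms B.br_bilin G_sub G_sub zero_submodule[OF B.module_axioms], rotated])
      (simp add: gl_br)
  then show ?thesis by simp
qed

lemma filt_gensE:
  assumes "t \<in> filt_gens n"
  obtains i a b where "i \<le> n" "a \<in> fil i" "b \<in> fil (n - i)" "t = pt a b"
  using assms unfolding filt_gens_def by blast

text \<open>The product of the two coproducts is contracted with f in \<open>J\<close>. A term with
  both first factors in B_0 is killed because B_0 is a subalgebra. In every other term the second
  factors have total degree below i + j, where the induction hypothesis applies.\<close>

lemma fil_mult: "x \<in> fil i \<Longrightarrow> y \<in> fil j \<Longrightarrow> x \<otimes> y \<in> fil (i + j)"
proof (induction "i + j" arbitrary: i j x y rule: less_induct)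
  case less
  have xy: "x \<in> carrier B" "y \<in> carrier B" using less.prems fil_sub by blast+
  have "L f (x \<otimes> y) \<in> low (i + j)" if f: "f \<in> J" for f
  proof -
    have fd: "f \<in> dual" using f by simp
    let ?l = "tlift K B (\<lambda>a b. f a \<odot> b)"
    have bil: "bilin K BB BB B (\<lambda>s t. ?l (s \<otimes>\<^bsub>BB\<^esub> t))"
      by (rule bilin_linear[OF B.T2.T.bilin_mult B.T2.tlift_linear[OF B.module_axioms L_bilin[OF fd]]])
    have "?l (\<Delta> x \<otimes>\<^bsub>BB\<^esub> \<Delta> y) \<in> low (i + j)"
    proof (rule bilin_span[OF B.T2.T.module_axioms B.T2.T.module_axioms B.module_axioms bil filt_gens_sub[of i] filt_gens_sub[of j] low_submodule])
      show "\<Delta> x \<in> lin_span K BB (filt_gens i)" "\<Delta> y \<in> lin_span K BB (filt_gens j)"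
        using \<Delta>_fil[OF less.prems(1)] \<Delta>_fil[OF less.prems(2)] unfolding F2_def by auto
      fix s t assume "s \<in> filt_gens i" "t \<in> filt_gens j"
      then obtain p a b q c d where s: "p \<le> i" "a \<in> fil p" "b \<in> fil (i - p)" "s = pt a b"
        and t: "q \<le> j" "c \<in> fil q" "d \<in> fil (j - q)" "t = pt c d" by (elim filt_gensE) blast
      have cl: "a \<in> carrier B" "b \<in> carrier B" "c \<in> carrier B" "d \<in> carrier B" using s t fil_sub by blast+
      have eq: "?l (s \<otimes>\<^bsub>BB\<^esub> t) = f (a \<otimes> c) \<odot> (b \<otimes> d)"
        using cl by (simp add: s(4) t(4) B.T2.pt_mult B.T2.tlift_pt[OF B.module_axioms L_bilin[OF fd]])
      show "?l (s \<otimes>\<^bsub>BB\<^esub> t) \<in> low (i + j)"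
      proof (cases "p = 0 \<and> q = 0")
        case True
        then have "a \<otimes> c \<in> B0" using s(2) t(2) by (intro B0_mult) simp_all
        then have "f (a \<otimes> c) = \<zero>\<^bsub>K\<^esub>" using f by blast
        then show ?thesis unfolding eq using cl lowE(4) by simp
      next
        case False
        then have lt: "(i - p) + (j - q) < i + j" using s(1) t(1) by auto
        then have "b \<otimes> d \<in> fil ((i - p) + (j - q))" using less.hyps s(3) t(3) by blast
        then have "b \<otimes> d \<in> low (Suc ((i - p) + (j - q)))" by (simp only: low_Suc)
        then have "b \<otimes> d \<in> low (i + j)" using low_mono[of "Suc ((i - p) + (j - q))" "i + j"] lt by auto
        then show ?thesis unfolding eq using lowE(2) dual_closed[OF fd] cl by simp
      qed
    qed
    then show ?thesis unfolding L_def using xy by (simp add: \<Delta>_simps(2))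
  qed
  then show ?case unfolding fil_low using xy by simp
qed

text \<open>As for products, with two summands. If both first factors lie in B_0, one summand is
  killed by f and the other contains a bracket in B_0, which is zero. Otherwise the second factors
  have smaller total degree; their bracket falls under the induction hypothesis and their product
  under \<open>fil_mult\<close>.\<close>

lemma fil_br: "x \<in> fil i \<Longrightarrow> y \<in> fil j \<Longrightarrow> br x y \<in> fil (i + j)"
proof (induction "i + j" arbitrary: i j x y rule: less_induct)
  case less
  have xy: "x \<in> carrier B" "y \<in> carrier B" using less.prems fil_sub by blast+
  have "L f (br x y) \<in> low (i + j)" if f: "f \<in> J" for f
  proof -
    have fd: "f \<in> dual" using f by simp
    let ?l = "tlift K B (\<lambda>a b. f a \<odot> b)"
    note l = B.T2.tlift_simps[OF B.module_axioms L_bilin[OF fd]]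
    have bil: "bilin K BB BB B (\<lambda>s t. ?l (B.tb s t))"
      by (rule bilin_linear[OF B.tb_bilin B.T2.tlift_linear[OF B.module_axioms L_bilin[OF fd]]])
    have "?l (B.tb (\<Delta> x) (\<Delta> y)) \<in> low (i + j)"
    proof (rule bilin_span[OF B.T2.T.module_axioms B.T2.T.module_axioms B.module_axioms bil filt_gens_sub[of i] filt_gens_sub[of j] low_submodule])
      show "\<Delta> x \<in> lin_span K BB (filt_gens i)" "\<Delta> y \<in> lin_span K BB (filt_gens j)"
        using \<Delta>_fil[OF less.prems(1)] \<Delta>_fil[OF less.prems(2)] unfolding F2_def by auto
      fix s t assume "s \<in> filt_gens i" "t \<in> filt_gens j"
      then obtain p a b q c d where s: "p \<le> i" "a \<in> fil p" "b \<in> fil (i - p)" "s = pt a b"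
        and t: "q \<le> j" "c \<in> fil q" "d \<in> fil (j - q)" "t = pt c d" by (elim filt_gensE) blast
      have cl: "a \<in> carrier B" "b \<in> carrier B" "c \<in> carrier B" "d \<in> carrier B" using s t fil_sub by blast+
      have eq: "?l (B.tb s t) = f (a \<otimes> c) \<odot> br b d \<oplus> f (br a c) \<odot> (b \<otimes> d)"
        using cl by (simp add: s(4) t(4) B.tb_pt l)
      show "?l (B.tb s t) \<in> low (i + j)"
      proof (cases "p = 0 \<and> q = 0")
        case True
        then have "a \<in> B0" "c \<in> B0" using s(2) t(2) by simp_all
        then have "f (a \<otimes> c) = \<zero>\<^bsub>K\<^esub>" "br a c = \<zero>" using f B0_mult B0_br by blast+
        then show ?thesis unfolding eq using cl lowE(4) linear_maps_zero[OF B.module_axioms k_module fd] by simp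
      next
        case False
        then have lt: "(i - p) + (j - q) < i + j" using s(1) t(1) by auto
        then have "br b d \<in> fil ((i - p) + (j - q))" using less.hyps s(3) t(3) by blast
        then have "br b d \<in> low (Suc ((i - p) + (j - q)))" by (simp only: low_Suc)
        then have 1: "br b d \<in> low (i + j)" using low_mono[of "Suc ((i - p) + (j - q))" "i + j"] lt by auto
        have "b \<otimes> d \<in> low (Suc ((i - p) + (j - q)))" using fil_mult[OF s(3) t(3)] by (simp only: low_Suc)
        then have 2: "b \<otimes> d \<in> low (i + j)" using low_mono[of "Suc ((i - p) + (j - q))" "i + j"] lt by auto
        show ?thesis unfolding eq using 1 2 lowE(2,3) dual_closed[OF fd] cl by simp
      qed
    qed
    then show ?thesis unfolding L_def using xy by (simp add: B.comult_br)
  qed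
  then show ?case unfolding fil_low using xy by simp
qed

section \<open>The associated graded Poisson algebra\<close>

lemmas low_additive = submodule_additive[OF low_submodule]
lemmas B_ag = B.M.abelian_group_axioms

lemmas lc_mem = coset_mem[OF B_ag low_additive]
lemmas lc_self = coset_self[OF B_ag low_additive]
lemmas lc_eq = coset_eq[OF B_ag low_additive]
lemmas lc_add = coset_add[OF B_ag low_additive]
lemmas lc_zero = coset_zero[OF B_ag low_additive]

lemma lc_smult:
  assumes "c \<in> carrier K" "x \<in> carrier B"
  shows "(\<Union>y\<in>low n +> x. low n +> (c \<odot> y)) = low n +> (c \<odot> x)"
proof -
  have "low n +> (c \<odot> y) = low n +> (c \<odot> x)" if "y \<in> low n +> x" for y
  proof -
    have y: "y \<in> carrier B" "y \<ominus> x \<in> low n" using that lc_mem[OF assms(2)] by auto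
    have "c \<odot> y \<ominus> c \<odot> x = c \<odot> (y \<ominus> x)"
      using assms y(1) by (simp add: a_minus_def B.smult_r_distr B.smult_r_minus)
    then show ?thesis using lowE(2)[OF assms(1) y(2)] assms y(1) by (simp add: lc_eq)
  qed
  then have "(\<Union>y\<in>low n +> x. low n +> (c \<odot> y)) = (\<Union>y\<in>low n +> x. low n +> (c \<odot> x))"
    by (intro SUP_cong refl)
  moreover have "low n +> x \<noteq> {}" using lc_self[OF assms(2)] by blast
  ultimately show ?thesis by (simp only: UN_constant if_False)
qed

lemma low_coset_iff: "x \<in> carrier B \<Longrightarrow> low n +> x = low n \<longleftrightarrow> x \<in> low n"
  using lc_eq[of x "\<zero>" n] by (simp add: lc_zero a_minus_def)

abbreviation C where "C \<equiv> gr_algebra K B"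
abbreviation cls where "cls \<equiv> gr_class K B"

text \<open>Families of representatives for the elements of C. Operations are computed on such
  families and transferred by \<open>cl\<close>; finiteness is asked of the family itself, so that
  it passes to sums and convolutions.\<close>

definition adm where "adm x \<longleftrightarrow> (\<forall>n. x n \<in> fil n) \<and> finite {n. x n \<noteq> \<zero>}"
definition cl where "cl x = (\<lambda>n. low n +> x n)"

lemma C_sel:
  "carrier C = {c. (\<forall>n. \<exists>x\<in>fil n. c n = low n +> x) \<and> finite {n. c n \<noteq> low n}}"
  "mult C = gr_op K B (mult B)" "\<one>\<^bsub>C\<^esub> = cls 0 \<one>" "\<zero>\<^bsub>C\<^esub> = low"
  "c \<oplus>\<^bsub>C\<^esub> d = (\<lambda>n. c n <+>\<^bsub>B\<^esub> d n)"
  "s \<odot>\<^bsub>C\<^esub> c = (\<lambda>n. \<Union>x\<in>c n. low n +> (s \<odot> x))"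
  by (simp_all add: gr_algebra_def)

lemma adm_closed: "adm x \<Longrightarrow> x n \<in> fil n" "adm x \<Longrightarrow> x n \<in> carrier B"
  unfolding adm_def using fil_sub by blast+

lemma cl_mem: assumes "adm x" shows "cl x \<in> carrier C"
proof -
  have "{n. cl x n \<noteq> low n} \<subseteq> {n. x n \<noteq> \<zero>}" by (auto simp: cl_def lc_zero)
  then have "finite {n. cl x n \<noteq> low n}" using assms unfolding adm_def by (blast intro: finite_subset)
  then show ?thesis unfolding C_sel using assms by (auto simp: cl_def adm_def)
qed

text \<open>A zero class is represented by 0 and any other class by a chosen element, so the family
  has finite support because the element has.\<close>

lemma C_rep: assumes "c \<in> carrier C" obtains x where "adm x" "c = cl x"
proof -
  have ex: "\<exists>x. x \<in> fil n \<and> c n = low n +> x \<and> (c n = low n \<longrightarrow> x = \<zero>)" for n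
  proof (cases "c n = low n")
    case True then show ?thesis using filE(4) lc_zero by auto
  next
    case False then show ?thesis using assms unfolding C_sel by auto
  qed
  define x where "x n = (SOME x. x \<in> fil n \<and> c n = low n +> x \<and> (c n = low n \<longrightarrow> x = \<zero>))" for n
  have x: "x n \<in> fil n \<and> c n = low n +> x n \<and> (c n = low n \<longrightarrow> x n = \<zero>)" for n
    unfolding x_def by (rule someI_ex[OF ex])
  have "{n. x n \<noteq> \<zero>} \<subseteq> {n. c n \<noteq> low n}" using x by blast
  moreover have "finite {n. c n \<noteq> low n}" using assms unfolding C_sel by auto
  ultimately have "adm x" unfolding adm_def using x by (blast intro: finite_subset)
  moreover have "c = cl x" unfolding cl_def using x by auto
  ultimately show thesis by (rule that)
qed

lemma adm_add: assumes "adm x" "adm y" shows "adm (\<lambda>n. x n \<oplus> y n)"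
proof -
  have "{n. x n \<oplus> y n \<noteq> \<zero>} \<subseteq> {n. x n \<noteq> \<zero>} \<union> {n. y n \<noteq> \<zero>}" by auto
  then show ?thesis using assms filE(3) unfolding adm_def by (auto intro: finite_subset)
qed

lemma adm_smult: assumes "c \<in> carrier K" "adm x" shows "adm (\<lambda>n. c \<odot> x n)"
proof -
  have "{n. c \<odot> x n \<noteq> \<zero>} \<subseteq> {n. x n \<noteq> \<zero>}" using assms(1) by auto
  then show ?thesis using assms filE(2) unfolding adm_def by (auto intro: finite_subset)
qed

lemma adm_zero: "adm (\<lambda>n. \<zero>)" unfolding adm_def using filE(4) by simp

lemma adm_single: "x \<in> fil n \<Longrightarrow> adm (\<lambda>m. if m = n then x else \<zero>)"
  unfolding adm_def using filE(4) by simp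

lemma cl_add: "adm x \<Longrightarrow> adm y \<Longrightarrow> cl x \<oplus>\<^bsub>C\<^esub> cl y = cl (\<lambda>n. x n \<oplus> y n)"
  unfolding cl_def C_sel by (intro ext lc_add adm_closed)

lemma cl_smult: "c \<in> carrier K \<Longrightarrow> adm x \<Longrightarrow> c \<odot>\<^bsub>C\<^esub> cl x = cl (\<lambda>n. c \<odot> x n)"
  unfolding cl_def C_sel by (intro ext lc_smult adm_closed)

lemma cl_zero: "\<zero>\<^bsub>C\<^esub> = cl (\<lambda>n. \<zero>)"
  unfolding cl_def C_sel by (simp add: lc_zero)

lemma cls_cl: "cls n x = cl (\<lambda>m. if m = n then x else \<zero>)"
  unfolding cl_def gr_class_def by (intro ext) (simp add: lc_zero)

lemma C_module: "module K C"
proof (intro moduleI abelian_groupI K.cring_axioms)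
  fix c assume "c \<in> carrier C"
  then obtain x where x: "adm x" "c = cl x" by (rule C_rep)
  have m: "\<ominus>\<^bsub>K\<^esub> \<one>\<^bsub>K\<^esub> \<in> carrier K" by simp
  have "cl (\<lambda>n. (\<ominus>\<^bsub>K\<^esub> \<one>\<^bsub>K\<^esub>) \<odot> x n) \<oplus>\<^bsub>C\<^esub> c = \<zero>\<^bsub>C\<^esub>"
    unfolding x(2) cl_zero cl_add[OF adm_smult[OF m x(1)] x(1)]
    using adm_closed(2)[OF x(1)] by (simp add: B.smult_l_minus B.M.l_neg)
  then show "\<exists>d\<in>carrier C. d \<oplus>\<^bsub>C\<^esub> c = \<zero>\<^bsub>C\<^esub>" using cl_mem[OF adm_smult[OF m x(1)]] by blast
qed ((elim C_rep)?; simp add: cl_add cl_smult cl_zero cl_mem adm_add adm_smult adm_zero adm_closed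
    B.M.a_ac B.smult_l_distr B.smult_r_distr B.smult_assoc1)+

sublocale C: module K C by (rule C_module)

lemma cls_closed [simp]: "x \<in> fil n \<Longrightarrow> cls n x \<in> carrier C"
  unfolding cls_cl by (intro cl_mem adm_single)

lemma cls_add: assumes "x \<in> fil n" "y \<in> fil n" shows "cls n (x \<oplus> y) = cls n x \<oplus>\<^bsub>C\<^esub> cls n y"
proof -
  have "(\<lambda>m. if m = n then x \<oplus> y else \<zero>) = (\<lambda>m. (if m = n then x else \<zero>) \<oplus> (if m = n then y else \<zero>))" by auto
  then show ?thesis unfolding cls_cl cl_add[OF adm_single[OF assms(1)] adm_single[OF assms(2)]] by (simp only:)
qed

lemma cls_smult: assumes "c \<in> carrier K" "x \<in> fil n" shows "cls n (c \<odot> x) = c \<odot>\<^bsub>C\<^esub> cls n x"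
proof -
  have "(\<lambda>m. if m = n then c \<odot> x else \<zero>) = (\<lambda>m. c \<odot> (if m = n then x else \<zero>))" using assms(1) by auto
  then show ?thesis unfolding cls_cl cl_smult[OF assms(1) adm_single[OF assms(2)]] by (simp only:)
qed

lemma cls_low: assumes "x \<in> low n" shows "cls n x = \<zero>\<^bsub>C\<^esub>"
  unfolding gr_class_def C_sel
  using low_coset_iff[OF low_sub[OF assms], of n] assms by (intro ext) simp

lemma cls_zero: "cls n \<zero> = \<zero>\<^bsub>C\<^esub>" by (rule cls_low[OF lowE(4)])

lemma cls_uminus: assumes "x \<in> fil n" shows "cls n (\<ominus> x) = \<ominus>\<^bsub>C\<^esub> cls n x"
proof -
  have x: "x \<in> carrier B" using assms by (rule fil_sub)
  have "cls n (\<ominus> x) = cls n ((\<ominus>\<^bsub>K\<^esub> \<one>\<^bsub>K\<^esub>) \<odot> x)" using x by (simp add: B.smult_l_minus)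
  also have "\<dots> = (\<ominus>\<^bsub>K\<^esub> \<one>\<^bsub>K\<^esub>) \<odot>\<^bsub>C\<^esub> cls n x" by (rule cls_smult) (simp_all add: assms)
  finally show ?thesis using assms by (simp add: C.smult_l_minus)
qed

lemma C_induct [consumes 1, case_names add cls]:
  assumes "c \<in> carrier C"
    and add: "\<And>c d. c \<in> carrier C \<Longrightarrow> d \<in> carrier C \<Longrightarrow> P c \<Longrightarrow> P d \<Longrightarrow> P (c \<oplus>\<^bsub>C\<^esub> d)"
    and cls: "\<And>n x. x \<in> fil n \<Longrightarrow> P (cls n x)"
  shows "P c"
proof -
  have "\<forall>x. adm x \<longrightarrow> {n. x n \<noteq> \<zero>} \<subseteq> X \<longrightarrow> P (cl x)" if "finite X" for X
    using that
  proof (induction X rule: finite_induct)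
    case empty
    have "P (cl x)" if "{n. x n \<noteq> \<zero>} \<subseteq> {}" for x
    proof -
      have "cl x = cls 0 \<zero>" using that unfolding cls_cl by (auto intro!: arg_cong[where f = cl])
      then show ?thesis using cls[OF filE(4)] by simp
    qed
    then show ?case by blast
  next
    case (insert n X)
    show ?case
    proof (intro allI impI)
      fix x assume x: "adm x" "{n. x n \<noteq> \<zero>} \<subseteq> insert n X"
      let ?y = "x(n := \<zero>)"
      have sub: "{m. ?y m \<noteq> \<zero>} \<subseteq> {m. x m \<noteq> \<zero>}" by auto
      have y: "adm ?y" unfolding adm_def
        using x(1) filE(4) finite_subset[OF sub] unfolding adm_def by simp
      have "{m. ?y m \<noteq> \<zero>} \<subseteq> X" using x(2) by auto
      then have "P (cl ?y)" using insert.IH y by blast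
      moreover have xn: "x n \<in> fil n" by (rule adm_closed(1)[OF x(1)])
      moreover have "cl x = cl ?y \<oplus>\<^bsub>C\<^esub> cls n (x n)"
      proof -
        have "x = (\<lambda>m. ?y m \<oplus> (if m = n then x n else \<zero>))"
          using adm_closed(2)[OF x(1)] by (auto simp: fun_eq_iff)
        then show ?thesis unfolding cls_cl cl_add[OF y adm_single[OF xn]] by (rule arg_cong)
      qed
      ultimately show "P (cl x)" using add[OF cl_mem[OF y] cls_closed[OF xn]] cls[OF xn] by simp
    qed
  qed
  moreover obtain x where "adm x" "c = cl x" using assms(1) by (rule C_rep)
  ultimately show ?thesis unfolding adm_def by blast
qed

lemma B_finsum_low: "finite X \<Longrightarrow> (\<And>i. i \<in> X \<Longrightarrow> f i \<in> low n) \<Longrightarrow> (\<Oplus>i\<in>X. f i) \<in> low n"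
  by (rule submodule_finsum[OF B.module_axioms low_submodule])

lemma B_finsum_fil: "finite X \<Longrightarrow> (\<And>i. i \<in> X \<Longrightarrow> f i \<in> fil n) \<Longrightarrow> (\<Oplus>i\<in>X. f i) \<in> fil n"
  by (rule submodule_finsum[OF B.module_axioms fil_submodule])

section \<open>Operations on C induced by filtered bilinear operations on B\<close>

context
  fixes f
  assumes f_bilin: "bilin K B B B f"
    and f_fil: "\<And>(i::nat) (j::nat) x y. x \<in> fil i \<Longrightarrow> y \<in> fil j \<Longrightarrow> f x y \<in> fil (i + j)"
begin

lemmas f_simps = bilin_simps[OF f_bilin]

lemma f_zero: "y \<in> carrier B \<Longrightarrow> f \<zero> y = \<zero>" "x \<in> carrier B \<Longrightarrow> f x \<zero> = \<zero>"
  using linear_maps_zero[OF B.module_axioms B.module_axioms bilinD(2)[OF f_bilin]]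
    linear_maps_zero[OF B.module_axioms B.module_axioms bilinD(1)[OF f_bilin]] by auto

lemma f_low: "x \<in> low i \<Longrightarrow> y \<in> fil j \<Longrightarrow> f x y \<in> low (i + j)" "x \<in> fil i \<Longrightarrow> y \<in> low j \<Longrightarrow> f x y \<in> low (i + j)"
proof -
  show "f x y \<in> low (i + j)" if "x \<in> low i" "y \<in> fil j"
  proof (cases i)
    case 0
    then have "x = \<zero>" using that(1) by (simp add: low_0)
    then show ?thesis using f_zero(1)[OF fil_sub[OF that(2)]] lowE(4) by simp
  next
    case (Suc i')
    then show ?thesis using f_fil[of x i' y j] that by (simp only: low_Suc add_Suc)
  qed
  show "f x y \<in> low (i + j)" if "x \<in> fil i" "y \<in> low j"
  proof (cases j)
    case 0
    then have "y = \<zero>" using that(2) by (simp add: low_0)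
    then show ?thesis using f_zero(2)[OF fil_sub[OF that(1)]] lowE(4) by simp
  next
    case (Suc j')
    then show ?thesis using f_fil[of x i y j'] that by (simp only: low_Suc add_Suc_right)
  qed
qed

lemma conv_fil: assumes "adm x" "adm y" shows "(\<Oplus>i\<in>{..n}. f (x i) (y (n - i))) \<in> fil n"
proof (rule B_finsum_fil)
  fix i assume "i \<in> {..n}"
  then show "f (x i) (y (n - i)) \<in> fil n"
    using f_fil[OF adm_closed(1)[OF assms(1), of i] adm_closed(1)[OF assms(2), of "n - i"]] by simp
qed simp

lemma adm_conv: assumes "adm x" "adm y" shows "adm (\<lambda>n. \<Oplus>i\<in>{..n}. f (x i) (y (n - i)))"
proof -
  let ?X = "{n. x n \<noteq> \<zero>}" and ?Y = "{n. y n \<noteq> \<zero>}"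
  have "n \<in> (\<lambda>p. fst p + snd p) ` (?X \<times> ?Y)" if n: "(\<Oplus>i\<in>{..n}. f (x i) (y (n - i))) \<noteq> \<zero>" for n
  proof (rule ccontr)
    assume no: "n \<notin> (\<lambda>p. fst p + snd p) ` (?X \<times> ?Y)"
    have "f (x i) (y (n - i)) = \<zero>" if i: "i \<in> {..n}" for i
    proof (cases "x i = \<zero> \<or> y (n - i) = \<zero>")
      case True then show ?thesis using f_zero adm_closed(2)[OF assms(1)] adm_closed(2)[OF assms(2)] by auto
    next
      case False
      then have "(i, n - i) \<in> ?X \<times> ?Y" by simp
      then have "i + (n - i) \<in> (\<lambda>p. fst p + snd p) ` (?X \<times> ?Y)" by force
      then show ?thesis using no i by simp
    qed
    then have "(\<Oplus>i\<in>{..n}. f (x i) (y (n - i))) = \<zero>" by (rule B.M.add.finprod_one_eqI)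
    then show False using n by simp
  qed
  then have "{n. (\<Oplus>i\<in>{..n}. f (x i) (y (n - i))) \<noteq> \<zero>} \<subseteq> (\<lambda>p. fst p + snd p) ` (?X \<times> ?Y)" by blast
  moreover have "finite ((\<lambda>p. fst p + snd p) ` (?X \<times> ?Y))" using assms unfolding adm_def by blast
  ultimately show ?thesis using conv_fil[OF assms] unfolding adm_def by (blast intro: finite_subset)
qed

text \<open>Changing the representatives x_i and y_j within their classes changes the sum in degree
  n by an element of B_{n-1}, so the union in \<open>gr_op\<close> is taken over a single
  coset.\<close>

lemma gr_op_cl: assumes "adm x" "adm y"
  shows "gr_op K B f (cl x) (cl y) = cl (\<lambda>n. \<Oplus>i\<in>{..n}. f (x i) (y (n - i)))"
proof (rule ext)
  fix n :: nat
  note xc = adm_closed[OF assms(1)] and yc = adm_closed[OF assms(2)]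
  let ?s = "\<lambda>x y. \<Oplus>i\<in>{..n}. f (x i) (y (n - i))"
  have key: "low n +> ?s x' y' = low n +> ?s x y"
    if x': "\<forall>i. x' i \<in> cl x i" and y': "\<forall>i. y' i \<in> cl y i" for x' y'
  proof -
    have xm: "x' i \<in> carrier B" "x' i \<ominus> x i \<in> low i" for i
      using x' lc_mem[OF xc(2), of "x' i" i] unfolding cl_def by auto
    have ym: "y' i \<in> carrier B" "y' i \<ominus> y i \<in> low i" for i
      using y' lc_mem[OF yc(2), of "y' i" i] unfolding cl_def by auto
    have x'd: "x' i = x i \<oplus> (x' i \<ominus> x i)" and y'd: "y' i = y i \<oplus> (y' i \<ominus> y i)" for i
      using xm(1)[of i] xc(2)[of i] ym(1)[of i] yc(2)[of i] by (simp_all add: a_minus_def B.M.r_neg3)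
    have lowfil: "low i \<subseteq> fil i" for i using low_Suc_mono[of i] by (simp only: low_Suc)
    have x'f: "x' i \<in> fil i" for i
      using filE(3)[OF xc(1)[of i] subsetD[OF lowfil xm(2)[of i]]] x'd[of i] by simp
    \<comment> \<open>The two arguments are replaced one after the other; each difference has one
      argument in the next lower step of the filtration.\<close>
    have d: "f (x' i) (y' j) = f (x i) (y j) \<oplus> (f (x' i \<ominus> x i) (y j) \<oplus> f (x' i) (y' j \<ominus> y j))" for i j
    proof -
      have "f (x' i) (y' j) = f (x' i) (y j) \<oplus> f (x' i) (y' j \<ominus> y j)"
        by (subst y'd) (rule f_simps(3)[OF xm(1) yc(2)], simp add: ym yc)
      also have "f (x' i) (y j) = f (x i) (y j) \<oplus> f (x' i \<ominus> x i) (y j)"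
        by (subst x'd) (rule f_simps(2)[OF xc(2) yc(2)], simp add: xm xc)
      finally show ?thesis using xm yc xc ym by (simp add: f_simps(1) B.M.a_assoc)
    qed
    let ?e = "\<lambda>i. f (x' i \<ominus> x i) (y (n - i)) \<oplus> f (x' i) (y' (n - i) \<ominus> y (n - i))"
    have e: "?e i \<in> low n" if "i \<in> {..n}" for i
    proof -
      have "f (x' i \<ominus> x i) (y (n - i)) \<in> low (i + (n - i))" "f (x' i) (y' (n - i) \<ominus> y (n - i)) \<in> low (i + (n - i))"
        by (rule f_low(1)[OF xm(2) yc(1)], rule f_low(2)[OF x'f ym(2)])
      then show ?thesis using that lowE(3) by simp
    qed
    have "?s x' y' = (\<Oplus>i\<in>{..n}. f (x i) (y (n - i)) \<oplus> ?e i)"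
      by (rule B.M.finsum_cong') (simp_all add: d f_simps(1) xm ym xc yc)
    also have "\<dots> = ?s x y \<oplus> (\<Oplus>i\<in>{..n}. ?e i)"
      by (rule B.M.finsum_addf) (simp_all add: Pi_def f_simps(1) xm ym xc yc)
    finally have eq: "?s x' y' = ?s x y \<oplus> (\<Oplus>i\<in>{..n}. ?e i)" .
    have E: "(\<Oplus>i\<in>{..n}. ?e i) \<in> low n" by (rule B_finsum_low[OF _ e]) simp_all
    have sc: "?s x y \<in> carrier B" using conv_fil[OF assms] fil_sub by blast
    have "(?s x y \<oplus> (\<Oplus>i\<in>{..n}. ?e i)) \<ominus> ?s x y = (\<Oplus>i\<in>{..n}. ?e i)"
      using sc low_sub[OF E] by (simp add: a_minus_def B.M.a_assoc B.M.r_neg3)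
    then show ?thesis unfolding eq using sc low_sub[OF E] E by (simp add: lc_eq)
  qed
  have self: "(\<forall>i. x i \<in> cl x i) \<and> (\<forall>i. y i \<in> cl y i)"
    unfolding cl_def using lc_self xc yc by blast
  show "gr_op K B f (cl x) (cl y) n = cl (\<lambda>n. \<Oplus>i\<in>{..n}. f (x i) (y (n - i))) n"
  proof -
    have "{low n +> ?s x' y' | x' y'. (\<forall>i. x' i \<in> cl x i) \<and> (\<forall>i. y' i \<in> cl y i)} = {low n +> ?s x y}"
    proof (intro equalityI subsetI)
      fix Z assume "Z \<in> {low n +> ?s x' y' | x' y'. (\<forall>i. x' i \<in> cl x i) \<and> (\<forall>i. y' i \<in> cl y i)}"
      then obtain x' y' where "Z = low n +> ?s x' y'" "\<forall>i. x' i \<in> cl x i" "\<forall>i. y' i \<in> cl y i" by blast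
      then show "Z \<in> {low n +> ?s x y}" using key by simp
    next
      fix Z assume "Z \<in> {low n +> ?s x y}"
      then show "Z \<in> {low n +> ?s x' y' | x' y'. (\<forall>i. x' i \<in> cl x i) \<and> (\<forall>i. y' i \<in> cl y i)}" using self by blast
    qed
    then show ?thesis unfolding gr_op_def by (simp add: cl_def)
  qed
qed

lemma gr_op_bilin: "bilin K C C C (gr_op K B f)"
proof -
  note a = adm_closed(2)
  have s: "(\<Oplus>i\<in>{..n}. f (x i) (y (n - i) \<oplus> z (n - i))) =
      (\<Oplus>i\<in>{..n}. f (x i) (y (n - i))) \<oplus> (\<Oplus>i\<in>{..n}. f (x i) (z (n - i)))"
     "(\<Oplus>i\<in>{..n}. f (x i \<oplus> y i) (z (n - i))) =
      (\<Oplus>i\<in>{..n}. f (x i) (z (n - i))) \<oplus> (\<Oplus>i\<in>{..n}. f (y i) (z (n - i)))"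
    if "adm x" "adm y" "adm z" for x y z n
    using that by (simp_all add: f_simps a Pi_def flip: B.M.finsum_addf)
  have t: "(\<Oplus>i\<in>{..n}. f (x i) (c \<odot> y (n - i))) = c \<odot> (\<Oplus>i\<in>{..n}. f (x i) (y (n - i)))"
    "(\<Oplus>i\<in>{..n}. f (c \<odot> x i) (y (n - i))) = c \<odot> (\<Oplus>i\<in>{..n}. f (x i) (y (n - i)))"
    if "c \<in> carrier K" "adm x" "adm y" for c x y n
    using that by (simp_all add: f_simps a Pi_def B.finsum_smult_ldistr)
  show ?thesis
    by (intro bilinI linear_mapsI; elim C_rep; simp add: gr_op_cl cl_add cl_smult cl_mem adm_add adm_smult adm_conv s t)
qed

lemma gr_op_cls:
  assumes "x \<in> fil i" "y \<in> fil j"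
  shows "gr_op K B f (cls i x) (cls j y) = cls (i + j) (f x y)"
proof -
  let ?x = "\<lambda>m. if m = i then x else \<zero>" and ?y = "\<lambda>m. if m = j then y else \<zero>"
  have xy: "x \<in> carrier B" "y \<in> carrier B" using assms fil_sub by blast+
  have "(\<Oplus>k\<in>{..n}. f (?x k) (?y (n - k))) = (if n = i + j then f x y else \<zero>)" for n
  proof -
    have "(\<Oplus>k\<in>{..n}. f (?x k) (?y (n - k))) = (\<Oplus>k\<in>{..n}. if i = k then (if n - i = j then f x y else \<zero>) else \<zero>)"
      by (rule B.M.finsum_cong') (auto simp: f_zero xy f_simps(1))
    also have "\<dots> = (if n = i + j then f x y else \<zero>)"
    proof (cases "i \<in> {..n}")
      case True
      then show ?thesis
        using B.M.finsum_singleton[OF True, of "\<lambda>k. if n - i = j then f x y else \<zero>"] xy f_simps(1)[of x y] by auto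
    next
      case False
      have "(\<Oplus>k\<in>{..n}. if i = k then (if n - i = j then f x y else \<zero>) else \<zero>) = \<zero>"
        using False by (intro B.M.add.finprod_one_eqI) auto
      then show ?thesis using False by auto
    qed
    finally show ?thesis .
  qed
  then show ?thesis unfolding cls_cl gr_op_cl[OF adm_single[OF assms(1)] adm_single[OF assms(2)]] by (simp only:)
qed

end

section \<open>The Poisson algebra structure of C\<close>

lemma C_mult_bilin: "bilin K C C C (\<lambda>c d. c \<otimes>\<^bsub>C\<^esub> d)"
  unfolding C_sel by (rule gr_op_bilin[OF B.bilin_mult fil_mult])

lemma cls_mult: "x \<in> fil i \<Longrightarrow> y \<in> fil j \<Longrightarrow> cls i x \<otimes>\<^bsub>C\<^esub> cls j y = cls (i + j) (x \<otimes> y)"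
  unfolding C_sel by (rule gr_op_cls[OF B.bilin_mult fil_mult])

abbreviation brC where "brC \<equiv> gr_bracket K B br"

lemma brC_bilin: "bilin K C C C brC"
  unfolding gr_bracket_def by (rule gr_op_bilin[OF B.br_bilin fil_br])

lemma cls_br: "x \<in> fil i \<Longrightarrow> y \<in> fil j \<Longrightarrow> brC (cls i x) (cls j y) = cls (i + j) (br x y)"
  unfolding gr_bracket_def by (rule gr_op_cls[OF B.br_bilin fil_br])

lemma one_fil: "\<one> \<in> fil 0" using G_B0[OF gl_one] by simp

lemmas Cm = bilin_simps[OF C_mult_bilin]
lemmas Cb = bilin_simps[OF brC_bilin]

lemma C_comm: assumes "c \<in> carrier C" "d \<in> carrier C" shows "c \<otimes>\<^bsub>C\<^esub> d = d \<otimes>\<^bsub>C\<^esub> c"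
  using assms(1)
proof (induction c rule: C_induct)
  case (add c c') then show ?case using assms(2) by (simp add: Cm)
next
  case (cls n x)
  show ?case
    using assms(2)
  proof (induction d rule: C_induct)
    case (add c c') then show ?case using cls by (simp add: Cm)
  next
    case (cls m y)
    then show ?case using \<open>x \<in> fil n\<close> by (simp add: cls_mult B.mult_comm[of x y] add.commute)
  qed
qed

lemma C_assoc: assumes "c \<in> carrier C" "d \<in> carrier C" "e \<in> carrier C"
  shows "(c \<otimes>\<^bsub>C\<^esub> d) \<otimes>\<^bsub>C\<^esub> e = c \<otimes>\<^bsub>C\<^esub> (d \<otimes>\<^bsub>C\<^esub> e)"
  using assms(1)
proof (induction c rule: C_induct)
  case (add c c') then show ?case using assms(2,3) by (simp add: Cm)
next
  case (cls n x)
  show ?case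
    using assms(2)
  proof (induction d rule: C_induct)
    case (add c c') then show ?case using cls assms(3) by (simp add: Cm)
  next
    case (cls m y)
    show ?case
      using assms(3)
    proof (induction e rule: C_induct)
      case (add c c') then show ?case using cls \<open>x \<in> fil n\<close> by (simp add: Cm)
    next
      case (cls l z)
      then show ?case using \<open>x \<in> fil n\<close> \<open>y \<in> fil m\<close> by (simp add: cls_mult fil_mult B.m_assoc add.assoc)
    qed
  qed
qed

lemma C_one: assumes "c \<in> carrier C" shows "\<one>\<^bsub>C\<^esub> \<otimes>\<^bsub>C\<^esub> c = c"
  using assms
proof (induction c rule: C_induct)
  case (add c c') then show ?case using cls_closed[OF one_fil] by (simp add: Cm C_sel(3))
next
  case (cls n x) then show ?case by (simp add: C_sel(3) cls_mult[OF one_fil])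
qed

lemma C_asalg: "asalg K C"
proof (intro asalgI C_module monoidI)
  show "\<one>\<^bsub>C\<^esub> \<in> carrier C" unfolding C_sel(3) by (rule cls_closed[OF one_fil])
  then show "c \<otimes>\<^bsub>C\<^esub> \<one>\<^bsub>C\<^esub> = c" if "c \<in> carrier C" for c using that C_one C_comm by metis
qed (simp_all add: Cm C_assoc C_one)

lemma brC_anti: assumes "c \<in> carrier C" "d \<in> carrier C" shows "brC c d \<oplus>\<^bsub>C\<^esub> brC d c = \<zero>\<^bsub>C\<^esub>"
  using assms(1)
proof (induction c rule: C_induct)
  case (add c c')
  then have "brC (c \<oplus>\<^bsub>C\<^esub> c') d \<oplus>\<^bsub>C\<^esub> brC d (c \<oplus>\<^bsub>C\<^esub> c') = (brC c d \<oplus>\<^bsub>C\<^esub> brC d c) \<oplus>\<^bsub>C\<^esub> (brC c' d \<oplus>\<^bsub>C\<^esub> brC d c')"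
    using assms(2) by (simp add: Cb C.M.a_ac)
  then show ?case using add by simp
next
  case (cls n x)
  show ?case
    using assms(2)
  proof (induction d rule: C_induct)
    case (add c c')
    then have "brC (cls n x) (c \<oplus>\<^bsub>C\<^esub> c') \<oplus>\<^bsub>C\<^esub> brC (c \<oplus>\<^bsub>C\<^esub> c') (cls n x) =
        (brC (cls n x) c \<oplus>\<^bsub>C\<^esub> brC c (cls n x)) \<oplus>\<^bsub>C\<^esub> (brC (cls n x) c' \<oplus>\<^bsub>C\<^esub> brC c' (cls n x))"
      using cls by (simp add: Cb C.M.a_ac)
    then show ?case using add by simp
  next
    case (cls m y)
    have "br x y \<in> fil (n + m)" by (rule fil_br[OF \<open>x \<in> fil n\<close> \<open>y \<in> fil m\<close>])
    then show ?case
      using cls \<open>x \<in> fil n\<close>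
      by (simp add: cls_br B.br_anti[of x y] add.commute[of m n] cls_uminus C.M.r_neg)
  qed
qed

lemma brC_self: assumes "c \<in> carrier C" shows "brC c c = \<zero>\<^bsub>C\<^esub>"
  using assms
proof (induction c rule: C_induct)
  case (add c d)
  then have "brC (c \<oplus>\<^bsub>C\<^esub> d) (c \<oplus>\<^bsub>C\<^esub> d) = (brC c c \<oplus>\<^bsub>C\<^esub> brC d d) \<oplus>\<^bsub>C\<^esub> (brC c d \<oplus>\<^bsub>C\<^esub> brC d c)"
    by (simp add: Cb(1,2) Cb(3) C.M.a_ac)
  then show ?case using add by (simp add: brC_anti)
next
  case (cls n x) then show ?case by (simp add: cls_br B.br_self cls_zero)
qed

lemma brC_leibniz: assumes "c \<in> carrier C" "d \<in> carrier C" "e \<in> carrier C"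
  shows "brC c (d \<otimes>\<^bsub>C\<^esub> e) = brC c d \<otimes>\<^bsub>C\<^esub> e \<oplus>\<^bsub>C\<^esub> d \<otimes>\<^bsub>C\<^esub> brC c e"
  using assms(1)
proof (induction c rule: C_induct)
  case (add c c') then show ?case using assms(2,3) by (simp add: Cm Cb C.M.a_ac)
next
  case (cls n x)
  show ?case
    using assms(2)
  proof (induction d rule: C_induct)
    case (add c c') then show ?case using cls assms(3) by (simp add: Cm Cb C.M.a_ac)
  next
    case (cls m y)
    show ?case
      using assms(3)
    proof (induction e rule: C_induct)
      case (add c c') then show ?case using cls \<open>x \<in> fil n\<close> by (simp add: Cm Cb C.M.a_ac)
    next
      case (cls l z)
      have "br x y \<otimes> z \<in> fil (n + (m + l))" "y \<otimes> br x z \<in> fil (n + (m + l))"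
        using fil_mult[OF fil_br[OF \<open>x \<in> fil n\<close> \<open>y \<in> fil m\<close>] cls] fil_mult[OF \<open>y \<in> fil m\<close> fil_br[OF \<open>x \<in> fil n\<close> cls]]
        by (simp_all add: ac_simps)
      then show ?case using cls \<open>x \<in> fil n\<close> \<open>y \<in> fil m\<close>
        by (simp add: cls_br cls_mult fil_mult fil_br B.leibniz add.assoc add.left_commute cls_add)
    qed
  qed
qed

lemma brC_jacobi: assumes "c \<in> carrier C" "d \<in> carrier C" "e \<in> carrier C"
  shows "brC c (brC d e) \<oplus>\<^bsub>C\<^esub> brC d (brC e c) \<oplus>\<^bsub>C\<^esub> brC e (brC c d) = \<zero>\<^bsub>C\<^esub>"
proof -
  have add4: "a \<oplus>\<^bsub>C\<^esub> a' \<oplus>\<^bsub>C\<^esub> (b \<oplus>\<^bsub>C\<^esub> b') \<oplus>\<^bsub>C\<^esub> (u \<oplus>\<^bsub>C\<^esub> u') = (a \<oplus>\<^bsub>C\<^esub> b \<oplus>\<^bsub>C\<^esub> u) \<oplus>\<^bsub>C\<^esub> (a' \<oplus>\<^bsub>C\<^esub> b' \<oplus>\<^bsub>C\<^esub> u')"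
    if "a \<in> carrier C" "a' \<in> carrier C" "b \<in> carrier C" "b' \<in> carrier C" "u \<in> carrier C" "u' \<in> carrier C" for a a' b b' u u'
    using that by (simp add: C.M.a_ac)
  show ?thesis
    using assms(1)
  proof (induction c rule: C_induct)
    case (add c c') then show ?case using assms(2,3) by (simp add: Cb add4)
  next
    case (cls n x)
    show ?case
      using assms(2)
    proof (induction d rule: C_induct)
      case (add c c') then show ?case using cls assms(3) by (simp add: Cb add4)
    next
      case (cls m y)
      show ?case
        using assms(3)
      proof (induction e rule: C_induct)
        case (add c c') then show ?case using cls \<open>x \<in> fil n\<close> by (simp add: Cb add4)
      next
        case (cls l z)
        note x = \<open>x \<in> fil n\<close> and y = \<open>y \<in> fil m\<close> and z = cls
        have 1: "br x (br y z) \<in> fil (n + (m + l))" "br y (br z x) \<in> fil (n + (m + l))" "br z (br x y) \<in> fil (n + (m + l))"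
          using fil_br[OF x fil_br[OF y z]] fil_br[OF y fil_br[OF z x]] fil_br[OF z fil_br[OF x y]]
          by (simp_all add: ac_simps)
        have i: "m + (l + n) = n + (m + l)" "l + (n + m) = n + (m + l)" by simp_all
        have "brC (cls n x) (brC (cls m y) (cls l z)) \<oplus>\<^bsub>C\<^esub> brC (cls m y) (brC (cls l z) (cls n x)) \<oplus>\<^bsub>C\<^esub> brC (cls l z) (brC (cls n x) (cls m y)) =
            cls (n + (m + l)) (br x (br y z) \<oplus> br y (br z x) \<oplus> br z (br x y))"
          using 1 filE(3) by (simp add: cls_br x y z fil_br i cls_add)
        also have "br x (br y z) \<oplus> br y (br z x) \<oplus> br z (br x y) = \<zero>"
          by (rule B.jacobi[OF fil_sub[OF x] fil_sub[OF y] fil_sub[OF z]])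
        finally show ?case by (simp only: cls_zero)
      qed
    qed
  qed
qed

abbreviation Ch where "Ch \<equiv> gr K B"

lemma Ch_same: "same_algebra C Ch"
  by (simp add: same_algebra_def gr_def module.defs hopf.defs)

lemmas Ch_sel = same_algebraD[OF Ch_same, symmetric]

lemma Ch_comult: "comult Ch = gr_comult K B"
  by (simp add: gr_def module.defs hopf.defs)

lemma Ch_asalg: "asalg K Ch"
  by (rule same_algebra_asalg[OF Ch_same C_asalg])

lemma Ch_linear: "linear_maps K Ch Ch = linear_maps K C C"
  by (rule same_algebra_linear_maps[OF same_algebra_sym[OF Ch_same] same_algebra_sym[OF Ch_same]])

lemma Ch_poisson: "poisson_algebra K Ch brC"
proof -
  have "algebra K Ch" by (rule asalg_algebra[OF Ch_asalg]) (simp add: Ch_sel C_comm)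
  then show ?thesis
    unfolding poisson_algebra_def Ch_linear Ch_sel
    by (intro conjI ballI bilinD[OF brC_bilin] brC_self brC_jacobi brC_leibniz)
qed

sublocale Ch: pois K Ch brC by (rule poisI[OF Ch_poisson])

section \<open>The coproduct of the associated graded algebra\<close>

text \<open>The class map from B_i to C(i), extended linearly to B: \<open>ret (Suc i)\<close>
  retracts onto B_i. On B_i itself the value does not depend on the retraction.\<close>

definition p where "p i x = cls i (ret (Suc i) x)"

lemma ret_fil: "x \<in> carrier B \<Longrightarrow> ret (Suc i) x \<in> fil i"
  using ret(2)[of x "Suc i"] by (simp only: low_Suc)

lemma p_linear: "p i \<in> linear_maps K B C"
  unfolding p_def
  by (intro linear_mapsI)
    (simp_all add: linear_mapsD(2,3)[OF ret(1)] cls_add cls_smult ret_fil)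

lemma p_fil: "x \<in> fil i \<Longrightarrow> p i x = cls i x"
  unfolding p_def using ret(3)[of x "Suc i"] by (simp only: low_Suc)

lemma low_fil: "x \<in> low i \<Longrightarrow> x \<in> fil i"
  using low_Suc_mono[of i] by (simp only: low_Suc) blast

lemma p_low: "x \<in> low i \<Longrightarrow> p i x = \<zero>\<^bsub>C\<^esub>"
  using p_fil[OF low_fil] cls_low by simp

abbreviation CC where "CC \<equiv> tensor K C C"
abbreviation cpt where "cpt \<equiv> ptensor K C C"

sublocale CC: tens K C C by (intro tens.intro C_asalg)

lemma pp_bilin: "bilin K B B CC (\<lambda>a b. cpt (p i a) (p j b))"
  by (rule bilin_compose[OF CC.pt_bilin p_linear p_linear])

text \<open>Extends to all of B \<otimes> B the passage from the sum of the B_i \<otimes> B_{n-i} to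
  the part of degree n in C \<otimes> C. As this is one linear map, the graded coproduct cannot
  depend on how a tensor is split into summands.\<close>

definition P where "P n t = (\<Oplus>\<^bsub>CC\<^esub>i\<in>{..n}. tlift K CC (\<lambda>a b. cpt (p i a) (p (n - i) b)) t)"

lemma P_linear: "P n \<in> linear_maps K BB CC"
  unfolding P_def
  by (intro linear_maps_finsum_map CC.T.module_axioms finite_atMost B.T2.tlift_linear pp_bilin)

lemmas P_simps = linear_mapsD[OF P_linear]

text \<open>In the summand of index i > j the element a lies in B_{i-1}, and for i < j the element b
  lies in B_{n-i-1}; so only i = j contributes.\<close>

lemma P_pt: assumes "a \<in> fil j" "b \<in> fil (n - j)" "j \<le> n"
  shows "P n (pt a b) = cpt (cls j a) (cls (n - j) b)"
proof -
  have ab: "a \<in> carrier B" "b \<in> carrier B" using assms fil_sub by blast+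
  have pc: "p i x \<in> carrier C" if "x \<in> carrier B" for i x by (rule linear_mapsD(1)[OF p_linear that])
  have "cpt (p i a) (p (n - i) b) = (if j = i then cpt (cls j a) (cls (n - j) b) else \<zero>\<^bsub>CC\<^esub>)" if "i \<le> n" for i
  proof -
    consider "i = j" | "j < i" | "i < j" by linarith
    then show ?thesis
    proof cases
      case 1 then show ?thesis using assms by (simp add: p_fil)
    next
      case 2
      then have "a \<in> low i" using assms(1) low_mono[of "Suc j" i] by (simp only: low_Suc Suc_le_eq) blast
      then show ?thesis using 2 ab pc by (simp add: p_low CC.pt_zero)
    next
      case 3
      then have "Suc (n - j) \<le> n - i" using assms(3) by linarith
      then have "b \<in> low (n - i)" using assms(2) low_mono[of "Suc (n - j)" "n - i"] by (simp only: low_Suc) blast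
      then show ?thesis using 3 ab pc by (simp add: p_low CC.pt_zero)
    qed
  qed
  then have "P n (pt a b) = (\<Oplus>\<^bsub>CC\<^esub>i\<in>{..n}. if j = i then cpt (cls j a) (cls (n - j) b) else \<zero>\<^bsub>CC\<^esub>)"
    unfolding P_def using assms(1,2) ab pc
    by (intro CC.T.M.finsum_cong') (auto simp: B.T2.tlift_pt[OF CC.T.module_axioms pp_bilin])
  also have "\<dots> = cpt (cls j a) (cls (n - j) b)"
    using assms by (intro CC.T.M.finsum_singleton) (auto intro!: CC.pt_closed)
  finally show ?thesis .
qed

text \<open>The coproduct of x lies in the sum of the B_j \<otimes> B_{n-1-j}, and an element of
  B_{n-1-j} has zero class in degree n - j.\<close>

lemma P_\<Delta>_low: assumes "x \<in> low n" shows "P n (\<Delta> x) = \<zero>\<^bsub>CC\<^esub>"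
proof (cases n)
  case 0
  then have "x = \<zero>" using assms by (simp add: low_0)
  then show ?thesis
    using linear_maps_zero[OF B.module_axioms B.T2.T.module_axioms \<Delta>_linear]
      linear_maps_zero[OF B.T2.T.module_axioms CC.T.module_axioms P_linear] by simp
next
  case (Suc m)
  then have "\<Delta> x \<in> lin_span K BB (filt_gens m)"
    using \<Delta>_fil[of x m] assms by (simp only: low_Suc F2_def)
  then show ?thesis
  proof (rule linear_span_eq[OF B.T2.T.module_axioms CC.T.module_axioms P_linear
        linear_maps_zero_map[OF CC.T.module_axioms] filt_gens_sub, rotated])
    fix t assume "t \<in> filt_gens m"
    then obtain j a b where t: "j \<le> m" "a \<in> fil j" "b \<in> fil (m - j)" "t = pt a b" by (rule filt_gensE)
    have n: "n - j = Suc (m - j)" using t(1) Suc by simp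
    have b: "b \<in> low (n - j)" using t(3) unfolding n low_Suc .
    have "P n (pt a b) = cpt (cls j a) (cls (n - j) b)"
      using t(1) Suc by (intro P_pt t(2) low_fil[OF b]) simp
    then show "P n t = \<zero>\<^bsub>CC\<^esub>" using t(2) unfolding t(4) cls_low[OF b] by (simp add: CC.pt_zero)
  qed
qed

abbreviation tc where "tc \<equiv> tensor_class K B B"

text \<open>Turns membership in \<open>F2\<close> into the family of formal combinations that
  \<open>gr_comult_class\<close> asks for.\<close>

lemma formal_combination:
  assumes "t \<in> F2 n"
  shows "\<exists>r. (\<forall>i\<le>n. r i \<in> carrier B.T2.F \<and> supp K (r i) \<subseteq> fil i \<times> fil (n - i)) \<and> t = tc (\<Oplus>\<^bsub>B.T2.F\<^esub>i\<in>{..n}. r i)"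
proof -
  interpret F: module K B.T2.F by (rule B.T2.F_module)
  note l = linear_mapsD[OF B.T2.tensor_class_linear]
  have c: "(\<Oplus>\<^bsub>B.T2.F\<^esub>i\<in>{..n}. r i) \<in> carrier B.T2.F" if "\<forall>i\<le>n. r i \<in> carrier B.T2.F \<and> supp K (r i) \<subseteq> fil i \<times> fil (n - i)" for r
    using that by (intro F.M.finsum_closed) auto
  show ?thesis
    using B.T2.T.module_axioms filt_gens_sub[of n] assms unfolding F2_def
  proof (induction rule: lin_span_induct)
    case zero
    have "supp K \<zero>\<^bsub>B.T2.F\<^esub> = {}" by (simp add: supp_def B.T2.F_sel)
    moreover have "(\<Oplus>\<^bsub>B.T2.F\<^esub>i\<in>{..n}. \<zero>\<^bsub>B.T2.F\<^esub>) = \<zero>\<^bsub>B.T2.F\<^esub>" by (rule F.M.finsum_zero)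
    ultimately show ?case
      using linear_maps_zero[OF F.module_axioms B.T2.T.module_axioms B.T2.tensor_class_linear]
      by (intro exI[of _ "\<lambda>i. \<zero>\<^bsub>B.T2.F\<^esub>"]) simp
  next
    case (base t)
    then obtain j a b where t: "j \<le> n" "a \<in> fil j" "b \<in> fil (n - j)" "t = pt a b" by (rule filt_gensE)
    have d: "mdelta K (a, b) \<in> carrier B.T2.F" using t by simp
    let ?r = "\<lambda>i. if j = i then mdelta K (a, b) else \<zero>\<^bsub>B.T2.F\<^esub>"
    have "(\<Oplus>\<^bsub>B.T2.F\<^esub>i\<in>{..n}. ?r i) = mdelta K (a, b)"
      using t(1) d by (intro F.M.finsum_singleton) auto
    then have "t = tc (\<Oplus>\<^bsub>B.T2.F\<^esub>i\<in>{..n}. ?r i)" unfolding t(4) ptensor_def by simp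
    moreover have "supp K (?r i) \<subseteq> fil i \<times> fil (n - i)" for i
      using t by (auto simp: supp_def mdelta_def B.T2.F_sel split: if_splits)
    ultimately show ?case using d by (intro exI[of _ ?r]) simp
  next
    case (add s t)
    then obtain r r' where r: "\<forall>i\<le>n. r i \<in> carrier B.T2.F \<and> supp K (r i) \<subseteq> fil i \<times> fil (n - i)" "s = tc (\<Oplus>\<^bsub>B.T2.F\<^esub>i\<in>{..n}. r i)"
      and r': "\<forall>i\<le>n. r' i \<in> carrier B.T2.F \<and> supp K (r' i) \<subseteq> fil i \<times> fil (n - i)" "t = tc (\<Oplus>\<^bsub>B.T2.F\<^esub>i\<in>{..n}. r' i)" by blast
    have "(\<Oplus>\<^bsub>B.T2.F\<^esub>i\<in>{..n}. r i \<oplus>\<^bsub>B.T2.F\<^esub> r' i) = (\<Oplus>\<^bsub>B.T2.F\<^esub>i\<in>{..n}. r i) \<oplus>\<^bsub>B.T2.F\<^esub> (\<Oplus>\<^bsub>B.T2.F\<^esub>i\<in>{..n}. r' i)"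
      using r(1) r'(1) by (intro F.M.finsum_addf) auto
    then have e: "s \<oplus>\<^bsub>BB\<^esub> t = tc (\<Oplus>\<^bsub>B.T2.F\<^esub>i\<in>{..n}. r i \<oplus>\<^bsub>B.T2.F\<^esub> r' i)"
      using l(2)[OF c[OF r(1)] c[OF r'(1)]] r(2) r'(2) by simp
    have "supp K (r i \<oplus>\<^bsub>B.T2.F\<^esub> r' i) \<subseteq> supp K (r i) \<union> supp K (r' i)" for i
      by (auto simp: supp_def B.T2.F_sel)
    then show ?case using r(1) r'(1) e by (intro exI[of _ "\<lambda>i. r i \<oplus>\<^bsub>B.T2.F\<^esub> r' i"]) blast
  next
    case (smult k t)
    then obtain r where r: "\<forall>i\<le>n. r i \<in> carrier B.T2.F \<and> supp K (r i) \<subseteq> fil i \<times> fil (n - i)" "t = tc (\<Oplus>\<^bsub>B.T2.F\<^esub>i\<in>{..n}. r i)" by blast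
    have "(\<Oplus>\<^bsub>B.T2.F\<^esub>i\<in>{..n}. k \<odot>\<^bsub>B.T2.F\<^esub> r i) = k \<odot>\<^bsub>B.T2.F\<^esub> (\<Oplus>\<^bsub>B.T2.F\<^esub>i\<in>{..n}. r i)"
      using r(1) smult(1) by (intro F.finsum_smult_ldistr[symmetric]) auto
    then have e: "k \<odot>\<^bsub>BB\<^esub> t = tc (\<Oplus>\<^bsub>B.T2.F\<^esub>i\<in>{..n}. k \<odot>\<^bsub>B.T2.F\<^esub> r i)"
      using l(3)[OF smult(1) c[OF r(1)]] r(2) by simp
    have "supp K (k \<odot>\<^bsub>B.T2.F\<^esub> r i) \<subseteq> supp K (r i)" for i
      using smult(1) by (auto simp: supp_def B.T2.F_sel)
    then show ?case using r(1) smult(1) e by (intro exI[of _ "\<lambda>i. k \<odot>\<^bsub>B.T2.F\<^esub> r i"]) (blast intro: F.smult_closed)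
  qed
qed

lemma P_formal_combination:
  assumes r: "\<And>i. i \<le> n \<Longrightarrow> r i \<in> carrier B.T2.F" "\<And>i. i \<le> n \<Longrightarrow> supp K (r i) \<subseteq> fil i \<times> fil (n - i)"
  shows "P n (tc (\<Oplus>\<^bsub>B.T2.F\<^esub>i\<in>{..n}. r i)) =
    (\<Oplus>\<^bsub>CC\<^esub>i\<in>{..n}. lin_ext K CC (\<lambda>(a, b). cpt (cls i a) (cls (n - i) b)) (r i))"
proof -
  interpret F: module K B.T2.F by (rule B.T2.F_module)
  have tm: "P n (tc (r i)) = lin_ext K CC (\<lambda>(a, b). cpt (cls i a) (cls (n - i) b)) (r i)" if i: "i \<le> n" for i
  proof -
    have fin: "finite (supp K (r i))" and rk: "\<And>z. r i z \<in> carrier K" using r(1)[OF i] unfolding B.T2.F_carrier by auto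
    have s: "fst z \<in> fil i" "snd z \<in> fil (n - i)" if "z \<in> supp K (r i)" for z using r(2)[OF i] that by auto
    have "P n (tc (r i)) = P n (\<Oplus>\<^bsub>BB\<^esub>z\<in>supp K (r i). r i z \<odot>\<^bsub>BB\<^esub> pt (fst z) (snd z))"
      unfolding B.T2.tensor_class_eq[OF r(1)[OF i]] lin_ext_def by (simp add: case_prod_unfold)
    also have "\<dots> = (\<Oplus>\<^bsub>CC\<^esub>z\<in>supp K (r i). P n (r i z \<odot>\<^bsub>BB\<^esub> pt (fst z) (snd z)))"
      by (intro linear_maps_finsum[OF B.T2.T.module_axioms CC.T.module_axioms P_linear fin] Pi_I
          B.T2.T.smult_closed rk B.T2.pt_closed fil_sub[OF s(1)] fil_sub[OF s(2)])
    also have "\<dots> = (\<Oplus>\<^bsub>CC\<^esub>z\<in>supp K (r i). r i z \<odot>\<^bsub>CC\<^esub> cpt (cls i (fst z)) (cls (n - i) (snd z)))"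
    proof (rule CC.T.M.finsum_cong')
      fix z assume z: "z \<in> supp K (r i)"
      show "P n (r i z \<odot>\<^bsub>BB\<^esub> pt (fst z) (snd z)) = r i z \<odot>\<^bsub>CC\<^esub> cpt (cls i (fst z)) (cls (n - i) (snd z))"
        using P_simps(3)[OF rk B.T2.pt_closed[OF fil_sub[OF s(1)[OF z]] fil_sub[OF s(2)[OF z]]]]
          P_pt[OF s(1)[OF z] s(2)[OF z] i] by simp
    qed (auto intro!: CC.T.smult_closed rk CC.pt_closed cls_closed s)
    finally show ?thesis unfolding lin_ext_def by (simp add: case_prod_unfold)
  qed
  note l = B.T2.tensor_class_linear
  have "P n (tc (\<Oplus>\<^bsub>B.T2.F\<^esub>i\<in>{..n}. r i)) = (\<Oplus>\<^bsub>CC\<^esub>i\<in>{..n}. P n (tc (r i)))"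
    using r(1) by (intro linear_maps_finsum[OF F.module_axioms CC.T.module_axioms linear_maps_comp[OF l P_linear]]) auto
  also have "\<dots> = (\<Oplus>\<^bsub>CC\<^esub>i\<in>{..n}. lin_ext K CC (\<lambda>(a, b). cpt (cls i a) (cls (n - i) b)) (r i))"
    using P_simps(1) linear_mapsD(1)[OF l] r(1) by (intro CC.T.M.finsum_cong') (auto simp flip: tm)
  finally show ?thesis .
qed

text \<open>\<open>P n\<close> sends every admissible family of formal combinations to the sum in
  the definition, so the relation is the graph of \<open>P n\<close> after the coproduct.\<close>

lemma gr_comult_class_iff: assumes "x \<in> fil n" shows "gr_comult_class K B n x w \<longleftrightarrow> w = P n (\<Delta> x)"
proof -
  have *: "gr_comult_class K B n x w \<longleftrightarrow> (\<exists>r. (\<forall>i\<le>n. r i \<in> carrier B.T2.F \<and> supp K (r i) \<subseteq> fil i \<times> fil (n - i)) \<and>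
      \<Delta> x = tc (\<Oplus>\<^bsub>B.T2.F\<^esub>i\<in>{..n}. r i) \<and>
      w = (\<Oplus>\<^bsub>CC\<^esub>i\<in>{..n}. lin_ext K CC (\<lambda>(a, b). cpt (cls i a) (cls (n - i) b)) (r i)))" for w
    unfolding gr_comult_class_def Let_def by (rule refl)
  show ?thesis
  proof
    assume "gr_comult_class K B n x w"
    then show "w = P n (\<Delta> x)" unfolding * by (elim exE conjE) (simp add: P_formal_combination)
  next
    assume w: "w = P n (\<Delta> x)"
    obtain r where r: "\<forall>i\<le>n. r i \<in> carrier B.T2.F \<and> supp K (r i) \<subseteq> fil i \<times> fil (n - i)" "\<Delta> x = tc (\<Oplus>\<^bsub>B.T2.F\<^esub>i\<in>{..n}. r i)"
      using formal_combination[OF \<Delta>_fil[OF assms]] by blast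
    then have "w = (\<Oplus>\<^bsub>CC\<^esub>i\<in>{..n}. lin_ext K CC (\<lambda>(a, b). cpt (cls i a) (cls (n - i) b)) (r i))"
      unfolding w r(2) by (intro P_formal_combination) auto
    then show "gr_comult_class K B n x w" unfolding * using r by blast
  qed
qed

lemma P\<Delta>_linear: "(\<lambda>x. P n (\<Delta> x)) \<in> linear_maps K B CC"
  by (rule linear_maps_comp[OF \<Delta>_linear P_linear])

lemmas P\<Delta>_simps = linear_mapsD[OF P\<Delta>_linear]

text \<open>Two representatives of a class in degree n differ by an element of B_{n-1}, which
  \<open>P n\<close> after the coproduct kills; so the definite description has one candidate.
  Degrees with zero class contribute nothing, which allows any larger index set.\<close>

lemma gr_comult_cl:
  assumes x: "adm x" and S: "finite S" "{n. x n \<noteq> \<zero>} \<subseteq> S"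
  shows "gr_comult K B (cl x) = (\<Oplus>\<^bsub>CC\<^esub>n\<in>S. P n (\<Delta> (x n)))"
proof -
  note xc = adm_closed[OF x]
  have the: "(THE w. \<exists>y\<in>cl x n. gr_comult_class K B n y w) = P n (\<Delta> (x n))" for n
  proof (rule the_equality)
    have self: "x n \<in> cl x n" unfolding cl_def using lc_self xc by blast
    show "\<exists>y\<in>cl x n. gr_comult_class K B n y (P n (\<Delta> (x n)))"
      using gr_comult_class_iff[OF xc(1)] self by blast
    fix w assume "\<exists>y\<in>cl x n. gr_comult_class K B n y w"
    then obtain y where y: "y \<in> cl x n" "gr_comult_class K B n y w" by blast
    have yc: "y \<in> carrier B" "y \<ominus> x n \<in> low n" using y(1) lc_mem[OF xc(2)] unfolding cl_def by auto
    have yx: "y = x n \<oplus> (y \<ominus> x n)" using yc xc(2)[of n] by (simp add: a_minus_def B.M.r_neg3)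
    have "y \<in> fil n" using filE(3)[OF xc(1)[of n] low_fil[OF yc(2)]] yx by simp
    then have "w = P n (\<Delta> y)" using y(2) gr_comult_class_iff by blast
    also have "\<dots> = P n (\<Delta> (x n)) \<oplus>\<^bsub>CC\<^esub> P n (\<Delta> (y \<ominus> x n))"
      by (subst yx) (rule P\<Delta>_simps(2)[OF xc(2) low_sub[OF yc(2)]])
    also have "\<dots> = P n (\<Delta> (x n))" using P\<Delta>_simps(1)[OF xc(2)] P_\<Delta>_low[OF yc(2)] by simp
    finally show "w = P n (\<Delta> (x n))" .
  qed
  have sub: "{n. cl x n \<noteq> low n} \<subseteq> S"
  proof
    fix n assume "n \<in> {n. cl x n \<noteq> low n}"
    then have "x n \<noteq> \<zero>" using lc_zero by (auto simp: cl_def)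
    then show "n \<in> S" using S(2) by blast
  qed
  have "gr_comult K B (cl x) = (\<Oplus>\<^bsub>CC\<^esub>n\<in>{n. cl x n \<noteq> low n}. P n (\<Delta> (x n)))"
    unfolding gr_comult_def Let_def the ..
  also have "\<dots> = (\<Oplus>\<^bsub>CC\<^esub>n\<in>S. P n (\<Delta> (x n)))"
  proof (rule CC.T.M.add.finprod_mono_neutral_cong_left[OF S(1) sub])
    fix i assume "i \<in> S - {n. cl x n \<noteq> low n}"
    then have "x i \<in> low i" using low_coset_iff[OF xc(2)] unfolding cl_def by blast
    then show "P i (\<Delta> (x i)) = \<zero>\<^bsub>CC\<^esub>" by (rule P_\<Delta>_low)
  qed (auto intro!: P\<Delta>_simps(1) xc)
  finally show ?thesis .
qed

lemma gr_comult_cls: assumes "x \<in> fil n" shows "gr_comult K B (cls n x) = P n (\<Delta> x)"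
proof -
  have "gr_comult K B (cls n x) = (\<Oplus>\<^bsub>CC\<^esub>m\<in>{n}. P m (\<Delta> (if m = n then x else \<zero>)))"
    unfolding cls_cl by (rule gr_comult_cl[OF adm_single[OF assms]]) auto
  then show ?thesis using P\<Delta>_simps(1)[OF fil_sub[OF assms]] by simp
qed

lemma gr_comult_linear: "gr_comult K B \<in> linear_maps K C CC"
proof (rule linear_mapsI)
  fix c assume "c \<in> carrier C"
  then obtain x where x: "adm x" "c = cl x" by (rule C_rep)
  have fx: "finite {n. x n \<noteq> \<zero>}" using x(1) unfolding adm_def by blast
  note xc = adm_closed[OF x(1)]
  show "gr_comult K B c \<in> carrier CC"
    unfolding x(2) gr_comult_cl[OF x(1) fx subset_refl]
    by (intro CC.T.M.finsum_closed) (auto intro!: P\<Delta>_simps(1) xc)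
  { fix d assume "d \<in> carrier C"
    then obtain y where y: "adm y" "d = cl y" by (rule C_rep)
    have fy: "finite {n. y n \<noteq> \<zero>}" using y(1) unfolding adm_def by blast
    note yc = adm_closed[OF y(1)]
    let ?S = "{n. x n \<noteq> \<zero>} \<union> {n. y n \<noteq> \<zero>}"
    have "gr_comult K B (c \<oplus>\<^bsub>C\<^esub> d) = (\<Oplus>\<^bsub>CC\<^esub>n\<in>?S. P n (\<Delta> (x n \<oplus> y n)))"
      unfolding x(2) y(2) cl_add[OF x(1) y(1)] by (rule gr_comult_cl[OF adm_add[OF x(1) y(1)]]) (use fx fy in auto)
    also have "\<dots> = (\<Oplus>\<^bsub>CC\<^esub>n\<in>?S. P n (\<Delta> (x n)) \<oplus>\<^bsub>CC\<^esub> P n (\<Delta> (y n)))"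
      using P\<Delta>_simps(1)[OF xc(2)] P\<Delta>_simps(1)[OF yc(2)] by (intro CC.T.M.finsum_cong') (auto simp: P\<Delta>_simps(2)[OF xc(2) yc(2)])
    also have "\<dots> = (\<Oplus>\<^bsub>CC\<^esub>n\<in>?S. P n (\<Delta> (x n))) \<oplus>\<^bsub>CC\<^esub> (\<Oplus>\<^bsub>CC\<^esub>n\<in>?S. P n (\<Delta> (y n)))"
      by (rule CC.T.M.finsum_addf) (auto intro!: P\<Delta>_simps(1) xc yc)
    also have "(\<Oplus>\<^bsub>CC\<^esub>n\<in>?S. P n (\<Delta> (x n))) = gr_comult K B c"
      unfolding x(2) by (rule gr_comult_cl[OF x(1), symmetric]) (use fx fy in auto)
    also have "(\<Oplus>\<^bsub>CC\<^esub>n\<in>?S. P n (\<Delta> (y n))) = gr_comult K B d"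
      unfolding y(2) by (rule gr_comult_cl[OF y(1), symmetric]) (use fx fy in auto)
    finally show "gr_comult K B (c \<oplus>\<^bsub>C\<^esub> d) = gr_comult K B c \<oplus>\<^bsub>CC\<^esub> gr_comult K B d" . }
  fix k assume k: "k \<in> carrier K"
  let ?S = "{n. x n \<noteq> \<zero>}"
  have "gr_comult K B (k \<odot>\<^bsub>C\<^esub> c) = (\<Oplus>\<^bsub>CC\<^esub>n\<in>?S. P n (\<Delta> (k \<odot> x n)))"
    unfolding x(2) cl_smult[OF k x(1)] by (rule gr_comult_cl[OF adm_smult[OF k x(1)] fx]) (use k in auto)
  also have "\<dots> = (\<Oplus>\<^bsub>CC\<^esub>n\<in>?S. k \<odot>\<^bsub>CC\<^esub> P n (\<Delta> (x n)))"
    using P\<Delta>_simps(1)[OF xc(2)] k by (intro CC.T.M.finsum_cong') (auto simp: P\<Delta>_simps(3)[OF k xc(2)])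
  also have "\<dots> = k \<odot>\<^bsub>CC\<^esub> gr_comult K B c"
    unfolding x(2) gr_comult_cl[OF x(1) fx subset_refl]
    by (rule CC.T.finsum_smult_ldistr[symmetric, OF fx k]) (auto intro!: P\<Delta>_simps(1) xc)
  finally show "gr_comult K B (k \<odot>\<^bsub>C\<^esub> c) = k \<odot>\<^bsub>CC\<^esub> gr_comult K B c" .
qed

text \<open>On generators of \<open>F2\<close> the degrees add in each tensor factor, so classes of
  products are products of classes. \<open>P_br\<close> follows the same pattern.\<close>

lemma P_mult: assumes "s \<in> F2 n" "t \<in> F2 m" shows "P (n + m) (s \<otimes>\<^bsub>BB\<^esub> t) = P n s \<otimes>\<^bsub>CC\<^esub> P m t"
proof (rule bilin_span_eq[OF B.T2.T.module_axioms B.T2.T.module_axioms CC.T.module_axioms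
      bilin_linear[OF B.T2.T.bilin_mult P_linear] bilin_compose[OF CC.T.bilin_mult P_linear P_linear]
      filt_gens_sub filt_gens_sub _ assms[unfolded F2_def]])
  fix s t assume "s \<in> filt_gens n" "t \<in> filt_gens m"
  then obtain i a b j c d where s: "i \<le> n" "a \<in> fil i" "b \<in> fil (n - i)" "s = pt a b"
    and t: "j \<le> m" "c \<in> fil j" "d \<in> fil (m - j)" "t = pt c d" by (elim filt_gensE) blast
  have e: "n + m - (i + j) = (n - i) + (m - j)" using s(1) t(1) by simp
  have "P (n + m) (pt (a \<otimes> c) (b \<otimes> d)) = cpt (cls (i + j) (a \<otimes> c)) (cls ((n - i) + (m - j)) (b \<otimes> d))"
    using P_pt[OF fil_mult[OF s(2) t(2)], of "b \<otimes> d" "n + m"] fil_mult[OF s(3) t(3)] s(1) t(1) unfolding e by simp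
  then show "P (n + m) (s \<otimes>\<^bsub>BB\<^esub> t) = P n s \<otimes>\<^bsub>CC\<^esub> P m t"
    using s t by (simp add: B.T2.pt_mult P_pt CC.pt_mult cls_mult)
qed

lemma Ch_tensor: "tensor K Ch Ch = CC" "ptensor K Ch Ch = cpt"
  by (rule same_algebra_tensor[OF Ch_same Ch_same, symmetric], rule same_algebra_ptensor[OF Ch_same Ch_same, symmetric])

lemmas tbC_bilin = Ch.tb_bilin[unfolded Ch_tensor]
lemmas tbC_pt = Ch.tb_pt[unfolded Ch_tensor Ch_sel]

lemma P_br: assumes "s \<in> F2 n" "t \<in> F2 m" shows "P (n + m) (B.tb s t) = Ch.tb (P n s) (P m t)"
proof (rule bilin_span_eq[OF B.T2.T.module_axioms B.T2.T.module_axioms CC.T.module_axioms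
      bilin_linear[OF B.tb_bilin P_linear] bilin_compose[OF tbC_bilin P_linear P_linear]
      filt_gens_sub filt_gens_sub _ assms[unfolded F2_def]])
  fix s t assume "s \<in> filt_gens n" "t \<in> filt_gens m"
  then obtain i a b j c d where s: "i \<le> n" "a \<in> fil i" "b \<in> fil (n - i)" "s = pt a b"
    and t: "j \<le> m" "c \<in> fil j" "d \<in> fil (m - j)" "t = pt c d" by (elim filt_gensE) blast
  have e: "n + m - (i + j) = (n - i) + (m - j)" using s(1) t(1) by simp
  have "P (n + m) (pt (a \<otimes> c) (br b d)) = cpt (cls (i + j) (a \<otimes> c)) (cls ((n - i) + (m - j)) (br b d))"
    using P_pt[OF fil_mult[OF s(2) t(2)], of "br b d" "n + m"] fil_br[OF s(3) t(3)] s(1) t(1) unfolding e by simp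
  moreover have "P (n + m) (pt (br a c) (b \<otimes> d)) = cpt (cls (i + j) (br a c)) (cls ((n - i) + (m - j)) (b \<otimes> d))"
    using P_pt[OF fil_br[OF s(2) t(2)], of "b \<otimes> d" "n + m"] fil_mult[OF s(3) t(3)] s(1) t(1) unfolding e by simp
  moreover have "B.tb s t = pt (a \<otimes> c) (br b d) \<oplus>\<^bsub>BB\<^esub> pt (br a c) (b \<otimes> d)"
    using s t by (simp add: B.tb_pt)
  moreover have "Ch.tb (P n s) (P m t) = cpt (cls i a \<otimes>\<^bsub>C\<^esub> cls j c) (brC (cls (n - i) b) (cls (m - j) d)) \<oplus>\<^bsub>CC\<^esub>
      cpt (brC (cls i a) (cls j c)) (cls (n - i) b \<otimes>\<^bsub>C\<^esub> cls (m - j) d)"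
    using s t by (simp add: P_pt tbC_pt)
  moreover have "br b d \<in> carrier B" "br a c \<in> carrier B" "a \<otimes> c \<in> carrier B" "b \<otimes> d \<in> carrier B"
    using s t by (simp_all add: B.br_simps(1))
  ultimately show "P (n + m) (B.tb s t) = Ch.tb (P n s) (P m t)"
    using s t by (simp add: P_simps(2) cls_mult cls_br)
qed

lemma gr_comult_mult: assumes "c \<in> carrier C" "d \<in> carrier C"
  shows "gr_comult K B (c \<otimes>\<^bsub>C\<^esub> d) = gr_comult K B c \<otimes>\<^bsub>CC\<^esub> gr_comult K B d"
proof -
  note l = linear_mapsD[OF gr_comult_linear]
  show ?thesis
    using assms(1)
  proof (induction c rule: C_induct)
    case (add c c') then show ?case using assms(2) by (simp add: Cm l CC.T.l_distr)
  next
    case (cls n x)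
    show ?case
      using assms(2)
    proof (induction d rule: C_induct)
      case (add c c') then show ?case using cls by (simp add: Cm l CC.T.r_distr)
    next
      case (cls m y)
      then show ?case
        using P_mult[OF \<Delta>_fil[OF \<open>x \<in> fil n\<close>] \<Delta>_fil[OF cls]] \<open>x \<in> fil n\<close>
        by (simp add: cls_mult gr_comult_cls fil_mult \<Delta>_simps(2))
    qed
  qed
qed

lemma gr_comult_br: assumes "c \<in> carrier C" "d \<in> carrier C"
  shows "gr_comult K B (brC c d) = Ch.tb (gr_comult K B c) (gr_comult K B d)"
proof -
  note l = linear_mapsD[OF gr_comult_linear]
  note b = bilin_simps[OF tbC_bilin]
  show ?thesis
    using assms(1)
  proof (induction c rule: C_induct)
    case (add c c') then show ?case using assms(2) by (simp add: Cb l b)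
  next
    case (cls n x)
    show ?case
      using assms(2)
    proof (induction d rule: C_induct)
      case (add c c') then show ?case using cls by (simp add: Cb l b)
    next
      case (cls m y)
      then show ?case
        using P_br[OF \<Delta>_fil[OF \<open>x \<in> fil n\<close>] \<Delta>_fil[OF cls]] \<open>x \<in> fil n\<close>
        by (simp add: cls_br gr_comult_cls fil_br B.comult_br)
    qed
  qed
qed

lemma gr_comult_gl: assumes "g \<in> G" shows "gr_comult K B (cls 0 g) = cpt (cls 0 g) (cls 0 g)"
proof -
  have g: "g \<in> fil 0" using G_B0[OF assms] by simp
  show ?thesis using P_pt[of g 0 g 0] g by (simp add: gr_comult_cls gl(2)[OF assms] del: corad_filt.simps)
qed

sublocale Ch: pois_comult K Ch brC
proof (unfold_locales, goal_cases)
  case 1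
  show ?case
    unfolding Ch_comult Ch_tensor
  proof (rule alg_homsI)
    show "gr_comult K B \<in> linear_maps K Ch CC"
      using gr_comult_linear unfolding linear_maps_def by (simp add: Ch_sel)
    show "gr_comult K B \<one>\<^bsub>Ch\<^esub> = \<one>\<^bsub>CC\<^esub>"
      using gr_comult_gl[OF gl_one] by (simp add: Ch_sel C_sel(3) CC.T_one)
  qed (simp add: Ch_sel gr_comult_mult)
next
  case (2 x y)
  then show ?case unfolding Ch_comult Ch_sel by (rule gr_comult_br)
qed

section \<open>The group algebra of the group-like elements\<close>

abbreviation GG where "GG \<equiv> grouplike_group K B"

lemma GG_sel: "carrier GG = G" "mult GG = mult B" "\<one>\<^bsub>GG\<^esub> = \<one>"
  by (simp_all add: grouplike_group_def)

text \<open>The antipode axiom makes S(g) an inverse of g. The coproduct is multiplicative, so the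
  coproduct of S(g) is inverse to g \<otimes> g, as is S(g) \<otimes> S(g); the two inverses
  agree.\<close>

lemma gl_inverse: assumes g: "g \<in> G" shows "antipode B g \<in> G" "antipode B g \<otimes> g = \<one>"
proof -
  let ?S = "antipode B"
  have S: "?S \<in> linear_maps K B B" and ax: "\<And>x. x \<in> carrier B \<Longrightarrow> tlift K B (\<lambda>a b. ?S a \<otimes> b) (\<Delta> x) = \<epsilon> x \<odot> \<one>"
    using B_parts(2) unfolding is_antipode_def by auto
  have bl: "bilin K B B B (\<lambda>a b. ?S a \<otimes> b)" by (rule bilin_compose[OF B.bilin_mult S linear_maps_ident])
  have gB: "g \<in> carrier B" by (rule gl(1)[OF g])
  have Sc: "?S g \<in> carrier B" by (rule linear_mapsD(1)[OF S gB])
  show inv: "?S g \<otimes> g = \<one>"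
    using ax[OF gB] gB by (simp add: gl[OF g] B.T2.tlift_pt[OF B.module_axioms bl])
  have inv': "g \<otimes> ?S g = \<one>" using inv B.mult_comm[OF Sc gB] by simp
  have "\<Delta> (?S g) = \<Delta> (?S g) \<otimes>\<^bsub>BB\<^esub> (pt g g \<otimes>\<^bsub>BB\<^esub> pt (?S g) (?S g))"
    using Sc gB inv' by (simp add: B.T2.pt_mult B.T2.T_one[symmetric])
  also have "\<dots> = (\<Delta> (?S g) \<otimes>\<^bsub>BB\<^esub> \<Delta> g) \<otimes>\<^bsub>BB\<^esub> pt (?S g) (?S g)"
    using Sc gB by (simp add: B.T2.T.m_assoc gl(2)[OF g])
  also have "\<Delta> (?S g) \<otimes>\<^bsub>BB\<^esub> \<Delta> g = \<one>\<^bsub>BB\<^esub>"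
    using \<Delta>_simps(2)[OF Sc gB] inv by (simp add: \<Delta>_simps(3))
  finally have "\<Delta> (?S g) = pt (?S g) (?S g)" using Sc by simp
  moreover have "\<epsilon> (?S g) = \<one>\<^bsub>K\<^esub>"
    using \<epsilon>_simps(2)[OF Sc gB] inv \<epsilon>_simps(3) \<epsilon>_simps(4)[OF Sc] by (simp add: gl(3)[OF g])
  ultimately show "?S g \<in> G" unfolding grouplikes_def using Sc by simp
qed

lemma GG_comm_group: "comm_group GG"
proof (rule comm_groupI)
  show "\<exists>h\<in>carrier GG. h \<otimes>\<^bsub>GG\<^esub> g = \<one>\<^bsub>GG\<^esub>" if "g \<in> carrier GG" for g
    using gl_inverse[of g] that unfolding GG_sel by blast
qed (auto simp: GG_sel gl_mult gl_one gl B.mult_ac)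

sublocale GE: grp_env K GG
  by (intro grp_env.intro K.cring_axioms GG_comm_group)

text \<open>Suppose h lies in the span of g and X. For a functional f that vanishes on the span of
  X, contraction by f is computed in two ways and gives f(h) (h - g) = 0, hence f(h) = 0. So h lies
  in the span of X already, against the induction hypothesis.\<close>

lemma gl_independent:
  assumes "finite X" "X \<subseteq> G" "h \<in> G" "h \<notin> X"
  shows "h \<notin> lin_span K B X"
  using assms
proof (induction X arbitrary: h rule: finite_induct)
  case empty
  have "lin_span K B {} \<subseteq> {\<zero>}" by (rule lin_span_minimal[OF zero_submodule[OF B.module_axioms]]) simp
  then show ?case using gl_nonzero[OF empty(2)] by blast
next
  case (insert g X)
  have g: "g \<in> G" and X: "X \<subseteq> G" and gX: "insert g X \<subseteq> carrier B" using insert.prems(1) G_sub by auto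
  have hB: "h \<in> carrier B" and gB: "g \<in> carrier B" using insert.prems(2) g gl(1) by auto
  have hX: "h \<notin> lin_span K B X" using insert.IH[OF X insert.prems(2)] insert.prems(3) by simp
  have Xs: "submodule (lin_span K B X) K B" by (rule lin_span_submodule[OF B.module_axioms]) (use gX in simp)
  show ?case
  proof
    assume h: "h \<in> lin_span K B (insert g X)"
    have "h \<in> lin_span K B X"
    proof (rule submodule_functionals[OF K_field B.module_axioms Xs hB])
      fix f assume f: "f \<in> dual" and fX: "\<And>y. y \<in> lin_span K B X \<Longrightarrow> f y = \<zero>\<^bsub>K\<^esub>"
      have lin: "(\<lambda>x. f x \<odot> g) \<in> linear_maps K B B"
        by (intro linear_mapsI) (use linear_mapsD[OF f] gB in \<open>simp_all add: B.smult_l_distr B.smult_assoc1\<close>)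
      \<comment> \<open>Contraction multiplies a group-like element by its f-value. As f kills X,
        contraction agrees with y -> f(y) g on g and on X, hence on their span.\<close>
      have "L f h = f h \<odot> g"
      proof (rule linear_span_eq[OF B.module_axioms B.module_axioms L_linear[OF f] lin gX _ h])
        fix y assume y: "y \<in> insert g X"
        show "L f y = f y \<odot> g"
        proof (cases "y = g")
          case True then show ?thesis by (simp add: L_gl[OF f g])
        next
          case False
          then have yX: "y \<in> X" using y by simp
          then have "f y = \<zero>\<^bsub>K\<^esub>" by (intro fX subsetD[OF lin_span_superset])
          then show ?thesis using yX X gX gB by (simp add: L_gl[OF f subsetD[OF X yX]] subset_iff)
        qed
      qed
      then have e: "f h \<odot> h = f h \<odot> g" by (simp only: L_gl[OF f insert.prems(2)])
      have fh: "f h \<in> carrier K" by (rule dual_closed[OF f hB])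
      have "f h \<odot> (h \<ominus> g) = \<zero>"
        using e fh hB gB by (simp add: a_minus_def B.smult_r_distr B.smult_r_minus B.M.r_neg)
      moreover have "h \<ominus> g \<noteq> \<zero>"
        using minus_zero_iff[OF B_ag hB gB] insert.prems(3) by simp
      ultimately show "f h = \<zero>\<^bsub>K\<^esub>"
        using smult_eq_zero[OF K_field B.module_axioms fh B.M.minus_closed[OF hB gB]] by blast
    qed
    then show False using hX by blast
  qed
qed

definition inc where "inc = lin_ext K B (\<lambda>g. g)"

lemma inc_hom: "inc \<in> alg_homs K GE.kG B"
  unfolding inc_def by (rule GE.kG_lin_ext_hom[OF B.asalg_axioms]) (use G_sub in \<open>auto simp: GG_sel\<close>)

lemmas inc_simps = alg_homsD[OF inc_hom] linear_mapsD[OF alg_homsD(1)[OF inc_hom]]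

lemma inc_\<delta>: "g \<in> G \<Longrightarrow> inc (GE.\<delta> g) = g"
  unfolding inc_def by (rule lin_ext_delta[OF B.module_axioms gl(1)])

lemma kG_carrier:
  "a \<in> carrier GE.kG \<longleftrightarrow> (\<forall>x. a x \<in> carrier K) \<and> finite (supp K a) \<and> supp K a \<subseteq> G"
  "\<zero>\<^bsub>GE.kG\<^esub> = (\<lambda>z. \<zero>\<^bsub>K\<^esub>)"
proof -
  interpret MA: monalg K GG by unfold_locales
  note s = same_algebraD[OF GE.kG_same, symmetric]
  show "a \<in> carrier GE.kG \<longleftrightarrow> (\<forall>x. a x \<in> carrier K) \<and> finite (supp K a) \<and> supp K a \<subseteq> G"
    unfolding s(1) MA.ma_carrier GG_sel ..
  show "\<zero>\<^bsub>GE.kG\<^esub> = (\<lambda>z. \<zero>\<^bsub>K\<^esub>)" unfolding s(4) MA.ma_sel ..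
qed

lemma inc_B0: assumes "a \<in> carrier GE.kG" shows "inc a \<in> B0"
proof -
  have a: "\<And>x. a x \<in> carrier K" "finite (supp K a)" "supp K a \<subseteq> G" using assms unfolding kG_carrier by auto
  show ?thesis
    unfolding inc_def lin_ext_def
    by (rule submodule_finsum[OF B.module_axioms B0_submodule a(2)])
      (rule B.submoduleE(4)[OF B0_submodule a(1) G_B0[OF subsetD[OF a(3)]]])
qed

text \<open>A nonzero coefficient at h could be inverted, which would express h by the other
  group-like elements in the support.\<close>

lemma inc_zero: assumes a: "a \<in> carrier GE.kG" and "inc a = \<zero>" shows "a = \<zero>\<^bsub>GE.kG\<^esub>"
proof (rule ccontr)
  assume "a \<noteq> \<zero>\<^bsub>GE.kG\<^esub>"
  have ac: "\<And>x. a x \<in> carrier K" "finite (supp K a)" "supp K a \<subseteq> G" using a unfolding kG_carrier by auto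
  obtain h where h: "h \<in> supp K a" using \<open>a \<noteq> _\<close> unfolding kG_carrier(2) supp_def by auto
  then have hG: "h \<in> G" and ah: "a h \<noteq> \<zero>\<^bsub>K\<^esub>" using ac(3) unfolding supp_def by auto
  have hB: "h \<in> carrier B" by (rule gl(1)[OF hG])
  let ?X = "supp K a - {h}"
  have X: "finite ?X" "?X \<subseteq> G" "?X \<subseteq> carrier B" using ac G_sub by auto
  let ?s = "\<Oplus>x\<in>?X. a x \<odot> x"
  have Xs: "submodule (lin_span K B ?X) K B" by (rule lin_span_submodule[OF B.module_axioms X(3)])
  have s: "?s \<in> lin_span K B ?X"
  proof (rule submodule_finsum[OF B.module_axioms Xs X(1)])
    show "a x \<odot> x \<in> lin_span K B ?X" if "x \<in> ?X" for x
      by (rule B.submoduleE(4)[OF Xs ac(1) subsetD[OF lin_span_superset that]])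
  qed
  have sB: "?s \<in> carrier B" using s B.submoduleE(1)[OF Xs] by blast
  have "inc a = (\<Oplus>x\<in>insert h ?X. a x \<odot> x)" using h unfolding inc_def lin_ext_def by (simp add: insert_absorb)
  also have "\<dots> = a h \<odot> h \<oplus> ?s"
    using X hB ac(1) by (intro B.M.finsum_insert) auto
  finally have "a h \<odot> h = \<ominus> ?s"
    using assms(2) B.M.minus_equality[of "a h \<odot> h" ?s] sB hB ac(1) by simp
  then have "a h \<odot> h \<in> lin_span K B ?X" using B.submoduleE(3)[OF Xs s] by simp
  moreover have u: "inv\<^bsub>K\<^esub> (a h) \<in> carrier K" "inv\<^bsub>K\<^esub> (a h) \<otimes>\<^bsub>K\<^esub> a h = \<one>\<^bsub>K\<^esub>"
    using ac(1)[of h] ah K.field_Units by auto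
  ultimately have "inv\<^bsub>K\<^esub> (a h) \<odot> (a h \<odot> h) \<in> lin_span K B ?X" using B.submoduleE(4)[OF Xs] by blast
  then have "h \<in> lin_span K B ?X" using u ac(1) hB by (simp flip: B.smult_assoc1)
  then show False using gl_independent[OF X(1,2) hG] by simp
qed

lemma inc_inj: assumes "a \<in> carrier GE.kG" "b \<in> carrier GE.kG" "inc a = inc b" shows "a = b"
proof -
  have "inc (a \<ominus>\<^bsub>GE.kG\<^esub> b) = \<zero>"
    using linear_maps_minus[OF GE.kG.module_axioms B.module_axioms inc_simps(1) assms(1,2)] assms
      minus_zero_iff[OF B_ag inc_simps(4)[OF assms(1)] inc_simps(4)[OF assms(2)]] by simp
  then have "a \<ominus>\<^bsub>GE.kG\<^esub> b = \<zero>\<^bsub>GE.kG\<^esub>" using assms by (intro inc_zero) simp_all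
  then show ?thesis using minus_zero_iff[OF GE.kG.M.abelian_group_axioms assms(1,2)] by simp
qed

lemma inc_surj: assumes "x \<in> B0" shows "\<exists>a\<in>carrier GE.kG. inc a = x"
  using B.module_axioms G_sub assms unfolding coradical_eq
proof (induction rule: lin_span_induct)
  case zero
  show ?case using linear_maps_zero[OF GE.kG.module_axioms B.module_axioms inc_simps(1)] by (intro bexI[of _ "\<zero>\<^bsub>GE.kG\<^esub>"]) simp_all
next
  case (base g) then show ?case using inc_\<delta> GE.\<delta>_closed[of g] unfolding GG_sel by blast
next
  case (add x y)
  then obtain a b where "a \<in> carrier GE.kG" "b \<in> carrier GE.kG" "inc a = x" "inc b = y" by blast
  then show ?case by (intro bexI[of _ "a \<oplus>\<^bsub>GE.kG\<^esub> b"]) (simp_all add: inc_simps)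
next
  case (smult c x)
  then obtain a where "a \<in> carrier GE.kG" "inc a = x" by blast
  then show ?case using smult(1) by (intro bexI[of _ "c \<odot>\<^bsub>GE.kG\<^esub> a"]) (simp_all add: inc_simps)
qed

definition ret0 where "ret0 x = (THE a. a \<in> carrier GE.kG \<and> inc a = x)"

lemma ret0_eq: "a \<in> carrier GE.kG \<Longrightarrow> inc a = x \<Longrightarrow> ret0 x = a"
  unfolding ret0_def by (intro the_equality) (auto intro: inc_inj)

lemma ret0: assumes "x \<in> B0" shows "ret0 x \<in> carrier GE.kG" "inc (ret0 x) = x"
  using inc_surj[OF assms] ret0_eq by auto

lemma ret0_simps:
  "x \<in> B0 \<Longrightarrow> y \<in> B0 \<Longrightarrow> ret0 (x \<oplus> y) = ret0 x \<oplus>\<^bsub>GE.kG\<^esub> ret0 y"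
  "c \<in> carrier K \<Longrightarrow> x \<in> B0 \<Longrightarrow> ret0 (c \<odot> x) = c \<odot>\<^bsub>GE.kG\<^esub> ret0 x"
  "x \<in> B0 \<Longrightarrow> y \<in> B0 \<Longrightarrow> ret0 (x \<otimes> y) = ret0 x \<otimes>\<^bsub>GE.kG\<^esub> ret0 y"
  "ret0 \<one> = \<one>\<^bsub>GE.kG\<^esub>" "ret0 \<zero> = \<zero>\<^bsub>GE.kG\<^esub>"
  using linear_maps_zero[OF GE.kG.module_axioms B.module_axioms inc_simps(1)]
  by (intro ret0_eq; simp add: inc_simps ret0)+

section \<open>The embedding of the group algebra and its retraction\<close>

lemma fil_0: "x \<in> fil 0 \<longleftrightarrow> x \<in> B0" by simp

lemma gr_incl_eq: assumes "a \<in> carrier GE.kG" shows "gr_incl K B a = cls 0 (inc a)"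
proof -
  have cl: "cls 0 x \<in> carrier C" if "x \<in> B0" for x using that fil_0 cls_closed by blast
  have "lin_ext K C (cls 0) \<in> linear_maps K GE.kA C"
    by (rule lin_ext_linear[OF C.module_axioms _ GE.G.is_monoid]) (use cl G_B0 in \<open>auto simp: GG_sel\<close>)
  then have 1: "gr_incl K B \<in> linear_maps K GE.kG C"
    unfolding gr_incl_def using same_algebra_linear_maps[OF GE.kG_same, of C C K] by (simp add: same_algebra_def)
  have 2: "(\<lambda>a. cls 0 (inc a)) \<in> linear_maps K GE.kG C"
    by (rule linear_mapsI) (simp_all add: cl inc_B0 inc_simps cls_add cls_smult fil_0 del: corad_filt.simps)
  show ?thesis
  proof (rule GE.kG_linear_eq[OF C.module_axioms 1 2 _ assms])
    fix g assume "g \<in> carrier GG"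
    then have g: "g \<in> G" unfolding GG_sel .
    show "gr_incl K B (GE.\<delta> g) = cls 0 (inc (GE.\<delta> g))"
      unfolding gr_incl_def inc_\<delta>[OF g]
      by (rule lin_ext_delta[where f = "cls 0", OF C.module_axioms cl[OF G_B0[OF g]]])
  qed
qed

lemma gr_incl_hom: "gr_incl K B \<in> alg_homs K GE.kG Ch"
proof (rule alg_homsI)
  have f: "inc a \<in> fil 0" if "a \<in> carrier GE.kG" for a using inc_B0[OF that] fil_0 by blast
  show "gr_incl K B \<in> linear_maps K GE.kG Ch"
    by (rule linear_mapsI) (simp_all add: gr_incl_eq f inc_simps cls_add cls_smult Ch_sel del: corad_filt.simps)
  show "gr_incl K B (a \<otimes>\<^bsub>GE.kG\<^esub> b) = gr_incl K B a \<otimes>\<^bsub>Ch\<^esub> gr_incl K B b" if "a \<in> carrier GE.kG" "b \<in> carrier GE.kG" for a b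
    using that cls_mult[OF f f, of a b] by (simp add: gr_incl_eq inc_simps Ch_sel del: corad_filt.simps)
  show "gr_incl K B \<one>\<^bsub>GE.kG\<^esub> = \<one>\<^bsub>Ch\<^esub>" by (simp add: gr_incl_eq inc_simps Ch_sel C_sel(3))
qed

lemma cls_0_inj: assumes "x \<in> B0" "y \<in> B0" "cls 0 x = cls 0 y" shows "x = y"
proof -
  have "low 0 +> x = low 0 +> y" using fun_cong[OF assms(3), of 0] by (simp add: gr_class_def)
  then have "x \<ominus> y \<in> low 0" using lc_eq B0_sub assms by blast
  then show ?thesis using minus_zero_iff[OF B_ag B0_sub[OF assms(1)] B0_sub[OF assms(2)]] by (simp add: low_0)
qed

text \<open>The class map in degree 0 is injective, since B_{-1} = 0. Therefore the definite
  descriptions of \<open>gr_proj\<close> and \<open>ret0\<close> have the same candidates.\<close>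

lemma gr_proj_cl: assumes "adm x" shows "gr_proj K B (cl x) = ret0 (x 0)"
proof -
  have x0: "x 0 \<in> B0" using adm_closed(1)[OF assms] fil_0 by blast
  have e: "(\<lambda>n. if n = 0 then cl x 0 else low n) = cls 0 (x 0)"
    by (simp add: cl_def gr_class_def fun_eq_iff)
  have u: "(a \<in> carrier GE.kG \<and> gr_incl K B a = cls 0 (x 0)) \<longleftrightarrow> (a \<in> carrier GE.kG \<and> inc a = x 0)" for a
    using cls_0_inj[OF inc_B0 x0] by (auto simp: gr_incl_eq)
  show ?thesis unfolding gr_proj_def e u ret0_def ..
qed

lemma gr_proj_cls: assumes "x \<in> fil n" shows "gr_proj K B (cls n x) = (if n = 0 then ret0 x else \<zero>\<^bsub>GE.kG\<^esub>)"
  unfolding cls_cl gr_proj_cl[OF adm_single[OF assms]] by (simp add: ret0_simps)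

lemma gr_proj_linear: "gr_proj K B \<in> linear_maps K C GE.kG"
proof (rule linear_mapsI)
  have a0: "x 0 \<in> B0" if "adm x" for x using adm_closed(1)[OF that, of 0] fil_0 by blast
  show "gr_proj K B c \<in> carrier GE.kG" if "c \<in> carrier C" for c
    using that by (elim C_rep) (simp add: gr_proj_cl ret0 a0)
  show "gr_proj K B (c \<oplus>\<^bsub>C\<^esub> d) = gr_proj K B c \<oplus>\<^bsub>GE.kG\<^esub> gr_proj K B d" if "c \<in> carrier C" "d \<in> carrier C" for c d
    using that by (elim C_rep) (simp add: gr_proj_cl cl_add adm_add ret0_simps a0)
  show "gr_proj K B (k \<odot>\<^bsub>C\<^esub> c) = k \<odot>\<^bsub>GE.kG\<^esub> gr_proj K B c" if "k \<in> carrier K" "c \<in> carrier C" for k c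
    using that by (elim C_rep) (simp add: gr_proj_cl cl_smult adm_smult ret0_simps a0)
qed

lemmas gr_proj_simps = linear_mapsD[OF gr_proj_linear]

lemma gr_proj_mult: assumes "c \<in> carrier C" "d \<in> carrier C"
  shows "gr_proj K B (c \<otimes>\<^bsub>C\<^esub> d) = gr_proj K B c \<otimes>\<^bsub>GE.kG\<^esub> gr_proj K B d"
  using assms(1)
proof (induction c rule: C_induct)
  case (add c c') then show ?case using assms(2) by (simp add: Cm gr_proj_simps GE.kG.l_distr)
next
  case (cls n x)
  show ?case
    using assms(2)
  proof (induction d rule: C_induct)
    case (add c c') then show ?case using cls by (simp add: Cm gr_proj_simps GE.kG.r_distr)
  next
    case (cls m y)
    have k: "ret0 z \<in> carrier GE.kG" if "z \<in> fil 0" for z using that ret0 fil_0 by blast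
    have "gr_proj K B (cls n x \<otimes>\<^bsub>C\<^esub> cls m y) = (if n + m = 0 then ret0 (x \<otimes> y) else \<zero>\<^bsub>GE.kG\<^esub>)"
      unfolding cls_mult[OF \<open>x \<in> fil n\<close> cls] by (rule gr_proj_cls[OF fil_mult[OF \<open>x \<in> fil n\<close> cls]])
    also have "\<dots> = (if n = 0 then ret0 x else \<zero>\<^bsub>GE.kG\<^esub>) \<otimes>\<^bsub>GE.kG\<^esub> (if m = 0 then ret0 y else \<zero>\<^bsub>GE.kG\<^esub>)"
      using k[of x] k[of y] ret0_simps(3)[of x y] \<open>x \<in> fil n\<close> cls
      by (cases "n = 0"; cases "m = 0") simp_all
    finally show ?case unfolding gr_proj_cls[OF \<open>x \<in> fil n\<close>] gr_proj_cls[OF cls] .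
  qed
qed

lemma gr_proj_br: assumes "c \<in> carrier C" "d \<in> carrier C"
  shows "gr_proj K B (brC c d) = \<zero>\<^bsub>GE.kG\<^esub>"
  using assms(1)
proof (induction c rule: C_induct)
  case (add c c') then show ?case using assms(2) by (simp add: Cb gr_proj_simps)
next
  case (cls n x)
  show ?case
    using assms(2)
  proof (induction d rule: C_induct)
    case (add c c') then show ?case using cls by (simp add: Cb gr_proj_simps)
  next
    case (cls m y)
    have "ret0 (br x y) = \<zero>\<^bsub>GE.kG\<^esub>" if "n = 0" "m = 0"
      using that \<open>x \<in> fil n\<close> cls by (simp add: B0_br ret0_simps)
    then show ?case
      using gr_proj_cls[OF fil_br[OF \<open>x \<in> fil n\<close> cls]] by (simp add: cls_br[OF \<open>x \<in> fil n\<close> cls])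
  qed
qed

lemma gr_boson: "boson K Ch brC GG (gr_incl K B) (gr_proj K B)"
proof (intro boson.intro boson_axioms.intro Ch.pois_comult_axioms GE.grp_env_axioms gr_incl_hom)
  have f: "inc a \<in> fil 0" if "a \<in> carrier GE.kG" for a using inc_B0[OF that] fil_0 by blast
  show "gr_proj K B \<in> alg_homs K Ch GE.kG"
  proof (rule alg_homsI)
    show "gr_proj K B \<in> linear_maps K Ch GE.kG" using gr_proj_linear unfolding linear_maps_def by (simp add: Ch_sel)
    show "gr_proj K B \<one>\<^bsub>Ch\<^esub> = \<one>\<^bsub>GE.kG\<^esub>" by (simp add: Ch_sel C_sel(3) gr_proj_cls[OF one_fil] ret0_simps)
  qed (simp add: Ch_sel gr_proj_mult)
  show "gr_proj K B (gr_incl K B a) = a" if "a \<in> carrier GE.kG" for a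
    using that gr_proj_cls[OF f[OF that]] ret0_eq[OF that refl] by (simp add: gr_incl_eq)
  show "brC (gr_incl K B a) (gr_incl K B b) = \<zero>\<^bsub>Ch\<^esub>" if "a \<in> carrier GE.kG" "b \<in> carrier GE.kG" for a b
    using cls_br[OF f[OF that(1)] f[OF that(2)]] B0_br[OF inc_B0[OF that(1)] inc_B0[OF that(2)]] that
    by (simp add: gr_incl_eq cls_zero Ch_sel)
  show "gr_proj K B (brC c d) = \<zero>\<^bsub>GE.kG\<^esub>" if "c \<in> carrier Ch" "d \<in> carrier Ch" for c d
    using gr_proj_br that by (simp only: Ch_sel)
  fix g assume "g \<in> carrier GG"
  then have g: "g \<in> G" unfolding GG_sel .
  have "gr_incl K B (GE.\<delta> g) = cls 0 g" using g by (simp add: gr_incl_eq GG_sel inc_\<delta>)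
  then show "comult Ch (gr_incl K B (GE.\<delta> g)) = ptensor K Ch Ch (gr_incl K B (GE.\<delta> g)) (gr_incl K B (GE.\<delta> g))"
    unfolding Ch_comult Ch_tensor by (simp only: gr_comult_gl[OF g])
qed

lemma gr_incl_\<delta>: "g \<in> G \<Longrightarrow> gr_incl K B (GE.\<delta> g) = cls 0 g"
  by (simp add: gr_incl_eq GG_sel inc_\<delta>)

end

theorem proposition7p7:
  fixes K :: "('k, 'r) ring_scheme" and B :: "('k, 'b) hopf" and br :: "'b \<Rightarrow> 'b \<Rightarrow> 'b"
  assumes "field K"
    and "poisson_hopf_algebra K B br"
    and "pointed K B"
    and "\<And>g t. g \<in> grouplikes K B \<Longrightarrow> t \<in> grouplikes K B \<Longrightarrow> br g t = \<zero>\<^bsub>B\<^esub>"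
    and C: "C = gr K B" "brC = gr_bracket K B br"
    and kG: "kG = group_algebra K (grouplike_group K B)" "br0 = (\<lambda>_ _. \<zero>\<^bsub>kG\<^esub>)"
    and R: "R = right_coinvariants K C kG (gr_proj K B)"
    and Re: "Re = env K R brC" "\<beta> = env_h K R brC" "mR = env_m K R brC"
    and Ce: "Ce = env_hopf K C brC"
    and H: "H = env_hopf K kG br0"
      "gH = (\<lambda>g. env_m K kG br0 (mdelta K g))" "hH = (\<lambda>g. env_h K kG br0 (mdelta K g))"
    and maps: "\<iota>e = env_map K kG br0 C brC (gr_incl K B)" "\<pi>e = env_map K C brC kG br0 (gr_proj K B)"
    and T: "T = right_coinvariants K Ce H \<pi>e"
    and ad: "ad = adjoint_action K H Ce \<iota>e"
    and \<Psi>: "\<Psi> = env_map K R brC C brC (\<lambda>y. y)"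
    and gC: "gC = gr_class K B 0"
    and \<delta>: "\<delta> = (\<lambda>g y. inv\<^bsub>C\<^esub> (gC g) \<otimes>\<^bsub>C\<^esub> brC (gC g) y)"
    and acts: "acts = (\<lambda>act. module_algebra K H Re act \<and>
      (\<forall>g\<in>grouplikes K B. \<forall>y\<in>carrier R.
         act (gH g) (mR y) = mR y \<and>
         act (gH g) (\<beta> y) = \<beta> y \<oplus>\<^bsub>Re\<^esub> mR (\<delta> g y) \<and>
         act (hH g) (mR y) = mR (\<delta> g y) \<and>
         act (hH g) (\<beta> y) = \<beta> (\<delta> g y) \<oplus>\<^bsub>Re\<^esub> mR (brC (gC g) (brC y (inv\<^bsub>C\<^esub> (gC g))))))"
  shows "(\<exists>act. acts act) \<and>
    left_module K H T ad \<and>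
    (\<forall>act. acts act \<longrightarrow> \<Psi> \<in> module_homs K H Re act T ad)"
proof -
  interpret P: pointed_poisson_hopf K B br by (rule pointed_poisson_hopf.intro[OF assms(1-4)])
  interpret b: boson K "gr K B" "gr_bracket K B br" "grouplike_group K B" "gr_incl K B" "gr_proj K B"
    by (rule P.gr_boson)
  \<comment> \<open>The statement uses the inverse in the ring C, whereas \<open>b.d\<close> uses
    the class of the inverse in the group; \<open>b.m_inv_e\<close> identifies the two.\<close>
  have d: "b.d g y = \<delta> g y" if "g \<in> grouplikes K B" for g y
    using that b.m_inv_e[of g] unfolding b.d_def \<delta> gC C by (simp add: P.gr_incl_\<delta> P.GG_sel)
  have "acts = b.acts"
    unfolding acts b.acts_def fun_eq_iff H Re R kG C gC P.GG_sel using d P.gr_incl_\<delta>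
    by simp
  then show ?thesis
    using b.boson_main unfolding T ad \<Psi> maps Ce H Re R kG C by simp
qed

end
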